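(* Let $d\ge3$, $\beta=(\beta_1,\dots,\beta_d)$ with $0<\beta_1\le\dots\le\beta_d$, and $\mathcal{L}=(\mathcal{L}_1,\dots,\mathcal{L}_d)$ with $\mathcal{L}_i>0$. Suppose that $(a,b)$ satisfies A1 and A2 with constants $0<a_{\min}\le a_0$, $a_1>0$, $b_0>0$, $b_1>0$, $\tilde C>0$, $\tilde\rho>0$. Let $\frac1{\bar\beta_3}=\frac1{d-2}\sum_{l=3}^d\frac1{\beta_l}$, $a_j=\frac{\bar\beta_3}{\beta_j(2\bar\beta_3+d-2)}$, and let $h^*=(h_1^*,\dots,h_d^* )$ with $h_j^*=\big(\frac{\log T_n}{T_n}\big)^{a_j}$ if $\beta_2<\beta_3$ and $h_j^*=\big(\frac1{T_n}\big)^{a_j}$ if $\beta_2=\beta_3$. Suppose moreover that $\Delta_n\le\frac14h_1^*h_2^*$. Let $x\in\mathbb{R}^d$. Then there exist $c>0$ and $T_0>0$ such that, for $T_n\ge T_0$, the asynchronous kernel estimator $\hat\pi^a_{h^*,T_n}$ satisfies $$\mathrm{Var}\big(\hat\pi^a_{h^*,T_n}(x)\big)\le\frac{c}{T_n}\,\frac{\sum_{j=1}^d|\log h_j^*|}{\prod_{l=3}^dh_l^*}.$$ Moreover, the constant $c$ is uniform over the set of coefficients $(a,b)\in\tilde\Sigma(\beta,\mathcal{L},a_{\min},a_0,a_1,b_0,b_1,\tilde C,\tilde\rho)$.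
   Context: Model. $X$ is the strong solution of $X_t=X_0+\int_0^t b(X_s)\,ds+\int_0^t a(X_s)\,dW_s$, where $b:\mathbb{R}^d\to\mathbb{R}^d$, $a:\mathbb{R}^d\to\mathbb{R}^{d\times d}$, $W$ is a $d$-dimensional Brownian motion and $X_0$ is independent of $W$. Put $\tilde a=a a^T$; $|\cdot|$ is the Euclidean norm (operator norm for matrices). A1 (with constants $a_{\min},a_0,a_1,b_0,b_1>0$): $a,b$ are bounded, globally Lipschitz and of class $\mathcal{C}^1$, with $|a(x)|\le a_0$, $|b(x)|\le b_0$, $|\partial_{x_i}b(x)|\le b_1$, $|\partial_{x_i}a(x)|\le a_1$ for all $x\in\mathbb{R}^d$, $i\in\{1,\dots,d\}$, and $a_{\min}^2 I_{d\times d}\le\tilde a(x)$ in the sense of quadratic forms. A2 (with constants $\tilde C,\tilde\rho>0$): $\langle x,b(x)\rangle\le-\tilde C|x|$ for all $|x|\ge\tilde\rho$. Under A1-A2, $X$ has a unique invariant probability measure, assumed to have a Lebesgue density $\pi=\pi_{(a,b)}$; the process is stationary, i.e. $X_0$ has density $\pi$. Hölder class. $g:\mathbb{R}^d\to\mathbb{R}$ belongs to $\mathcal{H}_d(\beta,\mathcal{L})$ if for all $i$: $\|D_i^kg\|_\infty\le\mathcal{L}_i$ for $k=0,\dots,\lfloor\beta_i\rfloor$, and $\|D_i^{\lfloor\beta_i\rfloor}g(\cdot+te_i)-D_i^{\lfloor\beta_i\rfloor}g(\cdot)\|_\infty\le\mathcal{L}_i|t|^{\beta_i-\lfloor\beta_i\rfloor}$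 for all $t\in\mathbb{R}$, where $D_i^k$ is the $k$-th partial derivative in direction $i$, $\lfloor\beta_i\rfloor$ is the largest integer strictly smaller than $\beta_i$, and $(e_i)$ is the canonical basis. $\Sigma(\beta,\mathcal{L},a_{\min},a_0,a_1,b_0,b_1,\tilde C,\tilde\rho)$ is the set of $(a,b)$ satisfying A1 with $(a_{\min},a_0,a_1,b_0,b_1)$, A2 with $(\tilde C,\tilde\rho)$, and $\pi_{(a,b)}\in\mathcal{H}_d(\beta,\mathcal{L})$; $\tilde\Sigma$ is the subset of those $(a,b)\in\Sigma$ such that $a,b$ are of class $\mathcal{C}^3$. Kernel. $K:\mathbb{R}\to\mathbb{R}$ satisfies $\int K=1$, $\|K\|_\infty<\infty$, $\mathrm{supp}(K)\subset[-1,1]$ and $\int K(x)x^l\,dx=0$ for $l\in\{1,\dots,M\}$, with $M\ge\max_i\beta_i$; $K_h(\cdot)=\frac1hK(\frac{\cdot}{h})$. Asynchronous sampling. For each $l\in\{1,\dots,d\}$ the component $X^l$ is observed at times $0=t_0^l<t_1^l<\dots<t_n^l\le T_n$ (depending on $n$), and $t_{n+1}^l:=T_n$. $\Delta_n:=\sup_{l=1,\dots,d}\sup_{i=0,\dots,n}(t_{i+1}^l-t_i^l)$; $T_n\to\infty$ and $\Delta_n\to0$ as $n\to\infty$. For $t\in[0,T_n]$, $\varphi_{n,l}(t)=\sup\{t_i^l: 0\le i\le n,\ t_i^l\le t\}$. Estimator. $\hat\pi^a_{h,T_n}(x)=\frac1{T_n}\int_0^{T_n}\prod_{l=1}^dK_{h_l}\big(x_l-X^l_{\varphi_{n,l}(u)}\big)\,du$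 for a bandwidth $h\in(0,1)^d$. *)

theory Defs
  imports "HOL-Probability.Probability"
begin

section \<open>Differentiability classes\<close>

definition partial :: "'n::finite \<Rightarrow> (real ^ 'n \<Rightarrow> 'b::real_normed_vector) \<Rightarrow> real ^ 'n \<Rightarrow> 'b" where
  "partial i f x = vector_derivative (\<lambda>s. f (x + s *\<^sub>R axis i 1)) (at 0)"

definition partially_differentiable ::
    "'n::finite \<Rightarrow> (real ^ 'n \<Rightarrow> 'b::real_normed_vector) \<Rightarrow> bool" where
  "partially_differentiable i f \<longleftrightarrow>
     (\<forall>x. (\<lambda>s. f (x + s *\<^sub>R axis i 1)) differentiable (at 0))"

primrec class_C :: "nat \<Rightarrow> (real ^ 'n::finite \<Rightarrow> 'b::real_normed_vector) \<Rightarrow> bool" where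
  "class_C 0 f \<longleftrightarrow> continuous_on UNIV f"
| "class_C (Suc k) f \<longleftrightarrow> continuous_on UNIV f \<and>
     (\<forall>i. partially_differentiable i f \<and> class_C k (partial i f))"

text \<open>The largest integer strictly smaller than \<open>r\<close>, for \<open>r > 0\<close> (so it is \<open>r - 1\<close> for an
  integer \<open>r\<close>).\<close>

definition strict_floor :: "real \<Rightarrow> nat" where
  "strict_floor r = nat (\<lceil>r\<rceil> - 1)"

definition Holder_class ::
    "('n::finite \<Rightarrow> real) \<Rightarrow> ('n \<Rightarrow> real) \<Rightarrow> (real ^ 'n \<Rightarrow> real) set" where
  "Holder_class \<beta> L = {g. \<forall>i.
     (\<forall>k < strict_floor (\<beta> i). partially_differentiable i ((partial i ^^ k) g)) \<and>
     (\<forall>k \<le> strict_floor (\<beta> i). \<forall>x. \<bar>(partial i ^^ k) g x\<bar> \<le> L i) \<and>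
     (\<forall>t x. \<bar>(partial i ^^ strict_floor (\<beta> i)) g (x + t *\<^sub>R axis i 1)
              - (partial i ^^ strict_floor (\<beta> i)) g x\<bar>
            \<le> L i * \<bar>t\<bar> powr (\<beta> i - real (strict_floor (\<beta> i))))}"


section \<open>Assumptions on the coefficients\<close>

definition op_norm :: "real ^ 'n ^ 'n \<Rightarrow> real" where
  "op_norm A = onorm (\<lambda>v. A *v v)"

definition A1 :: "real \<Rightarrow> real \<Rightarrow> real \<Rightarrow> real \<Rightarrow> real \<Rightarrow>
    (real ^ 'n \<Rightarrow> real ^ 'n ^ 'n) \<Rightarrow> (real ^ 'n::finite \<Rightarrow> real ^ 'n) \<Rightarrow> bool" where
  "A1 a\<^sub>m\<^sub>i\<^sub>n a\<^sub>0 a\<^sub>1 b\<^sub>0 b\<^sub>1 a b \<longleftrightarrow>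
     (\<exists>C. C-lipschitz_on UNIV a) \<and> (\<exists>C. C-lipschitz_on UNIV b) \<and>
     class_C 1 a \<and> class_C 1 b \<and>
     (\<forall>x. op_norm (a x) \<le> a\<^sub>0 \<and> norm (b x) \<le> b\<^sub>0) \<and>
     (\<forall>x i. norm (partial i b x) \<le> b\<^sub>1 \<and> op_norm (partial i a x) \<le> a\<^sub>1) \<and>
     (\<forall>x \<xi>. a\<^sub>m\<^sub>i\<^sub>n\<^sup>2 * (\<xi> \<bullet> \<xi>) \<le> \<xi> \<bullet> ((a x ** transpose (a x)) *v \<xi>))"

definition A2 :: "real \<Rightarrow> real \<Rightarrow> (real ^ 'n::finite \<Rightarrow> real ^ 'n) \<Rightarrow> bool" where
  "A2 C \<rho> b \<longleftrightarrow> (\<forall>x. norm x \<ge> \<rho> \<longrightarrow> x \<bullet> b x \<le> - C * norm x)"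


section \<open>Stochastic differential equations\<close>

definition brownian_motion :: "'w measure \<Rightarrow> (real \<Rightarrow> 'w \<Rightarrow> real ^ 'n::finite) \<Rightarrow> bool" where
  "brownian_motion M W \<longleftrightarrow>
     (\<forall>t\<ge>0. W t \<in> borel_measurable M) \<and>
     (AE \<omega> in M. W 0 \<omega> = 0) \<and>
     (AE \<omega> in M. continuous_on {0..} (\<lambda>t. W t \<omega>)) \<and>
     (\<forall>s t. 0 \<le> s \<and> s < t \<longrightarrow>
        distributed M lborel (\<lambda>\<omega>. W t \<omega> - W s \<omega>)
          (\<lambda>y. ennreal (\<Prod>i\<in>UNIV. normal_density 0 (sqrt (t - s)) (y $ i)))) \<and>
     (\<forall>k (\<tau> :: nat \<Rightarrow> real). 0 \<le> \<tau> 0 \<and> (\<forall>i<k. \<tau> i < \<tau> (Suc i)) \<longrightarrow>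
        prob_space.indep_vars M (\<lambda>_. borel) (\<lambda>i \<omega>. W (\<tau> (Suc i)) \<omega> - W (\<tau> i) \<omega>) {..<k})"

text \<open>The augmented filtration generated by the initial value and the Brownian motion.\<close>

definition strong_filtration ::
    "'w measure \<Rightarrow> (real \<Rightarrow> 'w \<Rightarrow> real ^ 'n::finite) \<Rightarrow> ('w \<Rightarrow> real ^ 'n) \<Rightarrow> real \<Rightarrow> 'w measure" where
  "strong_filtration M W X\<^sub>0 t = sigma (space M)
     ({X\<^sub>0 -` A \<inter> space M | A. A \<in> sets borel} \<union>
      {W s -` A \<inter> space M | s A. 0 \<le> s \<and> s \<le> t \<and> A \<in> sets borel} \<union>
      null_sets M)"

text \<open>Simple matrix-valued integrands: the value is \<open>\<xi> i\<close> on the interval from \<open>\<tau> i\<close> (excluded)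
  to \<open>\<tau> (i + 1)\<close> (included), for \<open>i < k\<close>.\<close>

definition simple_integrand :: "'w measure \<Rightarrow> (real \<Rightarrow> 'w measure) \<Rightarrow>
    nat \<Rightarrow> (nat \<Rightarrow> real) \<Rightarrow> (nat \<Rightarrow> 'w \<Rightarrow> real ^ 'n ^ 'n) \<Rightarrow> bool" where
  "simple_integrand M F k \<tau> \<xi> \<longleftrightarrow>
     0 \<le> \<tau> 0 \<and> (\<forall>i<k. \<tau> i \<le> \<tau> (Suc i)) \<and>
     (\<forall>i<k. \<xi> i \<in> borel_measurable (F (\<tau> i)) \<and> bounded (\<xi> i ` space M))"

definition simple_process ::
    "nat \<Rightarrow> (nat \<Rightarrow> real) \<Rightarrow> (nat \<Rightarrow> 'w \<Rightarrow> real ^ 'n ^ 'n) \<Rightarrow> real \<Rightarrow> 'w \<Rightarrow> real ^ 'n ^ 'n" where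
  "simple_process k \<tau> \<xi> s \<omega> = (\<Sum>i<k. indicator {\<tau> i<..\<tau> (Suc i)} s *\<^sub>R \<xi> i \<omega>)"

definition simple_ito_integral :: "(real \<Rightarrow> 'w \<Rightarrow> real ^ 'n::finite) \<Rightarrow>
    nat \<Rightarrow> (nat \<Rightarrow> real) \<Rightarrow> (nat \<Rightarrow> 'w \<Rightarrow> real ^ 'n ^ 'n) \<Rightarrow> real \<Rightarrow> 'w \<Rightarrow> real ^ 'n" where
  "simple_ito_integral W k \<tau> \<xi> t \<omega> =
     (\<Sum>i<k. \<xi> i \<omega> *v (W (min (\<tau> (Suc i)) t) \<omega> - W (min (\<tau> i) t) \<omega>))"

text \<open>\<open>I\<close> is (a version of) the Ito integral of \<open>H\<close> against \<open>W\<close> over \<open>[0, t]\<close>: the mean square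
  limit of the integrals of simple processes approximating \<open>H\<close> in mean square.\<close>

definition has_ito_integral :: "'w measure \<Rightarrow> (real \<Rightarrow> 'w measure) \<Rightarrow>
    (real \<Rightarrow> 'w \<Rightarrow> real ^ 'n::finite) \<Rightarrow> (real \<Rightarrow> 'w \<Rightarrow> real ^ 'n ^ 'n) \<Rightarrow> real \<Rightarrow>
    ('w \<Rightarrow> real ^ 'n) \<Rightarrow> bool" where
  "has_ito_integral M F W H t I \<longleftrightarrow>
     I \<in> borel_measurable M \<and>
     (\<exists>k \<tau> \<xi>.
        (\<forall>m::nat. simple_integrand M F (k m) (\<tau> m) (\<xi> m)) \<and>
        (\<lambda>m. \<integral>\<^sup>+ \<omega>. (\<integral>\<^sup>+ s. ennreal ((norm (simple_process (k m) (\<tau> m) (\<xi> m) s \<omega> - H s \<omega>))\<^sup>2)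
                   * indicator {0..t} s \<partial>lborel) \<partial>M) \<longlonglongrightarrow> 0 \<and>
        (\<lambda>m. \<integral>\<^sup>+ \<omega>. ennreal ((norm (simple_ito_integral W (k m) (\<tau> m) (\<xi> m) t \<omega> - I \<omega>))\<^sup>2) \<partial>M)
          \<longlonglongrightarrow> 0)"

definition strong_solution :: "(real ^ 'n \<Rightarrow> real ^ 'n ^ 'n) \<Rightarrow> (real ^ 'n::finite \<Rightarrow> real ^ 'n) \<Rightarrow>
    'w measure \<Rightarrow> (real \<Rightarrow> 'w \<Rightarrow> real ^ 'n) \<Rightarrow> (real \<Rightarrow> 'w \<Rightarrow> real ^ 'n) \<Rightarrow> bool" where
  "strong_solution a b M W X \<longleftrightarrow>
     prob_space M \<and> brownian_motion M W \<and>
     X 0 \<in> borel_measurable M \<and>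
     prob_space.indep_set M
       {X 0 -` A \<inter> space M | A. A \<in> sets borel}
       (sigma_sets (space M) {W s -` A \<inter> space M | s A. 0 \<le> s \<and> A \<in> sets borel}) \<and>
     (\<forall>t\<ge>0. X t \<in> borel_measurable (strong_filtration M W (X 0) t)) \<and>
     (AE \<omega> in M. continuous_on {0..} (\<lambda>t. X t \<omega>)) \<and>
     (\<forall>t\<ge>0. \<exists>I. has_ito_integral M (strong_filtration M W (X 0)) W (\<lambda>s \<omega>. a (X s \<omega>)) t I \<and>
        (AE \<omega> in M. X t \<omega> = X 0 \<omega> + (LINT s:{0..t}|lborel. b (X s \<omega>)) + I \<omega>))"

text \<open>A probability measure \<open>\<mu>\<close> is invariant if the solution started from \<open>\<mu>\<close> has law \<open>\<mu>\<close> at all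
  times. As one cannot quantify over types, the probability space lives on the canonical type of
  pairs (initial value, driving path), on which the equation can be solved for every initial law.
  The law of the solution does not depend on that choice when the coefficients are Lipschitz.\<close>

definition invariant_measure :: "(real ^ 'n \<Rightarrow> real ^ 'n ^ 'n) \<Rightarrow> (real ^ 'n::finite \<Rightarrow> real ^ 'n) \<Rightarrow>
    (real ^ 'n) measure \<Rightarrow> bool" where
  "invariant_measure a b \<mu> \<longleftrightarrow>
     prob_space \<mu> \<and> sets \<mu> = sets borel \<and>
     (\<exists>(M :: (real ^ 'n \<times> (real \<Rightarrow> real ^ 'n)) measure) W X.
        strong_solution a b M W X \<and> (\<forall>t\<ge>0. distr M borel (X t) = \<mu>))"

definition invariant_density :: "(real ^ 'n \<Rightarrow> real ^ 'n ^ 'n) \<Rightarrow> (real ^ 'n::finite \<Rightarrow> real ^ 'n) \<Rightarrow>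
    (real ^ 'n \<Rightarrow> real) \<Rightarrow> bool" where
  "invariant_density a b \<pi> \<longleftrightarrow>
     \<pi> \<in> borel_measurable borel \<and> (\<forall>x. 0 \<le> \<pi> x) \<and>
     invariant_measure a b (density lborel (\<lambda>x. ennreal (\<pi> x)))"

definition stationary_solution :: "(real ^ 'n \<Rightarrow> real ^ 'n ^ 'n) \<Rightarrow>
    (real ^ 'n::finite \<Rightarrow> real ^ 'n) \<Rightarrow> (real ^ 'n \<Rightarrow> real) \<Rightarrow>
    'w measure \<Rightarrow> (real \<Rightarrow> 'w \<Rightarrow> real ^ 'n) \<Rightarrow> (real \<Rightarrow> 'w \<Rightarrow> real ^ 'n) \<Rightarrow> bool" where
  "stationary_solution a b \<pi> M W X \<longleftrightarrow>
     invariant_density a b \<pi> \<and> strong_solution a b M W X \<and>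
     distributed M lborel (X 0) (\<lambda>x. ennreal (\<pi> x))"

definition Sigma_class :: "('n::finite \<Rightarrow> real) \<Rightarrow> ('n \<Rightarrow> real) \<Rightarrow>
    real \<Rightarrow> real \<Rightarrow> real \<Rightarrow> real \<Rightarrow> real \<Rightarrow> real \<Rightarrow> real \<Rightarrow>
    ((real ^ 'n \<Rightarrow> real ^ 'n ^ 'n) \<times> (real ^ 'n \<Rightarrow> real ^ 'n)) set" where
  "Sigma_class \<beta> L a\<^sub>m\<^sub>i\<^sub>n a\<^sub>0 a\<^sub>1 b\<^sub>0 b\<^sub>1 C \<rho> =
     {(a, b). A1 a\<^sub>m\<^sub>i\<^sub>n a\<^sub>0 a\<^sub>1 b\<^sub>0 b\<^sub>1 a b \<and> A2 C \<rho> b \<and>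
              (\<exists>\<pi>. invariant_density a b \<pi> \<and> \<pi> \<in> Holder_class \<beta> L)}"

definition Sigma_tilde :: "('n::finite \<Rightarrow> real) \<Rightarrow> ('n \<Rightarrow> real) \<Rightarrow>
    real \<Rightarrow> real \<Rightarrow> real \<Rightarrow> real \<Rightarrow> real \<Rightarrow> real \<Rightarrow> real \<Rightarrow>
    ((real ^ 'n \<Rightarrow> real ^ 'n ^ 'n) \<times> (real ^ 'n \<Rightarrow> real ^ 'n)) set" where
  "Sigma_tilde \<beta> L a\<^sub>m\<^sub>i\<^sub>n a\<^sub>0 a\<^sub>1 b\<^sub>0 b\<^sub>1 C \<rho> =
     {(a, b) \<in> Sigma_class \<beta> L a\<^sub>m\<^sub>i\<^sub>n a\<^sub>0 a\<^sub>1 b\<^sub>0 b\<^sub>1 C \<rho>. class_C 3 a \<and> class_C 3 b}"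


section \<open>Kernel estimation from asynchronous observations\<close>

definition kernel_of_order :: "nat \<Rightarrow> (real \<Rightarrow> real) \<Rightarrow> bool" where
  "kernel_of_order m K \<longleftrightarrow>
     K \<in> borel_measurable borel \<and> bounded (range K) \<and> closure {x. K x \<noteq> 0} \<subseteq> {-1..1} \<and>
     (LINT x|lborel. K x) = 1 \<and>
     (\<forall>l\<in>{1..m}. (LINT x|lborel. K x * x ^ l) = 0)"

definition scaled_kernel :: "(real \<Rightarrow> real) \<Rightarrow> real \<Rightarrow> real \<Rightarrow> real" where
  "scaled_kernel K h y = 1 / h * K (y / h)"

text \<open>\<open>t n l i\<close> is the time of the \<open>i\<close>-th observation of the component \<open>l\<close>, for \<open>i \<le> n\<close>;
  by convention \<open>t n l (n + 1)\<close> is the horizon \<open>T n\<close>.\<close>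

definition sampling_scheme :: "(nat \<Rightarrow> real) \<Rightarrow> (nat \<Rightarrow> 'n::finite \<Rightarrow> nat \<Rightarrow> real) \<Rightarrow> bool" where
  "sampling_scheme T t \<longleftrightarrow>
     (\<forall>n l. t n l 0 = 0 \<and> (\<forall>i<n. t n l i < t n l (Suc i)) \<and> t n l n \<le> T n \<and> t n l (Suc n) = T n)"

definition mesh :: "(nat \<Rightarrow> 'n::finite \<Rightarrow> nat \<Rightarrow> real) \<Rightarrow> nat \<Rightarrow> real" where
  "mesh t n = (SUP l. SUP i\<in>{0..n}. t n l (Suc i) - t n l i)"

definition last_obs :: "(nat \<Rightarrow> 'n::finite \<Rightarrow> nat \<Rightarrow> real) \<Rightarrow> nat \<Rightarrow> 'n \<Rightarrow> real \<Rightarrow> real" where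
  "last_obs t n l u = Sup {t n l i | i. i \<le> n \<and> t n l i \<le> u}"

definition async_estimator :: "(real \<Rightarrow> real) \<Rightarrow> ('n::finite \<Rightarrow> real) \<Rightarrow> (nat \<Rightarrow> real) \<Rightarrow>
    (nat \<Rightarrow> 'n \<Rightarrow> nat \<Rightarrow> real) \<Rightarrow> (real \<Rightarrow> 'w \<Rightarrow> real ^ 'n) \<Rightarrow> nat \<Rightarrow> real ^ 'n \<Rightarrow> 'w \<Rightarrow> real" where
  "async_estimator K h T t X n x \<omega> =
     1 / T n * (LINT u:{0..T n}|lborel.
       (\<Prod>l\<in>UNIV. scaled_kernel K (h l) (x $ l - X (last_obs t n l u) \<omega> $ l)))"

text \<open>Below, \<open>e\<close> enumerates the coordinates as \<open>e 1, \<dots>, e d\<close>, where \<open>d = CARD('n)\<close>.\<close>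

definition beta_bar3 :: "(nat \<Rightarrow> 'n::finite) \<Rightarrow> ('n \<Rightarrow> real) \<Rightarrow> real" where
  "beta_bar3 e \<beta> = 1 / (1 / (real CARD('n) - 2) * (\<Sum>l = 3..CARD('n). 1 / \<beta> (e l)))"

definition rate_exponent :: "(nat \<Rightarrow> 'n::finite) \<Rightarrow> ('n \<Rightarrow> real) \<Rightarrow> 'n \<Rightarrow> real" where
  "rate_exponent e \<beta> j =
     beta_bar3 e \<beta> / (\<beta> j * (2 * beta_bar3 e \<beta> + real CARD('n) - 2))"

definition opt_bandwidth :: "(nat \<Rightarrow> 'n::finite) \<Rightarrow> ('n \<Rightarrow> real) \<Rightarrow> real \<Rightarrow> 'n \<Rightarrow> real" where
  "opt_bandwidth e \<beta> T j =
     (if \<beta> (e 2) < \<beta> (e 3) then ln T / T else 1 / T) powr rate_exponent e \<beta> j"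

end

theory Submission
  imports Defs "HOL-Real_Asymp.Real_Asymp"
begin

text \<open>
The Markov property is replaced throughout by estimates of \<open>E[eta f(Y_t)]\<close> with a bounded weight \<open>eta\<close> that is
measurable with respect to the past of an earlier time s. Comparing Y with the Gaussian kernel whose covariance is
frozen at the end point (Dynkin's formula, then an integrable singularity in time) gives a Gaussian upper bound on
short time intervals, a local lower bound, and the fact that \<open>E[eta f(Y_t)]\<close> depends only on the conditional
expectation of \<open>eta\<close> given \<open>Y_s\<close>. The lower bound, chained along balls, is a minorization; with the Lyapunov function
\<open>exp (eps * sqrt (1 + |x|^2))\<close> it makes every weight of mean zero contract geometrically in a weighted total variation
norm (Harris). For the estimator at distinct observation times, each component is first moved back to a common earlier
time at the cost of smoothing its kernel by a one-dimensional Gaussian. The covariance of the integrand at lag s is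
then at most a constant times \<open>1 / (h_1 ... h_d)\<close> for \<open>s <= h_1 h_2\<close>, \<open>1 / (s h_3 ... h_d)\<close> up to a fixed time, 1 up to
\<open>D = sum |log h_j| / (h_3 ... h_d)\<close>, and exponentially small beyond; integrating over s yields the bound. All constants are
explicit in the bounds on the coefficients.
\<close>

text \<open>A solution is one process with one initial law; there is no family of solutions started
  at points, hence no transition density to compose. Every estimate is therefore about the law of
  \<open>Y t\<close> under a weight from the past, and such laws are compared through test
  functions. An increment of the path is a frozen Gaussian part plus a remainder known only in mean
  square, which is why expansions carry the minimum of a square and a cube. The integrable
  singularity comes from a cancellation: a kernel frozen at its end point solves its own heat
  equation, so the generator leaves only the drift and a coefficient difference, whose Lipschitz
  bound turns 1 / ta into 1 / sqrt ta. At intermediate lags s only two coordinates are smoothed,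
  each at the price s^(-1/2); their product 1 / s integrates to the logarithm, and the other kernels
  are bounded by a multiple of 1 / h_l. Uniformity comes from the locale constants, functions of
  dimension and numeric bounds that can be named before any process is fixed.\<close>

abbreviation (input) "NI == nn_integral"
abbreviation (input) "BI == lebesgue_integral"
abbreviation (input) "BB == borel_measurable borel"
abbreviation (input) "LB == lborel"
abbreviation (in prob_space) (input) "EE == expectation"
abbreviation (input) sq ("_^2" [1000] 999) where "sq x == power2 x"
notation (input) scaleR (infixr "*R" 75) and pair_measure (infixr "XM" 80) and LIMSEQ ("((_)/ ----> (_))" [60, 60] 60)

lemmas integrable_bound' = Bochner_Integration.integrable_bound
lemmas integral_nonneg' = Bochner_Integration.integral_nonneg
lemmas integral_sum' = Bochner_Integration.integral_sum
lemmas integrable_sum' = Bochner_Integration.integrable_sum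
lemmas integral_cong' = Bochner_Integration.integral_cong
lemmas integral_diff' = Bochner_Integration.integral_diff

section \<open>Product integrals over coordinates and Gaussian moments\<close>

lemma vec_prod_Basis: "(PROD b:(Basis::(real^'n::finite) set). f (axis_index b) (x \<bullet> b)) = (PROD i:UNIV. f i (x $ i))"
proof -
 have B: "(Basis::(real^'n) set) = (%i. axis i 1) ` UNIV" by (auto simp: Basis_vec_def)
 have inj: "inj (%i. axis i (1::real) :: real^'n)" by (auto intro!: injI simp: axis_eq_axis)
 have ai: "axis_index (axis i (1::real) :: real^'n) = i" for i
  by (metis axis_index axis_inverse B axis_eq_axis inj rangeI zero_neq_one)
 show ?thesis unfolding B by (subst prod.reindex[OF inj]) (simp add: ai inner_axis)
qed

lemma nn_integral_vec_prod:
 fixes f :: "'n::finite => real => ennreal"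
 assumes [measurable]: "!!i. f i : BB"
 shows "NI (LB :: (real^'n) measure) (%x. (PROD i:UNIV. f i (x $ i))) = (PROD i:UNIV. NI LB (%x. f i x))"
proof -
 have "NI (LB :: (real^'n) measure) (%x. (PROD i:UNIV. f i (x $ i))) = NI (LB::(real^'n) measure) (%x. (PROD b:Basis. f (axis_index b) (x \<bullet> b)))"
  by (simp add: vec_prod_Basis)
 also have "... = (PROD b:(Basis::(real^'n) set). NI LB (%x. f (axis_index b) x))"
  by (rule nn_integral_lborel_prod) auto
 also have "... = (PROD i:UNIV. NI LB (%x. f i x))"
  using vec_prod_Basis[of "%i _. NI LB (%x. f i x)"] by simp
 finally show ?thesis .
qed

lemma integral_vec_prod:
 fixes f :: "'n::finite => real => real"
 assumes [measurable]: "!!i. integrable LB (f i)"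
 shows "integrable (LB :: (real^'n) measure) (%x. PROD i:UNIV. f i (x $ i))" (is ?A)
  and "BI (LB :: (real^'n) measure) (%x. (PROD i:UNIV. f i (x $ i))) = (PROD i:UNIV. BI LB (%x. f i x))" (is ?B)
proof -
 interpret P: product_sigma_finite "%b::real^'n. LB :: real measure" by standard
 let ?g = "%b. f (axis_index b)"
 let ?T = "%h. SUM b:(Basis::(real^'n) set). h b *R b"
 have L: "(LB :: (real^'n) measure) = distr (\<Pi>\<^sub>M b\<in>Basis. LB) borel ?T"
  by (rule lborel_eq)
 have e: "(PROD i:UNIV. f i (?T h $ i)) = (PROD b:Basis. ?g b (h b))" for h
  unfolding vec_prod_Basis[symmetric] by (rule prod.cong) (auto simp: inner_sum_left inner_Basis if_distrib cong: if_cong)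
 have [measurable]: "f i : BB" for i using assms[of i] by simp
 have m1: "?T : measurable (\<Pi>\<^sub>M b\<in>Basis. LB) borel" by simp
 have m2: "(%x::real^'n. PROD i:UNIV. f i (x $ i)) : BB" by simp
 show ?A
  unfolding L by (subst integrable_distr_eq[OF m1 m2], unfold e) (intro P.product_integrable_prod assms finite_Basis)
 have "BI (LB :: (real^'n) measure) (%x. (PROD i:UNIV. f i (x $ i))) = (PROD b:(Basis::(real^'n) set). BI LB (%x. ?g b x))"
  unfolding L by (subst integral_distr[OF m1 m2], unfold e) (intro P.product_integral_prod assms finite_Basis)
 also have "... = (PROD i:UNIV. BI LB (%x. f i x))"
  using vec_prod_Basis[of "%i _. BI LB (%x. f i x)"] by simp
 finally show ?B .
qed

definition gauss :: "real => real^'n::finite => real" where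
 "gauss si y = (PROD i:UNIV. normal_density 0 si (y $ i))"

lemma gauss_measurable[measurable]: "gauss si : BB" unfolding gauss_def by measurable

lemma gauss_nonneg[simp]: "0 <= gauss si y" unfolding gauss_def by (simp add: prod_nonneg)

lemma gauss_moment:
 assumes "0 < si"
 shows "integrable LB (%y::real^'n::finite. gauss si y * (PROD i:UNIV. (y $ i) ^ k i))"
  and "BI LB (%y. gauss si (y::real^'n) * (PROD i:UNIV. (y $ i) ^ k i)) = (PROD i:UNIV. BI LB (%x. normal_density 0 si x * x ^ k i))"
proof -
 have i: "integrable LB (%x. normal_density 0 si x * x ^ k i)" for i
  using integrable_normal_moment[OF assms, of 0 "k i"] by simp
 show "integrable LB (%y::real^'n. gauss si y * (PROD i:UNIV. (y $ i) ^ k i))"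
  "BI LB (%y. gauss si (y::real^'n) * (PROD i:UNIV. (y $ i) ^ k i)) = (PROD i:UNIV. BI LB (%x. normal_density 0 si x * x ^ k i))"
  using integral_vec_prod[OF i] by (auto simp: gauss_def prod.distrib)
qed

lemma gauss_moments:
 fixes i j :: "'n::finite"
 assumes s: "0 < si"
 shows "integrable LB (%y::real^'n. gauss si y * (y $ i))" (is ?A) "BI LB (%y. gauss si (y::real^'n) * (y $ i)) = 0"
  and "integrable LB (%y::real^'n. gauss si y * (y $ i * y $ j))"
  and "BI LB (%y. gauss si (y::real^'n) * (y $ i * y $ j)) = (if i = j then si^2 else 0)" (is ?B)
  and "integrable LB (%y::real^'n. gauss si y * (y $ i) ^ 4)"
  and "BI LB (%y. gauss si (y::real^'n) * (y $ i) ^ 4) = 3 * si ^ 4"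
proof -
 have n1: "BI LB (%x. normal_density 0 si x * x) = 0"
  using integral_normal_moment_nz_1[OF s, of 0] by simp
 have n2: "BI LB (%x. normal_density 0 si x * x^2) = si^2"
  using integral_normal_moment_even[OF s, of 0 1] by (simp add: eval_nat_numeral)
 have n4: "BI LB (%x. normal_density 0 si x * x ^ 4) = 3 * si ^ 4"
  using integral_normal_moment_even[OF s, of 0 2] by (simp add: fact_numeral power2_eq_square eval_nat_numeral)
 have n0: "BI LB (%x. normal_density 0 si x) = 1" using s by simp
 \<comment> \<open>A moment in one or two coordinates is the monomial moment whose exponent vector
   is a sum of indicators; the other factors contribute the zeroth moment 1.\<close>
 have p1: "(PROD l:UNIV. (y $ l) ^ (if l = i then n else 0)) = (y $ i) ^ n" for y :: "real^'n" and n i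
 proof -
  have "(PROD l:UNIV. (y $ l) ^ (if l = i then n else 0)) = (PROD l:UNIV. if l = i then (y $ l) ^ n else 1)"
   by (rule prod.cong) auto
  thus ?thesis by simp
 qed
 have p2: "(PROD l:UNIV. (y $ l) ^ ((if l = i then 1 else 0) + (if l = j then 1 else 0))) = y $ i * y $ j" for y :: "real^'n"
  unfolding power_add prod.distrib p1 by simp
 have q: "(PROD l:UNIV. BI LB (%x. normal_density 0 si x * x ^ (if l = i then n else 0))) = BI LB (%x. normal_density 0 si x * x ^ n)" for n and i :: 'n
 proof -
  have "(PROD l:UNIV. BI LB (%x. normal_density 0 si x * x ^ (if l = i then n else 0))) = (PROD l:UNIV. if l = i then (BI LB (%x. normal_density 0 si x * x ^ n)) else 1)"
   by (rule prod.cong) (auto simp: n0)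
  thus ?thesis by simp
 qed
 note g1 = gauss_moment[OF s, of "%l. if l = i then 1 else 0", unfolded p1 q]
 note g4 = gauss_moment[OF s, of "%l. if l = i then 4 else 0", unfolded p1 q]
 note g2 = gauss_moment[OF s, of "%l. (if l = i then 1 else 0) + (if l = j then 1 else 0)", unfolded p2]
 show ?A "BI LB (%y. gauss si (y::real^'n) * (y $ i)) = 0"
  "integrable LB (%y::real^'n. gauss si y * (y $ i) ^ 4)"
  "BI LB (%y. gauss si (y::real^'n) * (y $ i) ^ 4) = 3 * si ^ 4"
  "integrable LB (%y::real^'n. gauss si y * (y $ i * y $ j))"
  using g1 g4 g2 by (simp_all add: n1 n4)
 have "(PROD l:UNIV. BI LB (%x. normal_density 0 si x * x ^ ((if l = i then 1 else 0) + (if l = j then 1 else 0)))) = (if i = j then si^2 else 0)"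
 proof (cases "i = j")
  case True
  hence "(PROD l:UNIV. BI LB (%x. normal_density 0 si x * x ^ ((if l = i then 1 else 0) + (if l = j then 1 else 0)))) = (PROD l:UNIV. BI LB (%x. normal_density 0 si x * x ^ (if l = i then 2 else 0)))"
   by (intro prod.cong) (auto simp: numeral_2_eq_2)
  thus ?thesis using True by (simp only: q n2 simp_thms if_True)
 next
  case False
  have "(PROD l:UNIV. BI LB (%x. normal_density 0 si x * x ^ ((if l = i then 1 else 0) + (if l = j then 1 else 0)))) = 0"
   by (rule prod_zero) (use False n1 in "auto intro!: bexI[of _ i]")
  thus ?thesis using False by simp
 qed
 thus ?B using g2 by simp
qed

section \<open>Weights measurable with respect to the past\<close>

locale sde_solution =
 fixes a :: "real^'n::finite => real^'n^'n" and b :: "real^'n => real^'n"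
  and M :: "'w measure" and W X :: "real => 'w => real^'n" and A B L :: real
 assumes sol: "strong_solution a b M W X"
  and a_bound: "norm (a x) <= A" and b_bound: "norm (b x) <= B"
  and a_lip: "norm (a x - a y) <= L * norm (x - y)" and b_lip: "norm (b x - b y) <= L * norm (x - y)"
  and pos: "0 < A" "0 < B" "0 < L"

sublocale sde_solution < prob_space M using sol unfolding strong_solution_def by blast

context sde_solution begin

abbreviation F :: "real => 'w measure" where "F t \<equiv> strong_filtration M W (X 0) t"

lemma bm: "brownian_motion M W" and X0_measurable[measurable]: "X 0 : borel_measurable M"
 and X_adapted: "0 <= t ==> X t : borel_measurable (F t)"
 and X_continuous: "AE w in M. continuous_on {0..} (%t. X t w)"
 using sol unfolding strong_solution_def by blast+

lemma W_measurable: "0 <= t ==> W t : borel_measurable M"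
 and W_zero: "AE w in M. W 0 w = 0"
 and W_distributed: "0 <= s ==> s < t ==> distributed M LB (%w. W t w - W s w) (%y. ennreal (gauss (sqrt (t - s)) y))"
 and W_indep: "0 <= ta 0 ==> (!!i. i < k ==> ta i < ta (Suc i)) ==> 
  indep_vars (%_. borel) (%i w. W (ta (Suc i)) w - W (ta i) w) {..<k}"
 using bm unfolding brownian_motion_def gauss_def by auto

abbreviation filtration_generator :: "real => 'w set set" where
 "filtration_generator t \<equiv> {X 0 -` A Int space M | A. A : sets borel} \<union>
   {W s -` A Int space M | s A. 0 <= s & s <= t & A : sets borel} \<union> null_sets M"

lemma generator_events: "filtration_generator t <= sets M"
 using measurable_sets[OF X0_measurable] measurable_sets[OF W_measurable] by (auto simp: null_sets_def)

lemma generator_Pow: "filtration_generator t <= Pow (space M)"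
 using generator_events sets.space_closed by blast

lemma space_F[simp]: "space (F t) = space M"
 unfolding strong_filtration_def by (rule space_measure_of[OF generator_Pow])

lemma sets_F: "sets (F t) = sigma_sets (space M) (filtration_generator t)"
 unfolding strong_filtration_def by (rule sets_measure_of[OF generator_Pow])

lemma F_events: "sets (F t) <= sets M"
 unfolding sets_F by (rule sets.sigma_sets_subset[OF generator_events])

lemma F_mono: "s <= t ==> sets (F s) <= sets (F t)"
 unfolding sets_F by (intro sigma_sets_mono' Un_mono subset_refl) (use order.trans in blast)

lemma measurable_F_mono: "f : measurable (F s) N ==> s <= t ==> f : measurable (F t) N"
 using F_mono[of s t] by (auto simp: measurable_def)

lemma measurable_F_M: "f : measurable (F s) N ==> f : measurable M N"
 using F_events[of s] by (auto simp: measurable_def)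

lemma W_adapted: "0 <= s ==> s <= t ==> W s : borel_measurable (F t)"
proof (rule measurableI)
 fix A :: "(real^'n) set" assume "0 <= s" "s <= t" "A : sets borel"
 hence "W s -` A Int space M : filtration_generator t" by blast
 thus "W s -` A Int space (F t) : sets (F t)" unfolding sets_F space_F by (rule sigma_sets.Basic)
qed simp

lemma null_F: "N : null_sets M ==> N : sets (F t)"
 unfolding sets_F by (rule sigma_sets.Basic) auto

text \<open>Independence is given only for the increments along one increasing sequence of times. So
  the times in \<open>R\<close> are sorted together with 0 and \<open>s\<close>, and
  \<open>t\<close> is appended: the values of \<open>W\<close> on \<open>R\<close> are partial sums
  of all increments but the last, and the last increment is the one from \<open>s\<close> to
  \<open>t\<close>.\<close>

lemma increments_indep_cylinder:
 assumes R: "finite R" "R <= {0..s}" and st: "0 <= s" "s < t" and Ar: "!!r. Ar r : sets borel" and U: "U : sets borel"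
 defines "C \<equiv> {w:space M. ALL r:R. W r w : Ar r}" and "D \<equiv> (%w. W t w - W s w) -` U Int space M"
 shows "C : sets M" "D : sets M" "prob (C Int D) = prob C * prob D" (is ?A)
proof -
 define l where "l = sorted_list_of_set (insert 0 (insert s R))"
 have fin: "finite (insert 0 (insert s R))" using R by simp
 have sl: "set l = insert 0 (insert s R)" "sorted l" "distinct l" unfolding l_def using fin by (simp_all only: set_sorted_list_of_set sorted_sorted_list_of_set distinct_sorted_list_of_set)
 define k where "k = length l"
 have k0: "0 < k" unfolding k_def using sl by (cases l) auto
 have ran: "x : set l ==> 0 <= x & x <= s" for x using sl R st by auto
 have lt: "i < j ==> j < k ==> l ! i < l ! j" for i j
  using sl sorted_wrt_nth_less[of "(<)" l i j] by (simp add: strict_sorted_iff k_def)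
 have l0: "l ! 0 = 0"
 proof -
  obtain i where "i < k" "l ! i = 0" using sl by (metis in_set_conv_nth insertI1 k_def)
  moreover have "0 <= l ! 0" using ran[of "l!0"] k0 by (simp add: k_def)
  ultimately show ?thesis using lt[of 0 i] by (cases i) auto
 qed
 have lk: "l ! (k - 1) = s"
 proof -
  obtain i where i: "i < k" "l ! i = s" using sl by (metis in_set_conv_nth insertCI k_def)
  moreover have "l ! (k - 1) <= s" using ran[of "l!(k-1)"] k0 by (simp add: k_def)
  moreover have "i = k - 1 \<or> i < k - 1" "k - 1 < k" using i k0 by auto
  ultimately show ?thesis using lt[of i "k-1"] i by fastforce
 qed
 define ta where "ta i = (if i < k then l ! i else t)" for i
 have ta0: "ta 0 = 0" using l0 k0 by (simp add: ta_def)
 have tak: "ta (k-1) = s" "ta k = t" using lk k0 by (simp_all add: ta_def)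
 have ind: "indep_vars (%_. borel) (%i w. W (ta (Suc i)) w - W (ta i) w) {..<k}"
 proof (rule W_indep)
  fix i assume i: "i < k"
  show "ta i < ta (Suc i)"
  proof (cases "Suc i < k")
   case True thus ?thesis using lt by (simp add: ta_def)
  next
   case False
   hence "i = k - 1" "Suc i = k" using i by auto
   thus ?thesis using tak st by simp
  qed
 qed (simp add: ta0)
 define X1 where "X1 i w = W (ta (Suc i)) w - W (ta i) w" for i w
 have tel: "(\<Sum>i<j. X1 i w) = W (ta j) w - W 0 w" for j w
  unfolding X1_def using sum_lessThan_telescope[of "%i. W (ta i) w" j] by (simp add: ta0)
 have "EX j<k. ta j = r" if "r : R" for r
  using sl that by (metis UnCI ta_def in_set_conv_nth insertCI k_def)
 then obtain ix where ix: "!!r. r : R ==> ix r < k & ta (ix r) = r" by metis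
 define Xa where "Xa = {f:space (PiM {..<k-1} (%_. borel::(real^'n) measure)). ALL r:R. (\<Sum>i<ix r. f i) : Ar r}"
 have Xa: "Xa : sets (PiM {..<k-1} (%_. borel))"
  unfolding Xa_def
 proof (rule sets.sets_Collect_finite_All[OF _ R(1)])
  fix r assume r: "r : R"
  have "(%f. \<Sum>i<ix r. f i) : measurable (PiM {..<k-1} (%_. borel)) (borel::(real^'n) measure)"
   using ix[OF r] by (intro borel_measurable_sum measurable_component_singleton) auto
  from measurable_sets_Collect[OF this, of "%y. y : Ar r"] Ar[of r]
  show "{f:space (PiM {..<k-1} (%_. borel::(real^'n) measure)). (\<Sum>i<ix r. f i) : Ar r} : sets (PiM {..<k-1} (%_. borel))"
   by simp
 qed
 define Xb where "Xb = (%f. f (k-1)) -` U Int space (PiM {k-1} (%_. borel::(real^'n) measure))"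
 have Xb: "Xb : sets (PiM {k-1} (%_. borel))" unfolding Xb_def
  by (intro measurable_sets[OF _ U] measurable_component_singleton) simp
 have iv: "indep_var (PiM {..<k-1} (%_. borel)) (%w. restrict (%i. X1 i w) {..<k-1}) (PiM {k-1} (%_. borel)) (%w. restrict (%i. X1 i w) {k-1})"
  unfolding X1_def by (rule indep_var_restrict[OF ind]) (use k0 in auto)
 note pr = indep_varD[OF iv Xa Xb]
 have Cm: "C : sets M" unfolding C_def
 proof (cases "R = {}")
  case False
  show "{w:space M. ALL r:R. W r w : Ar r} : sets M"
  proof (rule sets.sets_Collect_finite_All'[OF _ R(1) False])
   fix r assume "r : R"
   with R W_measurable[of r] have [measurable]: "W r : borel_measurable M" by auto
   show "{w:space M. W r w : Ar r} : sets M" using Ar[of r] by measurable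
  qed
 qed auto
 have Wm: "W t : borel_measurable M" "W s : borel_measurable M" using st by (auto intro: W_measurable)
 have Dm: "D : sets M" unfolding D_def by (intro measurable_sets[OF _ U] borel_measurable_diff Wm)
 have Deq: "D = (%w. restrict (%i. X1 i w) {k-1}) -` Xb Int space M"
  using k0 tak by (auto simp: D_def Xb_def X1_def space_PiM)
 \<comment> \<open>The partial sums reproduce \<open>W r - W 0\<close>, and \<open>W 0 = 0\<close>
   holds only almost surely; so \<open>?C\<close> is \<open>C\<close> up to a null set.\<close>
 let ?C = "(%w. restrict (%i. X1 i w) {..<k-1}) -` Xa Int space M"
 have Ceq: "?C = {w:space M. ALL r:R. W r w - W 0 w : Ar r}"
 proof -
  have "(\<Sum>i<ix r. restrict (%i. X1 i w) {..<k-1} i) = W r w - W 0 w" if "r : R" for r w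
  proof -
   have "(\<Sum>i<ix r. restrict (%i. X1 i w) {..<k-1} i) = (\<Sum>i<ix r. X1 i w)"
    by (rule sum.cong) (use ix[OF that] in auto)
   thus ?thesis using ix[OF that] by (simp add: tel)
  qed
  thus ?thesis by (auto simp: Xa_def space_PiM)
 qed
 have C'm: "?C : sets M"
  using iv Xa unfolding indep_var_eq by (auto intro: measurable_sets)
 have ae: "AE w in M. w : C \<longleftrightarrow> w : ?C"
  unfolding Ceq C_def using W_zero by eventually_elim auto
 have "prob (C Int D) = prob (?C Int D)"
  using ae C'm Cm Dm by (intro measure_eq_AE) (auto elim!: eventually_mono)
 also have "... = prob ?C * prob D"
 proof -
  have eq: "(%w. (restrict (%i. X1 i w) {..<k-1}, restrict (%i. X1 i w) {k-1})) -` (Xa \<times> Xb) Int space M = ?C Int D"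
   unfolding Deq by blast
  show ?thesis using pr unfolding Deq[symmetric] eq .
 qed
 also have "prob ?C = prob C" using ae C'm Cm by (intro measure_eq_AE) (auto elim!: eventually_mono)
 finally show ?A .
 show "C : sets M" "D : sets M" by fact+
qed

text \<open>An intersection-stable family that generates the filtration up to null sets, as needed
  for the passage from generators to sigma-algebras.\<close>

definition cylinders :: "real => 'w set set" where
 "cylinders s = {E. EX A0 R Ar. A0 : sets borel & finite R & R <= {0..s} & (ALL r. Ar r : sets borel) &
   E = {w:space M. X 0 w : A0 & (ALL r:R. W r w : Ar r)}}"

lemma cylindersI: "A0 : sets borel ==> finite R ==> R <= {0..s} ==> (!!r. Ar r : sets borel) ==> 
  {w:space M. X 0 w : A0 & (ALL r:R. W r w : Ar r)} : cylinders s"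
 unfolding cylinders_def by blast

lemma cylindersE:
 assumes "E : cylinders s"
 obtains A0 R Ar where "A0 : sets borel" "finite R" "R <= {0..s}" "ALL r. Ar r : sets borel"
  "E = {w:space M. X 0 w : A0 & (ALL r:R. W r w : Ar r)}"
 using assms that unfolding cylinders_def mem_Collect_eq by (elim exE conjE)

lemma Int_stable_cylinders: "Int_stable (cylinders s)"
proof (rule Int_stableI)
 fix E E' assume EE: "E : cylinders s" "E' : cylinders s"
 obtain A0 R Ar where e: "A0 : sets borel" "finite R" "R <= {0..s}" "ALL r. Ar r : sets borel"
  "E = {w:space M. X 0 w : A0 & (ALL r:R. W r w : Ar r)}" by (rule cylindersE[OF EE(1)])
 obtain A0' R' Ar' where e': "A0' : sets borel" "finite R'" "R' <= {0..s}" "ALL r. Ar' r : sets borel"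
  "E' = {w:space M. X 0 w : A0' & (ALL r:R'. W r w : Ar' r)}" by (rule cylindersE[OF EE(2)])
 have "E Int E' = {w:space M. X 0 w : A0 Int A0' & (ALL r:R \<union> R'. W r w : (if r : R then Ar r else UNIV) Int (if r : R' then Ar' r else UNIV))}"
  unfolding e(5) e'(5) by auto
 also have "... : cylinders s" by (rule cylindersI) (use e e' in auto)
 finally show "E Int E' : cylinders s" .
qed

text \<open>The initial value is independent of the whole driving path, so it is split off first,
  from \<open>G0 Int (G Int E')\<close> as well as from \<open>G0 Int G\<close>; what remains
  concerns \<open>W\<close> alone. Independence then passes from the two stable families to the
  sigma-algebras they generate.\<close>

lemma cylinders_indep:
 assumes st: "0 <= s" "s < t"
 shows "indep_set (sigma_sets (space M) (cylinders s)) (sigma_sets (space M) {(%w. W t w - W s w) -` U Int space M | U. U : sets borel})"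
proof (rule indep_set_sigma_sets)
 show "Int_stable (cylinders s)" by (rule Int_stable_cylinders)
 show "Int_stable {(%w. W t w - W s w) -` U Int space M | U. U : sets borel}"
 proof (rule Int_stableI)
  fix E E' assume "E : {(%w. W t w - W s w) -` U Int space M | U. U : sets borel}" "E' : {(%w. W t w - W s w) -` U Int space M | U. U : sets borel}"
  then obtain U U' where "E = (%w. W t w - W s w) -` U Int space M" "U : sets borel" "E' = (%w. W t w - W s w) -` U' Int space M" "U' : sets borel"
   by blast
  hence "E Int E' = (%w. W t w - W s w) -` (U Int U') Int space M" "U Int U' : sets borel" by auto
  thus "E Int E' : {(%w. W t w - W s w) -` U Int space M | U. U : sets borel}" by blast
 qed
 let ?SX = "{X 0 -` A Int space M | A. A : sets borel}" and ?SW = "sigma_sets (space M) {W s -` A Int space M | s A. 0 <= s & A : sets borel}"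
 have ind: "indep_set ?SX ?SW" using sol unfolding strong_solution_def by blast
 have sub: "{W s -` A Int space M | s A. 0 <= s & A : sets borel} <= Pow (space M)" by auto
 define S where "S = sigma (space M) {W s -` A Int space M | s A. 0 <= s & A : sets borel}"
 have setsS: "sets S = ?SW" and spS[simp]: "space S = space M"
  unfolding S_def by (rule sets_measure_of[OF sub], rule space_measure_of[OF sub])
 have WS: "W r : borel_measurable S" if "0 <= r" for r
 proof (rule measurableI)
  fix A :: "(real^'n) set" assume "A : sets borel"
  hence "W r -` A Int space M : {W s -` A Int space M | s A. 0 <= s & A : sets borel}" using that by blast
  thus "W r -` A Int space S : sets S" unfolding setsS spS by (rule sigma_sets.Basic)
 qed simp
 show "indep_set (cylinders s) {(%w. W t w - W s w) -` U Int space M | U. U : sets borel}"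
  unfolding indep_sets2_eq
 proof (intro conjI subsetI ballI)
  fix E assume "E : {(%w. W t w - W s w) -` U Int space M | U. U : sets borel}"
  then obtain U where E: "E = (%w. W t w - W s w) -` U Int space M" "U : sets borel" by blast
  show "E : events" unfolding E(1) using st by (intro measurable_sets[OF _ E(2)] borel_measurable_diff W_measurable) auto
 next
  fix E assume EE: "E : cylinders s"
  obtain A0 R Ar where e: "A0 : sets borel" "finite R" "R <= {0..s}" "ALL r. Ar r : sets borel"
   "E = {w:space M. X 0 w : A0 & (ALL r:R. W r w : Ar r)}" by (rule cylindersE[OF EE])
  have "E = (X 0 -` A0 Int space M) Int {w:space M. ALL r:R. W r w : Ar r}" unfolding e(5) by auto
  also have "... : events"
   by (intro sets.Int increments_indep_cylinder(1)[OF e(2,3) st _ sets.top[of borel, unfolded space_borel]] measurable_sets[OF X0_measurable e(1)]) (use e(4) in blast)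
  finally show "E : events" .
  fix E' assume "E' : {(%w. W t w - W s w) -` U Int space M | U. U : sets borel}"
  then obtain U where U: "E' = (%w. W t w - W s w) -` U Int space M" "U : sets borel" by blast
  define G where "G = {w:space M. ALL r:R. W r w : Ar r}"
  define G0 where "G0 = X 0 -` A0 Int space M"
  have G0: "G0 : ?SX" using e(1) unfolding G0_def by blast
  have EG: "E = G0 Int G" unfolding e(5) G_def G0_def by auto
  have GS: "G : ?SW" unfolding setsS[symmetric]
  proof (cases "R = {}")
   case True thus "G : sets S" unfolding G_def by (simp add: spS[symmetric] del: spS)
  next
   case False
   have "{w:space S. ALL r:R. W r w : Ar r} : sets S"
   proof (rule sets.sets_Collect_finite_All'[OF _ e(2) False])
    fix r assume "r : R"
    hence [measurable]: "W r : borel_measurable S" using e(3) by (intro WS) auto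
    show "{w:space S. W r w : Ar r} : sets S" using e(4) by measurable
   qed
   thus "G : sets S" unfolding G_def by simp
  qed
  have ES: "E' : ?SW" unfolding setsS[symmetric]
  proof -
   have "(%w. W t w - W s w) : borel_measurable S" using st by (intro borel_measurable_diff WS) auto
   from measurable_sets[OF this U(2)] show "E' : sets S" unfolding U(1) by simp
  qed
  have GE: "G Int E' : ?SW" using GS ES unfolding setsS[symmetric] by auto
  have "prob (E Int E') = prob (G0 Int (G Int E'))" unfolding EG by (simp add: Int_assoc)
  also have "... = prob G0 * prob (G Int E')" by (rule indep_setD[OF ind G0 GE])
  also have "prob (G Int E') = prob G * prob E'"
   using increments_indep_cylinder(3)[OF e(2,3) st e(4)[rule_format] U(2)] unfolding G_def U(1) .
  also have "prob G0 * (prob G * prob E') = prob E * prob E'"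
   unfolding EG by (simp add: indep_setD[OF ind G0 GS])
  finally show "prob (E Int E') = prob E * prob E'" .
 qed
qed

text \<open>The augmentation adds all null sets to the generators; induction over the generated
  sigma-algebra shows that it changes events only by null sets, which probabilities do not
  see.\<close>

lemma F_cylinders:
 assumes "E : sets (F s)"
 shows "EX E':sigma_sets (space M) (cylinders s). AE w in M. w : E \<longleftrightarrow> w : E'"
 using assms unfolding sets_F
proof induction
 case (Basic E)
 then consider A where "E = X 0 -` A Int space M" "A : sets borel" | r A where "E = W r -` A Int space M" "0 <= r" "r <= s" "A : sets borel"
  | "E : null_sets M" by blast
 thus ?case
 proof cases
  case (1 A)
  have "{w:space M. X 0 w : A & (ALL r:{}. W r w : UNIV)} : cylinders s" by (rule cylindersI) (use 1 in auto)
  moreover have "{w:space M. X 0 w : A & (ALL r:{}. W r w : UNIV)} = E" using 1 by auto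
  ultimately show ?thesis by (auto intro!: bexI[of _ E] sigma_sets.Basic)
 next
  case (2 r A)
  have "{w:space M. X 0 w : UNIV & (ALL r:{r}. W r w : A)} : cylinders s" by (rule cylindersI) (use 2 in auto)
  moreover have "{w:space M. X 0 w : UNIV & (ALL r:{r}. W r w : A)} = E" using 2 by auto
  ultimately show ?thesis by (auto intro!: bexI[of _ E] sigma_sets.Basic)
 next
  case 3
  hence "AE w in M. w \<notin> E" by (rule AE_not_in)
  thus ?thesis by (intro bexI[of _ "{}"] sigma_sets.Empty) (auto elim: eventually_mono)
 qed
next
 case Empty
 show ?case by (intro bexI[of _ "{}"] sigma_sets.Empty) auto
next
 case (Compl E)
 then obtain E' where "E' : sigma_sets (space M) (cylinders s)" "AE w in M. w : E \<longleftrightarrow> w : E'" by blast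
 thus ?case by (intro bexI[of _ "space M - E'"] sigma_sets.Compl) (auto elim: eventually_mono)
next
 case (Union E)
 then obtain E' where E': "!!i. E' i : sigma_sets (space M) (cylinders s)" "!!i::nat. AE w in M. w : E i \<longleftrightarrow> w : E' i" by metis
 have "AE w in M. ALL i. w : E i \<longleftrightarrow> w : E' i" using E'(2) by (simp add: AE_all_countable)
 thus ?case by (intro bexI[of _ "\<Union>i. E' i"] sigma_sets.Union E') (auto elim: eventually_mono)
qed

lemma F_indep:
 assumes st: "0 <= s" "s < t" and psi: "psi : borel_measurable (F s)"
 shows "indep_var borel psi borel (%w. W t w - W s w)"
proof -
 have Wm: "(%w. W t w - W s w) : borel_measurable M" using st by (intro borel_measurable_diff W_measurable) auto
 have ind: "indep_set (sets (F s)) (sigma_sets (space M) {(%w. W t w - W s w) -` U Int space M | U. U : sets borel})"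
  unfolding indep_sets2_eq
 proof (intro conjI ballI)
  note ci = cylinders_indep[OF st]
  show "sets (F s) <= events" by (rule F_events)
  show sW: "sigma_sets (space M) {(%w. W t w - W s w) -` U Int space M | U. U : sets borel} <= events"
   by (rule indep_setD_ev2[OF ci])
  fix E E' assume E: "E : sets (F s)" and E': "E' : sigma_sets (space M) {(%w. W t w - W s w) -` U Int space M | U. U : sets borel}"
  obtain G where G: "G : sigma_sets (space M) (cylinders s)" and ae: "AE w in M. w : E \<longleftrightarrow> w : G" using F_cylinders[OF E] by blast
  have ev: "E : events" "G : events" "E' : events" using E F_events G E' sW indep_setD_ev1[OF ci] by auto
  have "prob (E Int E') = prob (G Int E')" using ae ev by (intro measure_eq_AE) (auto elim!: eventually_mono)
  also have "... = prob G * prob E'" by (rule indep_setD[OF ci G E'])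
  also have "prob G = prob E" using ae ev by (intro measure_eq_AE) (auto elim!: eventually_mono)
  finally show "prob (E Int E') = prob E * prob E'" .
 qed
 have sub: "sigma_sets (space M) {psi -` A Int space M | A. A : sets borel} <= sets (F s)"
  using measurable_sets[OF psi] by (intro sets.sigma_sets_subset[of _ "F s", simplified]) auto
 show ?thesis unfolding indep_var_eq
 proof (intro conjI)
  show "indep_set (sigma_sets (space M) {psi -` A Int space M | A. A : sets borel}) (sigma_sets (space M) {(%w. W t w - W s w) -` A Int space M | A. A : sets borel})"
   unfolding indep_sets2_eq
   using sub F_events[of s] indep_setD_ev2[OF ind] indep_setD[OF ind] by (meson subset_trans subsetD)
 qed (rule measurable_F_M[OF psi] Wm)+
qed

end

lemma borel_measurable_nth[measurable (raw)]:
 fixes f :: "'a => 'b::real_normed_vector^'n::finite"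
 assumes "f : borel_measurable N" shows "(%x. f x $ i) : borel_measurable N"
 by (rule measurable_compose[OF assms borel_measurable_continuous_onI]) (intro continuous_intros)

lemma borel_measurable_vecI:
 fixes f :: "'a => real^'n::finite"
 assumes "!!i. (%x. f x $ i) : borel_measurable N" shows "f : borel_measurable N"
 unfolding borel_measurable_euclidean_space[of f] using assms by (auto simp: Basis_vec_def inner_axis)

lemma matrix_vector_measurable[measurable (raw)]:
 fixes f :: "'a => real^'n::finite^'m::finite"
 assumes [measurable]: "f : borel_measurable N" "g : borel_measurable N" shows "(%x. f x *v g x) : borel_measurable N"
 by (rule borel_measurable_vecI) (simp add: matrix_vector_mult_def)

section \<open>Weighted moments of Brownian increments and the isometry for simple integrals\<close>

context sde_solution begin

abbreviation dW :: "real => real => 'w => real^'n" where "dW u v w \<equiv> W v w - W u w"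

lemma dW_measurable: "0 <= u ==> 0 <= v ==> dW u v : borel_measurable M"
 by (intro borel_measurable_diff W_measurable)

lemma dW_gauss:
 fixes g :: "real^'n => real"
 assumes "0 <= u" "u < v" and g: "g : BB" and i: "integrable LB (%y. gauss (sqrt (v - u)) y * g y)"
 shows "integrable M (%w. g (dW u v w))" "EE (%w. g (dW u v w)) = BI LB (%y. gauss (sqrt (v - u)) y * g y)"
 using distributed_integrable[OF W_distributed[OF assms(1,2)], of g] distributed_integral[OF W_distributed[OF assms(1,2)], of g] g i
 by auto

lemma dW_sq_integrable: assumes "0 <= u" "u <= v" shows "integrable M (%w. (dW u v w $ i)^2)"
proof (cases "u = v")
 case False
 hence uv: "u < v" using assms by simp
 have "integrable LB (%y. gauss (sqrt (v - u)) (y::real^'n) * (y $ i)^2)"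
  using gauss_moments(3)[of "sqrt (v - u)" i i] uv by (simp add: power2_eq_square)
 from dW_gauss(1)[OF assms(1) uv _ this] show ?thesis by simp
qed simp

lemma integrable_sq_bound:
 fixes f g h :: "'w => real"
 assumes "integrable M (%w. (f w)^2)" "integrable M (%w. (g w)^2)"
  and [measurable]: "f : borel_measurable M" "g : borel_measurable M" "h : borel_measurable M"
  and h: "!!w. w : space M ==> abs (h w) <= K"
 shows "integrable M (%w. h w * f w * g w)"
proof (rule integrable_bound'[of M "%w. K * ((f w)^2 + (g w)^2)"])
 show "AE w in M. norm (h w * f w * g w) <= norm (K * ((f w)^2 + (g w)^2))"
 proof (rule AE_I2)
  fix w assume w: "w : space M"
  have "abs (f w) * abs (g w) <= (f w)^2 + (g w)^2"
   using sum_squares_bound[of "abs (f w)" "abs (g w)"] mult_nonneg_nonneg[OF abs_ge_zero abs_ge_zero, of "f w" "g w"] unfolding power2_abs mult.assoc by linarith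
  hence "abs (h w) * (abs (f w) * abs (g w)) <= K * ((f w)^2 + (g w)^2)"
   by (intro mult_mono h w) (use h[OF w] in auto)
  thus "norm (h w * f w * g w) <= norm (K * ((f w)^2 + (g w)^2))"
   using order.trans[OF abs_ge_zero h[OF w]] by (simp add: abs_mult mult.assoc)
 qed
qed (use assms in auto)

lemma F_indep_fun:
 fixes psi :: "'w => real"
 assumes "0 <= s" "s < t" "psi : borel_measurable (F s)" and [measurable]: "g : BB"
 shows "indep_var borel psi borel (%w. g (dW s t w) :: real)"
proof -
 \<comment> \<open>Both variables of \<open>indep_var\<close> have the same type, so the real weight
   is carried on one axis of the vector space.\<close>
 obtain k :: 'n where True by blast
 have "(%w. psi w *R axis k 1 :: real^'n) : borel_measurable (F s)"
  by (intro borel_measurable_scaleR assms(3) borel_measurable_const)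
 from indep_var_compose[OF F_indep[OF assms(1,2) this], of "%y. y $ k" borel g borel]
 show ?thesis by (simp add: comp_def)
qed

lemma dW_mean:
 assumes uv: "0 <= u" "u <= v" and psi: "psi : borel_measurable (F u)" "integrable M psi"
 shows "integrable M (%w. psi w * dW u v w $ i)" (is ?A) "EE (%w. psi w * dW u v w $ i) = 0"
proof -
 have "integrable M (%w. psi w * dW u v w $ i) & EE (%w. psi w * dW u v w $ i) = 0"
 proof (cases "u = v")
  case False
  hence uv': "u < v" using uv by simp
  have s: "0 < sqrt (v - u)" using uv' by simp
  have iv: "indep_var borel psi borel (%w. dW u v w $ i)"
   by (rule F_indep_fun[OF uv(1) uv' psi(1)]) measurable
  have g: "integrable M (%w. dW u v w $ i)" "EE (%w. dW u v w $ i) = 0"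
   using dW_gauss[OF uv(1) uv', of "%y. y $ i"] gauss_moments(1,2)[OF s, of i] by auto
  show ?thesis using indep_var_integrable[OF iv psi(2) g(1)] indep_var_lebesgue_integral[OF iv psi(2) g(1)] g(2) by simp
 qed simp
 thus ?A "EE (%w. psi w * dW u v w $ i) = 0" by auto
qed

lemma dW_square:
 assumes uv: "0 <= u" "u <= v" and psi: "psi : borel_measurable (F u)" "integrable M psi"
 shows "EE (%w. psi w * (dW u v w $ i * dW u v w $ j)) = (if i = j then v - u else 0) * EE psi"
proof (cases "u = v")
 case False
 hence uv': "u < v" using uv by simp
 have s: "0 < sqrt (v - u)" using uv' by simp
 have iv: "indep_var borel psi borel (%w. dW u v w $ i * dW u v w $ j)"
  by (rule F_indep_fun[OF uv(1) uv' psi(1)]) measurable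
 have g: "integrable M (%w. dW u v w $ i * dW u v w $ j)" "EE (%w. dW u v w $ i * dW u v w $ j) = (if i = j then v - u else 0)"
  using dW_gauss[OF uv(1) uv', of "%y. y $ i * y $ j"] gauss_moments(3,4)[OF s, of i j] uv' by auto
 show ?thesis using indep_var_lebesgue_integral[OF iv psi(2) g(1)] g(2) by simp
qed auto

text \<open>Testing against all bounded weights known at time \<open>s\<close> expresses
  conditioning on the past without forming conditional expectations.\<close>

definition bddF :: "real => ('w => real) => bool" where
 "bddF s psi \<longleftrightarrow> psi : borel_measurable (F s) & (EX K. ALL w:space M. abs (psi w) <= K)"

lemma bddF_D: assumes "bddF s psi" shows "psi : borel_measurable (F s)" (is ?A) "psi : borel_measurable M" "integrable M psi"
proof -
 obtain K where K: "!!w. w\<in>space M ==> abs (psi w) <= K" and m: "psi : borel_measurable (F s)" using assms unfolding bddF_def by blast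
 show ?A "psi : borel_measurable M" using m measurable_F_M by auto
 thus "integrable M psi" using K by (intro integrable_const_bound[of _ K]) auto
qed

lemma bddF_bound: assumes "bddF s psi" obtains K where "0 <= K" "!!w. w\<in>space M ==> abs (psi w) <= K"
proof -
 obtain K where K: "!!w. w\<in>space M ==> abs (psi w) <= K" using assms unfolding bddF_def by blast
 hence "abs (psi w) <= max K 0" if "w : space M" for w using that by (simp add: le_max_iff_disj)
 thus ?thesis by (intro that[of "max K 0"]) auto
qed

lemma bddF_mono: "bddF s psi ==> s <= t ==> bddF t psi"
 unfolding bddF_def using measurable_F_mono by blast

lemma bddF_mult: assumes "bddF s p" "bddF s q" shows "bddF s (%w. p w * q w)"
proof -
 obtain K1 where 1: "0 <= K1" "!!w. w\<in>space M ==> abs (p w) <= K1" using bddF_bound[OF assms(1)] by blast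
 obtain K2 where 2: "0 <= K2" "!!w. w\<in>space M ==> abs (q w) <= K2" using bddF_bound[OF assms(2)] by blast
 have "ALL w:space M. abs (p w * q w) <= K1 * K2" using 1 2 by (auto simp: abs_mult intro!: mult_mono)
 thus ?thesis unfolding bddF_def using bddF_D(1)[OF assms(1)] bddF_D(1)[OF assms(2)] by (intro conjI borel_measurable_times) auto
qed

lemma dW_orthogonal:
 assumes uv: "0 <= u" "u <= v" "v <= p" "p <= q" and psi: "bddF p psi"
 shows "EE (%w. psi w * dW u v w $ i * dW p q w $ j) = 0"
proof -
 obtain K where K: "!!w. w\<in>space M ==> abs (psi w) <= K" using bddF_bound[OF psi] by blast
 have Wm: "W v : borel_measurable (F p)" "W u : borel_measurable (F p)" using uv by (auto intro: W_adapted)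
 have m: "(%w. psi w * dW u v w $ i) : borel_measurable (F p)"
 proof -
  note [measurable] = bddF_D(1)[OF psi] Wm
  show ?thesis by measurable
 qed
 have "integrable M (%w. psi w * dW u v w $ i * 1)"
  using uv by (intro integrable_sq_bound[of _ _ _ K] dW_sq_integrable K bddF_D(2)[OF psi] borel_measurable_nth dW_measurable) auto
 hence "integrable M (%w. psi w * dW u v w $ i)" by simp
 from dW_mean(2)[OF _ uv(4) m this] uv show ?thesis by simp
qed

definition ov :: "real => real => real => real => real" where "ov u v p q = max 0 (min v q - max u p)"

text \<open>The later interval starts at \<open>p\<close>, where the weight is known. The part of
  (u, v] before \<open>p\<close> is orthogonal to the increment over (p, q]; after \<open>p\<close>
  both increments start at the same time, and the longer one is split at the end of the
  shorter.\<close>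

lemma dW_bilinear_aux:
 assumes o: "0 <= u" "u < v" "0 <= p" "p < q" "u <= p" and psi: "bddF p psi"
 shows "EE (%w. psi w * (dW u v w $ i * dW p q w $ j)) = (if i = j then ov u v p q else 0) * EE psi"
proof -
 obtain K where K: "!!w. w\<in>space M ==> abs (psi w) <= K" using bddF_bound[OF psi] by blast
 have int: "integrable M (%w. phi w * dW u v w $ i * dW p q w $ j)" if t: "0 <= u" "u <= v" "0 <= p" "p <= q" and phi: "bddF p' phi" for u v p q phi p' i j
 proof -
  obtain K where K: "!!w. w\<in>space M ==> abs (phi w) <= K" using bddF_bound[OF phi] by blast
  show ?thesis using t
   by (intro integrable_sq_bound[of _ _ _ K] dW_sq_integrable K bddF_D(2)[OF phi] borel_measurable_nth dW_measurable) auto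
 qed
 show ?thesis
 proof (cases "v <= p")
  case True
  hence "ov u v p q = 0" using o by (simp add: ov_def)
  thus ?thesis using dW_orthogonal[OF o(1) _ True _ psi, of q i j] o by (simp add: mult.assoc)
 next
  case False
  have split: "EE (%w. psi w * (dW u v w $ i * dW p q w $ j)) = EE (%w. psi w * (dW p v w $ i * dW p q w $ j))"
  proof -
   have "(%w. psi w * (dW u v w $ i * dW p q w $ j)) = (%w. psi w * dW u p w $ i * dW p q w $ j + psi w * dW p v w $ i * dW p q w $ j)"
    by (simp add: fun_eq_iff algebra_simps)
   hence "EE (%w. psi w * (dW u v w $ i * dW p q w $ j)) = EE (%w. psi w * dW u p w $ i * dW p q w $ j) + EE (%w. psi w * dW p v w $ i * dW p q w $ j)"
    using o False by (simp only:, intro Bochner_Integration.integral_add int[OF _ _ _ _ psi]) auto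
   thus ?thesis using dW_orthogonal[OF o(1,5) order.refl _ psi, of q i j] o by (simp add: mult.assoc)
  qed
  have sym: "EE (%w. psi w * (dW p v w $ i * dW p q w $ j)) = (if i = j then v - p else 0) * EE psi"
   if "p < v" "v <= q" for v q i j
  proof -
   have "(%w. psi w * (dW p v w $ i * dW p q w $ j)) = (%w. psi w * dW p v w $ i * dW p v w $ j + psi w * dW p v w $ i * dW v q w $ j)"
    by (simp add: fun_eq_iff algebra_simps)
   hence "EE (%w. psi w * (dW p v w $ i * dW p q w $ j)) = EE (%w. psi w * dW p v w $ i * dW p v w $ j) + EE (%w. psi w * dW p v w $ i * dW v q w $ j)"
    using o that by (simp only:, intro Bochner_Integration.integral_add int[OF _ _ _ _ psi]) auto
   moreover have "EE (%w. psi w * dW p v w $ i * dW v q w $ j) = 0"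
    using that o by (intro dW_orthogonal bddF_mono[OF psi]) auto
   ultimately show ?thesis using dW_square[OF o(3) _ bddF_D(1,3)[OF psi], of v i j] that by (simp add: mult.assoc)
  qed
  show ?thesis
  proof (cases "v <= q")
   case True
   hence "ov u v p q = v - p" using o False by (simp add: ov_def)
   thus ?thesis using sym[of v q i j] True False split by simp
  next
   case v: False
   hence "ov u v p q = q - p" using o False by (simp add: ov_def)
   moreover have "(%w. psi w * (dW p v w $ i * dW p q w $ j)) = (%w. psi w * (dW p q w $ j * dW p v w $ i))" by (simp add: mult.commute)
   ultimately show ?thesis using sym[of q v j i] v o split by auto
  qed
 qed
qed

lemma dW_bilinear:
 assumes o: "0 <= u" "u <= v" "0 <= p" "p <= q" and psi: "u < v ==> p < q ==> bddF (max u p) psi"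
 shows "EE (%w. psi w * (dW u v w $ i * dW p q w $ j)) = (if i = j then ov u v p q else 0) * EE psi"
proof (cases "u < v & p < q")
 case True
 show ?thesis
 proof (cases "u <= p")
  case le: True
  thus ?thesis using dW_bilinear_aux[of u v p q psi i j] True o psi by (simp add: max_absorb2)
 next
  case False
  have "(%w. psi w * (dW u v w $ i * dW p q w $ j)) = (%w. psi w * (dW p q w $ j * dW u v w $ i))" by (simp add: mult.commute)
  moreover have "ov u v p q = ov p q u v" by (simp add: ov_def min.commute max.commute)
  ultimately show ?thesis using dW_bilinear_aux[of p q u v psi j i] True o psi False by (auto simp: max_absorb1)
 qed
next
 case False
 hence "u = v \<or> p = q" using o by auto
 thus ?thesis by (auto simp: ov_def max_def min_def)
qed

text \<open>Measurability at time \<open>u\<close> is asked only of nonempty intervals: cutting a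
  simple process at time \<open>t\<close> leaves empty intervals at \<open>t\<close> whose
  coefficients are known only later.\<close>

definition ito_term :: "real => real => ('w => real^'n^'n) => bool" where
 "ito_term u v xi \<longleftrightarrow> 0 <= u & u <= v & (u < v --> xi : borel_measurable (F u)) & xi : borel_measurable M & (EX K. ALL w:space M. norm (xi w) <= K)"

text \<open>A simple integral is built together with its integrand, term by term and with
  overlapping intervals allowed. Sums and differences then need no common refinement of
  partitions.\<close>

inductive ito_sum :: "('w => real^'n) => (real => 'w => real^'n^'n) => bool" where
 ito_zero: "ito_sum (%_. 0) (%_ _. 0)"
| ito_add: "ito_term u v xi ==> ito_sum S H ==> 
  ito_sum (%w. xi w *v dW u v w + S w) (%s w. indicator {u<..v} s *R xi w + H s w)"

lemma ito_sum_term: "ito_term u v xi ==> ito_sum (%w. xi w *v dW u v w) (%s w. indicator {u<..v} s *R xi w)"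
 using ito_add[OF _ ito_zero] by simp

lemma ito_sum_add: "ito_sum S H ==> ito_sum S' H' ==> ito_sum (%w. S w + S' w) (%s w. H s w + H' s w)"
 by (induction rule: ito_sum.induct) (auto simp: add.assoc intro: ito_sum.intros)

lemma ito_sum_uminus: "ito_sum S H ==> ito_sum (%w. - S w) (%s w. - H s w)"
proof (induction rule: ito_sum.induct)
 case (ito_add u v xi S H)
 have "ito_term u v (%w. - xi w)" using ito_add(1) unfolding ito_term_def by auto
 from ito_sum.ito_add[OF this ito_add(3)]
 have "ito_sum (%w. (- xi w) *v dW u v w + - S w) (%s w. indicator {u<..v} s *R (- xi w) + - H s w)" .
 moreover have "(- xi w) *v dW u v w + - S w = - (xi w *v dW u v w + S w)" for w
  by (simp add: vec_eq_iff matrix_vector_mult_def sum_negf)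
 moreover have "indicator {u<..v} s *R (- xi w) + - H s w = - (indicator {u<..v} s *R xi w + H s w)" for s :: real and w
  by simp
 ultimately show ?case by simp
qed (simp add: ito_zero)

lemma indicator_overlap:
 assumes "u <= v" "p <= q"
 shows "integrable LB (%s. indicator {u<..v} s * indicator {p<..q} s :: real)" (is ?A) "BI LB (%s. indicator {u<..v} s * indicator {p<..q} s) = ov u v p q"
proof -
 have eq: "(%s. indicator {u<..v} s * indicator {p<..q} s :: real) = indicator {max u p<..min v q}"
  by (auto simp: fun_eq_iff indicator_def)
 show ?A "BI LB (%s. indicator {u<..v} s * indicator {p<..q} s) = ov u v p q"
  unfolding eq ov_def by (cases "max u p <= min v q"; simp del: max_less_iff_conj min_less_iff_conj max.bounded_iff min.bounded_iff)+
qed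

text \<open>The isometry in polarised form. It is additive in each argument, so it passes from two
  single terms to all pairs of sums by two nested inductions.\<close>

definition ito_pair where
 "ito_pair S H S' H' \<longleftrightarrow> integrable M (%w. S w \<bullet> S' w) & (ALL w. integrable LB (%s. H s w \<bullet> H' s w)) &
  integrable M (%w. BI LB (%s. H s w \<bullet> H' s w)) & EE (%w. S w \<bullet> S' w) = EE (%w. BI LB (%s. H s w \<bullet> H' s w))"

lemma ito_pair_add: "ito_pair S H T J ==> ito_pair S' H' T J ==> ito_pair (%w. S w + S' w) (%s w. H s w + H' s w) T J"
 unfolding ito_pair_def by (simp add: inner_add_left)

lemma ito_pair_commute: "ito_pair S H T J ==> ito_pair T J S H"
 unfolding ito_pair_def by (simp add: inner_commute)

lemma ito_pair_term:
 assumes "ito_term u v xi" "ito_term p q eta"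
 shows "ito_pair (%w. xi w *v dW u v w) (%s w. indicator {u<..v} s *R xi w) (%w. eta w *v dW p q w) (%s w. indicator {p<..q} s *R eta w)"
proof -
 note a = assms[unfolded ito_term_def]
 obtain K1 K2 where K: "!!w. w\<in>space M ==> norm (xi w) <= K1" "!!w. w\<in>space M ==> norm (eta w) <= K2" using a by blast
 have [measurable]: "xi : borel_measurable M" "eta : borel_measurable M" using a by auto
 have c: "abs (xi w $ i $ j) <= K1" "abs (eta w $ i $ j) <= K2" if "w : space M" for w i j
  using K[OF that] component_le_norm_cart[of "xi w $ i" j] component_le_norm_cart[of "eta w $ i" j] Finite_Cartesian_Product.norm_nth_le[of "xi w" i] Finite_Cartesian_Product.norm_nth_le[of "eta w" i]
  by linarith+
 have K0: "w : space M ==> 0 <= K1" "w : space M ==> 0 <= K2" for w using K[of w] norm_ge_zero order.trans by blast+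
 let ?p = "%i j l w. xi w $ i $ j * eta w $ i $ l"
 have pb: "abs (?p i j l w) <= K1 * K2" if "w : space M" for i j l w
  using c[OF that] K0[OF that] by (auto simp: abs_mult intro!: mult_mono)
 have pm: "?p i j l : borel_measurable M" for i j l by measurable
 have dm: "dW u v : borel_measurable M" "dW p q : borel_measurable M" using a by (auto intro!: dW_measurable)
 have e: "(xi w *v dW u v w) \<bullet> (eta w *v dW p q w) = (SUM i:UNIV. SUM j:UNIV. SUM l:UNIV. ?p i j l w * (dW u v w $ j * dW p q w $ l))" for w
  unfolding inner_vec_def matrix_vector_mult_def by (simp add: sum_product) (simp add: mult_ac)
 have int: "integrable M (%w. ?p i j l w * (dW u v w $ j * dW p q w $ l))" for i j l
  using a pb pm by (subst mult.assoc[symmetric]) (intro integrable_sq_bound[of _ _ _ "K1 * K2"] dW_sq_integrable borel_measurable_nth dm; blast)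
 have bd: "bddF (max u p) (?p i j l)" if "u < v" "p < q" for i j l
 proof -
  have [measurable]: "xi : borel_measurable (F (max u p))" "eta : borel_measurable (F (max u p))"
   using a that by (auto intro: measurable_F_mono)
  show ?thesis unfolding bddF_def using pb by (intro conjI) (measurable, blast)
 qed
 have inner: "xi w \<bullet> eta w = (SUM i:UNIV. SUM j:UNIV. xi w $ i $ j * eta w $ i $ j)" for w by (simp add: inner_vec_def)
 have pint: "integrable M (?p i j l)" for i j l by (rule integrable_const_bound[of _ "K1*K2"]) (use pb pm in auto)
 have HH: "(indicator {u<..v} s *R xi w) \<bullet> (indicator {p<..q} s *R eta w) = (indicator {u<..v} s * indicator {p<..q} s) * (xi w \<bullet> eta w)" for s w
  by simp
 have o: "u <= v" "p <= q" using a by auto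
 have I: "BI LB (%s. (indicator {u<..v} s *R xi w) \<bullet> (indicator {p<..q} s *R eta w)) = ov u v p q * (xi w \<bullet> eta w)" for w
  unfolding HH using indicator_overlap[OF o] by simp
 have "EE (%w. (xi w *v dW u v w) \<bullet> (eta w *v dW p q w)) = (SUM i:UNIV. SUM j:UNIV. SUM l:UNIV. EE (%w. ?p i j l w * (dW u v w $ j * dW p q w $ l)))"
  unfolding e by (simp only: integral_sum' integrable_sum' int)
 also have "... = (SUM i:UNIV. SUM j:UNIV. SUM l:UNIV. (if j = l then ov u v p q else 0) * EE (?p i j l))"
  using a by (intro sum.cong refl dW_bilinear bd) auto
 also have "... = ov u v p q * EE (%w. xi w \<bullet> eta w)"
  unfolding inner by (simp only: integral_sum' integrable_sum' pint) (simp add: sum_distrib_left if_distrib if_distribR cong: if_cong)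
 finally have E: "EE (%w. (xi w *v dW u v w) \<bullet> (eta w *v dW p q w)) = ov u v p q * EE (%w. xi w \<bullet> eta w)" .
 have "integrable M (%w. (xi w *v dW u v w) \<bullet> (eta w *v dW p q w))" unfolding e by (intro integrable_sum' int)
 moreover have "integrable M (%w. xi w \<bullet> eta w)" unfolding inner by (intro integrable_sum' pint)
 moreover have "integrable LB (%s. (indicator {u<..v} s *R xi w) \<bullet> (indicator {p<..q} s *R eta w))" for w
  unfolding HH by (rule integrable_mult_left) (rule indicator_overlap[OF o])
 ultimately show ?thesis unfolding ito_pair_def I using E by simp
qed

lemma ito_pair_sum:
 assumes "ito_sum S H" "ito_sum T J" shows "ito_pair S H T J"
 using assms(1)
proof induction
 case ito_zero
 show ?case by (simp add: ito_pair_def)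
next
 case (ito_add u v xi S H)
 have "ito_pair (%w. xi w *v dW u v w) (%s w. indicator {u<..v} s *R xi w) T J"
  using assms(2)
 proof induction
  case ito_zero
  show ?case by (simp add: ito_pair_def)
 next
  case t: (ito_add p q eta T J)
  show ?case
   by (rule ito_pair_commute, rule ito_pair_add) (rule ito_pair_commute, rule ito_pair_term[OF ito_add(1) t(1)], rule ito_pair_commute, rule t(3))
 qed
 thus ?case by (rule ito_pair_add) (rule ito_add(3))
qed

lemma ito_sum_measurable: "ito_sum S H ==> S : borel_measurable M & (%(s, w). H s w) : borel_measurable (LB XM M)"
proof (induction rule: ito_sum.induct)
 case (ito_add u v xi S H)
 hence [measurable]: "xi : borel_measurable M" "S : borel_measurable M" "(%(s, w). H s w) : borel_measurable (LB XM M)"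
  and [measurable]: "dW u v : borel_measurable M" by (auto simp: ito_term_def intro!: dW_measurable)
 show ?case by measurable
qed auto

lemma ito_isometry:
 assumes "ito_sum S H"
 shows "NI M (%w. ennreal ((norm (S w))^2)) = NI M (%w. (NI LB (%s. ennreal ((norm (H s w))^2))))"
proof -
 note p = ito_pair_sum[OF assms assms, unfolded ito_pair_def]
 have "NI M (%w. ennreal ((norm (S w))^2)) = ennreal (EE (%w. S w \<bullet> S w))"
  unfolding power2_norm_eq_inner using p by (intro nn_integral_eq_integral) auto
 also have "... = NI M (%w. ennreal (BI LB (%s. H s w \<bullet> H s w)))"
  using p by (simp add: nn_integral_eq_integral)
 also have "... = NI M (%w. (NI LB (%s. ennreal ((norm (H s w))^2))))"
  unfolding power2_norm_eq_inner using p by (intro nn_integral_cong nn_integral_eq_integral[symmetric]) auto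
 finally show ?thesis .
qed

end

lemma norm_sum3_sq: "(norm (x + y + z))^2 <= 3 * ((norm x)^2 + (norm y)^2 + (norm (z::'a::real_normed_vector))^2)"
proof -
 have "norm (x + y + z) <= norm x + norm y + norm z" by (metis add_mono_thms_linordered_semiring(3) norm_triangle_ineq norm_triangle_le)
 hence "(norm (x + y + z))^2 <= (norm x + norm y + norm z)^2" by (intro power_mono) auto
 also have "... <= 3 * ((norm x)^2 + (norm y)^2 + (norm z)^2)"
  using sum_power2_ge_zero[of "norm x - norm y" "norm y - norm z"] zero_le_power2[of "norm x - norm z"]
  by (simp add: power2_eq_square algebra_simps)
 finally show ?thesis .
qed

lemma norm_sum2_sq: "(norm (x + y))^2 <= 2 * ((norm x)^2 + (norm (y::'a::real_normed_vector))^2)"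
proof -
 have "(norm (x + y))^2 <= (norm x + norm y)^2" by (intro power_mono norm_triangle_ineq) auto
 also have "... <= 2 * ((norm x)^2 + (norm y)^2)"
  using zero_le_power2[of "norm x - norm y"] by (simp add: power2_eq_square algebra_simps)
 finally show ?thesis .
qed

lemma nn_integral_sum3_sq:
 fixes f g h :: "'a => 'b::{real_normed_vector, second_countable_topology}"
 assumes [measurable]: "f : borel_measurable N" "g : borel_measurable N" "h : borel_measurable N"
 shows "NI N (%x. ennreal ((norm (f x + g x + h x))^2)) <=
  3 * (NI N (%x. ennreal ((norm (f x))^2)) + NI N (%x. ennreal ((norm (g x))^2)) + NI N (%x. ennreal ((norm (h x))^2)))"
proof -
 have "NI N (%x. ennreal ((norm (f x + g x + h x))^2)) <= NI N (%x. 3 * (ennreal ((norm (f x))^2) + ennreal ((norm (g x))^2) + ennreal ((norm (h x))^2)))"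
 proof (rule nn_integral_mono)
  fix x
  have "ennreal ((norm (f x + g x + h x))^2) <= ennreal (3 * ((norm (f x))^2 + (norm (g x))^2 + (norm (h x))^2))"
   by (rule ennreal_leI) (rule norm_sum3_sq)
  thus "ennreal ((norm (f x + g x + h x))^2) <= 3 * (ennreal ((norm (f x))^2) + ennreal ((norm (g x))^2) + ennreal ((norm (h x))^2))"
   by (simp add: ennreal_mult)
 qed
 thus ?thesis by (simp add: nn_integral_cmult nn_integral_add)
qed

context sde_solution begin

section \<open>A continuous version and its increments\<close>

text \<open>Such a null set exists because the paths are almost surely continuous.\<close>
definition bad :: "'w set" where
 "bad = (SOME N. N : null_sets M & {w:space M. \<not> continuous_on {0..} (%t. X t w)} <= N)"

lemma bad: "bad : null_sets M" "w : space M ==> w \<notin> bad ==> continuous_on {0..} (%t. X t w)"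
proof -
 have "EX N. N : null_sets M & {w:space M. \<not> continuous_on {0..} (%t. X t w)} <= N"
  using X_continuous unfolding eventually_ae_filter by blast
 from someI_ex[OF this] show "bad : null_sets M" "w : space M ==> w \<notin> bad ==> continuous_on {0..} (%t. X t w)"
  unfolding bad_def by blast+
qed

text \<open>Bad paths are set to 0 and time is extended constantly to the negative half-line, so
  that every path is continuous on the whole line. The null set lies in every \<open>F t\<close>,
  hence adaptedness survives.\<close>

definition Y :: "real => 'w => real^'n" where "Y t w = (if w : bad then 0 else X (max t 0) w)"

lemma Y_continuous: assumes "w : space M" shows "continuous_on S (%t. Y t w)"
proof (cases "w : bad")
 case False
 have "continuous_on S (%t. X (max t 0) w)"
  by (rule continuous_on_compose2[OF bad(2)[OF assms False]]) (auto intro!: continuous_intros)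
 thus ?thesis using False by (simp add: Y_def)
qed (simp add: Y_def)

lemma Y_adapted: "0 <= t ==> Y t : borel_measurable (F t)"
 unfolding Y_def using X_adapted[of t] null_F[OF bad(1), of t] sets.sets_into_space[OF null_setsD2[OF bad(1)]]
 by (intro measurable_If_set) (auto simp: max_absorb1 Int_absorb2)

lemma Y_measurable[measurable]: "Y t : borel_measurable M"
proof -
 have "Y t = Y (max t 0)" by (simp add: Y_def fun_eq_iff)
 moreover have "Y (max t 0) : borel_measurable M" by (rule measurable_F_M[OF Y_adapted]) simp
 ultimately show ?thesis by simp
qed

lemma Y_eq_X: "AE w in M. ALL t>=0. Y t w = X t w"
 using AE_not_in[OF bad(1)] by eventually_elim (simp add: Y_def)

text \<open>Limit of the processes read at the grid point below \<open>s\<close>; each of these uses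
  countably many times only.\<close>

lemma Y_joint[measurable]: "(%(s, w). Y s w) : borel_measurable (LB XM M)"
proof (rule borel_measurable_LIMSEQ_metric)
 let ?g = "%n s. real_of_int \<lfloor>real (Suc n) * s\<rfloor> / real (Suc n)"
 show "(%(s, w). Y (?g n s) w) : borel_measurable (LB XM M)" for n
 proof -
  have "(%x. (%j x. Y (real_of_int j / real (Suc n)) (snd x)) \<lfloor>real (Suc n) * fst x\<rfloor> x) : borel_measurable (LB XM M)"
   by (rule measurable_compose_countable) measurable
  thus ?thesis by (simp add: case_prod_beta)
 qed
 fix x :: "real \<times> 'w" assume "x : space (LB XM M)"
 hence w: "snd x : space M" by (auto simp: space_pair_measure)
 have "(%n. ?g n (fst x)) ----> fst x"
 proof (rule LIMSEQ_I)
  fix r :: real assume r: "0 < r"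
  obtain n0 where n0: "1 / r < real n0" using reals_Archimedean2 by blast
  show "EX no. ALL n>=no. norm (?g n (fst x) - fst x) < r"
  proof (intro exI allI impI)
   fix n assume "n0 <= n"
   hence n: "1 / r < real (Suc n)" using n0 by simp
   have "abs (real_of_int \<lfloor>real (Suc n) * fst x\<rfloor> - real (Suc n) * fst x) <= 1" by linarith
   moreover have "?g n (fst x) - fst x = (real_of_int \<lfloor>real (Suc n) * fst x\<rfloor> - real (Suc n) * fst x) / real (Suc n)"
    by (simp add: field_simps)
   ultimately have "abs (?g n (fst x) - fst x) <= 1 / real (Suc n)"
    by (simp only: abs_divide abs_of_nat divide_right_mono of_nat_0_le_iff)
   also have "... < r" using n r by (simp add: field_simps)
   finally show "norm (?g n (fst x) - fst x) < r" by simp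
  qed
 qed
 thus "(%n. case x of (s, w) => Y (?g n s) w) ----> (case x of (s, w) => Y s w)"
  using continuous_on_tendsto_compose[OF Y_continuous[OF w, of UNIV]] by (simp add: case_prod_beta)
qed

lemma coeff_continuous: "continuous_on S a" "continuous_on S b"
 using lipschitz_on_continuous_on[of L S a] lipschitz_on_continuous_on[of L S b] a_lip b_lip pos
 by (auto simp: lipschitz_on_def dist_norm)

lemma coeff_measurable[measurable]: "a : BB" "b : BB"
 using coeff_continuous by (auto intro: borel_measurable_continuous_onI)

lemma ito_Y:
 assumes "0 <= t"
 obtains I where "has_ito_integral M F W (%s w. a (Y s w)) t I"
  "AE w in M. Y t w = Y 0 w + integral {0..t} (%s. b (Y s w)) + I w"
proof -
 obtain I where I: "has_ito_integral M F W (%s w. a (X s w)) t I"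
  and e: "AE w in M. X t w = X 0 w + (LINT s:{0..t}|lborel. b (X s w)) + I w"
  using sol assms unfolding strong_solution_def by blast
 have c: "NI M (%w. (NI LB (%s. ennreal ((norm (P s w - a (X s w)))^2) * indicator {0..t} s))) =
  NI M (%w. (NI LB (%s. ennreal ((norm (P s w - a (Y s w)))^2) * indicator {0..t} s)))" for P
  by (rule nn_integral_cong_AE) (use Y_eq_X in "eventually_elim, auto intro!: nn_integral_cong split: split_indicator")
 have "has_ito_integral M F W (%s w. a (Y s w)) t I" using I unfolding has_ito_integral_def c .
 moreover have "AE w in M. Y t w = Y 0 w + integral {0..t} (%s. b (Y s w)) + I w"
  using e Y_eq_X AE_space
 proof eventually_elim
  case (elim w)
  have "(LINT s:{0..t}|lborel. b (X s w)) = (LINT s:{0..t}|lborel. b (Y s w))"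
   by (rule set_lebesgue_integral_cong) (use elim in auto)
  also have "... = integral {0..t} (%s. b (Y s w))"
   by (intro set_borel_integral_eq_integral borel_integrable_atLeastAtMost' continuous_on_compose2[OF coeff_continuous(2) Y_continuous]) (use elim in auto)
  finally show ?case using elim assms by auto
 qed
 ultimately show ?thesis by (rule that)
qed

lemma simple_ito_sum:
 assumes si: "simple_integrand M F k ta \<xi>" and t: "0 <= t"
 shows "ito_sum (simple_ito_integral W k ta \<xi> t) (%s w. indicator {0..t} s *R simple_process k ta \<xi> s w)"
proof -
 have ta: "0 <= ta i" if "i <= k" for i
  using that by (induction i) (use si in "auto simp: simple_integrand_def Suc_le_eq intro: order.trans")
 have "ito_sum (%w. \<Sum>i<j. \<xi> i w *v dW (min (ta i) t) (min (ta (Suc i)) t) w) (%s w. \<Sum>i<j. indicator {min (ta i) t<..min (ta (Suc i)) t} s *R \<xi> i w)" if "j <= k" for j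
  using that
 proof (induction j)
  case (Suc j)
  have j: "j < k" using Suc by simp
  have x: "\<xi> j : borel_measurable (F (ta j))" "bounded (\<xi> j ` space M)" "ta j <= ta (Suc j)" using si j by (auto simp: simple_integrand_def)
  have "ito_term (min (ta j) t) (min (ta (Suc j)) t) (\<xi> j)" unfolding ito_term_def
  proof (intro conjI impI)
   show "0 <= min (ta j) t" "min (ta j) t <= min (ta (Suc j)) t" using ta[of j] j t x(3) by auto
   show "\<xi> j : borel_measurable M" using x measurable_F_M by blast
   show "EX K. ALL w:space M. norm (\<xi> j w) <= K" using x(2) by (auto simp: bounded_iff)
   assume "min (ta j) t < min (ta (Suc j)) t"
   hence "min (ta j) t = ta j" by auto
   thus "\<xi> j : borel_measurable (F (min (ta j) t))" using x by simp
  qed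
  from ito_add[OF this Suc.IH] Suc.prems show ?case by (simp add: add.commute)
 qed (simp add: ito_zero)
 from this[OF order.refl] have *: "ito_sum (simple_ito_integral W k ta \<xi> t) (%s w. \<Sum>i<k. indicator {min (ta i) t<..min (ta (Suc i)) t} s *R \<xi> i w)"
  by (simp add: simple_ito_integral_def[abs_def])
 have "(\<Sum>i<k. indicator {min (ta i) t<..min (ta (Suc i)) t} s *R \<xi> i w) = indicator {0..t} s *R simple_process k ta \<xi> s w" for s w
  unfolding simple_process_def scaleR_sum_right
 proof (rule sum.cong[OF refl])
  fix i assume "i : {..<k}"
  hence "0 <= ta i" using ta[of i] by simp
  thus "indicator {min (ta i) t<..min (ta (Suc i)) t} s *R \<xi> i w = indicator {0..t} s *R indicator {ta i<..ta (Suc i)} s *R \<xi> i w"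
   using t by (auto simp: indicator_def)
 qed
 thus ?thesis using * by simp
qed

lemma nn_dist2:
 fixes f :: "real => 'w => real^'n^'n"
 assumes [measurable]: "(%(s, w). f s w) : borel_measurable (LB XM M)"
 shows "NI M (%w. (NI LB (%s. ennreal ((norm (f s w))^2)))) = NI (LB XM M) (%x. ennreal ((norm (case x of (s, w) => f s w))^2))"
proof -
 interpret P: pair_sigma_finite "LB::real measure" M by standard
 show ?thesis
  using P.nn_integral_snd[of "%x. ennreal ((norm (case x of (s, w) => f s w))^2)"] by simp
qed

definition ito_approx where
 "ito_approx t I S H \<longleftrightarrow> (ALL m::nat. ito_sum (S m) (H m)) & (%m. NI M (%w. ennreal ((norm (S m w - I w))^2))) ----> 0 &
  (%m. NI M (%w. (NI LB (%s. ennreal ((norm (H m s w - indicator {0..t} s *R a (Y s w)))^2))))) ----> 0"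

lemma ito_approx_exists:
 assumes I: "has_ito_integral M F W (%s w. a (Y s w)) t I" and t: "0 <= t"
 obtains S H where "ito_approx t I S H"
proof -
 obtain k ta \<xi> where *: "!!m::nat. simple_integrand M F (k m) (ta m) (\<xi> m)"
  "(%m. NI M (%w. (NI LB (%s. ennreal ((norm (simple_process (k m) (ta m) (\<xi> m) s w - a (Y s w)))^2) * indicator {0..t} s)))) ----> 0"
  "(%m. NI M (%w. ennreal ((norm (simple_ito_integral W (k m) (ta m) (\<xi> m) t w - I w))^2))) ----> 0"
  using I unfolding has_ito_integral_def by blast
 have e: "ennreal ((norm (P - a (Y s w)))^2) * indicator {0..t} s = ennreal ((norm (indicator {0..t} s *R P - indicator {0..t} s *R a (Y s w)))^2)" for P s w
  by (simp add: indicator_def)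
 show ?thesis
  by (rule that, unfold ito_approx_def, intro conjI allI, rule simple_ito_sum[OF *(1) t], rule *(3), rule *(2)[unfolded e])
qed

text \<open>The isometry is exact for the simple sums approximating the two integrals, minus
  \<open>Z\<close>. Passing to the limit costs the inequality for the square of three summands
  twice, once for the random variables and once for the integrands: 9 = 3 * 3. The uses are
  \<open>Z = 0\<close> (size of an increment), \<open>Z\<close> the increment with frozen
  coefficient (error of freezing) and \<open>Z\<close> a simple sum cut off before \<open>s\<close>
  (mean zero).\<close>

lemma ito_diff_bound:
 assumes I: "has_ito_integral M F W (%s w. a (Y s w)) t I" "has_ito_integral M F W (%s w. a (Y s w)) s J"
  and t: "0 <= t" "0 <= s" and Z: "ito_sum Z P"
 shows "NI M (%w. ennreal ((norm (I w - J w - Z w))^2)) <=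
  9 * NI M (%w. (NI LB (%r. ennreal ((norm (indicator {0..t} r *R a (Y r w) - indicator {0..s} r *R a (Y r w) - P r w))^2))))"
proof -
 obtain S H where S: "ito_approx t I S H" by (rule ito_approx_exists[OF I(1) t(1)])
 obtain S' H' where S': "ito_approx s J S' H'" by (rule ito_approx_exists[OF I(2) t(2)])
 note iq = S[unfolded ito_approx_def] S'[unfolded ito_approx_def]
 have [measurable]: "I : borel_measurable M" "J : borel_measurable M" using I unfolding has_ito_integral_def by auto
 have [measurable]: "S m : borel_measurable M" "S' m : borel_measurable M" "(%(s, w). H m s w) : borel_measurable (LB XM M)"
  "(%(s, w). H' m s w) : borel_measurable (LB XM M)" for m using ito_sum_measurable iq by blast+
 have [measurable]: "Z : borel_measurable M" "(%(s, w). P s w) : borel_measurable (LB XM M)" using ito_sum_measurable[OF Z] by auto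
 let ?N = "%f. NI M (%w. ennreal ((norm (f w :: real^'n))^2))"
 let ?D = "%f. NI M (%w. (NI LB (%r. ennreal ((norm (f r w :: real^'n^'n))^2))))"
 let ?A = "%t r w. indicator {0..t} r *R a (Y r w)"
 define c where "c = ?D (%r w. ?A t r w - ?A s r w - P r w)"
 define x y p q where "x m = ?N (%w. S m w - I w)" and "y m = ?N (%w. S' m w - J w)"
  and "p m = ?D (%r w. H m r w - ?A t r w)" and "q m = ?D (%r w. H' m r w - ?A s r w)" for m
 have b: "?N (%w. I w - J w - Z w) <= 3 * (x m + y m + 3 * (p m + q m + c))" for m
 proof -
  have "?N (%w. I w - J w - Z w) = ?N (%w. (I w - S m w) + (S' m w - J w) + (S m w - S' m w - Z w))"
   by (rule nn_integral_cong) (simp add: algebra_simps)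
  also have "... <= 3 * (?N (%w. I w - S m w) + y m + ?N (%w. S m w - S' m w - Z w))"
   unfolding y_def by (rule nn_integral_sum3_sq) measurable
  also have "?N (%w. I w - S m w) = x m" unfolding x_def by (simp add: norm_minus_commute)
  also have "?N (%w. S m w - S' m w - Z w) = ?D (%r w. H m r w - H' m r w - P r w)"
   using ito_isometry[OF ito_sum_add[OF ito_sum_add[OF _ ito_sum_uminus] ito_sum_uminus[OF Z]], of "S m" "H m" "S' m" "H' m"] iq by simp
  also have "... = ?D (%r w. (H m r w - ?A t r w) + (?A s r w - H' m r w) + (?A t r w - ?A s r w - P r w))"
   by (intro nn_integral_cong) (simp add: algebra_simps)
  also have "... <= 3 * (p m + ?D (%r w. ?A s r w - H' m r w) + c)"
   unfolding p_def c_def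
   by (subst (1 2 3 4) nn_dist2; (measurable; fail)?) (unfold case_prod_beta', rule nn_integral_sum3_sq; measurable)
  also have "?D (%r w. ?A s r w - H' m r w) = q m" unfolding q_def by (simp add: norm_minus_commute)
  finally show ?thesis by (simp add: add_left_mono mult_left_mono)
 qed
 have "(%m. 3 * (x m + y m + 3 * (p m + q m + c))) ----> 3 * (0 + 0 + 3 * (0 + 0 + c))"
  using iq unfolding x_def y_def p_def q_def by (intro tendsto_add ennreal_tendsto_cmult tendsto_const) auto
 from LIMSEQ_le_const[OF this] b have "?N (%w. I w - J w - Z w) <= 3 * (3 * c)" by simp
 thus ?thesis unfolding c_def by (simp add: mult.assoc[symmetric])
qed

end

lemma norm_matrix_vector: "norm (A *v x) <= norm A * norm (x :: real^'n::finite)" for A :: "real^'n^'m::finite"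
proof -
 have "norm (A *v x) = L2_set (%i. norm ((A *v x) $ i)) UNIV" by (simp add: norm_vec_def)
 also have "... <= L2_set (%i. norm (A $ i) * norm x) UNIV"
  by (rule L2_set_mono) (simp_all add: matrix_vector_mul_component Cauchy_Schwarz_ineq2)
 also have "... = norm A * norm x" by (simp add: L2_set_left_distrib norm_vec_def)
 finally show ?thesis .
qed

lemma (in prob_space) expectation_abs_le:
 fixes f :: "'a => real"
 assumes i: "integrable M (%x. (f x)^2)" and [measurable]: "f : borel_measurable M" and c: "EE (%x. (f x)^2) <= c^2" "0 < c"
 shows "integrable M f" "EE (%x. abs (f x)) <= c"
proof -
 have p: "abs (f x) <= ((f x)^2 + c^2) / (2 * c)" for x
  using c zero_le_power2[of "abs (f x) - c"] by (simp add: field_simps power2_diff)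
 have i2: "integrable M (%x. ((f x)^2 + c^2) / (2 * c))" using i by simp
 show "integrable M f" by (rule integrable_bound'[OF i2]) (use p c in auto)
 hence "EE (%x. abs (f x)) <= EE (%x. ((f x)^2 + c^2) / (2 * c))" using i2 p by (intro integral_mono) auto
 also have "... = (EE (%x. (f x)^2) + c^2) / (2 * c)" using i by (simp add: prob_space)
 also have "... <= c" using c by (simp add: field_simps power2_eq_square)
 finally show "EE (%x. abs (f x)) <= c" .
qed

lemma nn_sq_bound:
 fixes f :: "'a => 'b::{real_normed_vector, second_countable_topology}"
 assumes [measurable]: "f : borel_measurable N" and "NI N (%x. ennreal ((norm (f x))^2)) <= ennreal c" "0 <= c"
 shows "integrable N (%x. (norm (f x))^2)" (is ?A) "BI N (%x. (norm (f x))^2) <= c" (is ?B)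
proof -
 have "NI N (%x. ennreal ((norm (f x))^2)) < \<infinity>" using assms(2) by (rule le_less_trans) simp
 thus i: ?A by (intro integrableI_bounded) auto
 show ?B using assms(2,3) nn_integral_eq_integral[OF i] by simp
qed

lemma min_sq_cube:
 fixes p r :: "'a::real_normed_vector"
 shows "min ((norm (p + r))^2) (norm (p + r) ^ 3) <= 8 * norm p ^ 3 + 4 * (norm r)^2"
proof (cases "norm r <= norm p")
 case True
 hence "norm (p + r) ^ 3 <= (2 * norm p) ^ 3" using norm_triangle_ineq[of p r] by (intro power_mono) auto
 thus ?thesis by (simp add: min_le_iff_disj power_mult_distrib add_increasing2)
next
 case False
 hence "(norm (p + r))^2 <= (2 * norm r)^2" using norm_triangle_ineq[of p r] by (intro power_mono) auto
 thus ?thesis by (simp add: min_le_iff_disj power_mult_distrib add_increasing)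
qed

lemma cube_le: "0 < e ==> 0 <= y ==> y ^ 3 <= (e * y^2 + y ^ 4 / e) / 2" for e y :: real
proof -
 assume e: "0 < e" "0 <= y"
 have "0 <= y^2 * (y - e)^2" by simp
 hence "2 * e * y ^ 3 <= e^2 * y^2 + y ^ 4" by (simp add: power2_eq_square power3_eq_cube power4_eq_xxxx algebra_simps)
 thus ?thesis using e by (simp add: field_simps power2_eq_square)
qed

lemma prod_le_sq: "0 < e ==> x * y <= (e * x^2 + y^2 / e) / 2" for e x y :: real
proof -
 assume e: "0 < e"
 have "0 <= (e * x - y)^2" by simp
 thus ?thesis using e by (simp add: field_simps power2_eq_square)
qed

context sde_solution begin

text \<open>An increment over a time \<open>d <= 1\<close> will have second moment at most
  \<open>K1 * d\<close>; once the Gaussian part frozen at the left end is removed, at most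
  \<open>K2 * d^2\<close>.\<close>

definition "K1 = 2 * (B^2 + 9 * A^2)"
definition "K2 = 2 * (9 * L^2 * K1 + B^2)"

lemma K_pos: "0 < K1" "0 < K2" unfolding K1_def K2_def using pos by (auto intro!: add_nonneg_pos)

text \<open>Only terms alive after \<open>s\<close> are kept, and they are restarted at
  \<open>max u s\<close>. Their coefficients and the weight are then known when the interval starts,
  so each term has mean zero: the martingale property of simple integrals.\<close>

lemma ito_sum_stop:
 assumes "ito_sum S H" "0 <= s"
 shows "EX S1. ito_sum S1 (%r w. indicator {s<..} r *R H r w) &
  (ALL psi i. bddF s psi --> integrable M (%w. psi w * S1 w $ i) & EE (%w. psi w * S1 w $ i) = 0)"
 using assms(1)
proof induction
 case ito_zero
 show ?case by (rule exI[of _ "%_. 0"]) (simp add: ito_sum.ito_zero)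
next
 case (ito_add u v xi S H)
 then obtain S1 where S1: "ito_sum S1 (%r w. indicator {s<..} r *R H r w)"
  "!!psi i. bddF s psi ==> integrable M (%w. psi w * S1 w $ i) & EE (%w. psi w * S1 w $ i) = 0" by blast
 note t = ito_add(1)[unfolded ito_term_def]
 show ?case
 proof (cases "u < v & s < v")
  case False
  hence ee: "indicator {s<..} r *R (indicator {u<..v} r *R xi w + H r w) = indicator {s<..} r *R H r w" for r :: real and w
   using t by (auto simp: indicator_def)
  have "(%r w. indicator {s<..} r *R (indicator {u<..v} r *R xi w + H r w)) = (%r w. indicator {s<..} r *R H r w)" by (intro ext ee)
  thus ?thesis using S1 by (intro exI[of _ S1] conjI allI impI) (simp only:, blast+)
 next
  case True
  let ?u = "max u s"
  have uv: "0 <= ?u" "?u < v" using True t assms(2) by auto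
  have xm: "xi : borel_measurable (F ?u)" by (rule measurable_F_mono[of xi u]) (use t True in simp_all)
  obtain K where K: "!!w. w : space M ==> norm (xi w) <= K" using t by blast
  have "ito_term ?u v xi" unfolding ito_term_def using uv xm t by (intro conjI impI) simp_all
  note ia = ito_sum.ito_add[OF this S1(1)]
  have e: "indicator {?u<..v} r *R xi w + indicator {s<..} r *R H r w = indicator {s<..} r *R (indicator {u<..v} r *R xi w + H r w)" for r :: real and w
   by (auto simp: indicator_def)
  have "integrable M (%w. psi w * (xi w *v dW ?u v w + S1 w) $ i) & EE (%w. psi w * (xi w *v dW ?u v w + S1 w) $ i) = 0"
   if psi: "bddF s psi" for psi i
  proof -
   have b: "bddF ?u (%w. xi w $ i $ j)" for j unfolding bddF_def
   proof (intro conjI exI ballI)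
    show "(%w. xi w $ i $ j) : borel_measurable (F ?u)" by (intro borel_measurable_nth xm)
    fix w assume "w : space M"
    from K[OF this] show "abs (xi w $ i $ j) <= K" using component_le_norm_cart[of "xi w $ i" j] Finite_Cartesian_Product.norm_nth_le[of "xi w" i] by linarith
   qed
   have c: "bddF ?u (%w. psi w * xi w $ i $ j)" for j by (intro bddF_mult b bddF_mono[OF psi]) simp
   have f: "psi w * (xi w *v dW ?u v w + S1 w) $ i = (SUM j:UNIV. psi w * xi w $ i $ j * dW ?u v w $ j) + psi w * S1 w $ i" for w
    by (simp add: matrix_vector_mult_def algebra_simps sum_distrib_left)
   note d = dW_mean[OF uv(1) less_imp_le[OF uv(2)] bddF_D(1,3)[OF c]]
   show ?thesis unfolding f using S1(2)[OF psi, of i] d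
    by (subst Bochner_Integration.integral_add) (auto intro!: Bochner_Integration.integrable_add integrable_sum' simp: integral_sum')
  qed
  thus ?thesis using ia unfolding e by blast
 qed
qed

text \<open>\<open>J\<close> stands for the Ito integral over (s, t]; these consequences are all
  that is kept of it.\<close>

definition increment_of :: "real => real => ('w => real^'n) => bool" where
 "increment_of s t J \<longleftrightarrow> J : borel_measurable M &
  (AE w in M. Y t w = Y s w + integral {s..t} (%r. b (Y r w)) + J w) &
  (ALL psi i. bddF s psi --> integrable M (%w. psi w * J w $ i) & EE (%w. psi w * J w $ i) = 0) &
  integrable M (%w. (norm (J w))^2) & EE (%w. (norm (J w))^2) <= 9 * A^2 * (t - s) &
  (NI M (%w. ennreal ((norm (J w - a (Y s w) *v dW s t w))^2))) <=
   9 * NI M (%w. (NI LB (%r. ennreal ((norm (indicator {s<..t} r *R (a (Y r w) - a (Y s w))))^2))))"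

lemma A_sq: "(norm (a x))^2 <= A^2" using a_bound by (intro power_mono) auto

lemma increment_exists:
 assumes st: "0 <= s" "s < t"
 obtains J where "increment_of s t J"
proof -
 obtain I where I: "has_ito_integral M F W (%s w. a (Y s w)) t I" "AE w in M. Y t w = Y 0 w + integral {0..t} (%s. b (Y s w)) + I w"
  by (rule ito_Y[of t]) (use st in auto)
 obtain I' where I': "has_ito_integral M F W (%s w. a (Y s w)) s I'" "AE w in M. Y s w = Y 0 w + integral {0..s} (%s. b (Y s w)) + I' w"
  by (rule ito_Y[of s]) (use st in auto)
 have [measurable]: "I : borel_measurable M" "I' : borel_measurable M" using I I' unfolding has_ito_integral_def by auto
 have t0: "0 <= t" using st by simp
 have ind: "indicator {0..t} r *R x - indicator {0..s} r *R x = indicator {s<..t} r *R x" for r :: real and x :: "real^'n^'n"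
  using st by (auto simp: indicator_def)
 define J where "J w = I w - I' w" for w
 have Jm[measurable]: "J : borel_measurable M" unfolding J_def by measurable
 note db = ito_diff_bound[OF I(1) I'(1) t0 st(1), unfolded ind J_def[symmetric]]
 have ae: "AE w in M. Y t w = Y s w + integral {s..t} (%r. b (Y r w)) + J w"
  using I(2) I'(2) AE_space
 proof eventually_elim
  case (elim w)
  have "(%r. b (Y r w)) integrable_on {0..t}"
   by (intro integrable_continuous_real continuous_on_compose2[OF coeff_continuous(2) Y_continuous]) (use elim in auto)
  from Henstock_Kurzweil_Integration.integral_combine[OF _ _ this, of s] show ?case using elim st by (simp add: J_def algebra_simps)
 qed
 have n1: "NI M (%w. ennreal ((norm (J w))^2)) <= ennreal (9 * A^2 * (t - s))"
 proof -
  have "NI M (%w. ennreal ((norm (J w))^2)) <= 9 * NI M (%w. (NI LB (%r. ennreal ((norm (indicator {s<..t} r *R a (Y r w)))^2))))"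
   using db[OF ito_zero] by simp
  also have "... <= 9 * NI M (%w. (NI LB (%r. ennreal (A^2) * indicator {s<..t} r)))"
   using A_sq by (intro mult_left_mono nn_integral_mono) (auto simp: indicator_def intro!: ennreal_leI)
  also have "... = 9 * (ennreal (A^2) * ennreal (t - s))" using st by (simp add: nn_integral_cmult_indicator emeasure_space_1)
  also have "... = ennreal (9 * A^2 * (t - s))" using st by (simp add: ennreal_mult mult.assoc)
  finally show ?thesis .
 qed
 have JI: "integrable M (%w. (norm (J w))^2)" "EE (%w. (norm (J w))^2) <= 9 * A^2 * (t - s)"
  using nn_sq_bound[OF Jm n1] st by auto
 have am: "a : BB" by measurable
 have "(%w. a (Y s w)) : borel_measurable (F s)" by (rule measurable_compose[OF Y_adapted[OF st(1)] am])
 hence "ito_term s t (%w. a (Y s w))" unfolding ito_term_def using st a_bound by auto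
 from db[OF ito_sum_term[OF this]]
 have n2: "NI M (%w. ennreal ((norm (J w - a (Y s w) *v dW s t w))^2)) <=
   9 * NI M (%w. (NI LB (%r. ennreal ((norm (indicator {s<..t} r *R (a (Y r w) - a (Y s w))))^2))))"
  by (simp add: scaleR_diff_right)
 \<comment> \<open>Simple sums approximating the integral up to \<open>t\<close>, cut off before
   \<open>s\<close>, still converge to \<open>J\<close> in mean square, because \<open>J\<close>
   integrates the part of the integrand on (s, t]. They have mean zero against \<open>psi\<close>,
   and so does the limit.\<close>
 have mean: "integrable M (%w. psi w * J w $ i) & EE (%w. psi w * J w $ i) = 0" if psi: "bddF s psi" for psi i
 proof -
  obtain P where P: "0 <= P" "!!w. w : space M ==> abs (psi w) <= P" using bddF_bound[OF psi] by blast
  note [measurable] = bddF_D(2)[OF psi]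
  have Jint: "integrable M (%w. norm (J w))"
   by (rule expectation_abs_le(1)[of _ "sqrt (9 * A^2 * (t - s))"]) (use JI st pos in "auto simp: real_sqrt_pow2")
  have int: "integrable M (%w. psi w * J w $ i)"
  proof (rule integrable_bound'[of M "%w. P * norm (J w)"])
   show "AE w in M. norm (psi w * J w $ i) <= norm (P * norm (J w))"
    using P by (auto intro!: AE_I2 mult_mono component_le_norm_cart simp: abs_mult)
  qed (use Jint in auto)
  obtain S H where S: "ito_approx t I S H" by (rule ito_approx_exists[OF I(1) t0])
  have "ALL m. EX S1. ito_sum S1 (%r w. indicator {s<..} r *R H m r w) &
   (integrable M (%w. psi w * S1 w $ i) & EE (%w. psi w * S1 w $ i) = 0)"
  proof
   fix m
   have "ito_sum (S m) (H m)" using S unfolding ito_approx_def by blast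
   from ito_sum_stop[OF this st(1)] show "EX S1. ito_sum S1 (%r w. indicator {s<..} r *R H m r w) &
    (integrable M (%w. psi w * S1 w $ i) & EE (%w. psi w * S1 w $ i) = 0)" using psi by (elim exE conjE, intro exI conjI) (assumption, blast+)
  qed
  from choice[OF this] obtain S1 where S1': "ALL m. ito_sum (S1 m) (%r w. indicator {s<..} r *R H m r w) &
   (integrable M (%w. psi w * S1 m w $ i) & EE (%w. psi w * S1 m w $ i) = 0)" by (elim exE)
  note S1 = S1'[rule_format, THEN conjunct1] S1'[rule_format, THEN conjunct2]
  define q where "q m = NI M (%w. ennreal ((norm (J w - S1 m w))^2))" for m
  have qb: "q m <= 9 * NI M (%w. (NI LB (%r. ennreal ((norm (H m r w - indicator {0..t} r *R a (Y r w)))^2))))" for m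
  proof -
   have nle: "norm (indicator {s<..t} r *R a (Y r w) - indicator {s<..} r *R H m r w) <= norm (H m r w - indicator {0..t} r *R a (Y r w))" for r w
    using st by (auto simp: indicator_def norm_minus_commute)
   have "q m <= 9 * NI M (%w. (NI LB (%r. ennreal ((norm (indicator {s<..t} r *R a (Y r w) - indicator {s<..} r *R H m r w))^2))))"
    unfolding q_def by (rule db[OF S1(1)])
   also have "... <= 9 * NI M (%w. (NI LB (%r. ennreal ((norm (H m r w - indicator {0..t} r *R a (Y r w)))^2))))"
    by (intro mult_left_mono nn_integral_mono ennreal_leI power_mono nle) auto
   finally show ?thesis .
  qed
  have "(%m. 9 * NI M (%w. (NI LB (%r. ennreal ((norm (H m r w - indicator {0..t} r *R a (Y r w)))^2))))) ----> 9 * 0"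
   using S unfolding ito_approx_def by (intro ennreal_tendsto_cmult) auto
  hence q0: "q ----> 0" using qb by (intro tendsto_sandwich[OF _ _ tendsto_const, of 0 q _ "%m. 9 * NI M (%w. (NI LB (%r. ennreal ((norm (H m r w - indicator {0..t} r *R a (Y r w)))^2))))"]) auto
  have mb: "abs (EE (%w. psi w * J w $ i)) <= P * c" if c: "0 < c" for c
  proof -
   have "eventually (%m. q m < ennreal (c^2)) sequentially" using c by (intro order_tendstoD(2)[OF q0]) simp
   then obtain m where m: "q m < ennreal (c^2)" by (auto dest: eventually_happens)
   have [measurable]: "S1 m : borel_measurable M" using ito_sum_measurable[OF S1(1)] by blast
   have d: "integrable M (%w. (norm (J w - S1 m w))^2)" "EE (%w. (norm (J w - S1 m w))^2) <= c^2"
    using nn_sq_bound[of "%w. J w - S1 m w" M "c^2"] m unfolding q_def by (auto simp: less_imp_le)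
   note ea = expectation_abs_le[of "%w. norm (J w - S1 m w)", OF d(1) _ d(2) c]
   have eai: "integrable M (%w. norm (J w - S1 m w))" by (rule ea(1)) measurable
   have eam: "EE (%w. norm (J w - S1 m w)) <= c" using ea(2) by simp
   have "EE (%w. psi w * J w $ i) = EE (%w. psi w * J w $ i - psi w * S1 m w $ i)"
    by (subst integral_diff'[OF int conjunct1[OF S1(2)]]) (simp add: S1(2)[THEN conjunct2])
   also have "\<bar>...\<bar> <= EE (%w. P * norm (J w - S1 m w))"
   proof (rule order.trans[OF integral_abs_bound integral_mono])
    fix w assume w: "w : space M"
    have "abs (psi w * (J w - S1 m w) $ i) <= P * norm (J w - S1 m w)"
     unfolding abs_mult using P w by (intro mult_mono component_le_norm_cart) auto
    thus "abs (psi w * J w $ i - psi w * S1 m w $ i) <= P * norm (J w - S1 m w)" by (simp add: algebra_simps)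
   qed (intro integrable_abs Bochner_Integration.integrable_diff int S1(2)[THEN conjunct1] integrable_mult_right eai)+
   also have "... <= P * c" using eam P by (simp add: mult_left_mono)
   finally show ?thesis by simp
  qed
  have "abs (EE (%w. psi w * J w $ i)) <= 0 + e" if "0 < e" for e
  proof -
   have "P * (e / (P + 1)) <= e" using P that by (simp add: field_simps)
   moreover have "0 < e / (P + 1)" using that P by simp
   ultimately show ?thesis using mb[of "e / (P + 1)"] by linarith
  qed
  hence "abs (EE (%w. psi w * J w $ i)) <= 0" by (rule field_le_epsilon)
  thus ?thesis using int by simp
 qed
 show ?thesis using that[of J] unfolding increment_of_def using Jm ae mean JI n2 by blast
qed

lemma Y_increment:
 assumes st: "0 <= s" "s <= t" "t <= s + 1"
 shows "integrable M (%w. (norm (Y t w - Y s w))^2)" (is ?A) "EE (%w. (norm (Y t w - Y s w))^2) <= K1 * (t - s)"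
proof -
 have "integrable M (%w. (norm (Y t w - Y s w))^2) & EE (%w. (norm (Y t w - Y s w))^2) <= K1 * (t - s)"
 proof (cases "s = t")
  case False
  hence s: "s < t" using st by simp
  obtain J where "increment_of s t J" by (rule increment_exists[OF st(1) s])
  note J = this[unfolded increment_of_def]
  have bd: "norm (integral {s..t} (%r. b (Y r w))) <= B * (t - s)" if "w : space M" for w
   by (rule integral_bound) (use s b_bound that in "auto intro!: continuous_on_compose2[OF coeff_continuous(2) Y_continuous]")
  have ae: "AE w in M. (norm (Y t w - Y s w))^2 <= 2 * (B^2 * (t - s) + (norm (J w))^2)"
   using J[THEN conjunct2, THEN conjunct1] AE_space
  proof eventually_elim
   case (elim w)
   have "(norm (Y t w - Y s w))^2 <= 2 * ((norm (integral {s..t} (%r. b (Y r w))))^2 + (norm (J w))^2)"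
    using norm_sum2_sq[of "integral {s..t} (%r. b (Y r w))" "J w"] elim by (simp add: algebra_simps)
   moreover have "(norm (integral {s..t} (%r. b (Y r w))))^2 <= (B * (t - s))^2" using bd elim by (intro power_mono) auto
   moreover have "(B * (t - s))^2 <= B^2 * (t - s)"
    using st s pos mult_left_mono[of "t - s" 1 "B^2 * (t - s)"] by (simp add: power_mult_distrib power2_eq_square mult_ac)
   ultimately show ?case by (meson add_right_mono mult_left_mono order.trans zero_le_numeral)
  qed
  have i2: "integrable M (%w. 2 * (B^2 * (t - s) + (norm (J w))^2))" using J by simp
  have i1: ?A
   by (rule integrable_bound'[OF i2]) (use ae in "auto elim!: eventually_mono")
  have "EE (%w. (norm (Y t w - Y s w))^2) <= EE (%w. 2 * (B^2 * (t - s) + (norm (J w))^2))"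
   by (rule integral_mono_AE[OF i1 i2 ae])
  also have "... = 2 * (B^2 * (t - s) + EE (%w. (norm (J w))^2))" using J by (simp add: prob_space)
  also have "... <= K1 * (t - s)" using J unfolding K1_def by (simp add: algebra_simps)
  finally show ?thesis using i1 by blast
 qed simp
 thus ?A "EE (%w. (norm (Y t w - Y s w))^2) <= K1 * (t - s)" by auto
qed

text \<open>Freezing makes an integrand error of order sqrt(t - s) in mean square, by
  \<open>Y_increment\<close> and the Lipschitz bound; its square integrated over a time t - s has
  order (t - s)^2, the same as the squared drift.\<close>

lemma increment_remainder:
 assumes st: "0 <= s" "s < t" "t <= s + 1"
 shows "integrable M (%w. (norm (Y t w - Y s w - a (Y s w) *v dW s t w))^2)"
  "EE (%w. (norm (Y t w - Y s w - a (Y s w) *v dW s t w))^2) <= K2 * (t - s)^2"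
proof -
 obtain J where "increment_of s t J" by (rule increment_exists[OF st(1,2)])
 note J = this[unfolded increment_of_def]
 have [measurable]: "J : borel_measurable M" "dW s t : borel_measurable M" using J st by (auto intro!: dW_measurable)
 have bd: "norm (integral {s..t} (%r. b (Y r w))) <= B * (t - s)" if "w : space M" for w
  by (rule integral_bound) (use st b_bound that in "auto intro!: continuous_on_compose2[OF coeff_continuous(2) Y_continuous]")
 let ?R = "%w. J w - a (Y s w) *v dW s t w"
 interpret P: pair_sigma_finite "LB::real measure" M by standard
 have "NI M (%w. (NI LB (%r. ennreal ((norm (indicator {s<..t} r *R (a (Y r w) - a (Y s w))))^2))))
  = NI LB (%r. (NI M (%w. ennreal ((norm (indicator {s<..t} r *R (a (Y r w) - a (Y s w))))^2))))"
  by (rule P.Fubini') measurable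
 also have "... <= NI LB (%r. ennreal (L^2 * K1 * (t - s)) * indicator {s<..t} r)"
 proof (rule nn_integral_mono)
  fix r
  show "NI M (%w. ennreal ((norm (indicator {s<..t} r *R (a (Y r w) - a (Y s w))))^2)) <= ennreal (L^2 * K1 * (t - s)) * indicator {s<..t} r"
  proof (cases "r : {s<..t}")
   case True
   hence r: "s <= r" "r <= s + 1" "r <= t" using st by auto
   have "NI M (%w. ennreal ((norm (indicator {s<..t} r *R (a (Y r w) - a (Y s w))))^2)) <= NI M (%w. ennreal (L^2 * (norm (Y r w - Y s w))^2))"
   proof (intro nn_integral_mono ennreal_leI)
    fix w
    have "(norm (a (Y r w) - a (Y s w)))^2 <= (L * norm (Y r w - Y s w))^2" by (intro power_mono a_lip) auto
    thus "(norm (indicator {s<..t} r *R (a (Y r w) - a (Y s w))))^2 <= L^2 * (norm (Y r w - Y s w))^2"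
     using True by (simp add: power_mult_distrib)
   qed
   also have "... = ennreal (L^2 * EE (%w. (norm (Y r w - Y s w))^2))"
    using Y_increment(1)[OF st(1) r(1,2)] by (subst nn_integral_eq_integral) auto
   also have "... <= ennreal (L^2 * K1 * (t - s))"
   proof (rule ennreal_leI)
    have "EE (%w. (norm (Y r w - Y s w))^2) <= K1 * (t - s)"
     using Y_increment(2)[OF st(1) r(1,2)] r K_pos by (smt (verit) mult_left_mono)
    thus "L^2 * EE (%w. (norm (Y r w - Y s w))^2) <= L^2 * K1 * (t - s)" by (simp add: mult.assoc mult_left_mono)
   qed
   finally show ?thesis using True by simp
  qed simp
 qed
 also have "... = ennreal (L^2 * K1 * (t - s) * (t - s))"
  using st K_pos by (simp add: nn_integral_cmult_indicator ennreal_mult'')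
 also have "... = ennreal (L^2 * K1 * (t - s)^2)" by (simp add: power2_eq_square mult.assoc)
 finally have "NI M (%w. ennreal ((norm (?R w))^2)) <= 9 * ennreal (L^2 * K1 * (t - s)^2)"
  using J by (elim conjE) (erule order.trans, rule mult_left_mono, auto)
 also have "... = ennreal (9 * (L^2 * K1 * (t - s)^2))" using K_pos by (simp add: ennreal_mult)
 finally have R: "integrable M (%w. (norm (?R w))^2)" "EE (%w. (norm (?R w))^2) <= 9 * (L^2 * K1 * (t - s)^2)"
  using nn_sq_bound[of ?R M] K_pos by auto
 let ?Q = "%w. Y t w - Y s w - a (Y s w) *v dW s t w"
 have ae: "AE w in M. (norm (?Q w))^2 <= 2 * ((B * (t - s))^2 + (norm (?R w))^2)"
  using J[THEN conjunct2, THEN conjunct1] AE_space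
 proof eventually_elim
  case (elim w)
  have "?Q w = integral {s..t} (%r. b (Y r w)) + ?R w" using elim by simp
  hence "(norm (?Q w))^2 <= 2 * ((norm (integral {s..t} (%r. b (Y r w))))^2 + (norm (?R w))^2)"
   using norm_sum2_sq by metis
  moreover have "(norm (integral {s..t} (%r. b (Y r w))))^2 <= (B * (t - s))^2" using bd elim by (intro power_mono) auto
  ultimately show ?case by (meson add_right_mono mult_left_mono order.trans zero_le_numeral)
 qed
 have i2: "integrable M (%w. 2 * ((B * (t - s))^2 + (norm (?R w))^2))" using R by simp
 show i1: "integrable M (%w. (norm (?Q w))^2)"
  by (rule integrable_bound'[OF i2]) (use ae in "auto elim!: eventually_mono")
 have "EE (%w. (norm (?Q w))^2) <= EE (%w. 2 * ((B * (t - s))^2 + (norm (?R w))^2))"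
  by (rule integral_mono_AE[OF i1 i2 ae])
 also have "... = 2 * ((B * (t - s))^2 + EE (%w. (norm (?R w))^2))" using R by (simp add: prob_space)
 also have "... <= K2 * (t - s)^2"
 proof -
  have "2 * ((B * (t - s))^2 + E) <= K2 * (t - s)^2" if "E <= 9 * (L^2 * K1 * (t - s)^2)" for E
   using that unfolding K2_def power_mult_distrib by (simp add: algebra_simps)
  thus ?thesis using R(2) .
 qed
 finally show "EE (%w. (norm (?Q w))^2) <= K2 * (t - s)^2" .
qed

end

text \<open>When \<open>u\<close> is an increment with uncorrelated coordinates, only the diagonal
  of the conjugated form survives in the mean; the cyclic trace turns it into the second-order term
  of the generator.\<close>

lemma quadratic_conj:
 fixes A :: "real^'n::finite^'n" and H :: "real^'n^'n"
 shows "(A *v u) \<bullet> (H *v (A *v u)) = (SUM k:UNIV. SUM l:UNIV. (transpose A ** H ** A) $ k $ l * (u $ k * u $ l))" (is ?A)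
  and "(SUM k:UNIV. (transpose A ** H ** A) $ k $ k) = H \<bullet> (A ** transpose A)" (is ?B)
proof -
 have "(A *v u) \<bullet> (H *v (A *v u)) = u \<bullet> ((transpose A ** H ** A) *v u)"
  by (metis dot_lmul_matrix inner_commute matrix_vector_mul_assoc transpose_matrix_vector transpose_transpose)
 thus ?A
  by (simp add: inner_vec_def matrix_vector_mult_def sum_distrib_left mult_ac)
 have "(SUM k:UNIV. (transpose A ** H ** A) $ k $ k) = (SUM k:UNIV. SUM l:UNIV. SUM m:UNIV. A $ m $ k * H $ m $ l * A $ l $ k)"
  by (simp add: matrix_matrix_mult_def transpose_def sum_distrib_right)
 also have "... = (SUM l:UNIV. SUM m:UNIV. SUM k:UNIV. A $ m $ k * H $ m $ l * A $ l $ k)"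
  by (subst sum.swap) (rule sum.cong[OF refl], rule sum.swap)
 also have "... = (SUM m:UNIV. SUM l:UNIV. SUM k:UNIV. A $ m $ k * H $ m $ l * A $ l $ k)" by (rule sum.swap)
 also have "... = H \<bullet> (A ** transpose A)"
  by (simp add: inner_vec_def matrix_matrix_mult_def transpose_def sum_distrib_left mult_ac)
 finally show ?B .
qed

section \<open>One-step expansion and Dynkin's formula\<close>

text \<open>\<open>f0\<close> and \<open>f1\<close> are the values of a time-dependent function at
  the start and at the end of a step of length \<open>d\<close>; \<open>p\<close>, \<open>g\<close>,
  \<open>H\<close> are its time derivative, gradient and Hessian at the start. The cube yields local
  errors of order d^(3/2); far away the square is taken because the increments of \<open>Y\<close>
  are controlled in mean square only.\<close>

definition taylor_le :: "real => real => (real^'n::finite => real) => (real^'n => real) => (real^'n => real) => (real^'n => real^'n) => (real^'n => real^'n^'n) => bool" where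
 "taylor_le C d f0 f1 p g H \<longleftrightarrow> (ALL x y. abs (f1 y - f0 x - d * p x - g x \<bullet> (y - x) - (y - x) \<bullet> (H x *v (y - x)) / 2)
   <= C * (min ((norm (y - x))^2) (norm (y - x) ^ 3) + d * norm (y - x) + d^2))"

context sde_solution begin

definition gen :: "(real^'n => real) => (real^'n => real^'n) => (real^'n => real^'n^'n) => real^'n => real" where
 "gen p g H x = p x + g x \<bullet> b x + H x \<bullet> (a x ** transpose (a x)) / 2"

lemma drift_error:
 assumes st: "0 <= s" "s < t" "t <= s + 1"
 shows "integrable M (%w. norm (integral {s..t} (%r. b (Y r w)) - (t - s) *R b (Y s w)))"
  "EE (%w. norm (integral {s..t} (%r. b (Y r w)) - (t - s) *R b (Y s w))) <= L * (t - s) * sqrt (K1 * (t - s))"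
proof -
 interpret P: pair_sigma_finite "LB::real measure" M by standard
 let ?D = "%w. integral {s..t} (%r. b (Y r w)) - (t - s) *R b (Y s w)"
 have ib: "integral {s..t} (%r. b (Y r w)) = (LINT r:{s..t}|lborel. b (Y r w))" if "w : space M" for w
  by (intro set_borel_integral_eq_integral(2)[symmetric] borel_integrable_atLeastAtMost' continuous_on_compose2[OF coeff_continuous(2) Y_continuous]) (use that in auto)
 have lm: "(%w. LINT r:{s..t}|lborel. b (Y r w)) : borel_measurable M" unfolding set_lebesgue_integral_def by measurable
 have [measurable]: "(%w. integral {s..t} (%r. b (Y r w))) : borel_measurable M"
  by (rule measurable_cong[THEN iffD2, OF _ lm]) (rule ib)
 have Dn: "ennreal (norm (?D w)) <= NI LB (%r. ennreal (L * norm (Y r w - Y s w)) * indicator {s..t} r)" if w: "w : space M" for w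
 proof -
  have ci: "continuous_on {s..t} (%r. b (Y r w))" "continuous_on {s..t} (%r. L * norm (Y r w - Y s w))"
   using Y_continuous[OF w] by (intro continuous_on_compose2[OF coeff_continuous(2)] continuous_intros; auto)+
  have "?D w = integral {s..t} (%r. b (Y r w) - b (Y s w))"
   using st ci(1) by (subst Henstock_Kurzweil_Integration.integral_diff) (auto intro: integrable_continuous_real)
  also have "norm ... <= integral {s..t} (%r. L * norm (Y r w - Y s w))"
   using ci by (intro integral_norm_bound_integral integrable_continuous_real continuous_on_diff continuous_on_const b_lip) auto
  also have "... = (LINT r:{s..t}|lborel. L * norm (Y r w - Y s w))"
   by (intro set_borel_integral_eq_integral(2)[symmetric] borel_integrable_atLeastAtMost' ci)
  finally have "ennreal (norm (?D w)) <= ennreal (LINT r:{s..t}|lborel. L * norm (Y r w - Y s w))" by (rule ennreal_leI)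
  also have "... = NI LB (%r. ennreal (indicator {s..t} r *R (L * norm (Y r w - Y s w))))"
   unfolding set_lebesgue_integral_def using pos borel_integrable_atLeastAtMost'[OF ci(2)]
   by (intro nn_integral_eq_integral[symmetric]) (auto simp: set_integrable_def)
  also have "... = NI LB (%r. ennreal (L * norm (Y r w - Y s w)) * indicator {s..t} r)"
   by (rule nn_integral_cong) (simp add: indicator_def)
  finally show ?thesis .
 qed
 have "NI M (%w. ennreal (norm (?D w))) <= NI M (%w. (NI LB (%r. ennreal (L * norm (Y r w - Y s w)) * indicator {s..t} r)))"
  by (rule nn_integral_mono) (use Dn in auto)
 also have "... = NI LB (%r. (NI M (%w. ennreal (L * norm (Y r w - Y s w)) * indicator {s..t} r)))"
  by (rule P.Fubini') measurable
 also have "... <= NI LB (%r. ennreal (L * sqrt (K1 * (t - s))) * indicator {s..t} r)"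
 proof (rule nn_integral_mono)
  fix r
  show "NI M (%w. ennreal (L * norm (Y r w - Y s w)) * indicator {s..t} r) <= ennreal (L * sqrt (K1 * (t - s))) * indicator {s..t} r"
  proof (cases "r : {s..t}")
   case True
   hence r: "s <= r" "r <= s + 1" "r <= t" using st by auto
   have sq: "EE (%w. (norm (Y r w - Y s w))^2) <= (sqrt (K1 * (t - s)))^2"
   proof -
    have "K1 * (r - s) <= K1 * (t - s)" using r K_pos by (intro mult_left_mono) auto
    moreover have "(sqrt (K1 * (t - s)))^2 = K1 * (t - s)" using K_pos st by (intro real_sqrt_pow2) simp
    ultimately show ?thesis using Y_increment(2)[OF st(1) r(1,2)] by linarith
   qed
   have p: "0 < sqrt (K1 * (t - s))" using K_pos st by simp
   note e = expectation_abs_le[OF Y_increment(1)[OF st(1) r(1,2)] _ sq p]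
   have ei: "integrable M (%w. norm (Y r w - Y s w))" by (rule e(1)) measurable
   have ee: "EE (%w. norm (Y r w - Y s w)) <= sqrt (K1 * (t - s))" using e(2) by simp
   have "NI M (%w. ennreal (L * norm (Y r w - Y s w))) = ennreal (L * EE (%w. norm (Y r w - Y s w)))"
    using ei pos by (subst nn_integral_eq_integral) auto
   also have "... <= ennreal (L * sqrt (K1 * (t - s)))" using ee pos by (intro ennreal_leI mult_left_mono) auto
   finally show ?thesis using True by simp
  qed simp
 qed
 also have "... = ennreal (L * sqrt (K1 * (t - s)) * (t - s))"
  using st K_pos pos by (simp add: nn_integral_cmult_indicator ennreal_mult'')
 finally have n: "NI M (%w. ennreal (norm (?D w))) <= ennreal (L * (t - s) * sqrt (K1 * (t - s)))" by (simp add: mult_ac)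
 hence "NI M (%w. ennreal (norm (norm (?D w)))) < \<infinity>" using le_less_trans by fastforce
 thus i: "integrable M (%w. norm (?D w))" by (intro integrableI_bounded) auto
 thus "EE (%w. norm (?D w)) <= L * (t - s) * sqrt (K1 * (t - s))"
  using n st K_pos pos by (simp add: nn_integral_eq_integral)
qed

lemma dW_norm_moments:
 fixes s t :: real
 assumes st: "0 <= s" "s < t"
 shows "integrable M (%w. (norm (dW s t w))^2)" (is ?A) "EE (%w. (norm (dW s t w))^2) = CARD('n) * (t - s)"
  and "integrable M (%w. norm (dW s t w) ^ 4)" (is ?B) "EE (%w. norm (dW s t w) ^ 4) <= 3 * (CARD('n))^2 * (t - s)^2" (is ?C)
proof -
 have sg: "0 < sqrt (t - s)" using st by simp
 have s4: "sqrt (t - s) ^ 4 = (t - s)^2" using st by (simp add: power4_eq_xxxx power2_eq_square)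
 have m2: "integrable M (%w. dW s t w $ i * dW s t w $ i)" "EE (%w. dW s t w $ i * dW s t w $ i) = t - s" for i
  using dW_gauss[OF st, of "%y. y $ i * y $ i"] gauss_moments(3,4)[OF sg, of i i] st by auto
 have m4: "integrable M (%w. dW s t w $ i ^ 4)" "EE (%w. dW s t w $ i ^ 4) = 3 * (t - s)^2" for i
  using dW_gauss[OF st, of "%y. y $ i ^ 4"] gauss_moments(5,6)[OF sg, of i] st s4 by auto
 have n2: "(norm y)^2 = (SUM i:UNIV. y $ i * y $ i)" for y :: "real^'n" by (simp add: power2_norm_eq_inner inner_vec_def)
 show ?A "EE (%w. (norm (dW s t w))^2) = CARD('n) * (t - s)"
  unfolding n2 using m2 by (auto simp: integral_sum')
 have n4: "norm y ^ 4 <= CARD('n) * (SUM i:UNIV. y $ i ^ 4)" for y :: "real^'n"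
 proof -
  have "norm y ^ 4 = (SUM i:UNIV. 1 * (y $ i)^2)^2" using n2[of y] by (simp add: power2_eq_square power4_eq_xxxx)
  also have "... <= (SUM i:(UNIV::'n set). 1^2) * (SUM i:UNIV. ((y $ i)^2)^2)" by (rule Cauchy_Schwarz_ineq_sum)
  finally show ?thesis by simp
 qed
 have i4: "integrable M (%w. CARD('n) * (SUM i:UNIV. dW s t w $ i ^ 4))" using m4 by auto
 have [measurable]: "dW s t : borel_measurable M" using st by (auto intro: dW_measurable)
 show i: ?B
 proof (rule integrable_bound'[OF i4 _ AE_I2])
  show "norm (norm (dW s t w) ^ 4) <= norm (CARD('n) * (SUM i:UNIV. dW s t w $ i ^ 4))" for w
   using n4[of "dW s t w"] by simp
 qed measurable
 have "EE (%w. norm (dW s t w) ^ 4) <= EE (%w. CARD('n) * (SUM i:UNIV. dW s t w $ i ^ 4))"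
  by (rule integral_mono[OF i i4 n4])
 also have "... = 3 * (CARD('n))^2 * (t - s)^2" using m4 by (simp add: integral_sum' power2_eq_square)
 finally show ?C .
qed

abbreviation (input) "QH H s t w == (a (Y s w) *v dW s t w) \<bullet> (H (Y s w) *v (a (Y s w) *v dW s t w))"

lemma quadratic_mean:
 assumes st: "0 <= s" "s < t" and psi: "bddF s psi" and [measurable]: "H : BB" and HC: "!!x. norm (H x) <= C"
 shows "integrable M (%w. psi w * QH H s t w)" (is ?A)
  "EE (%w. psi w * QH H s t w) =
   (t - s) * EE (%w. psi w * (H (Y s w) \<bullet> (a (Y s w) ** transpose (a (Y s w)))))" (is ?B)
proof -
 let ?G = "%w. transpose (a (Y s w)) ** H (Y s w) ** a (Y s w)"
 have am: "a : BB" "H : BB" by measurable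
 have entry: "abs (Q $ i $ j) <= norm Q" for Q :: "real^'n^'n" and i j
  using component_le_norm_cart[of "Q $ i" j] Finite_Cartesian_Product.norm_nth_le[of Q i] by linarith
 have e: "bddF s (%w. h (Y s w) $ i $ j)" if h: "h : BB" "!!x. norm (h x) <= c" for h :: "real^'n => real^'n^'n" and c i j
  unfolding bddF_def using entry order.trans that(2)
  by (intro conjI borel_measurable_nth measurable_compose[OF Y_adapted[OF st(1)] h(1)]) blast
 have bs: "bddF s (%w. SUM i:UNIV. f i w)" if "!!i. bddF s (f i)" for f :: "'n => 'w => real"
 proof -
  have "ALL i. EX K. ALL w:space M. abs (f i w) <= K" using that unfolding bddF_def by blast
  then obtain K where K: "!!i w. w : space M ==> abs (f i w) <= K i" by metis
  have "ALL w:space M. abs (SUM i:UNIV. f i w) <= (SUM i:UNIV. K i)" using K by (auto intro!: order.trans[OF sum_abs] sum_mono)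
  moreover have "(%w. SUM i:UNIV. f i w) : borel_measurable (F s)" using bddF_D(1)[OF that] by (intro borel_measurable_sum) auto
  ultimately show ?thesis unfolding bddF_def by blast
 qed
 have G: "bddF s (%w. psi w * ?G w $ k $ l)" for k l
  unfolding matrix_matrix_mult_def transpose_def
  by (simp, intro bddF_mult psi bs e[OF am(1) a_bound] e[OF am(2) HC])
 have d: "integrable M (%w. psi w * ?G w $ k $ l * (dW s t w $ k * dW s t w $ l))" for k l
 proof -
  obtain K where K: "!!w. w\<in>space M ==> abs (psi w * ?G w $ k $ l) <= K" using bddF_bound[OF G] by blast
  show ?thesis using st K bddF_D(2)[OF G]
   by (subst mult.assoc[symmetric]) (intro integrable_sq_bound[of _ _ _ K] dW_sq_integrable borel_measurable_nth dW_measurable; simp)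
 qed
 have x: "psi w * QH H s t w =
  (SUM k:UNIV. SUM l:UNIV. psi w * ?G w $ k $ l * (dW s t w $ k * dW s t w $ l))" for w
  unfolding quadratic_conj by (simp add: sum_distrib_left mult.assoc)
 show ?A
  unfolding x by (intro integrable_sum' d)
 have "EE (%w. psi w * QH H s t w) =
  (SUM k:UNIV. SUM l:UNIV. EE (%w. psi w * ?G w $ k $ l * (dW s t w $ k * dW s t w $ l)))"
  unfolding x by (simp only: integral_sum' integrable_sum' d)
 also have "... = (SUM k:UNIV. SUM l:UNIV. (if k = l then t - s else 0) * EE (%w. psi w * ?G w $ k $ l))"
  using st by (intro sum.cong refl dW_square bddF_D(1,3)[OF G]) auto
 also have "... = (t - s) * (SUM k:UNIV. EE (%w. psi w * ?G w $ k $ k))"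
  by (simp add: if_distrib[of "%x. x * _"] sum_distrib_left cong: if_cong)
 also have "(SUM k:UNIV. EE (%w. psi w * ?G w $ k $ k)) = EE (%w. SUM k:UNIV. psi w * ?G w $ k $ k)"
  by (rule integral_sum'[symmetric]) (rule bddF_D(3)[OF G])
 finally show ?B
  unfolding sum_distrib_left[symmetric] quadratic_conj(2) .
qed

text \<open>The coefficients of the mean of the variable \<open>U\<close> in
  \<open>one_step\<close>: Gaussian moments, \<open>K2\<close>, \<open>K1\<close> and the drift
  error, each measured in units of d * sqrt d with \<open>d <= 1\<close>.\<close>

definition "K3 = 4 * A ^ 3 * (CARD('n) + 3 * (CARD('n))^2) + 5 * K2 + (A^2 * CARD('n) + K2) / 2 + (1 + K1) / 2 + 1 + L * sqrt K1"

lemma K3_pos: "0 < K3" unfolding K3_def using K_pos pos by (intro add_nonneg_pos add_pos_nonneg) auto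

lemma borel_bound_integrable:
 assumes "bddF s psi" "f : BB" "!!x. abs (f x) <= C"
 shows "integrable M (%w. psi w * f (Y t w))"
proof -
 obtain P where P: "0 <= P" "!!w. w : space M ==> abs (psi w) <= P" using bddF_bound[OF assms(1)] by blast
 have [measurable]: "psi : borel_measurable M" "f : BB" using assms bddF_D by auto
 show ?thesis
 proof (rule integrable_const_bound[of _ "P * C"])
  show "AE w in M. norm (psi w * f (Y t w)) <= P * C"
   using P assms(3) by (auto intro!: AE_I2 mult_mono simp: abs_mult)
 qed measurable
qed

lemma gen_bound:
 assumes "!!x. abs (p x) <= C" "!!x. norm (g x) <= C" "!!x. norm (H x) <= C"
 shows "abs (gen p g H x) <= C * (1 + B + (norm (a x ** transpose (a x))) / 2)"
proof -
 have "abs (g x \<bullet> b x) <= C * B"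
  using Cauchy_Schwarz_ineq2[of "g x" "b x"] mult_mono[OF assms(2)[of x] b_bound[of x]] order.trans[OF norm_ge_zero assms(2)[of x]] by auto
 moreover have "abs (H x \<bullet> (a x ** transpose (a x))) <= C * norm (a x ** transpose (a x))"
  by (rule order.trans[OF Cauchy_Schwarz_ineq2 mult_right_mono[OF assms(3) norm_ge_zero]])
 ultimately show ?thesis using assms(1)[of x] unfolding gen_def by (simp add: algebra_simps)
qed

text \<open>The order (t - s)^(3/2) of the error is better than t - s, so it disappears when steps
  are summed. Once the mean-zero terms \<open>Q\<close> of first and second order are removed, the
  rest is bounded pathwise by \<open>U\<close>.\<close>

lemma one_step:
 assumes st: "0 <= s" "s < t" "t <= s + 1" and psi: "bddF s psi" and P: "!!w. w : space M ==> abs (psi w) <= P" and C: "0 <= C"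
  and T: "taylor_le C (t - s) f0 f1 p g H"
  and [measurable]: "f0 : BB" "f1 : BB" "p : BB"
   "g : BB" "H : BB"
  and bd: "!!x. abs (f0 x) <= C'" "!!x. abs (f1 x) <= C'" "!!x. abs (p x) <= C'" "!!x. norm (g x) <= C" "!!x. norm (H x) <= C"
 shows "abs (EE (%w. psi w * f1 (Y t w)) - EE (%w. psi w * f0 (Y s w)) - (t - s) * EE (%w. psi w * gen p g H (Y s w)))
   <= P * C * (K3 * ((t - s) * sqrt (t - s)))"
proof -
 define d where "d = t - s"
 define e where "e = sqrt d"
 have d: "0 < d" "d <= 1" and e: "0 < e" "e <= 1" "e * e = d" using st by (auto simp: d_def e_def)
 have P0: "0 <= P" using P not_empty by (meson abs_ge_zero equals0I order.trans)
 obtain J where "increment_of s t J" by (rule increment_exists[OF st(1,2)])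
 note J = this[unfolded increment_of_def]
 have [measurable]: "J : borel_measurable M" "dW s t : borel_measurable M" "psi : borel_measurable M" using J st bddF_D[OF psi] by (auto intro!: dW_measurable)
 define al R D where "al w = a (Y s w) *v dW s t w" and "R w = Y t w - Y s w - al w"
  and "D w = norm (integral {s..t} (%r. b (Y r w)) - d *R b (Y s w))" for w
 have [measurable]: "al : borel_measurable M" "R : borel_measurable M" unfolding al_def R_def by measurable
 have Di: "integrable M D" "EE D <= L * d * sqrt (K1 * d)" unfolding D_def d_def by (rule drift_error[OF st])+
 have Ri: "integrable M (%w. (norm (R w))^2)" "EE (%w. (norm (R w))^2) <= K2 * d^2"
  unfolding R_def al_def d_def by (rule increment_remainder[OF st])+
 have Wi: "integrable M (%w. (norm (dW s t w))^2)" "EE (%w. (norm (dW s t w))^2) = CARD('n) * d"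
  "integrable M (%w. norm (dW s t w) ^ 4)" "EE (%w. norm (dW s t w) ^ 4) <= 3 * (CARD('n))^2 * d^2"
  unfolding d_def by (rule dW_norm_moments[OF st(1,2)])+
 have Vi: "integrable M (%w. (norm (Y t w - Y s w))^2)" "EE (%w. (norm (Y t w - Y s w))^2) <= K1 * d"
  unfolding d_def using Y_increment[of s t] st by auto
 define q where "q x = H x \<bullet> (a x ** transpose (a x))" for x
 define Q where "Q w = psi w * (g (Y s w) \<bullet> J w) + (psi w * (al w \<bullet> (H (Y s w) *v al w)) - d * (psi w * q (Y s w))) / 2" for w
 have am: "norm (a x ** transpose (a x)) <= CARD('n) * (CARD('n) * A^2)" for x
 proof -
  have "abs ((a x ** transpose (a x)) $ i $ j) <= A^2" for i j
  proof -
   have "(a x ** transpose (a x)) $ i $ j = a x $ i \<bullet> a x $ j" by (simp add: matrix_matrix_mult_def transpose_def inner_vec_def)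
   moreover have "norm (a x $ i) <= A" for i using Finite_Cartesian_Product.norm_nth_le[of "a x" i] a_bound[of x] by linarith
   ultimately show ?thesis using Cauchy_Schwarz_ineq2[of "a x $ i" "a x $ j"] mult_mono[of "norm (a x $ i)" A "norm (a x $ j)" A] pos
    by (simp add: power2_eq_square)
  qed
  note 1 = this
  have 2: "norm ((a x ** transpose (a x)) $ i) <= CARD('n) * A^2" for i
   by (rule order.trans[OF norm_le_l1_cart]) (rule sum_bounded_above[OF 1])
  have "L2_set (%i. norm ((a x ** transpose (a x)) $ i)) UNIV <= CARD('n) * (CARD('n) * A^2)"
   by (rule order.trans[OF L2_set_le_sum]) (rule norm_ge_zero, rule sum_bounded_above[OF 2])
  thus ?thesis by (simp add: norm_vec_def)
 qed
 have qb: "abs (q x) <= C * (CARD('n) * (CARD('n) * A^2))" for x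
  unfolding q_def using Cauchy_Schwarz_ineq2[of "H x" "a x ** transpose (a x)"] mult_mono[OF bd(5)[of x] am[of x] C norm_ge_zero] by linarith
 have mm: "(%x. a x ** transpose (a x)) : BB"
 proof -
  have "continuous_on UNIV (%x. \<chi> i j. a x $ i \<bullet> a x $ j)"
   by (intro continuous_on_vec_lambda continuous_on_inner continuous_on_component coeff_continuous)
  moreover have "(\<chi> i j. a x $ i \<bullet> a x $ j) = a x ** transpose (a x)" for x
   by (simp add: matrix_matrix_mult_def transpose_def inner_vec_def)
  ultimately show ?thesis by (auto intro: borel_measurable_continuous_onI)
 qed
 have [measurable]: "q : BB" unfolding q_def using mm by measurable
 have gp: "bddF s (%w. psi w * g (Y s w) $ i)" for i
 proof (rule bddF_mult[OF psi])
  have gm: "g : BB" by measurable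
  show "bddF s (%w. g (Y s w) $ i)" unfolding bddF_def
  proof (intro conjI exI ballI)
   show "(%w. g (Y s w) $ i) : borel_measurable (F s)"
    by (rule borel_measurable_nth[OF measurable_compose[OF Y_adapted[OF st(1)] gm]])
   show "abs (g (Y s w) $ i) <= C" for w using component_le_norm_cart[of "g (Y s w)" i] bd(4)[of "Y s w"] by linarith
  qed
 qed
 have gJ: "psi w * (g (Y s w) \<bullet> J w) = (SUM i:UNIV. psi w * g (Y s w) $ i * J w $ i)" for w
  by (simp add: inner_vec_def sum_distrib_left mult.assoc)
 have gJm: "integrable M (%w. psi w * g (Y s w) $ i * J w $ i)" "EE (%w. psi w * g (Y s w) $ i * J w $ i) = 0" for i
  using J gp[of i] by blast+
 have gJi: "integrable M (%w. psi w * (g (Y s w) \<bullet> J w))" "EE (%w. psi w * (g (Y s w) \<bullet> J w)) = 0"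
  unfolding gJ using gJm by (auto simp: integral_sum')
 have Hm: "H : BB" by measurable
 note qm = quadratic_mean[OF st(1,2) psi Hm bd(5), folded al_def d_def q_def]
 have qi: "integrable M (%w. psi w * q (Y s w))" by (rule borel_bound_integrable[OF psi _ qb]) measurable
 have Qi: "integrable M Q" "EE Q = 0" unfolding Q_def[abs_def] using gJi qm qi by auto
 have gbb: "abs (gen p g H x) <= (C + C') * (1 + B + CARD('n) * (CARD('n) * A^2) / 2)" for x
 proof -
  have C': "0 <= C'" using bd(3)[of 0] by linarith
  have "abs (gen p g H x) <= (C + C') * (1 + B + (norm (a x ** transpose (a x))) / 2)"
   using bd(3,4,5) C C' by (intro gen_bound) (meson add_increasing add_increasing2 order.trans)+
  also have "... <= (C + C') * (1 + B + CARD('n) * (CARD('n) * A^2) / 2)" using am[of x] C C' by (intro mult_left_mono) auto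
  finally show ?thesis .
 qed
 have [measurable]: "gen p g H : BB" unfolding gen_def q_def[symmetric] by measurable
 have mms: "f0 : BB" "f1 : BB" "gen p g H : BB" by measurable
 note ints = borel_bound_integrable[OF psi mms(1) bd(1), where t=s] borel_bound_integrable[OF psi mms(2) bd(2), where t=t] borel_bound_integrable[OF psi mms(3) gbb, where t=s]
 define Z where "Z w = psi w * f1 (Y t w) - psi w * f0 (Y s w) - d * (psi w * gen p g H (Y s w))" for w
 have Zi: "integrable M Z" "EE Z = EE (%w. psi w * f1 (Y t w)) - EE (%w. psi w * f0 (Y s w)) - d * EE (%w. psi w * gen p g H (Y s w))"
  unfolding Z_def[abs_def] using ints by auto
 \<comment> \<open>Products such as |al| |R| are split by Young's inequality with weight
   \<open>e = sqrt d\<close>, the balance at which no summand has a mean of larger order than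
   \<open>d * e\<close>.\<close>
 define U where "U w = 4 * A ^ 3 * (e * (norm (dW s t w))^2 + norm (dW s t w) ^ 4 / e) + 5 * (norm (R w))^2 +
  (e * (A^2 * (norm (dW s t w))^2) + (norm (R w))^2 / e) / 2 + d * ((e + (norm (Y t w - Y s w))^2 / e) / 2) + d^2 + D w" for w
 have Ui: "integrable M U" unfolding U_def[abs_def]
  by (intro Bochner_Integration.integrable_add integrable_mult_right integrable_divide_zero Wi Ri Vi Di integrable_const)
 have EU: "EE U <= K3 * (d * e)"
 proof -
  have "EE U = 4 * A ^ 3 * (e * (CARD('n) * d) + EE (%w. norm (dW s t w) ^ 4) / e) + 5 * EE (%w. (norm (R w))^2) +
   (e * (A^2 * (CARD('n) * d)) + EE (%w. (norm (R w))^2) / e) / 2 + d * ((e + EE (%w. (norm (Y t w - Y s w))^2) / e) / 2) + d^2 + EE D"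
   unfolding U_def[abs_def] using Wi Ri Vi Di by (simp add: prob_space)
  also have "... <= 4 * A ^ 3 * (e * (CARD('n) * d) + 3 * (CARD('n))^2 * d^2 / e) + 5 * (K2 * d^2) +
   (e * (A^2 * (CARD('n) * d)) + K2 * d^2 / e) / 2 + d * ((e + K1 * d / e) / 2) + d^2 + L * d * sqrt (K1 * d)"
   using Wi(4) Ri(2) Vi(2) Di(2) pos e d by (intro add_mono mult_left_mono divide_right_mono order.refl) auto
  also have "... = (K3 + (5 * K2 + 1) * (e - 1)) * (d * e)"
  proof -
   have "sqrt (K1 * d) = sqrt K1 * e" by (simp add: real_sqrt_mult e_def)
   thus ?thesis using e(1) unfolding K3_def e(3)[symmetric] by (simp add: field_simps power2_eq_square)
  qed
  also have "... <= K3 * (d * e)" using e d K_pos by (intro mult_right_mono) (auto simp: mult_nonneg_nonpos)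
  finally show ?thesis .
 qed
 have ae: "AE w in M. abs (Z w - Q w) <= P * C * U w"
  using J[THEN conjunct2, THEN conjunct1] AE_space
 proof eventually_elim
  case (elim w)
  define x y v r where "x = Y s w" and "y = Y t w" and "v = y - x" and "r = R w"
  define I where "I = integral {s..t} (%r. b (Y r w))"
  have vI: "v = I + J w" using elim by (simp add: v_def x_def y_def I_def)
  have vr: "v = al w + r" by (simp add: v_def x_def y_def r_def R_def)
  have T': "abs (f1 y - f0 x - d * p x - g x \<bullet> v - v \<bullet> (H x *v v) / 2) <= C * (min ((norm v)^2) (norm v ^ 3) + d * norm v + d^2)"
   using T unfolding taylor_le_def d_def v_def by blast
  have g1: "abs (g x \<bullet> (I - d *R b x)) <= C * D w"
   using Cauchy_Schwarz_ineq2[of "g x" "I - d *R b x"] mult_right_mono[OF bd(4)[of x], of "D w"] by (simp add: D_def I_def x_def)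
  have hb: "abs (u1 \<bullet> (H x *v u2)) <= C * (norm u1 * norm u2)" for u1 u2
   using Cauchy_Schwarz_ineq2[of u1 "H x *v u2"] norm_matrix_vector[of "H x" u2] mult_right_mono[OF bd(5)[of x], of "norm u2"]
    mult_left_mono[of "norm (H x *v u2)" "C * norm u2" "norm u1"] by (simp add: mult_ac)
  have q1: "abs (v \<bullet> (H x *v v) - al w \<bullet> (H x *v al w)) <= C * (2 * (norm (al w) * norm r) + (norm r)^2)"
  proof -
   have "v \<bullet> (H x *v v) - al w \<bullet> (H x *v al w) = al w \<bullet> (H x *v r) + r \<bullet> (H x *v al w) + r \<bullet> (H x *v r)"
    unfolding vr by (simp add: matrix_vector_right_distrib inner_add_left inner_add_right)
   thus ?thesis using hb[of "al w" r] hb[of r "al w"] hb[of r r] by (simp add: power2_eq_square algebra_simps)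
  qed
  have id: "Z w - Q w = psi w * ((f1 y - f0 x - d * p x - g x \<bullet> v - v \<bullet> (H x *v v) / 2) + g x \<bullet> (I - d *R b x) + (v \<bullet> (H x *v v) - al w \<bullet> (H x *v al w)) / 2)"
   unfolding Z_def Q_def gen_def q_def x_def[symmetric] y_def[symmetric]
   by (simp add: vI[THEN arg_cong[where f="%v. g x \<bullet> v"]] inner_diff_right inner_add_right field_simps)
  have aln: "norm (al w) <= A * norm (dW s t w)"
   unfolding al_def using norm_matrix_vector[of "a (Y s w)" "dW s t w"] mult_right_mono[OF a_bound[of "Y s w"] norm_ge_zero[of "dW s t w"]] by linarith
  have al3: "norm (al w) ^ 3 <= A ^ 3 * ((e * (norm (dW s t w))^2 + norm (dW s t w) ^ 4 / e) / 2)"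
  proof -
   have "norm (al w) ^ 3 <= (A * norm (dW s t w)) ^ 3" by (intro power_mono aln) simp
   also have "... <= A ^ 3 * ((e * (norm (dW s t w))^2 + norm (dW s t w) ^ 4 / e) / 2)"
    unfolding power_mult_distrib using pos e by (intro mult_left_mono cube_le) auto
   finally show ?thesis .
  qed
  have al2: "(norm (al w))^2 <= A^2 * (norm (dW s t w))^2" using power_mono[OF aln norm_ge_zero, of 2] by (simp add: power_mult_distrib)
  have alr: "norm (al w) * norm r <= (e * (A^2 * (norm (dW s t w))^2) + (norm r)^2 / e) / 2"
   by (rule order.trans[OF prod_le_sq[OF e(1)]]) (intro divide_right_mono add_right_mono mult_left_mono al2; use e in simp)
  have vn: "norm v <= (e + (norm v)^2 / e) / 2" using prod_le_sq[OF e(1), of 1 "norm v"] by simp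
  have mn: "min ((norm v)^2) (norm v ^ 3) <= 8 * norm (al w) ^ 3 + 4 * (norm r)^2" unfolding vr by (rule min_sq_cube)
  have "(min ((norm v)^2) (norm v ^ 3) + d * norm v + d^2) + D w + (2 * (norm (al w) * norm r) + (norm r)^2) / 2 <= U w"
  proof -
   have aux: "m + dv + d2 + D + (2 * pr + n) / 2 <= 4 * A3 * x + 5 * n + y / 2 + dz + d2 + D"
    if "m <= 8 * c + 4 * n" "c <= A3 * (x / 2)" "pr <= y / 2" "dv <= dz" "0 <= n" for m dv d2 D pr n A3 x y dz c :: real
    using that by (simp add: field_simps)
   show ?thesis unfolding U_def r_def[symmetric] v_def[symmetric, unfolded x_def y_def]
    by (rule aux[OF mn al3 alr mult_left_mono[OF vn less_imp_le[OF d(1)]]]) simp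
  qed
  note ub = mult_left_mono[OF this C]
  have "abs ((f1 y - f0 x - d * p x - g x \<bullet> v - v \<bullet> (H x *v v) / 2) + g x \<bullet> (I - d *R b x) + (v \<bullet> (H x *v v) - al w \<bullet> (H x *v al w)) / 2) <= C * U w"
  proof -
   have aux: "abs (X + G + Q / 2) <= u" if "abs X <= C * m" "abs G <= C * D" "abs Q <= C * n" "C * (m + D + n / 2) <= u" for X G Q m D n u
    using that by (simp add: distrib_left)
   show ?thesis by (rule aux[OF T' g1 q1 ub])
  qed
  from mult_mono[OF P[OF elim(2)] this P0 abs_ge_zero] show ?case unfolding id abs_mult by (simp add: mult.assoc)
 qed
 have "abs (EE Z) = abs (EE (%w. Z w - Q w))" using Zi Qi by simp
 also have "... <= EE (%w. abs (Z w - Q w))" by (rule integral_abs_bound)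
 also have "... <= EE (%w. P * C * U w)" using Zi Qi Ui ae by (intro integral_mono_AE) auto
 also have "... <= P * C * (K3 * (d * e))" using EU P0 C by (simp add: mult_left_mono)
 finally show ?thesis unfolding Zi d_def e_def .
qed

end

text \<open>Steps know the candidate derivative at their left end only. For a difference quotient
  from the left of \<open>x\<close> the step starts at \<open>y < x\<close>, and continuity of
  \<open>D\<close> replaces \<open>D y\<close> by \<open>D x\<close>.\<close>

lemma has_integral_of_right_increments:
 fixes fi D :: "real => real"
 assumes "s <= t" and K: "0 <= K" and D: "continuous_on {s..t} D"
  and step: "!!u v. s <= u ==> u < v ==> v <= t ==> v <= u + 1 ==> abs (fi v - fi u - (v - u) * D u) <= K * ((v - u) * sqrt (v - u))"
 shows "(D has_integral fi t - fi s) {s..t}"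
proof (rule fundamental_theorem_of_calculus[OF assms(1)])
 fix x assume x: "x : {s..t}"
 show "(fi has_vector_derivative D x) (at x within {s..t})"
  unfolding has_vector_derivative_def has_derivative_within_alt
 proof (intro conjI allI impI)
  show "bounded_linear (%y. y *R D x)" by (rule bounded_linear_scaleR_left)
  fix e :: real assume e: "0 < e"
  obtain d where d: "0 < d" "!!y. y : {s..t} ==> dist y x < d ==> dist (D y) (D x) < e / 2"
   using D x e unfolding continuous_on_iff by (metis half_gt_zero)
  define r where "r = (e / (2 * (K + 1)))^2"
  have r: "0 < r" using e K by (simp add: r_def)
  have sr: "K * sqrt z <= e / 2" if "0 <= z" "z <= r" for z
  proof -
   have "sqrt z <= sqrt r" using that by simp
   also have "sqrt r = e / (2 * (K + 1))" using e K by (simp add: r_def)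
   finally have "K * sqrt z <= K * (e / (2 * (K + 1)))" using K by (intro mult_left_mono) auto
   also have "... <= e / 2" using K e by (simp add: field_simps)
   finally show ?thesis .
  qed
  show "EX d>0. ALL y:{s..t}. norm (y - x) < d --> norm (fi y - fi x - (y - x) *R D x) <= e * norm (y - x)"
  proof (intro exI conjI ballI impI)
   show "0 < min d (min r 1)" using d r by simp
   fix y assume y: "y : {s..t}" "norm (y - x) < min d (min r 1)"
   hence yd: "abs (D y - D x) <= e / 2" using d(2)[of y] by (simp add: dist_real_def)
   consider "y = x" | "x < y" | "y < x" by linarith
   thus "norm (fi y - fi x - (y - x) *R D x) <= e * norm (y - x)"
   proof cases
    case 2
    have "abs (fi y - fi x - (y - x) * D x) <= (y - x) * (K * sqrt (y - x))"
     using step[of x y] x y 2 by (simp add: mult_ac)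
    also have "... <= (y - x) * e" using sr[of "y - x"] 2 y e by (intro mult_left_mono) auto
    finally show ?thesis using 2 by (simp add: mult.commute)
   next
    case 3
    have "abs (fi x - fi y - (x - y) * D y) <= (x - y) * (K * sqrt (x - y))"
     using step[of y x] x y 3 by (simp add: mult_ac)
    also have "... <= (x - y) * (e / 2)" using sr[of "x - y"] 3 y e by (intro mult_left_mono) auto
    finally have 1: "abs (fi x - fi y - (x - y) * D y) <= (x - y) * (e / 2)" .
    have 2: "abs ((x - y) * (D y - D x)) <= (x - y) * (e / 2)" using yd 3 by (simp add: abs_mult)
    have "fi y - fi x - (y - x) * D x = - (fi x - fi y - (x - y) * D y) - (x - y) * (D y - D x)" by (simp add: algebra_simps)
    hence "abs (fi y - fi x - (y - x) * D x) <= (x - y) * (e / 2) + (x - y) * (e / 2)" using 1 2 by linarith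
    also have "... = e * (x - y)" by (simp add: field_simps)
    finally show ?thesis using 3 by simp
   qed simp
  qed
 qed
qed

context sde_solution begin

lemma expectation_continuous:
 assumes psi: "bddF u psi" and G: "continuous_on ({s..t} \<times> UNIV) (%(v, x). G v x :: real)" and bd: "!!v x. v : {s..t} ==> abs (G v x) <= C"
 shows "continuous_on {s..t} (%v. EE (%w. psi w * G v (Y v w)))" (is ?A)
  and "v : {s..t} ==> G v : BB"
proof -
 have Gv: "continuous_on UNIV (G v)" if "v : {s..t}" for v
 proof -
  have "continuous_on UNIV (Pair v :: real^'n => _)" by (intro continuous_intros)
  moreover have "range (Pair v :: real^'n => _) <= {s..t} \<times> UNIV" using that by auto
  ultimately show ?thesis using continuous_on_compose2[OF G, of UNIV "Pair v"] by simp
 qed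
 hence Gm: "G v : BB" if "v : {s..t}" for v using that by (auto intro: borel_measurable_continuous_onI)
 thus "v : {s..t} ==> G v : BB" .
 obtain P where P: "0 <= P" "!!w. w : space M ==> abs (psi w) <= P" using bddF_bound[OF psi] by blast
 have pm: "psi : borel_measurable M" using bddF_D[OF psi] by auto
 show ?A
  unfolding continuous_on_sequentially comp_def
 proof (intro allI ballI impI, elim conjE)
  fix x a assume a: "a : {s..t}" and x: "ALL n. x n : {s..t}" and lim: "x ----> a"
  show "(%n. EE (%w. psi w * G (x n) (Y (x n) w))) ----> EE (%w. psi w * G a (Y a w))"
  proof (rule integral_dominated_convergence[where w="%_. P * C"])
   show "(%w. psi w * G a (Y a w)) : borel_measurable M" "!!i. (%w. psi w * G (x i) (Y (x i) w)) : borel_measurable M"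
    using a x by (auto intro!: borel_measurable_times pm measurable_compose[OF Y_measurable Gm])
   show "AE w in M. norm (psi w * G (x i) (Y (x i) w)) <= P * C" for i
    using P bd x by (auto intro!: AE_I2 mult_mono simp: abs_mult)
   show "AE w in M. (%i. psi w * G (x i) (Y (x i) w)) ----> psi w * G a (Y a w)"
   proof (rule AE_I2)
    fix w assume w: "w : space M"
    have c: "continuous_on {s..t} (%v. case (v, Y v w) of (v, x) => G v x)"
     by (rule continuous_on_compose2[OF G]) (auto intro!: continuous_intros Y_continuous w)
    show "(%i. psi w * G (x i) (Y (x i) w)) ----> psi w * G a (Y a w)"
     using continuous_on_tendsto_compose[OF c lim a] x by (intro tendsto_mult tendsto_const) auto
   qed
  qed simp
 qed
qed

text \<open>The one-step errors make the expectation differentiable in time with the mean of the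
  generator as derivative. The expansion constant \<open>C\<close> leaves no trace in the identity,
  so it may be arbitrarily large.\<close>

lemma dynkin:
 assumes st: "0 <= s" "s <= t" and psi: "bddF s psi" and C: "0 <= C"
  and T: "!!u v. s <= u ==> u < v ==> v <= t ==> v <= u + 1 ==> taylor_le C (v - u) (f u) (f v) (p u) (g u) (H u)"
  and m: "!!v. f v : BB" "!!v. p v : BB" "!!v. g v : BB" "!!v. H v : BB"
  and bd: "!!v x. v : {s..t} ==> abs (f v x) <= C" "!!v x. v : {s..t} ==> abs (p v x) <= C" "!!v x. v : {s..t} ==> norm (g v x) <= C" "!!v x. v : {s..t} ==> norm (H v x) <= C"
  and G: "continuous_on ({s..t} \<times> UNIV) (%(v, x). gen (p v) (g v) (H v) x)" "!!v x. v : {s..t} ==> abs (gen (p v) (g v) (H v) x) <= C'"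
 shows "((%v. EE (%w. psi w * gen (p v) (g v) (H v) (Y v w))) has_integral
  EE (%w. psi w * f t (Y t w)) - EE (%w. psi w * f s (Y s w))) {s..t}"
proof -
 obtain P where P: "0 <= P" "!!w. w : space M ==> abs (psi w) <= P" using bddF_bound[OF psi] by blast
 show ?thesis
 proof (rule has_integral_of_right_increments[OF st(2)])
  show "0 <= P * C * K3" using P C K3_pos by simp
  show "continuous_on {s..t} (%v. EE (%w. psi w * gen (p v) (g v) (H v) (Y v w)))"
   by (rule expectation_continuous(1)[OF psi G])
  fix u v assume uv: "s <= u" "u < v" "v <= t" "v <= u + 1"
  have u: "u : {s..t}" "v : {s..t}" using uv by auto
  show "abs (EE (%w. psi w * f v (Y v w)) - EE (%w. psi w * f u (Y u w)) - (v - u) * EE (%w. psi w * gen (p u) (g u) (H u) (Y u w)))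
   <= P * C * K3 * ((v - u) * sqrt (v - u))"
   using one_step[OF order.trans[OF st(1) uv(1)] uv(2,4) bddF_mono[OF psi uv(1)] P(2) C T[OF uv] m(1,1,2,3,4) bd(1)[OF u(1)] bd(1)[OF u(2)] bd(2)[OF u(1)] bd(3)[OF u(1)] bd(4)[OF u(1)]]
   by (simp add: mult.assoc)
 qed
qed

end

section \<open>Gaussian kernels with frozen covariance\<close>

text \<open>Gaussian kernel whose covariance is \<open>ta\<close> times the inverse of
  \<open>N\<close>, not normalised: its total mass depends on \<open>N\<close> but not on
  \<open>ta\<close>. The power of \<open>ta\<close> is written as the exponential of a logarithm,
  which differentiates easily.\<close>

definition qk :: "real^'n::finite^'n => real => real^'n => real" where
 "qk N ta w = exp (- (CARD('n) / 2 * ln ta) - w \<bullet> (N *v w) / (2 * ta))"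

text \<open>Minus the derivative in \<open>ta\<close>: the kernel is used with the remaining time
  \<open>ta = t - v\<close>, which decreases as the clock \<open>v\<close> runs.\<close>

definition pk :: "real^'n::finite^'n => real => real^'n => real" where
 "pk N ta w = qk N ta w * (CARD('n) / (2 * ta) - w \<bullet> (N *v w) / (2 * ta^2))"

definition gk :: "real^'n::finite^'n => real => real^'n => real^'n" where
 "gk N ta w = - (qk N ta w / ta) *R (N *v w)"

definition outer :: "real^'n::finite => real^'n^'n" where "outer u = (\<chi> i j. u $ i * u $ j)"

definition Hk :: "real^'n::finite^'n => real => real^'n => real^'n^'n" where
 "Hk N ta w = qk N ta w *R ((1 / ta^2) *R outer (N *v w) - (1 / ta) *R N)"

lemma outer_apply: "outer u *v x = (u \<bullet> x) *R u"
 by (simp add: vec_eq_iff outer_def matrix_vector_mult_def inner_vec_def sum_distrib_left sum_distrib_right mult_ac)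

lemma outer_inner: "outer u \<bullet> S = u \<bullet> (S *v u)"
 by (simp add: outer_def matrix_vector_mult_def inner_vec_def sum_distrib_left mult_ac)

lemma norm_outer: "norm (outer u) = (norm u)^2"
proof -
 have "(norm (outer u))^2 = ((norm u)^2)^2"
  unfolding power2_norm_eq_inner outer_inner outer_apply by (simp add: power2_eq_square)
 thus ?thesis by (metis norm_ge_zero power2_eq_iff_nonneg zero_le_power2)
qed

lemma taylor3:
 fixes h :: "real => real"
 assumes "!!x. 0 <= x ==> x <= 1 ==> (h has_real_derivative h1 x) (at x)" "!!x. 0 <= x ==> x <= 1 ==> (h1 has_real_derivative h2 x) (at x)"
  "!!x. 0 <= x ==> x <= 1 ==> (h2 has_real_derivative h3 x) (at x)" and K: "!!x. 0 <= x ==> x <= 1 ==> abs (h3 x) <= K"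
 shows "abs (h 1 - h 0 - h1 0 - h2 0 / 2) <= K"
proof -
 let ?d = "%m::nat. if m = 0 then h else if m = 1 then h1 else if m = 2 then h2 else h3"
 have "EX t>0. t < 1 & h 1 = (\<Sum>m<3. ?d m 0 / fact m * 1 ^ m) + ?d 3 t / fact 3 * 1 ^ 3"
 proof (rule Maclaurin[where diff="?d"])
  show "ALL m t. m < 3 & 0 <= t & t <= 1 --> (?d m has_real_derivative ?d (Suc m) t) (at t)"
   using assms(1-3) by (auto simp: less_Suc_eq numeral_3_eq_3)
 qed auto
 then obtain t where t: "0 < t" "t < 1" "h 1 = (\<Sum>m<3. ?d m 0 / fact m * 1 ^ m) + ?d 3 t / fact 3 * 1 ^ 3" by blast
 have "h 1 - h 0 - h1 0 - h2 0 / 2 = h3 t / 6" using t(3) by (simp add: numeral_3_eq_3 fact_numeral eval_nat_numeral)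
 thus ?thesis using K[of t] t(1,2) by simp
qed

lemma taylor2:
 fixes h :: "real => real"
 assumes D: "!!x. 0 <= x ==> x <= 1 ==> (h has_real_derivative h1 x) (at x)" "!!x. 0 <= x ==> x <= 1 ==> (h1 has_real_derivative h2 x) (at x)"
  and K: "!!x. 0 <= x ==> x <= 1 ==> abs (h2 x) <= K"
 shows "abs (h 1 - h 0 - h1 0) <= K"
proof -
 obtain z where z: "0 < z" "z < 1" "h 1 - h 0 = (1 - 0) * h1 z" using MVT2[of 0 1 h h1] D(1) by auto
 obtain u where u: "0 < u" "u < z" "h1 z - h1 0 = (z - 0) * h2 u" using MVT2[of 0 z h1 h2] D(2) z by auto
 have "abs (z * h2 u) <= 1 * K" unfolding abs_mult using z u K[of u] by (intro mult_mono) auto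
 thus ?thesis using z(3) u(3) by simp
qed

lemma entry_norm:
 fixes Q :: "real^'n::finite^'n" and c :: real
 assumes "!!i j. abs (Q $ i $ j) <= c"
 shows "norm Q <= CARD('n) * (CARD('n) * c)"
proof -
 have 2: "norm (Q $ i) <= CARD('n) * c" for i
  by (rule order.trans[OF norm_le_l1_cart]) (rule sum_bounded_above[OF assms])
 have "L2_set (%i. norm (Q $ i)) UNIV <= CARD('n) * (CARD('n) * c)"
  by (rule order.trans[OF L2_set_le_sum]) (rule norm_ge_zero, rule sum_bounded_above[OF 2])
 thus ?thesis by (simp add: norm_vec_def)
qed

lemma cube_exp: "0 <= x ==> 0 < c ==> (1 + x) ^ 3 * exp (- (c * x)) <= 27 / c ^ 3 * exp c" for x c :: real
proof -
 assume x: "0 <= x" "0 < c"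
 have "(c * (1 + x) / 3) ^ 3 <= exp (c * (1 + x) / 3) ^ 3" using x by (intro power_mono order.trans[OF _ exp_ge_add_one_self]) auto
 also have "... = exp (c * (1 + x))" by (simp add: exp_of_nat_mult[symmetric])
 finally have "c ^ 3 * (1 + x) ^ 3 <= 27 * exp (c * (1 + x))" by (simp only: power_divide power_mult_distrib) simp
 also have "exp (c * (1 + x)) = exp c * exp (c * x)" by (simp add: distrib_left exp_add)
 finally have 1: "c ^ 3 * (1 + x) ^ 3 <= 27 * (exp c * exp (c * x))" .
 have "y * exp (- (c * x)) <= 27 / c ^ 3 * exp c" if "c ^ 3 * y <= 27 * (exp c * exp (c * x))" for y
  using x that by (simp add: exp_minus field_simps)
 from this[OF 1] show ?thesis .
qed

locale spd =
 fixes N :: "real^'n::finite^'n" and c n :: real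
 assumes sym: "u \<bullet> (N *v v) = v \<bullet> (N *v u)" and lower: "c * (norm u)^2 <= u \<bullet> (N *v u)" and upper: "norm (N *v u) <= n * norm u"
  and c: "0 < c" and n: "0 < n"
begin

lemma qN: "abs (u \<bullet> (N *v v)) <= n * (norm u * norm v)"
 using Cauchy_Schwarz_ineq2[of u "N *v v"] mult_left_mono[OF upper[of v] norm_ge_zero[of u]] by (simp add: mult_ac)

lemma Q_nonneg: "0 <= u \<bullet> (N *v u)" using lower[of u] c by (meson less_imp_le mult_nonneg_nonneg order.trans zero_le_power2)

text \<open>All remainders below are the kernel times a factor growing at most like the third power
  of 1 + |w|^2; Gaussian decay absorbs it uniformly for \<open>ta\<close> in [e, 1].\<close>

lemma qk_cube:
 assumes e: "0 < e" "e <= ta" "ta <= 1"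
 shows "qk N ta w * (1 + (norm w)^2) ^ 3 <= exp (- (CARD('n) / 2 * ln e)) * (27 / (c / 2) ^ 3 * exp (c / 2))"
proof -
 have "c / 2 * (norm w)^2 <= w \<bullet> (N *v w) / (2 * ta)"
 proof -
  have "c / 2 * (norm w)^2 <= (w \<bullet> (N *v w)) / 2" using lower[of w] by simp
  also have "... <= w \<bullet> (N *v w) / (2 * ta)" using e Q_nonneg[of w] by (intro divide_left_mono) auto
  finally show ?thesis .
 qed
 have "qk N ta w <= exp (- (CARD('n) / 2 * ln e)) * exp (- (c / 2 * (norm w)^2))"
 proof -
  have "CARD('n) / 2 * ln e <= CARD('n) / 2 * ln ta" using e by (intro mult_left_mono) auto
  with \<open>c / 2 * (norm w)^2 <= w \<bullet> (N *v w) / (2 * ta)\<close> show ?thesis unfolding qk_def exp_add[symmetric] exp_le_cancel_iff by linarith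
 qed
 hence "qk N ta w * (1 + (norm w)^2) ^ 3 <= (exp (- (CARD('n) / 2 * ln e)) * exp (- (c / 2 * (norm w)^2))) * (1 + (norm w)^2) ^ 3"
  by (intro mult_right_mono) auto
 also have "... = exp (- (CARD('n) / 2 * ln e)) * ((1 + (norm w)^2) ^ 3 * exp (- (c / 2 * (norm w)^2)))" by simp
 also have "... <= exp (- (CARD('n) / 2 * ln e)) * (27 / (c / 2) ^ 3 * exp (c / 2))"
  using c by (intro mult_left_mono cube_exp) auto
 finally show ?thesis .
qed

text \<open>The constants may blow up as \<open>e\<close> tends to 0. This is harmless: they are fed
  only into Dynkin's formula on an interval where the remaining time is at least \<open>e\<close>,
  and there they leave no trace.\<close>

lemma qk_taylor:
 assumes e: "0 < e" "e <= 1"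
 shows "EX K>=0. ALL ta d. 0 < d --> e <= ta - d --> ta <= 1 -->
  taylor_le K d (%z. qk N ta (z - y)) (%z. qk N (ta - d) (z - y)) (%z. pk N ta (z - y)) (%z. gk N ta (z - y)) (%z. Hk N ta (z - y))" (is ?A)
  and "EX K>=0. ALL ta w. e <= ta --> ta <= 1 --> abs (qk N ta w) <= K & abs (pk N ta w) <= K & norm (gk N ta w) <= K & norm (Hk N ta w) <= K" (is ?B)
proof -
 define D :: real where "D = CARD('n)"
 define Kq where "Kq = exp (- (D / 2 * ln e)) * (27 / (c / 2) ^ 3 * exp (c / 2))"
 \<comment> \<open>Dominates each of the numerators that occur, together with up to three factors 1
   / ta, since \<open>ta >= e\<close>.\<close>
 define k where "k = (D + n + D * (D * n) + 1) * (1 / e) ^ 3"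
 define iv :: "real => real" where "iv ta = 1 / ta" for ta
 define X where "X w = 1 + (norm w)^2" for w :: "real^'n"
 define m1 where "m1 ta w = w \<bullet> (N *v w) * (iv ta)^2 / 2 - D * iv ta / 2" for ta w
 have D: "1 <= D" "0 <= D * (D * n)" using n by (auto simp: D_def Suc_le_eq)
 have Kq0: "0 <= Kq" using c by (simp add: Kq_def)
 have X: "1 <= X w" "norm w <= X w" "(norm w)^2 <= X w" "0 <= X w" for w
 proof -
  show "1 <= X w" "(norm w)^2 <= X w" "0 <= X w" by (auto simp: X_def)
  have "0 <= (norm w - 1)^2" by simp
  hence "2 * norm w <= X w" by (simp add: X_def power2_diff)
  thus "norm w <= X w" using norm_ge_zero[of w] by linarith
 qed
 have q0: "0 <= qk N ta w" for ta w by (simp add: qk_def)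
 have qT: "abs (qk N ta w * T) <= C * Kq" if t: "e <= ta" "ta <= 1" and T: "abs T <= C * X w ^ j" "j <= 3" "0 <= C" for ta w T C and j :: nat
 proof -
  have "abs T <= C * X w ^ 3" using T(1) mult_left_mono[OF power_increasing[OF T(2) X(1)] T(3)] by (rule order.trans)
  hence "abs (qk N ta w * T) <= qk N ta w * (C * X w ^ 3)" unfolding abs_mult using q0 by (intro mult_mono) auto
  also have "... = C * (qk N ta w * X w ^ 3)" by simp
  also have "... <= C * Kq" using qk_cube[OF e(1) t, of w] T(3) by (intro mult_left_mono) (auto simp: Kq_def D_def X_def)
  finally show ?thesis .
 qed
 have kr: "0 <= k" "abs (x * iv ta ^ j) <= k * z" if "e <= ta" "abs x <= C * z" "C <= D + n + D * (D * n) + 1" "0 <= z" "j <= 3" for x ta C z and j :: nat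
 proof -
  have m: "iv ta <= 1 / e" "1 <= 1 / e" "0 <= iv ta" using that(1) e by (auto simp: iv_def frac_le)
  have "iv ta ^ j <= (1 / e) ^ j" using m by (intro power_mono) auto
  also have "... <= (1 / e) ^ 3" using m that(5) by (intro power_increasing) auto
  finally have p: "iv ta ^ j <= (1 / e) ^ 3" .
  show "0 <= k" unfolding k_def using D n e by simp
  have "abs x <= (D + n + D * (D * n) + 1) * z" using that(2) mult_right_mono[OF that(3,4)] by (rule order.trans)
  hence "abs x * iv ta ^ j <= ((D + n + D * (D * n) + 1) * z) * (1 / e) ^ 3" using p m that(4) D n by (intro mult_mono) auto
  thus "abs (x * iv ta ^ j) <= k * z" using m(3) by (simp add: k_def abs_mult power_abs mult_ac)
 qed
 have k: "1 <= k"
 proof -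
  have "1 * 1 <= (D + n + D * (D * n) + 1) * (1 / e) ^ 3" using D n e by (intro mult_mono one_le_power) auto
  thus ?thesis by (simp add: k_def)
 qed
 hence k0: "0 <= k" by simp
 have nD: "n <= D + n + D * (D * n) + 1" "D <= D + n + D * (D * n) + 1" "D * (D * n) <= D + n + D * (D * n) + 1" using D n by auto
 have Nw: "abs (w \<bullet> (N *v v) * iv ta ^ j) <= k * (X w * norm v)" if "e <= ta" "j <= 3" for w v ta and j :: nat
 proof (rule kr(2)[OF that(1) _ nD(1) _ that(2)])
  have "n * (norm w * norm v) <= n * (X w * norm v)" using X n by (intro mult_left_mono mult_right_mono) auto
  thus "abs (w \<bullet> (N *v v)) <= n * (X w * norm v)" using qN[of w v] by linarith
 qed (use X in auto)
 have Nv: "abs (v \<bullet> (N *v v) * iv ta) <= k * (norm v)^2" if "e <= ta" for v ta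
  using kr(2)[OF that, of "v \<bullet> (N *v v)" n "(norm v)^2" 1] qN[of v v] nD(1) by (simp add: power2_eq_square)
 have NX: "abs (w \<bullet> (N *v w) * iv ta ^ j) <= k * X w" if "e <= ta" "j <= 3" for w ta and j :: nat
 proof (rule kr(2)[OF that(1) _ nD(1) X(4) that(2)])
  show "abs (w \<bullet> (N *v w)) <= n * X w" using qN[of w w] mult_left_mono[OF X(3)[of w] less_imp_le[OF n]] by (simp add: power2_eq_square)
 qed
 have DX: "abs (D * iv ta ^ j) <= k * X w" if "e <= ta" "j <= 3" for w ta and j :: nat
  by (rule kr(2)[OF that(1) _ nD(2) X(4) that(2)]) (use D X(1)[of w] in simp)
 have m1b: "abs (m1 ta w) <= k * X w" if "e <= ta" for ta w using NX[OF that, of 2 w] DX[OF that, of 1 w] unfolding m1_def by (auto simp: abs_le_iff)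
 have qk: "qk N ta w = exp (- (D / 2 * ln ta) - w \<bullet> (N *v w) * iv ta / 2)" for ta w by (simp add: qk_def D_def iv_def mult.commute)
 have pk: "pk N ta w = - (qk N ta w * m1 ta w)" for ta w by (simp add: pk_def m1_def iv_def D_def power_one_over field_simps)
 have gk: "gk N ta w \<bullet> v = qk N ta w * - (w \<bullet> (N *v v) * iv ta)" for ta w v
  using sym[of w v] by (simp add: gk_def iv_def inner_commute)
 have Hk: "v \<bullet> (Hk N ta w *v v) = qk N ta w * ((w \<bullet> (N *v v) * iv ta)^2 + - (v \<bullet> (N *v v) * iv ta))" for ta w v
  using sym[of w v] by (simp add: Hk_def iv_def matrix_vector_mult_diff_rdistrib scaleR_matrix_vector_assoc[symmetric] outer_apply inner_diff_right inner_commute power2_eq_square algebra_simps)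
 define K where "K = 4 * (k ^ 3 + 3 * k^2 + 2 * k + 1) * Kq"
 have k23: "k <= k^2" "0 <= k^2" "0 <= k ^ 3" using k mult_left_mono[of 1 k k] by (auto simp: power2_eq_square)
 have K: "C * Kq <= K" if "C <= 4 * (k ^ 3 + 3 * k^2 + 2 * k + 1)" for C unfolding K_def using that Kq0 by (rule mult_right_mono)
 have K0: "0 <= K" using K[of 0] k k23 by simp
 have bounds: "abs (qk N ta w) <= Kq" "abs (pk N ta w) <= k * Kq" "norm (gk N ta w) <= k * Kq" "norm (Hk N ta w) <= (k^2 + k) * Kq" if t: "e <= ta" "ta <= 1" for ta w
 proof -
  have tp: "0 < ta" using t e by simp
  show "abs (qk N ta w) <= Kq" using qT[OF t, where T=1 and C=1 and j=0 and w=w] by simp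
  show "abs (pk N ta w) <= k * Kq" unfolding pk abs_minus using m1b[OF t(1), of w] k0 by (intro qT[OF t, where j=1]) auto
  have a: "abs (norm (N *v w) * iv ta ^ 1) <= k * X w"
   by (rule kr(2)[OF t(1) _ nD(1) X(4)]) (use upper[of w] mult_left_mono[OF X(2)[of w] less_imp_le[OF n]] in auto)
  have "norm (gk N ta w) = abs (qk N ta w * (norm (N *v w) * iv ta ^ 1))" using tp by (simp add: gk_def iv_def abs_mult)
  also have "... <= k * Kq" using a k0 by (intro qT[OF t, where j=1]) auto
  finally show "norm (gk N ta w) <= k * Kq" .
  have "norm N <= D * (D * n)" unfolding D_def
  proof (rule entry_norm)
   fix i j
   have "N $ i $ j = (N *v axis j 1) $ i" by (simp add: matrix_vector_mult_basis column_def)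
   thus "abs (N $ i $ j) <= n" using component_le_norm_cart[of "N *v axis j 1" i] upper[of "axis j 1"] by simp
  qed
  hence b: "abs (norm N * iv ta ^ 1) <= k * 1" by (intro kr(2)[OF t(1) _ nD(3)]) auto
  have "norm (Hk N ta w) <= qk N ta w * (norm ((1 / ta^2) *R outer (N *v w)) + norm ((1 / ta) *R N))"
   unfolding Hk_def norm_scaleR[of "qk N ta w"] using q0 by (simp only: abs_of_nonneg, intro mult_left_mono norm_triangle_ineq4) auto
  also have "norm ((1 / ta^2) *R outer (N *v w)) = (norm (N *v w) * iv ta ^ 1)^2" by (simp add: norm_outer iv_def power_divide)
  also have "norm ((1 / ta) *R N) = norm N * iv ta ^ 1" using tp by (simp add: iv_def)
  also have "qk N ta w * ((norm (N *v w) * iv ta ^ 1)^2 + norm N * iv ta ^ 1) <= (k^2 + k) * Kq"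
  proof (rule order.trans[OF abs_ge_self qT[OF t, where j=2]])
   have "(norm (N *v w) * iv ta ^ 1)^2 <= (k * X w)^2" using power_mono[OF a, of 2] by (simp add: power_mult_distrib)
   moreover have "norm N * iv ta ^ 1 <= k * (X w)^2" using b one_le_power[OF X(1)[of w], of 2] k0 mult_left_mono[of 1 "(X w)^2" k] by (simp add: abs_le_iff)
   ultimately show "abs ((norm (N *v w) * iv ta ^ 1)^2 + norm N * iv ta ^ 1) <= (k^2 + k) * X w ^ 2"
    using tp by (subst abs_of_nonneg) (auto simp: power_mult_distrib distrib_right iv_def)
  qed (use k23 k0 in auto)
  finally show "norm (Hk N ta w) <= (k^2 + k) * Kq" .
 qed
 have b4: "Kq <= K" "k * Kq <= K" "(k^2 + k) * Kq <= K" using K[of 1] K[of k] K[of "k^2 + k"] k k23 by auto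
 show ?B
  using bounds b4 K0 by (intro exI[of _ K]) (meson order.trans)
 \<comment> \<open>Three pieces: the time step at the new point, the change of \<open>pk\<close>
   between the two points, and the spatial remainder \<open>R\<close> at fixed time. They account
   for d^2, d |v| and the minimum, in this order.\<close>
 have "taylor_le (6 * K) d (%z. qk N ta (z - y)) (%z. qk N (ta - d) (z - y)) (%z. pk N ta (z - y)) (%z. gk N ta (z - y)) (%z. Hk N ta (z - y))"
  if d: "0 < d" "e <= ta - d" and t: "ta <= 1" for ta d
  unfolding taylor_le_def
 proof (intro allI)
  fix x z :: "real^'n"
  define w v where "w = x - y" and "v = z - x"
  have zy: "z - y = w + v" "x - y = w" by (auto simp: w_def v_def)
  define l where "l te = (w + te *R v) \<bullet> (N *v v)" for te
  define Q where "Q te = (w + te *R v) \<bullet> (N *v (w + te *R v))" for te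
  define ga where "ga = v \<bullet> (N *v v)"
  define h where "h te = qk N ta (w + te *R v)" for te
  define R where "R = qk N ta (w + v) - qk N ta w - gk N ta w \<bullet> v - v \<bullet> (Hk N ta w *v v) / 2"
  have et: "e <= ta" "0 < ta" using d e by auto
  have dl: "(l has_real_derivative ga) (at te)" for te unfolding l_def[abs_def] by (auto intro!: derivative_eq_intros simp: inner_add_left ga_def)
  have dQ: "(Q has_real_derivative 2 * l te) (at te)" for te
  proof -
   have "Q = (%te. w \<bullet> (N *v w) + 2 * te * (w \<bullet> (N *v v)) + te^2 * ga)"
    unfolding Q_def[abs_def] ga_def using sym[of v w] by (simp add: matrix_vector_right_distrib matrix_vector_mult_scaleR inner_add_left inner_add_right power2_eq_square algebra_simps)
   thus ?thesis by (auto intro!: derivative_eq_intros simp: l_def ga_def inner_add_left algebra_simps)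
  qed
  have h: "h = (%te. exp (- (D / 2 * ln ta) - Q te * iv ta / 2))" by (simp add: h_def[abs_def] qk Q_def)
  have dh: "(h has_real_derivative h te * - (l te * iv ta)) (at te)" for te unfolding h by (auto intro!: derivative_eq_intros dQ)
  have lb: "abs (l te * iv ta ^ j) <= k * (X (w + te *R v) * norm v)" if "j <= 3" for te and j :: nat unfolding l_def by (rule Nw[OF et(1) that])
  have hT: "abs (h te * T) <= C * Kq" if "abs T <= C * X (w + te *R v) ^ j" "j <= 3" "0 <= C" for te T C and j :: nat
   unfolding h_def by (rule qT[OF et(1) t that])
  have time: "abs (qk N (ta - d) u - qk N ta u - d * pk N ta u) <= K * d^2" for u
  proof -
   define s where "s te = ta - te * d" for te
   have s: "e <= s te" "s te <= 1" "0 < s te" if "0 <= te" "te <= 1" for te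
    using mult_right_mono[OF that(2) less_imp_le[OF d(1)]] mult_nonneg_nonneg[OF that(1) less_imp_le[OF d(1)]] d t e unfolding s_def mult_1 by linarith+
   define m2 where "m2 te = D * (iv (s te))^2 / 2 - u \<bullet> (N *v u) * iv (s te) ^ 3" for te
   have ds: "(s has_real_derivative - d) (at te)" for te unfolding s_def[abs_def] by (auto intro!: derivative_eq_intros)
   have dr: "((%te. iv (s te)) has_real_derivative d * (iv (s te))^2) (at te)" if "0 <= te" "te <= 1" for te
    using DERIV_inverse'[OF ds, of te] s(3)[OF that] by (simp add: iv_def inverse_eq_divide power2_eq_square)
   have dn: "((%te. ln (s te)) has_real_derivative - d * iv (s te)) (at te)" if "0 <= te" "te <= 1" for te
    using DERIV_chain2[OF DERIV_ln[OF s(3)[OF that]] ds] by (simp add: iv_def inverse_eq_divide)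
   have df: "((%te. qk N (s te) u) has_real_derivative - d * (qk N (s te) u * m1 (s te) u)) (at te)" if "0 <= te" "te <= 1" for te

   proof -
    have "((%te. - (D / 2 * ln (s te)) - u \<bullet> (N *v u) * iv (s te) / 2) has_real_derivative - (D / 2 * (- d * iv (s te))) - u \<bullet> (N *v u) * (d * (iv (s te))^2) / 2) (at te)"
     by (intro DERIV_diff DERIV_minus DERIV_cmult DERIV_cdivide dn dr that)
    from DERIV_chain2[OF DERIV_exp this] show ?thesis unfolding qk by (rule DERIV_cong) (simp add: m1_def algebra_simps)
   qed
   have dm: "((%te. m1 (s te) u) has_real_derivative - d * m2 te) (at te)" if "0 <= te" "te <= 1" for te
    unfolding m1_def by (auto intro!: derivative_eq_intros dr[OF that] simp: m2_def power2_eq_square power3_eq_cube algebra_simps add_divide_distrib)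
   have "abs (qk N (s 1) u - qk N (s 0) u - - d * (qk N (s 0) u * m1 (s 0) u)) <= K * d^2"
   proof (rule taylor2[where ?h2.0="%te. d^2 * (qk N (s te) u * ((m1 (s te) u)^2 + m2 te))"])
    fix te :: real assume te: "0 <= te" "te <= 1"
    show "((%te. qk N (s te) u) has_real_derivative - d * (qk N (s te) u * m1 (s te) u)) (at te)" by (rule df[OF te])
    show "((%te. - d * (qk N (s te) u * m1 (s te) u)) has_real_derivative d^2 * (qk N (s te) u * ((m1 (s te) u)^2 + m2 te))) (at te)"
     by (auto intro!: derivative_eq_intros df[OF te] dm[OF te] simp: power2_eq_square algebra_simps)
    have "abs (m2 te) <= 2 * k * X u ^ 2"
    proof -
     have "abs (m2 te) <= 2 * (k * X u)" using NX[OF s(1)[OF te], of 3 u] DX[OF s(1)[OF te], of 2 u] unfolding m2_def by simp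
     also have "... <= 2 * (k * X u ^ 2)" using X(1,4)[of u] k0 mult_left_mono[of 1 "X u" "X u"] by (intro mult_left_mono) (auto simp: power2_eq_square)
     finally show ?thesis by simp
    qed
    moreover have "(m1 (s te) u)^2 <= k^2 * X u ^ 2" using power_mono[OF m1b[OF s(1)[OF te], of u], of 2] by (simp add: power_mult_distrib)
    ultimately have "abs ((m1 (s te) u)^2 + m2 te) <= (k^2 + 2 * k) * X u ^ 2" using zero_le_power2[of "m1 (s te) u"] unfolding distrib_right by linarith
    from qT[OF s(1,2)[OF te] this] have "abs (qk N (s te) u * ((m1 (s te) u)^2 + m2 te)) <= K" using K[of "k^2 + 2 * k"] k0 k23 by simp
    thus "abs (d^2 * (qk N (s te) u * ((m1 (s te) u)^2 + m2 te))) <= K * d^2"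
     using mult_left_mono[OF _ zero_le_power2[of d]] by (simp only: abs_mult[of "d^2"] abs_power2 mult.commute[of K])
   qed
   thus ?thesis by (simp add: s_def pk)
  qed
  have lip: "abs (pk N ta (w + v) - pk N ta w) <= K * norm v"
  proof -
   define f where "f te = - (h te * (Q te * (iv ta)^2 / 2 - D * iv ta / 2))" for te
   have mQ: "m1 ta (w + te *R v) = Q te * (iv ta)^2 / 2 - D * iv ta / 2" for te by (simp add: m1_def Q_def)
   have f: "f te = pk N ta (w + te *R v)" for te by (simp add: f_def pk mQ h_def)
   have df: "(f has_real_derivative h te * (l te * iv ta ^ 1 * m1 ta (w + te *R v) - l te * iv ta ^ 2)) (at te)" for te
    unfolding f_def[abs_def] mQ by (auto intro!: derivative_eq_intros dh dQ simp: power2_eq_square algebra_simps diff_divide_distrib)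
   obtain te where te: "f 1 - f 0 = (1 - 0) * (h te * (l te * iv ta ^ 1 * m1 ta (w + te *R v) - l te * iv ta ^ 2))" using MVT2[of 0 1 f, OF zero_less_one df] by blast
   let ?X = "X (w + te *R v)"
   have "abs (l te * iv ta ^ 1) * abs (m1 ta (w + te *R v)) <= (k * (?X * norm v)) * (k * ?X)" by (intro mult_mono lb m1b et) (use k0 X(4) in auto)
   moreover have "k * (?X * norm v) <= (k * (?X * norm v)) * ?X" using mult_left_mono[OF X(1), of "k * (?X * norm v)" "w + te *R v"] k0 X(4)[of "w + te *R v"] by simp
   ultimately have "abs (l te * iv ta ^ 1 * m1 ta (w + te *R v) - l te * iv ta ^ 2) <= (k * (?X * norm v)) * (k * ?X) + (k * (?X * norm v)) * ?X"
    using lb[of 2 te] abs_triangle_ineq4[of "l te * iv ta ^ 1 * m1 ta (w + te *R v)" "l te * iv ta ^ 2"] unfolding abs_mult[of "l te * iv ta ^ 1"] by linarith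
   also have "... = ((k^2 + k) * norm v) * ?X ^ 2" by (simp add: power2_eq_square algebra_simps)
   finally have "abs (f 1 - f 0) <= (k^2 + k) * norm v * Kq" unfolding te using k0 k23 by (simp only: diff_zero mult_1) (intro hT[where j=2], auto)
   also have "... <= K * norm v" using mult_right_mono[OF b4(3) norm_ge_zero[of v]] by (simp add: mult_ac)
   finally show ?thesis by (simp add: f)
  qed
  have R3: "abs R <= K * norm v ^ 3"
  proof -
   let ?a = "%te. l te * iv ta" and ?g = "ga * iv ta"
   have "abs (h 1 - h 0 - h 0 * - ?a 0 - h 0 * ((?a 0)^2 - ?g) / 2) <= K * norm v ^ 3"
   proof (rule taylor3[OF dh, where ?h2.0="%te. h te * ((?a te)^2 - ?g)" and ?h3.0="%te. h te * (- (?a te ^ 3) + 3 * (?a te * ?g))"])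
    fix te :: real
    show "((%te. h te * - ?a te) has_real_derivative h te * ((?a te)^2 - ?g)) (at te)"
     by (auto intro!: derivative_eq_intros dh dl simp: power2_eq_square algebra_simps)
    show "((%te. h te * ((?a te)^2 - ?g)) has_real_derivative h te * (- (?a te ^ 3) + 3 * (?a te * ?g))) (at te)"
     by (auto intro!: derivative_eq_intros dh dl simp: power2_eq_square power3_eq_cube algebra_simps)
    let ?X = "X (w + te *R v)"
    have a: "abs (?a te) <= k * (?X * norm v)" using lb[of 1 te] by simp
    have g: "abs (?g) <= k * (norm v)^2" unfolding ga_def by (rule Nv[OF et(1)])
    have "abs (?a te ^ 3) <= (k * (?X * norm v)) ^ 3" unfolding power_abs by (intro power_mono a) simp
    moreover have "abs (?a te) * abs (?g) <= (k * (?X * norm v)) * (k * (norm v)^2)" by (intro mult_mono a g) (use k0 X(4) in auto)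
    moreover have "(k * (?X * norm v)) * (k * (norm v)^2) <= k^2 * norm v ^ 3 * ?X ^ 3"
     using mult_left_mono[OF power_increasing[of 1 3 ?X] , of "k^2 * norm v ^ 3"] X(1)[of "w + te *R v"] mult_nonneg_nonneg[OF k23(2), of "norm v ^ 3"] by (simp add: power2_eq_square power3_eq_cube mult_ac)
    ultimately have "abs (- (?a te ^ 3) + 3 * (?a te * ?g)) <= (k * (?X * norm v)) ^ 3 + 3 * (k^2 * norm v ^ 3 * ?X ^ 3)"
     using abs_triangle_ineq[of "- (?a te ^ 3)" "3 * (?a te * ?g)"] unfolding abs_mult[of 3] abs_mult[of "?a te" ?g] by simp
    also have "... = ((k ^ 3 + 3 * k^2) * norm v ^ 3) * ?X ^ 3" by (simp add: power_mult_distrib algebra_simps)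
    finally have "abs (h te * (- (?a te ^ 3) + 3 * (?a te * ?g))) <= (k ^ 3 + 3 * k^2) * norm v ^ 3 * Kq" using k23 by (intro hT[where j=3]) auto
    also have "... <= K * norm v ^ 3" using mult_right_mono[OF K[of "k ^ 3 + 3 * k^2"], of "norm v ^ 3"] k23 k0 by (simp add: mult_ac)
    finally show "abs (h te * (- (?a te ^ 3) + 3 * (?a te * ?g))) <= K * norm v ^ 3" .
   qed
   thus ?thesis by (simp add: R_def gk Hk h_def l_def ga_def)
  qed
  have "abs R <= 4 * K * min ((norm v)^2) (norm v ^ 3)"
  proof (cases "norm v <= 1")
   case True
   have "norm v ^ 3 <= (norm v)^2" using True by (intro power_decreasing) auto
   moreover have "0 <= K * norm v ^ 3" using K0 by simp
   ultimately show ?thesis using R3 by (simp add: min_absorb2)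
  next
   case False
   \<comment> \<open>Far away no cancellation is used: each of the four terms of \<open>R\<close> is
     at most a multiple of |v|^2, because |v| exceeds 1.\<close>
   hence v: "1 <= (norm v)^2" "norm v <= (norm v)^2" "(norm v)^2 <= norm v ^ 3" by (auto simp: one_le_power power_increasing self_le_power)
   have "abs (gk N ta w \<bullet> v) <= K * (norm v)^2"
    using order.trans[OF Cauchy_Schwarz_ineq2 mult_mono[OF order.trans[OF bounds(3)[OF et(1) t] b4(2)] v(2)]] K0 by simp
   moreover have "abs (v \<bullet> (Hk N ta w *v v)) <= K * (norm v)^2"
   proof -
    have "abs (v \<bullet> (Hk N ta w *v v)) <= norm v * (norm (Hk N ta w) * norm v)"
     by (rule order.trans[OF Cauchy_Schwarz_ineq2]) (intro mult_left_mono norm_matrix_vector norm_ge_zero)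
    also have "... <= norm v * (K * norm v)" using order.trans[OF bounds(4)[OF et(1) t] b4(3)] by (intro mult_left_mono mult_right_mono) auto
    finally show ?thesis by (simp add: power2_eq_square mult_ac)
   qed
   moreover have "abs (qk N ta u) <= K * (norm v)^2" for u
    using order.trans[OF bounds(1)[OF et(1) t] b4(1)] mult_left_mono[OF v(1) K0] unfolding mult_1_right by (rule order.trans)
   note this[of "w + v"] this[of w]
   ultimately have "abs R <= 4 * (K * (norm v)^2)" unfolding R_def by linarith
   thus ?thesis using v by (simp add: min_absorb1)
  qed
  moreover have "abs (d * (pk N ta (w + v) - pk N ta w)) <= K * (d * norm v)" using mult_left_mono[OF lip, of d] d by (simp add: abs_mult mult_ac)
  moreover have "qk N (ta - d) (z - y) - qk N ta (x - y) - d * pk N ta (x - y) - gk N ta (x - y) \<bullet> (z - x) - (z - x) \<bullet> (Hk N ta (x - y) *v (z - x)) / 2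
   = (qk N (ta - d) (w + v) - qk N ta (w + v) - d * pk N ta (w + v)) + d * (pk N ta (w + v) - pk N ta w) + R"
   unfolding R_def zy v_def[symmetric] by (simp add: algebra_simps)
  moreover have "0 <= K * min ((norm v)^2) (norm v ^ 3)" "0 <= K * (d * norm v)" "0 <= K * d^2" using K0 d by auto
  ultimately show "abs (qk N (ta - d) (z - y) - qk N ta (x - y) - d * pk N ta (x - y) - gk N ta (x - y) \<bullet> (z - x) - (z - x) \<bullet> (Hk N ta (x - y) *v (z - x)) / 2)
   <= 6 * K * (min ((norm (z - x))^2) (norm (z - x) ^ 3) + d * norm (z - x) + d^2)"
   using time[of "w + v"] unfolding v_def[symmetric] distrib_left by linarith
 qed
 thus ?A
  using K0 by (intro exI[of _ "6 * K"]) auto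
qed

end

lemma gauss_eq: "0 < si ==> gauss si w = exp (- (CARD('n) / 2 * ln (2 * pi * si^2)) - (norm w)^2 / (2 * si^2))" for w :: "real^'n::finite"
proof -
 assume s: "0 < si"
 have p: "0 < 2 * pi * si^2" using s by simp
 have "normal_density 0 si x = exp (- (ln (2 * pi * si^2) / 2)) * exp (- (x^2 / (2 * si^2)))" for x
 proof -
  have "1 / sqrt (2 * pi * si^2) = exp (- (ln (2 * pi * si^2) / 2))"
   using p by (simp add: ln_sqrt[symmetric] exp_minus inverse_eq_divide)
  thus ?thesis by (simp add: normal_density_def)
 qed
 hence "gauss si w = exp (- (ln (2 * pi * si^2) / 2)) ^ CARD('n) * exp (SUM i:UNIV. - ((w $ i)^2 / (2 * si^2)))"
  by (simp add: gauss_def prod.distrib exp_sum)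
 also have "(SUM i:UNIV. - ((w $ i)^2 / (2 * si^2))) = - ((norm w)^2 / (2 * si^2))"
  unfolding power2_norm_eq_inner by (simp add: sum_negf sum_divide_distrib inner_vec_def power2_eq_square)
 also have "exp (- (ln (2 * pi * si^2) / 2)) ^ CARD('n) = exp (- (CARD('n) / 2 * ln (2 * pi * si^2)))"
  by (simp add: exp_of_nat_mult[symmetric])
 finally show ?thesis by (simp add: exp_add[symmetric])
qed

section \<open>The parametrix\<close>

locale elliptic_sde = sde_solution a b M W X A B L
 for a :: "real^'n::finite => real^'n^'n" and b :: "real^'n => real^'n"
  and M :: "'w measure" and W X :: "real => 'w => real^'n" and A B L :: real +
 fixes lam :: real
 assumes lam: "0 < lam" and elliptic: "lam * (norm u)^2 <= u \<bullet> ((a x ** transpose (a x)) *v u)"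
begin

definition S :: "real^'n => real^'n^'n" where "S x = a x ** transpose (a x)"

definition N :: "real^'n => real^'n^'n" where "N x = matrix_inv (S x)"

lemma S_form: "u \<bullet> (S x *v v) = (transpose (a x) *v u) \<bullet> (transpose (a x) *v v)"
 by (metis S_def dot_lmul_matrix inner_commute matrix_vector_mul_assoc transpose_matrix_vector transpose_transpose)

lemma S_entry: "S x $ i $ j = a x $ i \<bullet> a x $ j"
 by (simp add: S_def matrix_matrix_mult_def transpose_def inner_vec_def)

lemma row_bound: "norm (a x $ i) <= A"
 using Finite_Cartesian_Product.norm_nth_le[of "a x" i] a_bound[of x] by linarith

lemma row_lip: "norm (a x $ i - a y $ i) <= L * norm (x - y)"
 using Finite_Cartesian_Product.norm_nth_le[of "a x - a y" i] a_lip[of x y] by simp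

definition "d1 = real CARD('n)"
definition "LS = d1 * (d1 * (2 * A * L))"
definition "SB = d1 * (d1 * (A * A))"

lemma d1: "1 <= d1" unfolding d1_def by (simp add: Suc_le_eq)

lemma S_lip: "norm (S x - S y) <= LS * norm (x - y)"
proof -
 have "abs ((S x - S y) $ i $ j) <= 2 * A * L * norm (x - y)" for i j
 proof -
  have "(S x - S y) $ i $ j = (a x $ i - a y $ i) \<bullet> a x $ j + a y $ i \<bullet> (a x $ j - a y $ j)"
   by (simp add: S_entry inner_diff_left inner_diff_right)
  moreover have "abs ((a x $ i - a y $ i) \<bullet> a x $ j) <= (L * norm (x - y)) * A"
   by (rule order.trans[OF Cauchy_Schwarz_ineq2]) (use row_lip row_bound pos in "intro mult_mono; simp")
  moreover have "abs (a y $ i \<bullet> (a x $ j - a y $ j)) <= A * (L * norm (x - y))"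
   by (rule order.trans[OF Cauchy_Schwarz_ineq2]) (use row_lip row_bound pos in "intro mult_mono; simp")
  ultimately show ?thesis by (simp add: abs_le_iff algebra_simps)
 qed
 thus ?thesis using entry_norm[of "S x - S y" "2 * A * L * norm (x - y)"] by (simp add: LS_def d1_def mult_ac)
qed

lemma S_bound: "norm (S x) <= SB"
proof -
 have "abs (S x $ i $ j) <= A * A" for i j
  unfolding S_entry by (rule order.trans[OF Cauchy_Schwarz_ineq2]) (use row_bound pos in "intro mult_mono; simp")
 thus ?thesis using entry_norm[of "S x" "A * A"] by (simp add: SB_def d1_def)
qed

lemma NS: "N x ** S x = mat 1" "S x ** N x = mat 1"
proof -
 have "u = 0" if "S x *v u = 0" for u
  using elliptic[of u x] that lam unfolding S_def[symmetric] by (simp add: mult_le_0_iff)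
 hence "inj ((*v) (S x))" using linear_injective_0[OF matrix_vector_mul_linear[of "S x"]] by blast
 then obtain B where "B ** S x = mat 1" using matrix_left_invertible_injective by blast
 hence "EX B. S x ** B = mat 1 & B ** S x = mat 1" using matrix_left_right_inverse by blast
 from someI_ex[OF this] show "N x ** S x = mat 1" "S x ** N x = mat 1" unfolding N_def matrix_inv_def by auto
qed

lemma NS_apply: "N x *v (S x *v u) = u" "S x *v (N x *v u) = u"
 by (simp_all add: matrix_vector_mul_assoc NS)

text \<open>With z = a^T N u one has u . N u = |z|^2 and u = a z, so the bound on \<open>a\<close>
  becomes the lower bound; ellipticity at the vector N u gives the upper one.\<close>

lemma spd_N: "spd (N y) (1 / A^2) (1 / lam)"
proof
 fix u v
 show "u \<bullet> (N y *v v) = v \<bullet> (N y *v u)"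
  using S_form[of "N y *v u" y "N y *v v"] S_form[of "N y *v v" y "N y *v u"] unfolding NS_apply by (metis inner_commute)
 show "1 / A^2 * (norm u)^2 <= u \<bullet> (N y *v u)"
 proof -
  let ?z = "transpose (a y) *v (N y *v u)"
  have 1: "u \<bullet> (N y *v u) = (norm ?z)^2"
   using S_form[of "N y *v u" y "N y *v u"] unfolding NS_apply power2_norm_eq_inner by (metis inner_commute)
  have "u = a y *v ?z" using NS_apply(2)[of y u] unfolding S_def by (simp add: matrix_vector_mul_assoc[symmetric])
  hence "norm u <= A * norm ?z" using norm_matrix_vector[of "a y" ?z] mult_right_mono[OF a_bound[of y] norm_ge_zero[of ?z]] by simp
  hence "(norm u)^2 <= A^2 * (norm ?z)^2" by (metis norm_ge_zero power_mono power_mult_distrib)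
  thus ?thesis unfolding 1 using pos by (simp add: field_simps)
 qed
 show "norm (N y *v u) <= 1 / lam * norm u"
 proof (cases "N y *v u = 0")
  case False
  have "lam * (norm (N y *v u))^2 <= (N y *v u) \<bullet> u"
   using elliptic[of "N y *v u" y] unfolding S_def[symmetric] NS_apply by simp
  also have "... <= norm (N y *v u) * norm u" by (rule norm_cauchy_schwarz)
  finally have "lam * norm (N y *v u) <= norm u" using False by (simp add: power2_eq_square)
  thus ?thesis using lam by (simp add: field_simps)
 qed (use lam in simp)
qed (use pos lam in auto)

text \<open>Resolvent identity: the difference of the inverses is \<open>N x\<close> times
  \<open>S y - S x\<close> times \<open>N y\<close>.\<close>

lemma N_diff: "norm (N x *v w - N y *v w) <= 1 / lam * (LS * norm (x - y) * (1 / lam * norm w))"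
proof -
 have "N x *v w - N y *v w = N x *v ((S y - S x) *v (N y *v w))"
  by (simp add: matrix_vector_mult_diff_rdistrib NS_apply matrix_vector_mult_diff_distrib)
 also have "norm ... <= 1 / lam * (norm ((S y - S x) *v (N y *v w)))" by (rule spd.upper[OF spd_N])
 also have "... <= 1 / lam * (LS * norm (x - y) * (1 / lam * norm w))"
 proof (rule mult_left_mono)
  have "norm ((S y - S x) *v (N y *v w)) <= norm (S y - S x) * norm (N y *v w)" by (rule norm_matrix_vector)
  also have "... <= (LS * norm (x - y)) * (1 / lam * norm w)"
   using S_lip[of y x] spd.upper[OF spd_N] order.trans[OF norm_ge_zero S_lip[of y x]] by (intro mult_mono) (auto simp: norm_minus_commute)
  finally show "norm ((S y - S x) *v (N y *v w)) <= LS * norm (x - y) * (1 / lam * norm w)" .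
 qed (use lam in simp)
 finally show ?thesis .
qed

lemma N_norm: "norm (N y) <= d1 * (d1 * (1 / lam))"
 unfolding d1_def
proof (rule entry_norm)
 fix i j
 have "N y $ i $ j = (N y *v axis j 1) $ i" by (simp add: matrix_vector_mult_basis column_def)
 thus "abs (N y $ i $ j) <= 1 / lam"
  using component_le_norm_cart[of "N y *v axis j 1" i] spd.upper[OF spd_N[of y], of "axis j 1"] by simp
qed

lemma N_inner_S: "N y \<bullet> S y = d1"
proof -
 have "N y \<bullet> S y = (SUM i:UNIV. (N y ** S y) $ i $ i)"
  unfolding inner_vec_def matrix_matrix_mult_def by (simp add: S_entry inner_commute)
 thus ?thesis by (simp add: NS mat_def d1_def)
qed

lemma N_continuous: "continuous_on UNIV (%y. N y *v w)"
proof (rule lipschitz_on_continuous_on)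
 show "(1 / lam * LS * (1 / lam * norm w))-lipschitz_on UNIV (%y. N y *v w)"
 proof (rule lipschitz_onI)
  fix x y
  show "dist (N x *v w) (N y *v w) <= 1 / lam * LS * (1 / lam * norm w) * dist x y"
   using N_diff[of x w y] by (simp add: dist_norm mult_ac)
 qed (use lam pos d1 in "auto simp: LS_def")
qed

definition G :: "real => real^'n => real" where "G ta w = gauss (sqrt (2 * A^2 * ta)) w"

definition "cq = exp (d1 / 2 * ln (4 * pi * A^2))"

lemma G_eq: "0 < ta ==> cq * G ta w = exp (- (d1 / 2 * ln ta) - (norm w)^2 / (4 * A^2 * ta))"
proof -
 assume t: "0 < ta"
 have s: "0 < sqrt (2 * A^2 * ta)" "(sqrt (2 * A^2 * ta))^2 = 2 * A^2 * ta" using t pos by auto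
 have "ln (2 * pi * (2 * A^2 * ta)) = ln (4 * pi * A^2) + ln ta" using t pos by (subst ln_mult_pos[symmetric]) (auto simp: mult_ac)
 thus ?thesis unfolding G_def gauss_eq[OF s(1)] s(2) cq_def d1_def[symmetric] exp_add[symmetric] by (simp add: field_simps)
qed

lemma cq_pos: "0 < cq" by (simp add: cq_def)

lemma qk_le:
 assumes t: "0 < ta"
 shows "qk (N y) ta w <= exp (- (d1 / 2 * ln ta) - (norm w)^2 / (2 * A^2 * ta))" (is ?A) "qk (N y) ta w <= cq * G ta w" (is ?B)
proof -
 have l: "1 / A^2 * (norm w)^2 <= w \<bullet> (N y *v w)" by (rule spd.lower[OF spd_N])
 have "(norm w)^2 / (2 * A^2 * ta) = (1 / A^2 * (norm w)^2) / (2 * ta)" by simp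
 also have "... <= w \<bullet> (N y *v w) / (2 * ta)" using l t by (intro divide_right_mono) auto
 finally show 1: ?A unfolding qk_def d1_def by simp
 have "(norm w)^2 / (4 * A^2 * ta) <= (norm w)^2 / (2 * A^2 * ta)" using t pos by (intro divide_left_mono) auto
 thus ?B unfolding G_eq[OF t] using 1 by (smt (verit) exp_le_cancel_iff)
qed

text \<open>Coefficients of the cubic polynomial in \<open>HK_bound\<close>, times the maximum of a
  cube against the spare Gaussian factor, times the normalisation \<open>cq\<close> of
  \<open>G\<close>.\<close>

definition "CH = (B / lam + LS * (1 / lam^2 + d1 * (d1 * (1 / lam)))) * (27 / (1 / (4 * A^2)) ^ 3 * exp (1 / (4 * A^2))) * cq"

lemma LS_nonneg: "0 <= LS" using d1 pos by (simp add: LS_def)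

lemma CH_nonneg: "0 <= CH" unfolding CH_def using d1 pos lam LS_nonneg cq_pos by (auto intro!: mult_nonneg_nonneg add_nonneg_nonneg)

definition HK :: "real => real^'n => real^'n => real" where
 "HK ta z y = gen (%z. pk (N y) ta (z - y)) (%z. gk (N y) ta (z - y)) (%z. Hk (N y) ta (z - y)) z"

text \<open>The kernel frozen at \<open>y\<close> solves the heat equation with covariance
  \<open>S y\<close>, so \<open>pk\<close> cancels against that Hessian term. Only the drift and the
  difference \<open>S z - S y\<close> remain, and the latter gains one factor |z - y|.\<close>

lemma HK_eq:
 assumes t: "0 < ta"
 shows "HK ta z y = gk (N y) ta (z - y) \<bullet> b z + Hk (N y) ta (z - y) \<bullet> (S z - S y) / 2"
proof -
 let ?w = "z - y"
 have "Hk (N y) ta ?w \<bullet> S y = qk (N y) ta ?w * (1 / ta^2 * (?w \<bullet> (N y *v ?w)) - 1 / ta * d1)"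
  unfolding Hk_def inner_scaleR_left inner_diff_left outer_inner NS_apply N_inner_S inner_commute[of "N y *v ?w" ?w] ..
 also have "... = - 2 * pk (N y) ta ?w" unfolding pk_def d1_def using t by (simp add: field_simps power2_eq_square)
 finally show ?thesis unfolding HK_def gen_def S_def[symmetric] by (simp add: inner_diff_right)
qed

text \<open>In the scaled variable r = |z - y| / sqrt ta both terms are 1 / sqrt ta times a
  polynomial of degree at most 3 in \<open>r\<close>. This is the singularity that is integrable in
  time.\<close>

lemma HK_bound:
 assumes t: "0 < ta" "ta <= 1"
 shows "abs (HK ta z y) <= CH / sqrt ta * G ta (z - y)"
proof -
 define w r q n where "w = z - y" and "r = norm w / sqrt ta" and "q = qk (N y) ta w" and "n = 1 / lam"
 have n: "0 < n" using lam by (simp add: n_def)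
 have st: "0 < sqrt ta" "sqrt ta * sqrt ta = ta" using t by auto
 have wr: "norm w = r * sqrt ta" using st by (simp add: r_def)
 have r0: "0 <= r" using t by (simp add: r_def)
 have q0: "0 <= q" by (simp add: q_def qk_def)
 have up: "norm (N y *v w) <= n * norm w" unfolding n_def by (rule spd.upper[OF spd_N])
 have 1: "abs (gk (N y) ta w \<bullet> b z) <= q / sqrt ta * (n * B * r)"
 proof -
  have "norm (gk (N y) ta w) <= q / ta * (n * norm w)"
   unfolding gk_def q_def[symmetric] using q0 t up by (simp add: mult_left_mono divide_right_mono)
  hence "abs (gk (N y) ta w \<bullet> b z) <= (q / ta * (n * norm w)) * B"
   by (intro order.trans[OF Cauchy_Schwarz_ineq2] mult_mono b_bound) (use q0 n t in auto)
  also have "... = q / sqrt ta * (n * B * r)" unfolding wr using st by (simp add: field_simps)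
  finally show ?thesis .
 qed
 have 2: "abs (Hk (N y) ta w \<bullet> (S z - S y)) <= q / sqrt ta * (LS * (n^2 * r ^ 3 + d1 * (d1 * n) * r))"
 proof -
  have "norm (Hk (N y) ta w) <= q * (norm ((1 / ta^2) *R outer (N y *v w)) + norm ((1 / ta) *R N y))"
  proof -
   have "norm (Hk (N y) ta w) = q * norm ((1 / ta^2) *R outer (N y *v w) - (1 / ta) *R N y)"
    unfolding Hk_def q_def[symmetric] using q0 by simp
   thus ?thesis by (simp only: mult_left_mono[OF norm_triangle_ineq4 q0])
  qed
  also have "... <= q * (1 / ta^2 * (n * norm w)^2 + 1 / ta * (d1 * (d1 * n)))"
  proof (intro mult_left_mono[OF _ q0] add_mono)
   have "norm ((1 / ta^2) *R outer (N y *v w)) = 1 / ta^2 * (norm (N y *v w))^2" by (simp add: norm_outer)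
   thus "norm ((1 / ta^2) *R outer (N y *v w)) <= 1 / ta^2 * (n * norm w)^2"
    using mult_left_mono[OF power_mono[OF up norm_ge_zero, of 2], of "1 / ta^2"] t by (simp add: norm_outer)
   have "norm ((1 / ta) *R N y) = 1 / ta * norm (N y)" using t by simp
   thus "norm ((1 / ta) *R N y) <= 1 / ta * (d1 * (d1 * n))"
    using mult_left_mono[OF N_norm[of y], of "1 / ta"] t by (simp add: n_def)
  qed
  finally have "abs (Hk (N y) ta w \<bullet> (S z - S y)) <= (q * (1 / ta^2 * (n * norm w)^2 + 1 / ta * (d1 * (d1 * n)))) * (LS * norm w)"
   unfolding w_def by (intro order.trans[OF Cauchy_Schwarz_ineq2] mult_mono S_lip) (use q0 n t d1 in auto)
  also have "... = q / sqrt ta * (LS * (n^2 * r ^ 3 + d1 * (d1 * n) * r))"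
  proof -
   have "1 / ta^2 * (n * (r * s))^2 * s = n^2 * r^2 / s" "1 / ta * s = 1 / s" if "s * s = ta" "0 < s" for s
    using that(2) unfolding that(1)[symmetric] by (simp_all add: field_simps power2_eq_square)
   note e = this[OF st(2,1)]
   have "(q * (1 / ta^2 * (n * (r * sqrt ta))^2 + 1 / ta * (d1 * (d1 * n)))) * (LS * (r * sqrt ta)) =
    q * LS * r * ((1 / ta^2 * (n * (r * sqrt ta))^2 * sqrt ta) + (1 / ta * sqrt ta) * (d1 * (d1 * n)))" by (simp add: algebra_simps)
   also have "... = q * LS * r * (n^2 * r^2 / sqrt ta + 1 / sqrt ta * (d1 * (d1 * n)))" unfolding e ..
   also have "... = q / sqrt ta * (LS * (n^2 * r ^ 3 + d1 * (d1 * n) * r))" by (simp add: algebra_simps power2_eq_square power3_eq_cube add_divide_distrib)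
   finally show ?thesis unfolding wr .
  qed
  finally show ?thesis .
 qed
 define X where "X = (1 + r^2) ^ 3"
 have "(r - 1)^2 = r^2 - 2 * r + 1" by (simp add: power2_diff)
 hence rX: "r <= 1 + r^2" using zero_le_power2[of "r - 1"] r0 by linarith
 hence X: "r <= X" "r ^ 3 <= X" unfolding X_def using r0 self_le_power[of "1 + r^2" 3] by (auto intro: power_mono)
 define k where "k = B * n + LS * (n^2 + d1 * (d1 * n))"
 have "n * B * r <= n * B * X" "LS * (n^2 * r ^ 3 + d1 * (d1 * n) * r) <= LS * (n^2 * X + d1 * (d1 * n) * X)"
  using X n pos d1 LS_nonneg by (auto intro!: mult_left_mono add_mono)
 hence "n * B * r + LS * (n^2 * r ^ 3 + d1 * (d1 * n) * r) <= k * X" by (simp add: k_def algebra_simps)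
 from mult_left_mono[OF this, of "q / sqrt ta"] have 3: "q / sqrt ta * (n * B * r) + q / sqrt ta * (LS * (n^2 * r ^ 3 + d1 * (d1 * n) * r)) <= q / sqrt ta * (k * X)"
  using q0 st by (simp add: distrib_left)
 have "abs (HK ta z y) <= q / sqrt ta * (k * X)"
  unfolding HK_eq[OF t(1)] using 1 2 3 abs_triangle_ineq[of "gk (N y) ta (z - y) \<bullet> b z" "Hk (N y) ta (z - y) \<bullet> (S z - S y) / 2"]
  unfolding w_def by (simp add: abs_divide)
 also have "... = k / sqrt ta * (q * X)" by simp
 also have "... <= k / sqrt ta * (27 / (1 / (4 * A^2)) ^ 3 * exp (1 / (4 * A^2)) * (cq * G ta w))"
 proof (rule mult_left_mono)
  let ?c = "1 / (4 * A^2)"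
  have rr: "r^2 = (norm w)^2 / ta" using t by (simp add: r_def power_divide)
  \<comment> \<open>The bound of the kernel is \<open>cq * G\<close> times the spare factor exp(-
    r^2 / (4 A^2)), which pays for the polynomial \<open>X\<close>.\<close>
  have e: "exp (- (d1 / 2 * ln ta) - (norm w)^2 / (2 * A^2 * ta)) = (cq * G ta w) * exp (- (?c * r^2))"
   unfolding G_eq[OF t(1)] exp_add[symmetric] rr by (simp add: field_simps)
  have "q * X <= (cq * G ta w) * exp (- (?c * r^2)) * X"
   using qk_le(1)[OF t(1), of y w] unfolding e q_def[symmetric] by (rule mult_right_mono) (simp add: X_def)
  also have "... = (cq * G ta w) * (X * exp (- (?c * r^2)))" by simp
  also have "... <= (cq * G ta w) * (27 / ?c ^ 3 * exp ?c)"
   unfolding X_def using pos cq_pos by (intro mult_left_mono cube_exp) (auto simp: G_def)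
  finally show "q * X <= 27 / ?c ^ 3 * exp ?c * (cq * G ta w)" by (simp add: mult_ac)
  show "0 <= k / sqrt ta" using n pos d1 LS_nonneg t by (auto simp: k_def)
 qed
 also have "... = CH / sqrt ta * G ta (z - y)"
  unfolding CH_def k_def n_def w_def by (simp add: power_one_over)
 finally show ?thesis .
qed

end

lemma taylor_le_mono:
 assumes "taylor_le C d f0 f1 p g H" "C <= C'" "0 <= d"
 shows "taylor_le C' d f0 f1 p g H"
 unfolding taylor_le_def
 by (intro allI, rule order.trans[OF assms(1)[unfolded taylor_le_def, rule_format] mult_right_mono[OF assms(2)]]) (use assms(3) in simp)

lemma lborel_affine_integrals:
 fixes z :: "real^'n::finite" and c :: real
 assumes c: "c ~= 0"
 shows "f : borel_measurable borel ==> (NI LB (%y. f y)) = ennreal (abs c ^ CARD('n)) * NI LB (%w. f (z + c *R w))"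
  and "g : borel_measurable borel ==> (BI LB (%y. g y)) = abs c ^ CARD('n) * (BI LB (%w. g (z + c *R w)) :: real)"
proof -
 have L: "LB = density (distr LB borel (%x. z + c *R x)) (%_. ennreal (abs c ^ CARD('n)))"
  using lborel_affine[OF c, of z] by simp
 show "NI LB (%y. f y) = ennreal (abs c ^ CARD('n)) * NI LB (%w. f (z + c *R w))" if [measurable]: "f : BB"
  by (subst L) (simp add: nn_integral_density nn_integral_distr nn_integral_cmult)
 show "BI LB (%y. g y) = abs c ^ CARD('n) * (BI LB (%w. g (z + c *R w)) :: real)" if [measurable]: "g : BB"
  by (subst L) (simp add: integral_density integral_distr)
qed

lemma lborel_reflect:
 fixes z :: "real^'n::finite"
 shows "f : borel_measurable borel ==> (NI LB (%y. f (z - y))) = NI LB (%w. f w)"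
  and "g : borel_measurable borel ==> (BI LB (%y. g (z - y))) = (BI LB (%w. g w) :: real)"
 using lborel_affine_integrals(1)[of "-1" f z] lborel_affine_integrals(2)[of "-1" g z] by simp_all

lemma nn_integral_gauss: "0 < si ==> (NI LB (%w. ennreal (gauss si (w::real^'n::finite)))) = 1"
proof -
 assume s: "0 < si"
 have "NI LB (%w. ennreal (gauss si (w::real^'n))) = NI (LB :: (real^'n) measure) (%w. (PROD i:UNIV. ennreal (normal_density 0 si (w $ i))))"
  by (simp add: gauss_def prod_ennreal)
 also have "... = 1" by (subst nn_integral_vec_prod) (use s in "simp_all add: nn_integral_eq_integral")
 finally show ?thesis .
qed

lemma outer_continuous: "continuous_on T outer"
 unfolding outer_def[abs_def] by (intro continuous_on_vec_lambda continuous_intros)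

lemma outer_measurable[measurable (raw)]: "f : borel_measurable M ==> (%x. outer (f x)) : borel_measurable M"
 using measurable_compose[OF _ borel_measurable_continuous_onI[OF outer_continuous]] by blast

lemma kernels_measurable[measurable (raw)]:
 assumes [measurable]: "f : borel_measurable M" "t : borel_measurable M" "g : borel_measurable M"
 shows "(%x. qk (f x) (t x) (g x)) : borel_measurable M" "(%x. pk (f x) (t x) (g x)) : borel_measurable M" (is ?A)
  "(%x. gk (f x) (t x) (g x)) : borel_measurable M" "(%x. Hk (f x) (t x) (g x)) : borel_measurable M"
proof -
 show [measurable]: "(%x. qk (f x) (t x) (g x)) : borel_measurable M" unfolding qk_def by measurable
 show ?A "(%x. gk (f x) (t x) (g x)) : borel_measurable M" "(%x. Hk (f x) (t x) (g x)) : borel_measurable M"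
  unfolding pk_def gk_def Hk_def by measurable
qed

lemma continuous_on_matrix_vector[continuous_intros]:
 fixes f :: "'a::topological_space => real^'n::finite^'m::finite"
 assumes "continuous_on T f" "continuous_on T g" shows "continuous_on T (%x. f x *v g x)"
 unfolding matrix_vector_mult_def by (intro continuous_on_vec_lambda continuous_intros assms)

lemma kernels_continuous[continuous_intros]:
 fixes f :: "'a::topological_space => real^'n::finite^'n"
 assumes "continuous_on T f" "continuous_on T t" "continuous_on T g" "!!x. x : T ==> 0 < t x"
 shows "continuous_on T (%x. qk (f x) (t x) (g x))" (is ?A) "continuous_on T (%x. gk (f x) (t x) (g x))" (is ?B) "continuous_on T (%x. Hk (f x) (t x) (g x))" (is ?C)
proof -
 have nz: "t x ~= 0" if "x : T" for x using assms(4)[OF that] by simp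
 show q: ?A unfolding qk_def by (intro continuous_intros assms) (use nz in auto)
 show ?B unfolding gk_def by (intro continuous_intros assms q) (use nz in auto)
 show ?C unfolding Hk_def
  by (intro continuous_intros assms q continuous_on_compose2[OF outer_continuous[of UNIV]]) (use nz in auto)
qed

context elliptic_sde begin

lemma N_cont: "continuous_on T N"
proof -
 have "N = (%y. \<chi> i j. (N y *v axis j 1) $ i)" by (simp add: fun_eq_iff vec_eq_iff matrix_vector_mult_basis column_def)
 moreover have "continuous_on UNIV (%y. \<chi> i j. (N y *v axis j 1) $ i)"
  by (intro continuous_on_vec_lambda continuous_on_component N_continuous)
 ultimately show ?thesis by (metis continuous_on_subset subset_UNIV)
qed

lemma S_cont: "continuous_on T S"
proof -
 have "S = (%x. \<chi> i j. a x $ i \<bullet> a x $ j)" by (simp add: fun_eq_iff vec_eq_iff S_entry)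
 moreover have "continuous_on T (%x. \<chi> i j. a x $ i \<bullet> a x $ j)"
  by (intro continuous_on_vec_lambda continuous_on_inner continuous_on_component coeff_continuous)
 ultimately show ?thesis by simp
qed

lemma NS_measurable[measurable]: "N : BB" "S : BB"
 using N_cont S_cont by (auto intro: borel_measurable_continuous_onI)

lemma HK_measurable[measurable (raw)]:
 assumes [measurable]: "t : borel_measurable M'" "z : borel_measurable M'" "y : borel_measurable M'"
 shows "(%x. HK (t x) (z x) (y x)) : borel_measurable M'"
 unfolding HK_def gen_def S_def[symmetric] by measurable

lemma G_measurable[measurable (raw)]:
 assumes [measurable]: "t : borel_measurable M'" "z : borel_measurable M'"
 shows "(%x. G (t x) (z x)) : borel_measurable M'"
 unfolding G_def gauss_def normal_density_def by measurable

lemma G_nonneg[simp]: "0 <= G ta w" by (simp add: G_def)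

lemma G_nn: "0 < ta ==> (NI LB (%w. ennreal (G ta w))) = 1" "0 < ta ==> (NI LB (%y. ennreal (G ta (z - y)))) = 1"
proof -
 show 1: "NI LB (%w. ennreal (G ta w)) = 1" if "0 < ta" unfolding G_def using that pos by (intro nn_integral_gauss) simp
 show "NI LB (%y. ennreal (G ta (z - y))) = 1" if "0 < ta"
  using lborel_reflect(1)[of "%w. ennreal (G ta w)" z] 1[OF that] by simp
qed

lemma G_integrable: "0 < ta ==> integrable LB (G ta)" "0 < ta ==> integrable LB (%y. G ta (z - y))"
 and G_integral: "0 < ta ==> (BI LB (%w. G ta w)) = 1" "0 < ta ==> (BI LB (%y. G ta (z - y))) = 1"
 using G_nn(1)[of ta] G_nn(2)[of ta z] by (auto intro!: integrableI_bounded simp: integral_eq_nn_integral)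

text \<open>The covariance is frozen at the integration variable \<open>y\<close>, the end point.
  The kernel then stays smooth in \<open>z\<close>, the variable on which the generator acts,
  although the coefficients are only Lipschitz.\<close>

definition AK where "AK ta fi z = BI LB (%y. fi y * qk (N y) ta (z - y))"
definition BK where "BK ta fi z = BI LB (%y. fi y * HK ta z y)"
definition GC where "GC ta fi z = BI LB (%y. fi y * G ta (z - y))"

definition bcont :: "real => (real^'n => real) => bool" where
 "bcont K fi \<longleftrightarrow> continuous_on UNIV fi & (ALL x. abs (fi x) <= K)"

lemma bcontD: assumes "bcont K fi" shows "fi : BB" "abs (fi x) <= K" "continuous_on UNIV fi" "0 <= K"
 using assms order.trans[OF abs_ge_zero, of "fi 0" K] unfolding bcont_def by (auto intro: borel_measurable_continuous_onI)

lemma kernel_integrable: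
 assumes phi: "fi : BB" "!!x. abs (fi x) <= K" and k: "(%y. k y) : BB" "!!y. abs (k y) <= c * G ta (z - y)" and t: "0 < ta"
 shows "integrable LB (%y. fi y * k y)" (is ?A) "abs (BI LB (%y. fi y * k y)) <= c * BI LB (%y. abs (fi y) * G ta (z - y))" (is ?B)
proof -
 have K: "0 <= K" using order.trans[OF abs_ge_zero phi(2)[of 0]] .
 have [measurable]: "fi : BB" "k : BB" using phi k by auto
 have i1: "integrable LB (%y. abs (fi y) * G ta (z - y))"
  by (rule integrable_bound'[OF integrable_mult_right[where c=K, OF G_integrable(2)[OF t, of z]]])
   (use phi K in "auto intro!: mult_right_mono simp: abs_mult")
 have le: "abs (fi y * k y) <= c * (abs (fi y) * G ta (z - y))" for y
  using mult_left_mono[OF k(2)[of y] abs_ge_zero[of "fi y"]] by (simp add: abs_mult mult_ac)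
 show i2: ?A
  by (rule integrable_bound'[OF integrable_mult_right[where c=c, OF i1]]) (use le in "auto intro!: AE_I2 order.trans[OF _ abs_ge_self]")
 have "abs (BI LB (%y. fi y * k y)) <= BI LB (%y. c * (abs (fi y) * G ta (z - y)))"
  by (rule order.trans[OF integral_abs_bound integral_mono]) (use i1 i2 le in auto)
 thus ?B by simp
qed

lemma GC_le: assumes "fi : BB" "!!x. abs (fi x) <= K" "0 < ta" shows "GC ta (%y. abs (fi y)) z <= K"
proof -
 have "GC ta (%y. abs (fi y)) z <= BI LB (%y. K * G ta (z - y))" unfolding GC_def
  using assms kernel_integrable(1)[of "%y. abs (fi y)" K "%y. G ta (z - y)" 1 ta z]
  by (intro integral_mono mult_right_mono integrable_mult_right G_integrable) auto
 thus ?thesis using G_integral(2)[OF assms(3)] by simp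
qed

lemma AK_bound: assumes "fi : BB" "!!x. abs (fi x) <= K" "0 < ta"
 shows "integrable LB (%y. fi y * qk (N y) ta (z - y))" (is ?A) "abs (AK ta fi z) <= cq * GC ta (%y. abs (fi y)) z" "abs (AK ta fi z) <= cq * K" (is ?B)
proof -
 have q: "abs (qk (N y) ta (z - y)) <= cq * G ta (z - y)" for y using qk_le(2)[OF assms(3), of y "z - y"] by (simp add: qk_def)
 show ?A and 1: "abs (AK ta fi z) <= cq * GC ta (%y. abs (fi y)) z"
  unfolding AK_def GC_def by (rule kernel_integrable[OF assms(1,2) _ q assms(3)]; measurable)+
 show ?B using 1 mult_left_mono[OF GC_le[OF assms, of z] less_imp_le[OF cq_pos]] by simp
qed

lemma BK_bound: assumes "fi : BB" "!!x. abs (fi x) <= K" "0 < ta" "ta <= 1"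
 shows "integrable LB (%y. fi y * HK ta z y)" (is ?A) "abs (BK ta fi z) <= CH / sqrt ta * GC ta (%y. abs (fi y)) z" "abs (BK ta fi z) <= CH / sqrt ta * K" (is ?B)
proof -
 show ?A and 1: "abs (BK ta fi z) <= CH / sqrt ta * GC ta (%y. abs (fi y)) z"
  unfolding BK_def GC_def by (rule kernel_integrable[OF assms(1,2) _ HK_bound[OF assms(3,4)] assms(3)]; measurable)+
 show ?B using 1 mult_left_mono[OF GC_le[OF assms(1-3), of z], of "CH / sqrt ta"] CH_nonneg assms(3) by simp
qed

text \<open>In the variable w = z - y the dominating function \<open>G ta w\<close> does not move
  with \<open>z\<close>, as dominated convergence requires for continuity in
  \<open>z\<close>.\<close>

lemma shifted:
 "fi : borel_measurable borel ==> BK ta fi z = BI LB (%w. fi (z - w) * HK ta z (z - w))"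
 "fi : borel_measurable borel ==> GC ta fi z = BI LB (%w. fi (z - w) * G ta w)"
 "fi : borel_measurable borel ==> AK ta fi z = BI LB (%w. fi (z - w) * qk (N (z - w)) ta w)"
 unfolding BK_def GC_def AK_def
 using lborel_reflect(2)[of "%w. fi (z - w) * HK ta z (z - w)" z] lborel_reflect(2)[of "%w. fi (z - w) * G ta w" z]
  lborel_reflect(2)[of "%w. fi (z - w) * qk (N (z - w)) ta w" z] by simp_all

lemma shifted_continuous:
 fixes k :: "real^'n => real^'n => real"
 assumes phi: "bcont K fi" and k: "!!w. continuous_on UNIV (%z. k z w)" "!!z. (%w. k z w) : BB" and b: "!!z w. abs (k z w) <= c * G ta w" and t: "0 < ta"
 shows "continuous_on UNIV (%z. BI LB (%w. fi (z - w) * k z w))"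
 unfolding continuous_on_sequentially comp_def
proof (intro allI ballI impI, elim conjE)
 fix x a assume lim: "x ----> (a :: real^'n)"
 note p = bcontD[OF phi]
 have [measurable]: "fi : BB" "(%w. k z w) : BB" for z using p k by auto
 show "(%n. BI LB (%w. fi (x n - w) * k (x n) w)) ----> (BI LB (%w. fi (a - w) * k a w))"
 proof (rule integral_dominated_convergence[where w="%w. K * (c * G ta w)"])
  show "AE w in lborel. (%n. fi (x n - w) * k (x n) w) ----> fi (a - w) * k a w"
   by (intro AE_I2 tendsto_mult continuous_on_tendsto_compose[OF p(3)] continuous_on_tendsto_compose[OF k(1)] tendsto_diff lim tendsto_const) auto
  show "AE w in lborel. norm (fi (x i - w) * k (x i) w) <= K * (c * G ta w)" for i
   using p b by (auto intro!: AE_I2 mult_mono simp: abs_mult)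
 qed (use G_integrable(1)[OF t] in auto)
qed

lemma BK_bcont:
 assumes phi: "bcont K fi" and t: "0 < ta" "ta <= 1" shows "bcont (CH / sqrt ta * K) (BK ta fi)"
 unfolding bcont_def
proof (intro conjI allI)
 have b: "abs (HK ta z (z - w)) <= CH / sqrt ta * G ta w" for z w using HK_bound[OF t, of z "z - w"] by simp
 have c: "continuous_on UNIV (%z. HK ta z (z - w))" for w unfolding HK_eq[OF t(1)]
  by (intro continuous_intros continuous_on_compose2[OF N_cont[of UNIV]] continuous_on_compose2[OF S_cont[of UNIV]] coeff_continuous) (use t in auto)
 have "continuous_on UNIV (%z. BI LB (%w. fi (z - w) * HK ta z (z - w)))"
  by (rule shifted_continuous[OF phi c _ b t(1)]) measurable
 thus "continuous_on UNIV (BK ta fi)" by (rule continuous_on_eq) (simp add: shifted(1)[OF bcontD(1)[OF phi]])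
 show "abs (BK ta fi x) <= CH / sqrt ta * K" for x using BK_bound(3)[OF bcontD(1,2)[OF phi] t] .
qed

lemma GC_bcont:
 assumes phi: "bcont K fi" "!!x. 0 <= fi x" and t: "0 < ta" shows "bcont K (GC ta fi)" "0 <= GC ta fi x"
proof -
 have "continuous_on UNIV (%z. BI LB (%w. fi (z - w) * G ta w))"
  by (rule shifted_continuous[OF phi(1) _ _ _ t, of "%z. G ta" 1]) auto
 hence "continuous_on UNIV (GC ta fi)" by (rule continuous_on_eq) (simp add: shifted(2)[OF bcontD(1)[OF phi(1)]])
 moreover show p: "0 <= GC ta fi x" for x unfolding GC_def using phi by (intro integral_nonneg' mult_nonneg_nonneg) auto
 moreover have "GC ta fi x <= K" for x using GC_le[OF bcontD(1,2)[OF phi(1)] t, of x] phi(2) by simp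
 ultimately show "bcont K (GC ta fi)" unfolding bcont_def by simp
qed

lemma AK_bcont:
 assumes phi: "bcont K fi" and t: "0 < ta" shows "bcont (cq * K) (AK ta fi)"
 unfolding bcont_def
proof (intro conjI allI)
 have b: "abs (qk (N (z - w)) ta w) <= cq * G ta w" for z w using qk_le(2)[OF t, of "z - w" w] by (simp add: qk_def)
 have c: "continuous_on UNIV (%z. qk (N (z - w)) ta w)" for w
  by (intro continuous_intros continuous_on_compose2[OF N_cont[of UNIV]]) (use t in auto)
 have "continuous_on UNIV (%z. BI LB (%w. fi (z - w) * qk (N (z - w)) ta w))"
  by (rule shifted_continuous[OF phi c _ b t]) measurable
 thus "continuous_on UNIV (AK ta fi)" by (rule continuous_on_eq) (simp add: shifted(3)[OF bcontD(1)[OF phi]])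
 show "abs (AK ta fi x) <= cq * K" for x using AK_bound(3)[OF bcontD(1,2)[OF phi] t] .
qed

text \<open>The time parameter of the kernel is the time left until \<open>t\<close>; the formula
  stops at \<open>t - e\<close> because the kernel degenerates at \<open>t\<close>.\<close>

lemma dynkin_q:
 assumes st: "0 <= s" "t <= s + 1" and e: "0 < e" "e <= t - s" and psi: "bddF s psi"
 shows "((%v. EE (%w. psi w * HK (t - v) (Y v w) y)) has_integral
  EE (%w. psi w * qk (N y) e (Y (t - e) w - y)) - EE (%w. psi w * qk (N y) (t - s) (Y s w - y))) {s..t - e}"
proof -
 have e1: "e <= 1" using e st by simp
 obtain K1 where K1: "0 <= K1" "!!ta d. 0 < d ==> e <= ta - d ==> ta <= 1 ==> 
  taylor_le K1 d (%z. qk (N y) ta (z - y)) (%z. qk (N y) (ta - d) (z - y)) (%z. pk (N y) ta (z - y)) (%z. gk (N y) ta (z - y)) (%z. Hk (N y) ta (z - y))"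
  using spd.qk_taylor(1)[OF spd_N[of y] e(1) e1, of y] by blast
 obtain K2 where K2: "0 <= K2" "!!ta w. e <= ta ==> ta <= 1 ==> abs (qk (N y) ta w) <= K2 & abs (pk (N y) ta w) <= K2 & norm (gk (N y) ta w) <= K2 & norm (Hk (N y) ta w) <= K2"
  using spd.qk_taylor(2)[OF spd_N[of y] e(1) e1] by blast
 have tv: "e <= t - v" "t - v <= 1" "0 < t - v" if "v : {s..t - e}" for v using that e st by auto
 have T: "taylor_le (K1 + K2) (v - u) (%z. qk (N y) (t - u) (z - y)) (%z. qk (N y) (t - v) (z - y)) (%z. pk (N y) (t - u) (z - y)) (%z. gk (N y) (t - u) (z - y)) (%z. Hk (N y) (t - u) (z - y))"
  if "s <= u" "u < v" "v <= t - e" for u v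
 proof -
  have "taylor_le K1 (v - u) (%z. qk (N y) (t - u) (z - y)) (%z. qk (N y) (t - v) (z - y)) (%z. pk (N y) (t - u) (z - y)) (%z. gk (N y) (t - u) (z - y)) (%z. Hk (N y) (t - u) (z - y))"
   using K1(2)[of "v - u" "t - u"] that st by simp
  thus ?thesis by (rule taylor_le_mono) (use that K2 in auto)
 qed
 have cont: "continuous_on ({s..t - e} \<times> UNIV) (%(v, x). HK (t - v) x y)"
 proof -
  have "continuous_on ({s..t - e} \<times> UNIV) (%p. gk (N y) (t - fst p) (snd p - y) \<bullet> b (snd p) + Hk (N y) (t - fst p) (snd p - y) \<bullet> (S (snd p) - S y) / 2)"
   by (intro continuous_intros continuous_on_compose2[OF S_cont[of UNIV]] continuous_on_compose2[OF coeff_continuous(2)[of UNIV]]) (use e in auto)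
  thus ?thesis
   by (rule continuous_on_cong[THEN iffD1, OF refl, rotated]) (use tv in "auto simp: HK_eq")
 qed
 have HKb: "abs (HK (t - v) x y) <= K2 * (1 + B + SB / 2)" if "v : {s..t - e}" for v x
 proof -
  have "abs (HK (t - v) x y) <= K2 * (1 + B + norm (S x) / 2)" unfolding HK_def S_def by (rule gen_bound) (use K2(2)[OF tv(1,2)[OF that]] in auto)
  also have "... <= K2 * (1 + B + SB / 2)" using S_bound[of x] K2(1) by (intro mult_left_mono) auto
  finally show ?thesis .
 qed
 have "((%v. EE (%w. psi w * gen (%z. pk (N y) (t - v) (z - y)) (%z. gk (N y) (t - v) (z - y)) (%z. Hk (N y) (t - v) (z - y)) (Y v w))) has_integral
  EE (%w. psi w * qk (N y) (t - (t - e)) (Y (t - e) w - y)) - EE (%w. psi w * qk (N y) (t - s) (Y s w - y))) {s..t - e}"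
 proof (rule dynkin[where f="%v z. qk (N y) (t - v) (z - y)", OF st(1) _ psi _ T])
  show "continuous_on ({s..t - e} \<times> UNIV) (%(v, x). gen (%z. pk (N y) (t - v) (z - y)) (%z. gk (N y) (t - v) (z - y)) (%z. Hk (N y) (t - v) (z - y)) x)"
   using cont unfolding HK_def .
  show "abs (gen (%z. pk (N y) (t - v) (z - y)) (%z. gk (N y) (t - v) (z - y)) (%z. Hk (N y) (t - v) (z - y)) x) <= K2 * (1 + B + SB / 2)" if "v : {s..t - e}" for v x
   using HKb[OF that] unfolding HK_def .
  show "abs (qk (N y) (t - v) (z - y)) <= K1 + K2" "abs (pk (N y) (t - v) (z - y)) <= K1 + K2" "norm (gk (N y) (t - v) (z - y)) <= K1 + K2" "norm (Hk (N y) (t - v) (z - y)) <= K1 + K2"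
   if "v : {s..t - e}" for v z
   using K2(2)[OF tv(1,2)[OF that], of "z - y"] K1(1) by auto
 qed (use e K1 K2 in auto)
 thus ?thesis unfolding HK_def by simp
qed

end

lemma integral_inverse_sqrt:
 fixes s t e :: real
 assumes e: "0 < e" "e <= t - s"
 shows "set_integrable LB {s..t - e} (%v. 1 / sqrt (t - v))" (is ?A) "(LINT v:{s..t - e}|lborel. 1 / sqrt (t - v)) = 2 * (sqrt (t - s) - sqrt e)" (is ?B)
proof -
 have p: "0 < t - v" if "v : {s..t - e}" for v using that e by auto
 have c: "continuous_on {s..t - e} (%v. 1 / sqrt (t - v))" by (intro continuous_intros) (use p in force)
 thus i: ?A by (rule borel_integrable_atLeastAtMost')
 have "((%v. 1 / sqrt (t - v)) has_integral (- 2 * sqrt (t - (t - e)) - - 2 * sqrt (t - s))) {s..t - e}"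
 proof (rule fundamental_theorem_of_calculus)
  fix v assume v: "v : {s..t - e}"
  have "((%v. - 2 * sqrt (t - v)) has_real_derivative 1 / sqrt (t - v)) (at v)"
   using p[OF v] by (auto intro!: derivative_eq_intros simp: field_simps)
  thus "((%v. - 2 * sqrt (t - v)) has_vector_derivative 1 / sqrt (t - v)) (at v within {s..t - e})"
   by (simp add: has_real_derivative_iff_has_vector_derivative has_vector_derivative_at_within)
 qed (use e in auto)
 thus ?B
  unfolding set_borel_integral_eq_integral(2)[OF i] by (simp add: integral_unique)
qed

context elliptic_sde begin

text \<open>The measure \<open>Q\<close> is general because the exchange is needed both on the
  probability space and on its product with the time axis. The kernel bound is asked only where
  \<open>psi\<close> is nonzero, which encodes the restriction of time to an interval.\<close>

lemma kernel_fubini: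
 fixes Q :: "'q measure" and Z :: "'q => real^'n"
 assumes Q: "sigma_finite_measure Q" and psi: "integrable Q psi" and [measurable]: "Z : borel_measurable Q" "T : borel_measurable Q"
  and T: "!!x. x : space Q ==> 0 < T x" and phi: "fi : BB" "!!x. abs (fi x) <= K"
  and km[measurable]: "(%(x, y). k x y) : borel_measurable (Q XM borel)" and k: "!!x y. x : space Q ==> psi x ~= 0 ==> abs (k x y) <= c * G (T x) (Z x - y)"
  and c: "0 <= c"
 shows "BI LB (%y. fi y * BI Q (%x. psi x * k x y)) = BI Q (%x. psi x * BI LB (%y. fi y * k x y))" (is ?A)
  "integrable LB (%y. fi y * BI Q (%x. psi x * k x y))" (is ?B)
proof -
 interpret P: pair_sigma_finite Q "LB :: (real^'n) measure"
  using Q by (intro pair_sigma_finite.intro) (auto intro: sigma_finite_lborel)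
 have K: "0 <= K" using order.trans[OF abs_ge_zero phi(2)[of 0]] .
 have pm[measurable]: "fi : BB" "psi : borel_measurable Q" using phi psi by auto
 have km'[measurable]: "(%(x, y). k x y) : borel_measurable (Q XM LB)" using km by (simp cong: measurable_cong_sets)
 let ?f = "%x y. fi y * (psi x * k x y)"
 have kx: "k x : BB" if "x : space Q" for x using measurable_compose_Pair1[OF that km] by simp
 have pw: "abs (psi x * k x y) <= abs (psi x) * c * G (T x) (Z x - y)" if "x : space Q" for x y
  using mult_left_mono[OF k[OF that, of y] abs_ge_zero[of "psi x"]] by (cases "psi x = 0") (auto simp: abs_mult mult_ac)
 have i2: "integrable LB (%y. ?f x y)" and b2: "BI LB (%y. abs (?f x y)) <= abs (psi x) * c * K" if x: "x : space Q" for x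
 proof -
  have kmx: "(%y. psi x * k x y) : BB" using kx[OF x] by measurable
  show i: "integrable LB (%y. ?f x y)" by (rule kernel_integrable(1)[OF phi kmx pw[OF x] T[OF x]])
  have "BI LB (%y. abs (?f x y)) = BI LB (%y. abs (fi y) * abs (psi x * k x y))" by (simp add: abs_mult)
  also have "... <= BI LB (%y. (K * (abs (psi x) * c)) * G (T x) (Z x - y))"
  proof (rule integral_mono)
   show "integrable LB (%y. abs (fi y) * abs (psi x * k x y))" using integrable_abs[OF i] by (simp add: abs_mult)
   show "integrable LB (%y. (K * (abs (psi x) * c)) * G (T x) (Z x - y))" by (intro integrable_mult_right G_integrable T x)
   show "abs (fi y) * abs (psi x * k x y) <= (K * (abs (psi x) * c)) * G (T x) (Z x - y)" for y
    using mult_mono[OF phi(2)[of y] pw[OF x, of y] K] by (simp add: mult.assoc)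
  qed
  also have "... = abs (psi x) * c * K" using G_integral(2)[OF T[OF x]] by simp
  finally show "BI LB (%y. abs (?f x y)) <= abs (psi x) * c * K" .
 qed
 have int: "integrable (Q XM LB) (%(x, y). ?f x y)"
 proof (rule P.Fubini_integrable)
  show "integrable Q (%x. BI LB (%y. norm (case (x, y) of (x, y) => ?f x y)))"
  proof (rule integrable_bound'[of Q "%x. abs (psi x) * c * K"])
   show "AE x in Q. norm (BI LB (%y. norm (case (x, y) of (x, y) => ?f x y))) <= norm (abs (psi x) * c * K)"
    using b2 c K by (auto intro!: AE_I2 simp: abs_mult)
  qed (use psi in auto)
  show "AE x in Q. integrable LB (%y. case (x, y) of (x, y) => ?f x y)" using i2 by (auto intro!: AE_I2)
 qed measurable
 have "BI LB (%y. fi y * BI Q (%x. psi x * k x y)) = BI LB (%y. (BI Q (%x. ?f x y)))" by simp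
 also have "... = BI Q (%x. (BI LB (%y. ?f x y)))" by (rule P.Fubini_integral[OF int])
 also have "... = BI Q (%x. psi x * BI LB (%y. fi y * k x y))"
 proof (rule integral_cong'[OF refl])
  fix x
  have "(%y. ?f x y) = (%y. psi x * (fi y * k x y))" by (simp add: mult_ac)
  thus "BI LB (%y. ?f x y) = psi x * BI LB (%y. fi y * k x y)" by simp
 qed
 finally show ?A .
 show ?B using P.integrable_snd[OF int] by simp
qed

lemma G_le: assumes "0 < e" "e <= ta" shows "G ta w <= exp (- (d1 / 2 * ln e)) / cq"
proof -
 have "0 < ta" using assms by simp
 have "cq * G ta w <= exp (- (d1 / 2 * ln e))"
  unfolding G_eq[OF \<open>0 < ta\<close>] exp_le_cancel_iff using assms pos d1 mult_left_mono[of "ln e" "ln ta" "d1 / 2"] by (smt (verit) divide_nonneg_nonneg ln_le_cancel_iff mult_nonneg_nonneg zero_le_power2)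
 thus ?thesis using cq_pos by (simp add: field_simps)
qed

text \<open>Dynkin's formula for each end point \<open>y\<close>, integrated against
  \<open>fi y\<close>. The error is a time integral of the mean of \<open>BK\<close>, and the bound
  D / sqrt(t - v) integrates to at most 2 D sqrt(t - s).\<close>

lemma parametrix_identity:
 assumes st: "0 <= s" "t <= s + 1" and e: "0 < e" "e <= t - s" and psi: "bddF s psi" and phi: "bcont K fi"
  and D: "!!v. s <= v ==> v < t ==> abs (EE (%w. psi w * BK (t - v) fi (Y v w))) <= D / sqrt (t - v)" and D0: "0 <= D"
 shows "abs (EE (%w. psi w * AK e fi (Y (t - e) w)) - EE (%w. psi w * AK (t - s) fi (Y s w))) <= 2 * D * sqrt (t - s)"
proof -
 interpret MP: pair_sigma_finite "LB :: real measure" M by standard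
 note pm = bddF_D[OF psi] and p = bcontD[OF phi]
 obtain P where P: "0 <= P" "!!w. w : space M ==> abs (psi w) <= P" using bddF_bound[OF psi] by blast
 have [measurable]: "psi : borel_measurable M" "fi : BB" using pm p by auto
 have ts: "0 < t - s" using e by simp
 have A: "EE (%w. psi w * AK ta fi (Y v w)) = BI LB (%y. fi y * EE (%w. psi w * qk (N y) ta (Y v w - y)))"
  and Ai: "integrable LB (%y. fi y * EE (%w. psi w * qk (N y) ta (Y v w - y)))" if ta: "0 < ta" for ta v
 proof -
  have b: "abs (qk (N y) ta (Y v w - y)) <= cq * G ta (Y v w - y)" for y w using qk_le(2)[OF ta, of y] by (simp add: qk_def)
  note F = kernel_fubini[where Q=M and psi=psi and Z="Y v" and T="%_. ta" and k="%w y. qk (N y) ta (Y v w - y)" and c=cq and K=K and fi=fi,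
   OF sigma_finite_measure_axioms pm(3) _ _ _ p(1,2) _ b]
  show "EE (%w. psi w * AK ta fi (Y v w)) = BI LB (%y. fi y * EE (%w. psi w * qk (N y) ta (Y v w - y)))"
   unfolding AK_def by (rule F(1)[symmetric]) (use ta cq_pos in "auto intro: less_imp_le")
  show "integrable LB (%y. fi y * EE (%w. psi w * qk (N y) ta (Y v w - y)))"
   by (rule F(2)) (use ta cq_pos in "auto intro: less_imp_le")
 qed
 let ?I = "{s..t - e}"
 \<comment> \<open>The weight is cut off outside the time interval; there \<open>T\<close> gets the
   dummy value 1, so that it stays positive.\<close>
 define ps where "ps x = indicator ?I (fst x) * psi (snd x)" for x :: "real \<times> 'w"
 define T where "T x = (if fst x : ?I then t - fst x else 1)" for x :: "real \<times> 'w"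
 have psm[measurable]: "ps : borel_measurable (LB XM M)" unfolding ps_def by measurable
 have ind: "integrable (LB XM M) (%x. indicator (?I \<times> space M) x * C)" for C :: real
 proof -
  have "emeasure (LB XM M) (?I \<times> space M) < \<infinity>"
   by (subst emeasure_pair_measure_Times) (use e in "auto simp: emeasure_space_1")
  thus ?thesis by (intro integrable_mult_left integrable_real_indicator) auto
 qed
 have psi_i: "integrable (LB XM M) ps"
 proof (rule integrable_bound'[OF ind[of P] psm AE_I2])
  fix x :: "real \<times> 'w" assume "x : space (LB XM M)"
  hence "snd x : space M" by (auto simp: space_pair_measure)
  thus "norm (ps x) <= norm (indicator (?I \<times> space M) x * P)"
   using P by (cases x) (auto simp: ps_def indicator_def)
 qed
 have Tm[measurable]: "T : borel_measurable (LB XM M)" unfolding T_def by measurable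
 have T0: "0 < T x" for x using e by (auto simp: T_def)
 have Tps: "T x = t - fst x" "e <= T x" "T x <= 1" if "ps x ~= 0" for x
  using that st e by (auto simp: ps_def T_def split: split_indicator_asm)
 let ?k = "%(x :: real \<times> 'w) y. HK (t - fst x) (Y (fst x) (snd x)) y"
 have Yj[measurable]: "(%x. Y (fst x) (snd x)) : borel_measurable (LB XM M)" using Y_joint by (simp add: case_prod_beta')
 have kb: "abs (?k x y) <= CH / sqrt e * G (T x) (Y (fst x) (snd x) - y)" if "ps x ~= 0" for x y
 proof -
  have "abs (?k x y) <= CH / sqrt (T x) * G (T x) (Y (fst x) (snd x) - y)"
   using HK_bound[OF T0 Tps(3)[OF that]] Tps(1)[OF that] by simp
  also have "... <= CH / sqrt e * G (T x) (Y (fst x) (snd x) - y)"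
   using Tps(2)[OF that] e CH_nonneg by (intro mult_right_mono divide_left_mono) auto
  finally show ?thesis .
 qed
 have km: "(%(x, y). ?k x y) : borel_measurable ((LB XM M) XM borel)" by measurable
 have sf: "sigma_finite_measure (LB XM M :: (real \<times> 'w) measure)" by (rule MP.P.sigma_finite_measure_axioms | standard)+
 have c0: "0 <= CH / sqrt e" using CH_nonneg e by simp
 note F = kernel_fubini[where T=T and c="CH / sqrt e", OF sf psi_i Yj Tm T0 p(1,2) km kb c0]
 have inner: "BI (LB XM M) (%x. ps x * ?k x y) = EE (%w. psi w * qk (N y) e (Y (t - e) w - y)) - EE (%w. psi w * qk (N y) (t - s) (Y s w - y))" for y
 proof -
  define C where "C = P * (CH / sqrt e * (exp (- (d1 / 2 * ln e)) / cq))"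
  have i: "integrable (LB XM M) (%x. ps x * ?k x y)"
  proof (rule integrable_bound'[OF ind[of C] _ AE_I2])
   fix x :: "real \<times> 'w" assume x: "x : space (LB XM M)"
   show "norm (ps x * ?k x y) <= norm (indicator (?I \<times> space M) x * C)"
   proof (cases "ps x = 0")
    case False
    hence xI: "x : ?I \<times> space M" using x by (cases x) (auto simp: ps_def space_pair_measure split: split_indicator_asm)
    have "abs (ps x) <= P" using P xI by (cases x) (auto simp: ps_def)
    moreover have "abs (?k x y) <= CH / sqrt e * (exp (- (d1 / 2 * ln e)) / cq)"
     using kb[OF False, of y] mult_left_mono[OF G_le[OF e(1) Tps(2)[OF False]] c0] order.trans by blast
    ultimately have "abs (ps x * ?k x y) <= C" unfolding abs_mult C_def using P by (intro mult_mono) auto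
    thus ?thesis using xI by simp
   qed simp
  qed measurable
  have "BI (LB XM M) (%x. ps x * ?k x y) = BI LB (%v. (BI M (%w. ps (v, w) * ?k (v, w) y)))"
   by (rule MP.integral_fst'[symmetric, OF i])
  also have "... = (LINT v:?I|lborel. EE (%w. psi w * HK (t - v) (Y v w) y))"
   unfolding set_lebesgue_integral_def ps_def by (simp add: mult.assoc)
  also have "... = integral ?I (%v. EE (%w. psi w * HK (t - v) (Y v w) y))"
  proof (rule set_borel_integral_eq_integral(2))
   show "set_integrable LB ?I (%v. EE (%w. psi w * HK (t - v) (Y v w) y))"
    using MP.integrable_fst'[OF i] unfolding set_integrable_def ps_def by (simp add: mult.assoc)
  qed
  also have "... = EE (%w. psi w * qk (N y) e (Y (t - e) w - y)) - EE (%w. psi w * qk (N y) (t - s) (Y s w - y))"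
   by (rule integral_unique[OF dynkin_q[OF st e psi]])
  finally show ?thesis .
 qed
 have Bint: "integrable (LB XM M) (%x. ps x * BK (t - fst x) fi (Y (fst x) (snd x)))"
 proof (rule integrable_bound'[OF ind[of "P * (CH / sqrt e * K)"] _ AE_I2])
  show "(%x. ps x * BK (t - fst x) fi (Y (fst x) (snd x))) : borel_measurable (LB XM M)" unfolding BK_def by measurable
  fix x :: "real \<times> 'w" assume x: "x : space (LB XM M)"
  show "norm (ps x * BK (t - fst x) fi (Y (fst x) (snd x))) <= norm (indicator (?I \<times> space M) x * (P * (CH / sqrt e * K)))"
  proof (cases "ps x = 0")
   case False
   hence xI: "x : ?I \<times> space M" using x by (cases x) (auto simp: ps_def space_pair_measure split: split_indicator_asm)
   have "abs (ps x) <= P" using P xI by (cases x) (auto simp: ps_def)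
   moreover have "abs (BK (t - fst x) fi (Y (fst x) (snd x))) <= CH / sqrt (T x) * K" using BK_bound(3)[OF p(1,2) T0 Tps(3)[OF False]] Tps(1)[OF False] by simp
   moreover have "CH / sqrt (T x) * K <= CH / sqrt e * K"
    using Tps(2)[OF False] e CH_nonneg p(4) by (intro mult_right_mono divide_left_mono) auto
   ultimately have "abs (ps x * BK (t - fst x) fi (Y (fst x) (snd x))) <= P * (CH / sqrt e * K)" unfolding abs_mult using P by (intro mult_mono) auto
   hence "abs (ps x * BK (t - fst x) fi (Y (fst x) (snd x))) <= abs (P * (CH / sqrt e * K))" by (rule order.trans[OF _ abs_ge_self])
   thus ?thesis using xI by simp
  qed simp
 qed
 have "EE (%w. psi w * AK e fi (Y (t - e) w)) - EE (%w. psi w * AK (t - s) fi (Y s w)) = BI LB (%y. fi y * BI (LB XM M) (%x. ps x * ?k x y))"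
  unfolding inner A[OF e(1)] A[OF ts] using Ai[OF e(1)] Ai[OF ts] by (simp add: right_diff_distrib integral_diff')
 also have "... = BI (LB XM M) (%x. ps x * BK (t - fst x) fi (Y (fst x) (snd x)))" unfolding BK_def by (rule F(1))
 also have "... = BI LB (%v. (BI M (%w. ps (v, w) * BK (t - v) fi (Y v w))))" using MP.integral_fst'[symmetric, OF Bint] by simp
 also have "... = (LINT v:?I|lborel. EE (%w. psi w * BK (t - v) fi (Y v w)))"
  unfolding set_lebesgue_integral_def ps_def by (simp add: mult.assoc)
 also have "\<bar>...\<bar> <= (LINT v:?I|lborel. D * (1 / sqrt (t - v)))"
  unfolding set_lebesgue_integral_def
 proof (rule order.trans[OF integral_abs_bound integral_mono])
  have "integrable LB (%v. indicator ?I v *R EE (%w. psi w * BK (t - v) fi (Y v w)))"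
   using MP.integrable_fst'[OF Bint] unfolding ps_def by (simp add: mult.assoc)
  thus "integrable LB (%v. abs (indicator ?I v *R EE (%w. psi w * BK (t - v) fi (Y v w))))" by (rule integrable_abs)
  show "integrable LB (%v. indicator ?I v *R (D * (1 / sqrt (t - v))))"
   using integrable_mult_right[OF integral_inverse_sqrt(1)[OF e, unfolded set_integrable_def], of D] by (simp add: mult_ac)
  show "abs (indicator ?I v *R EE (%w. psi w * BK (t - v) fi (Y v w))) <= indicator ?I v *R (D * (1 / sqrt (t - v)))" for v
   using D[of v] e by (auto simp: indicator_def)
 qed
 also have "... = D * (2 * (sqrt (t - s) - sqrt e))" using integral_inverse_sqrt(2)[OF e] by (simp only: set_integral_mult_right)
 also have "... <= 2 * D * sqrt (t - s)" using D0 e by (simp add: algebra_simps)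
 finally show ?thesis .
qed

text \<open>The mass of the unnormalised frozen kernel, (2 pi)^(d/2) sqrt(det S). No determinant is
  computed: continuity and the bounds \<open>k1\<close> and \<open>k2\<close> suffice.\<close>

definition kap :: "real^'n => real" where "kap z = BI LB (%w. exp (- (w \<bullet> (N z *v w) / 2)))"

definition "k1 = exp (d1 / 2 * ln (2 * pi * lam))"
definition "k2 = exp (d1 / 2 * ln (2 * pi * A^2))"

lemma gauss_kernel: "0 < si ==> exp (- ((norm w)^2 / (2 * si^2))) = exp (d1 / 2 * ln (2 * pi * si^2)) * gauss si (w :: real^'n)"
 by (simp add: gauss_eq exp_add[symmetric] d1_def)

lemma gauss_integrable: "0 < si ==> integrable LB (gauss si :: real^'n => real)" "0 < si ==> (BI LB (%w. gauss si (w :: real^'n))) = 1"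
 using nn_integral_gauss[of si, where 'n='n] by (auto intro!: integrableI_bounded simp: integral_eq_nn_integral)

lemma expN_bounds: "exp (- ((w :: real^'n) \<bullet> (N z *v w) / 2)) <= k2 * gauss A w" "k1 * gauss (sqrt lam) w <= exp (- (w \<bullet> (N z *v w) / 2))" (is ?A)
proof -
 have "(norm w)^2 / (2 * A^2) <= w \<bullet> (N z *v w) / 2" using spd.lower[OF spd_N, of w z] by simp
 hence "exp (- (w \<bullet> (N z *v w) / 2)) <= exp (- ((norm w)^2 / (2 * A^2)))" by simp
 thus "exp (- (w \<bullet> (N z *v w) / 2)) <= k2 * gauss A w" unfolding gauss_kernel[OF pos(1)] k2_def .
 have s: "0 < sqrt lam" "(sqrt lam)^2 = lam" using lam by auto
 have "w \<bullet> (N z *v w) / 2 <= (norm w)^2 / (2 * lam)" using spd.qN[OF spd_N, of w z w] by (simp add: power2_eq_square abs_le_iff)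
 hence "exp (- ((norm w)^2 / (2 * (sqrt lam)^2))) <= exp (- (w \<bullet> (N z *v w) / 2))" unfolding s by simp
 from this[unfolded gauss_kernel[OF s(1)]] show ?A unfolding s(2) k1_def .
qed

lemma k_pos: "0 < k1" "0 < k2" by (auto simp: k1_def k2_def)

lemma expN_integrable: "integrable LB (%w. exp (- (w \<bullet> (N z *v w) / 2)))"
 by (rule integrable_bound'[OF integrable_mult_right[where c=k2, OF gauss_integrable(1)[OF pos(1)]]])
  (auto intro!: AE_I2 order.trans[OF expN_bounds(1) abs_ge_self])

lemma kap_bounds: "k1 <= kap z" "kap z <= k2"
proof -
 have s: "0 < sqrt lam" using lam by simp
 have "BI LB (%w. k1 * gauss (sqrt lam) (w :: real^'n)) <= kap z" unfolding kap_def
  by (intro integral_mono integrable_mult_right gauss_integrable s expN_integrable expN_bounds)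
 thus "k1 <= kap z" using gauss_integrable(2)[OF s] by simp
 have "kap z <= BI LB (%w. k2 * gauss A (w :: real^'n))" unfolding kap_def
  by (intro integral_mono integrable_mult_right gauss_integrable pos expN_integrable expN_bounds)
 thus "kap z <= k2" using gauss_integrable(2)[OF pos(1)] by simp
qed

text \<open>Needed in two forms: with \<open>c\<close> constantly 0 it is the continuity of
  \<open>kap\<close>; with \<open>c n\<close> the square root of a vanishing time it is the
  concentration of the kernel along moving points.\<close>

lemma kernel_limit:
 assumes phi: "bcont K fi" and c: "c ----> 0" and z: "x ----> z"
 shows "(%n. BI LB (%w. fi (x n + c n *R w) * exp (- (w \<bullet> (N (x n + c n *R w) *v w) / 2)))) ----> fi z * kap z"
proof -
 note p = bcontD[OF phi]
 have [measurable]: "fi : BB" using p by auto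
 have "(%n. BI LB (%w. fi (x n + c n *R w) * exp (- (w \<bullet> (N (x n + c n *R w) *v w) / 2)))) ----> (BI LB (%w. fi z * exp (- (w \<bullet> (N z *v w) / 2))))"
 proof (rule integral_dominated_convergence[where w="%w. K * (k2 * gauss A w)"])
  show "AE w in lborel. norm (fi (x i + c i *R w) * exp (- (w \<bullet> (N (x i + c i *R w) *v w) / 2))) <= K * (k2 * gauss A w)" for i
   using p expN_bounds(1) by (auto intro!: AE_I2 mult_mono simp: abs_mult)
  show "integrable LB (%w :: real^'n. K * (k2 * gauss A w))" by (intro integrable_mult_right gauss_integrable pos)
  have l: "(%i. x i + c i *R w) ----> z" for w
   using tendsto_add[OF z tendsto_scaleR[OF c tendsto_const[of w]]] by simp
  show "AE w in lborel. (%i. fi (x i + c i *R w) * exp (- (w \<bullet> (N (x i + c i *R w) *v w) / 2))) ----> fi z * exp (- (w \<bullet> (N z *v w) / 2))"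
   by (intro AE_I2 tendsto_intros continuous_on_tendsto_compose[OF p(3) l] continuous_on_tendsto_compose[OF N_continuous l]) auto
 qed measurable
 thus ?thesis by (simp add: kap_def)
qed

lemma kap_continuous: "continuous_on T kap"
proof -
 have "bcont 1 (%_. 1)" by (simp add: bcont_def)
 hence "(%n. kap (x n)) ----> kap z" if "x ----> z" for x z
  using kernel_limit[OF _ tendsto_const that, of 1 "%_. 1"] by (simp add: kap_def)
 thus ?thesis by (auto simp: continuous_on_sequentially comp_def)
qed

lemma AK_scaled:
 assumes phi: "bcont K fi" and e: "0 < e"
 shows "AK e fi z = BI LB (%w. fi (z + sqrt e *R w) * exp (- (w \<bullet> (N (z + sqrt e *R w) *v w) / 2)))"
proof -
 have [measurable]: "fi : BB" using bcontD[OF phi] by auto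
 have s: "sqrt e ~= 0" using e by simp
 have x: "abs (sqrt e) ^ CARD('n) * exp (- (CARD('n) / 2 * ln e)) = 1"
 proof -
  have "sqrt e ^ CARD('n) = exp (CARD('n) * ln (sqrt e))" using e by (simp add: exp_of_nat_mult)
  thus ?thesis using e by (simp add: ln_sqrt exp_add[symmetric])
 qed
 have q: "qk (N (z + sqrt e *R w)) e (z - (z + sqrt e *R w)) = exp (- (CARD('n) / 2 * ln e)) * exp (- (w \<bullet> (N (z + sqrt e *R w) *v w) / 2))" for w
 proof -
  have "(- (sqrt e *R w)) \<bullet> (N' *v (- (sqrt e *R w))) = e * (w \<bullet> (N' *v w))" for N' :: "real^'n^'n"
  proof -
   have "N' *v (- (sqrt e *R w)) = - (sqrt e *R (N' *v w))"
    by (metis matrix_vector_mult_scaleR scaleR_minus_left)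
   thus ?thesis using e by simp
  qed
  thus ?thesis using e unfolding qk_def by (simp add: exp_add[symmetric])
 qed
 have "AK e fi z = abs (sqrt e) ^ CARD('n) * BI LB (%w. fi (z + sqrt e *R w) * qk (N (z + sqrt e *R w)) e (z - (z + sqrt e *R w)))"
  unfolding AK_def by (rule lborel_affine_integrals(2)[OF s]) measurable
 also have "... = abs (sqrt e) ^ CARD('n) * BI LB (%w. exp (- (CARD('n) / 2 * ln e)) * (fi (z + sqrt e *R w) * exp (- (w \<bullet> (N (z + sqrt e *R w) *v w) / 2))))"
  unfolding q by (simp add: mult.left_commute)
 also have "... = (abs (sqrt e) ^ CARD('n) * exp (- (CARD('n) / 2 * ln e))) * BI LB (%w. fi (z + sqrt e *R w) * exp (- (w \<bullet> (N (z + sqrt e *R w) *v w) / 2)))"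
  by simp
 finally show ?thesis unfolding x by simp
qed

lemma parametrix:
 assumes st: "0 <= s" "s < t" "t <= s + 1" and psi: "bddF s psi" and phi: "bcont K fi"
  and D: "!!v. s <= v ==> v < t ==> abs (EE (%w. psi w * BK (t - v) fi (Y v w))) <= D / sqrt (t - v)" and D0: "0 <= D"
 shows "abs (EE (%w. psi w * (fi (Y t w) * kap (Y t w))) - EE (%w. psi w * AK (t - s) fi (Y s w))) <= 2 * D * sqrt (t - s)"
proof -
 define e where "e n = (t - s) / real (Suc n)" for n
 have e: "0 < e n" "e n <= t - s" for n
  using st mult_left_mono[of 1 "real (Suc n)" "t - s"] by (auto simp: e_def divide_simps)
 have el: "e ----> 0" unfolding e_def by (rule LIMSEQ_Suc[OF lim_const_over_n])
 hence sl: "(%n. sqrt (e n)) ----> 0" using tendsto_real_sqrt by fastforce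
 obtain P where P: "0 <= P" "!!w. w : space M ==> abs (psi w) <= P" using bddF_bound[OF psi] by blast
 have [measurable]: "psi : borel_measurable M" using bddF_D[OF psi] by auto
 have AKm[measurable]: "AK ta fi : BB" if "0 < ta" for ta using bcontD(1)[OF AK_bcont[OF phi that]] .
 have [measurable]: "kap : BB" "fi : BB"
  using kap_continuous bcontD[OF phi] by (auto intro: borel_measurable_continuous_onI)
 have "(%n. EE (%w. psi w * AK (e n) fi (Y (t - e n) w))) ----> EE (%w. psi w * (fi (Y t w) * kap (Y t w)))"
 proof (rule integral_dominated_convergence[where w="%_. P * (cq * K)"])
  show "AE w in M. norm (psi w * AK (e i) fi (Y (t - e i) w)) <= P * (cq * K)" for i
   using P AK_bound(3)[OF bcontD(1,2)[OF phi] e(1)] by (auto intro!: AE_I2 mult_mono simp: abs_mult)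
  show "AE w in M. (%i. psi w * AK (e i) fi (Y (t - e i) w)) ----> psi w * (fi (Y t w) * kap (Y t w))"
  proof (rule AE_I2)
   fix w assume w: "w : space M"
   have "(%n. Y (t - e n) w) ----> Y (t - 0) w"
    by (rule continuous_on_tendsto_compose[OF Y_continuous[OF w, of UNIV]]) (intro tendsto_diff tendsto_const el, auto)
   hence "(%n. Y (t - e n) w) ----> Y t w" by simp
   from kernel_limit[OF phi sl this] show "(%i. psi w * AK (e i) fi (Y (t - e i) w)) ----> psi w * (fi (Y t w) * kap (Y t w))"
    unfolding AK_scaled[OF phi e(1)] by (intro tendsto_mult tendsto_const)
  qed
 qed (use AKm e in auto)
 hence "(%n. abs (EE (%w. psi w * AK (e n) fi (Y (t - e n) w)) - EE (%w. psi w * AK (t - s) fi (Y s w)))) ---->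
  abs (EE (%w. psi w * (fi (Y t w) * kap (Y t w))) - EE (%w. psi w * AK (t - s) fi (Y s w)))"
  by (intro tendsto_rabs tendsto_diff tendsto_const)
 thus ?thesis by (rule LIMSEQ_le_const2) (use parametrix_identity[OF st(1,3) e psi phi D D0] in auto)
qed

end

text \<open>Indicators of open sets inside \<open>V\<close> are increasing limits of truncated
  distance functions that vanish outside \<open>V\<close>; outer regularity of the finite measure
  \<nu> extends the comparison to Borel sets. A set \<open>V\<close> smaller than the space serves
  the local lower bound.\<close>

lemma nn_integral_le_of_continuous:
 fixes \<mu> \<nu> :: "(real^'n::finite) measure"
 assumes sets: "sets \<mu> = sets borel" "sets \<nu> = sets borel" and fin: "emeasure \<nu> UNIV ~= \<infinity>" and V: "open V" "emeasure \<mu> (- V) = 0"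
  and le: "!!fi. continuous_on UNIV fi ==> (!!x. 0 <= fi x & fi x <= 1) ==> (!!x. x \<notin> V ==> fi x = 0) ==> (NI \<mu> (%x. ennreal (fi x))) <= NI \<nu> (%x. ennreal (fi x))"
 shows "NI \<mu> (%x. f x) <= NI \<nu> (%x. f x)"
proof (rule nn_integral_mono_measure)
 have sp: "space \<mu> = UNIV" "space \<nu> = UNIV" using sets[THEN sets_eq_imp_space_eq] by auto
 have op': "emeasure \<mu> U <= emeasure \<nu> U" if U: "open U" "U <= V" for U
 proof (cases "U = UNIV")
  \<comment> \<open>The distance to the empty set is 0 by convention, so the whole space is treated
    apart.\<close>
  case True
  have "NI \<mu> (%x. ennreal 1) <= NI \<nu> (%x. ennreal 1)" by (rule le) (use True U in auto)
  thus ?thesis using True sp by simp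
 next
  case False
  have cl: "closed (- U)" "- U ~= {}" using U False by auto
  define fi where "fi k x = min 1 (real k * infdist x (- U))" for k x
  have Ub: "U : sets borel" using U by auto
  have le1: "NI \<mu> (%x. ennreal (fi k x)) <= emeasure \<nu> U" for k
  proof -
   have "NI \<mu> (%x. ennreal (fi k x)) <= NI \<nu> (%x. ennreal (fi k x))"
    proof (rule le)
    show "fi k x = 0" if "x \<notin> V" for x using that U by (subst fi_def, subst infdist_zero) auto
   qed (auto simp: fi_def infdist_nonneg intro!: continuous_intros)
   also have "... <= NI \<nu> (%x. indicator U x)"
    by (intro nn_integral_mono) (auto simp: fi_def ennreal_1[symmetric] indicator_def simp del: ennreal_1 intro!: ennreal_leI)
   finally show ?thesis using Ub sets by simp
  qed
  have "(%k. NI \<mu> (%x. ennreal (fi k x))) ----> (NI \<mu> (%x. indicator U x))"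
  proof (rule nn_integral_LIMSEQ)
   show "incseq (%k x. ennreal (fi k x))"
    by (intro incseq_SucI le_funI ennreal_leI) (unfold fi_def, intro min.mono mult_right_mono, auto simp: infdist_nonneg)
   have "continuous_on UNIV (fi k)" for k by (auto simp: fi_def intro!: continuous_intros)
   hence "fi k : borel_measurable \<mu>" for k unfolding measurable_cong_sets[OF sets(1) refl] by (rule borel_measurable_continuous_onI)
   thus "(%x. ennreal (fi k x)) : borel_measurable \<mu>" for k by measurable
   show "(%k. ennreal (fi k x)) ----> indicator U x" for x
   proof (cases "x : U")
    case True
    hence p: "0 < infdist x (- U)" using infdist_pos_not_in_closed[OF cl] by simp
    obtain n where n: "1 <= real n * infdist x (- U)"
     using real_arch_simple[of "1 / infdist x (- U)"] p by (auto simp: divide_simps)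
    have "fi k x = 1" if "n <= k" for k
     using order.trans[OF n mult_right_mono[of "real n" "real k" "infdist x (- U)"]] that p by (simp add: fi_def)
    hence "\<forall>\<^sub>F k in sequentially. ennreal (fi k x) = indicator U x" using True by (auto simp: eventually_sequentially)
    thus ?thesis by (rule tendsto_eventually)
   qed (simp add: fi_def)
  qed
  hence "NI \<mu> (%x. indicator U x) <= emeasure \<nu> U" using le1 by (intro LIMSEQ_le_const2) auto
  thus ?thesis using Ub sets by simp
 qed
 have op: "emeasure \<mu> U <= emeasure \<nu> U" if U: "open U" for U
 proof -
  have "emeasure \<mu> U = emeasure \<mu> (U Int V)"
   by (rule emeasure_eq_AE) (use AE_not_in[OF null_setsI[OF V(2)]] U V sets in auto)
  also have "... <= emeasure \<nu> (U Int V)" by (rule op') (use U V in auto)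
  also have "... <= emeasure \<nu> U" by (rule emeasure_mono) (use U sets in auto)
  finally show ?thesis .
 qed
 have "emeasure \<mu> A <= emeasure \<nu> A" if A: "A : sets \<mu>" for A
 proof -
  have Ab: "A : sets borel" using A sets by simp
  have "emeasure \<nu> A = (INF U \<in> {U. A <= U & open U}. emeasure \<nu> U)"
   by (rule outer_regular[OF sets(2) _ Ab]) (use fin sp in simp)
  also have "emeasure \<mu> A <= ..."
  proof (rule INF_greatest)
   fix U assume "U : {U. A <= U & open U}"
   hence U: "A <= U" "open U" by auto
   have "emeasure \<mu> A <= emeasure \<mu> U" by (rule emeasure_mono) (use U sets in auto)
   thus "emeasure \<mu> A <= emeasure \<nu> U" using op[OF U(2)] by simp
  qed
  finally show ?thesis .
 qed
 thus "\<mu> <= \<nu>" using sets by (simp add: le_measure)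
 show "sets \<mu> = sets \<nu>" using sets by simp
qed

lemma (in prob_space) expectation_bounded:
 fixes f :: "'a => real"
 assumes "!!w. w : space M ==> abs (f w) <= c" "0 <= c" shows "abs (EE f) <= c"
proof (cases "integrable M f")
 case True
 hence "EE (%w. abs (f w)) <= c" using assms(1) by (intro integral_le_const AE_I2) auto
 thus ?thesis by (rule order.trans[OF integral_abs_bound])
qed (use assms(2) in "simp add: not_integrable_integral_eq")

context elliptic_sde begin

lemma G_conv:
 assumes "0 < si" "0 < ta"
 shows "NI LB (%y. ennreal (G si (x - y)) * ennreal (G ta y)) = ennreal (G (si + ta) x)"
proof -
 let ?f = "%i v. ennreal (normal_density 0 (sqrt (2 * A^2 * si)) (x $ i - v) * normal_density 0 (sqrt (2 * A^2 * ta)) v)"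
 have s: "0 < sqrt (2 * A^2 * si)" "0 < sqrt (2 * A^2 * ta)" using assms pos by auto
 have e: "sqrt ((sqrt (2 * A^2 * si))^2 + (sqrt (2 * A^2 * ta))^2) = sqrt (2 * A^2 * (si + ta))" using assms by (simp add: distrib_left)
 have "NI LB (%y. ennreal (G si (x - y)) * ennreal (G ta y)) = NI (LB :: (real^'n) measure) (%y. (PROD i:UNIV. ?f i (y $ i)))"
  by (simp add: G_def gauss_def prod_ennreal prod_nonneg ennreal_mult[symmetric] prod.distrib)
 also have "... = (PROD i:UNIV. NI LB (%v. ?f i v))" by (rule nn_integral_vec_prod) measurable
 also have "... = (PROD i:UNIV. ennreal (normal_density 0 (sqrt (2 * A^2 * (si + ta))) (x $ i)))"
  by (rule prod.cong[OF refl]) (simp only: fun_cong[OF conv_normal_density_zero_mean[OF s]] e)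
 also have "... = ennreal (G (si + ta) x)" by (simp add: G_def gauss_def prod_ennreal)
 finally show ?thesis .
qed

section \<open>Upper bound and uniqueness\<close>

definition GN :: "real => (real^'n => ennreal) => real^'n => ennreal" where
 "GN ta f z = NI LB (%y. f y * ennreal (G ta (z - y)))"

lemma GN_measurable[measurable (raw)]:
 assumes [measurable]: "f : BB" "z : borel_measurable M'"
 shows "(%x. GN ta f (z x)) : borel_measurable M'"
 unfolding GN_def by measurable

lemma GN_GC:
 assumes "fi : BB" "!!x. 0 <= fi x" "!!x. abs (fi x) <= K" "0 < ta"
 shows "GN ta (%x. ennreal (fi x)) z = ennreal (GC ta fi z)"
proof -
 have "integrable LB (%y. fi y * G ta (z - y))"
  using kernel_integrable(1)[of fi K "%y. G ta (z - y)" 1 ta z] assms by simp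
 hence "ennreal (GC ta fi z) = NI LB (%y. ennreal (fi y * G ta (z - y)))"
  unfolding GC_def using assms(2) by (subst nn_integral_eq_integral) auto
 thus ?thesis using assms(2) by (simp add: GN_def ennreal_mult)
qed

lemma GN_semigroup:
 assumes [measurable]: "f : BB" and t: "0 < si" "0 < ta"
 shows "GN si (GN ta f) z = GN (si + ta) f z"
proof -
 have "GN si (GN ta f) z = NI LB (%y. (NI LB (%x. f x * ennreal (G ta (y - x)) * ennreal (G si (z - y)))))"
  unfolding GN_def by (subst nn_integral_multc[symmetric]) auto
 also have "... = NI LB (%x. (NI LB (%y. f x * ennreal (G ta (y - x)) * ennreal (G si (z - y)))))"
  by (rule lborel_pair.Fubini') measurable
 also have "... = NI LB (%x. f x * NI LB (%y. ennreal (G si (z - y)) * ennreal (G ta (y - x))))"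
  by (subst nn_integral_cmult[symmetric]) (auto simp: mult_ac)
 also have "... = GN (si + ta) f z" unfolding GN_def
 proof (rule nn_integral_cong)
  fix x :: "real^'n"
  have "NI LB (%y. ennreal (G si (z - y)) * ennreal (G ta (y - x))) = NI LB (%y. ennreal (G si (z - x - y)) * ennreal (G ta y))"
   by (subst (2) lborel_distr_plus[of "- x", symmetric], subst nn_integral_distr) (auto simp: algebra_simps)
  thus "f x * NI LB (%y. ennreal (G si (z - y)) * ennreal (G ta (y - x))) = f x * ennreal (G (si + ta) (z - x))"
   using G_conv[OF t, of "z - x"] by simp
 qed
 finally show ?thesis .
qed

lemma GC_semigroup:
 assumes phi: "bcont K fi" "!!x. 0 <= fi x" and t: "0 < si" "0 < ta" shows "GC si (GC ta fi) z = GC (si + ta) fi z"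
proof -
 note p = bcontD(1)[OF phi(1)] phi(2) bcontD(2)[OF phi(1)]
 have g: "bcont K (GC ta fi)" "!!x. 0 <= GC ta fi x" using GC_bcont[OF phi t(2)] by auto
 have 1: "GN ta (%x. ennreal (fi x)) = (%z. ennreal (GC ta fi z))" using GN_GC[OF p t(2)] by auto
 have "ennreal (GC si (GC ta fi) z) = GN si (%z. ennreal (GC ta fi z)) z" using GN_GC[OF bcontD(1)[OF g(1)] g(2) bcontD(2)[OF g(1)] t(1)] by simp
 also have "... = GN (si + ta) (%x. ennreal (fi x)) z" unfolding 1[symmetric] by (rule GN_semigroup) (use p(1) t in auto)
 also have "... = ennreal (GC (si + ta) fi z)" using GN_GC[OF p] t by simp
 finally show ?thesis using GC_bcont(2)[OF phi, of "si + ta"] GC_bcont(2)[OF g, of si] t by (subst (asm) ennreal_inj) auto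
qed

definition "c1 = cq / k1 + 1"
definition "t0 = (k1 / (4 * (CH + k1)))^2"

lemma c1: "1 <= c1" "c1 * k1 = cq + k1" using cq_pos k_pos by (auto simp: c1_def field_simps)

lemma t0: "0 < t0" "t0 <= 1" "4 * (CH * sqrt t0) <= k1" (is ?A)
proof -
 let ?r = "k1 / (4 * (CH + k1))"
 have r: "0 < ?r" "?r <= 1" using k_pos CH_nonneg by (auto simp: field_simps intro!: divide_pos_pos)
 thus "0 < t0" "t0 <= 1" by (auto simp: t0_def power_le_one)
 have "sqrt t0 = ?r" unfolding t0_def by (rule real_sqrt_unique) (use r in auto)
 hence "4 * (CH * sqrt t0) + 4 * (k1 * sqrt t0) = k1" using k_pos CH_nonneg by (simp add: divide_simps) (simp add: algebra_simps)
 moreover have "0 <= k1 * sqrt t0" using k_pos \<open>0 < t0\<close> by simp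
 ultimately show ?A by simp
qed

lemma psi_integrable:
 assumes psi: "bddF s psi" and h[measurable]: "h : BB" and b: "!!x. abs (h x) <= k"
 shows "integrable M (%w. psi w * h (Y t w))"
proof -
 note [measurable] = bddF_D(2)[OF psi]
 obtain P where P: "0 <= P" "!!w. w : space M ==> abs (psi w) <= P" using bddF_bound[OF psi] by blast
 have "norm (psi w * h (Y t w)) <= P * k" if "w : space M" for w
  using P(2)[OF that] b[of "Y t w"] P(1) unfolding real_norm_def abs_mult by (intro mult_mono) auto
 thus ?thesis by (intro integrable_const_bound[of _ "P * k"]) auto
qed

lemma expectation_mono_bdd:
 assumes psi: "bddF s psi" "!!w. 0 <= psi w" and f: "bcont K f" "bcont K' g" "!!x. f x <= c * g x" "0 <= c" and t: "0 <= t"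
 shows "EE (%w. psi w * f (Y t w)) <= c * EE (%w. psi w * g (Y t w))"
proof -
 have i: "integrable M (%w. psi w * f (Y t w))" "integrable M (%w. psi w * g (Y t w))"
  using psi_integrable[OF psi(1)] bcontD(1,2)[OF f(1)] bcontD(1,2)[OF f(2)] by blast+
 have "EE (%w. psi w * f (Y t w)) <= EE (%w. c * (psi w * g (Y t w)))"
 proof (rule integral_mono[OF i(1)])
  show "psi w * f (Y t w) <= c * (psi w * g (Y t w))" for w using mult_left_mono[OF f(3) psi(2), of w "Y t w"] by (simp add: mult_ac)
 qed (use i in simp)
 thus ?thesis by simp
qed

lemma BK_domination:
 assumes psi: "bddF s psi" "!!w. 0 <= psi w" and phi: "bcont K fi" "!!x. 0 <= fi x" and t: "0 < ta" "ta <= 1" "0 <= v"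
  and Z: "EE (%w. psi w * GC ta fi (Y v w)) <= Z"
 shows "abs (EE (%w. psi w * BK ta fi (Y v w))) <= CH / sqrt ta * Z"
proof -
 note bb = BK_bcont[OF phi(1) t(1,2)] and gg = GC_bcont[OF phi t(1)]
 have nb: "bcont (CH / sqrt ta * K) (%x. - BK ta fi x)" using bb by (auto simp: bcont_def intro: continuous_on_minus)
 have "abs (BK ta fi x) <= CH / sqrt ta * GC ta fi x" for x
  using BK_bound(2)[OF bcontD(1,2)[OF phi(1)] t(1,2), of x] phi(2) by simp
 hence le: "BK ta fi x <= CH / sqrt ta * GC ta fi x" "- BK ta fi x <= CH / sqrt ta * GC ta fi x" for x
  by (meson abs_le_D1 abs_le_D2)+
 have v0: "0 <= CH / sqrt ta" using CH_nonneg t by auto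
 have "EE (%w. psi w * BK ta fi (Y v w)) <= CH / sqrt ta * Z" "EE (%w. psi w * - BK ta fi (Y v w)) <= CH / sqrt ta * Z"
  using expectation_mono_bdd[OF psi bb gg(1) le(1) v0 t(3)] expectation_mono_bdd[OF psi nb gg(1) le(2) v0 t(3)] mult_left_mono[OF Z v0] by auto
 thus ?thesis by (simp add: abs_le_iff)
qed

text \<open>Inserting the bound into the parametrix error halves the last term, hence the powers of 1/2.\<close>
lemma claim_upper:
 assumes "0 <= s" "s < t" "t <= s + t0" "bddF s psi" "!!w. 0 <= psi w" "bcont K fi" "!!x. 0 <= fi x"
 shows "EE (%w. psi w * fi (Y t w)) <= 2 * c1 * EE (%w. psi w * GC (t - s) fi (Y s w)) + (1/2)^n * K * EE psi"
 using assms
proof (induction n arbitrary: t fi s psi)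
 case 0
 have "EE (%w. psi w * fi (Y t w)) <= K * EE (%w. psi w * 1)"
  by (rule expectation_mono_bdd[OF 0(4,5,6), where K'=1]) (use 0 bcontD(2,4)[OF 0(6)] in "auto simp: bcont_def intro: order.trans[OF abs_ge_self]")
 moreover have "0 <= EE (%w. psi w * GC (t - s) fi (Y s w))"
  using 0 GC_bcont(2)[OF 0(6,7)] by (intro integral_nonneg' mult_nonneg_nonneg) auto
 hence "0 <= 2 * c1 * EE (%w. psi w * GC (t - s) fi (Y s w))" using c1(1) by simp
 ultimately show ?case by simp
next
 case (Suc n)
 note st = Suc.prems(1-3) and psi = Suc.prems(4,5) and phi = Suc.prems(6,7)
 have K: "0 <= K" using bcontD(4)[OF phi(1)] .
 define g where "g = EE (%w. psi w * GC (t - s) fi (Y s w))"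
 define r where "r = (1/2)^n * K * EE psi"
 define Z where "Z = 2 * c1 * g + r"
 have g: "0 <= g" unfolding g_def
  using st psi GC_bcont(2)[OF phi] by (intro integral_nonneg' mult_nonneg_nonneg) auto
 have r: "0 <= r" unfolding r_def using K psi(2) by (intro mult_nonneg_nonneg integral_nonneg') auto
 have gZ: "g <= Z" using g r mult_right_mono[OF c1(1) g] by (simp add: Z_def)
 \<comment> \<open>By the semigroup property every intermediate time leads back to the same Gaussian
   average at time \<open>s\<close>.\<close>
 have ZI: "EE (%w. psi w * GC (t - v) fi (Y v w)) <= Z" if v: "s <= v" "v < t" for v
 proof (cases "v = s")
  case True thus ?thesis using gZ by (simp add: g_def)
 next
  case False
  have "EE (%w. psi w * GC (t - v) fi (Y v w)) <= 2 * c1 * EE (%w. psi w * GC (v - s) (GC (t - v) fi) (Y s w)) + (1/2)^n * K * EE psi"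
   by (rule Suc.IH) (use v st False psi GC_bcont[OF phi] in auto)
  also have "GC (v - s) (GC (t - v) fi) = GC (t - s) fi" using GC_semigroup[OF phi, of "v - s" "t - v"] v False by auto
  finally show ?thesis by (simp add: Z_def g_def r_def)
 qed
 have par: "abs (EE (%w. psi w * (fi (Y t w) * kap (Y t w))) - EE (%w. psi w * AK (t - s) fi (Y s w))) <= 2 * (CH * Z) * sqrt (t - s)"
 proof (rule parametrix[OF st(1,2) _ psi(1) phi(1)])
  show "t <= s + 1" using st t0 by simp
  show "0 <= CH * Z" using CH_nonneg g gZ by simp
  fix v assume v: "s <= v" "v < t"
  have "abs (EE (%w. psi w * BK (t - v) fi (Y v w))) <= CH / sqrt (t - v) * Z"
   by (rule BK_domination[OF psi phi _ _ _ ZI[OF v]]) (use v st t0 in auto)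
  thus "abs (EE (%w. psi w * BK (t - v) fi (Y v w))) <= CH * Z / sqrt (t - v)" by simp
 qed
 have A1: "EE (%w. psi w * AK (t - s) fi (Y s w)) <= cq * g"
  unfolding g_def
 proof (rule expectation_mono_bdd[OF psi AK_bcont[OF phi(1)] GC_bcont(1)[OF phi]])
  show "AK (t - s) fi x <= cq * GC (t - s) fi x" for x
   using AK_bound(2)[OF bcontD(1,2)[OF phi(1)], of "t - s" x] st phi(2) by auto
 qed (use st cq_pos in auto)
 have kb: "bcont (K * k2) (%x. fi x * kap x)" unfolding bcont_def
  using bcontD[OF phi(1)] kap_bounds k_pos by (auto intro!: continuous_on_mult kap_continuous mult_mono simp: abs_mult order.trans[OF less_imp_le[OF k_pos(1)] kap_bounds(1)])
 have "EE (%w. psi w * fi (Y t w)) <= 1 / k1 * EE (%w. psi w * (fi (Y t w) * kap (Y t w)))"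
 proof (rule expectation_mono_bdd[OF psi phi(1) kb])
  show "fi x <= 1 / k1 * (fi x * kap x)" for x
   using mult_left_mono[OF kap_bounds(1) phi(2)[of x]] k_pos by (simp add: field_simps)
 qed (use st k_pos in auto)
 hence "k1 * EE (%w. psi w * fi (Y t w)) <= EE (%w. psi w * (fi (Y t w) * kap (Y t w)))" using k_pos by (simp add: field_simps)
 also have "... <= cq * g + 2 * (CH * Z) * sqrt (t - s)" using par A1 by linarith
 also have "2 * (CH * Z) * sqrt (t - s) <= 2 * (CH * Z) * sqrt t0" using st CH_nonneg g gZ by (intro mult_left_mono) auto
 also have "cq * g + 2 * (CH * Z) * sqrt t0 <= c1 * k1 * g + k1 / 2 * Z"
  using mult_right_mono[OF t0(3), of Z] mult_nonneg_nonneg[OF g less_imp_le[OF k_pos(1)]] order.trans[OF g gZ] c1(2) by (simp add: distrib_right distrib_left mult_ac)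
 also have "... = k1 * (2 * c1 * g + r / 2)" by (simp add: Z_def algebra_simps)
 finally have "EE (%w. psi w * fi (Y t w)) <= 2 * c1 * g + r / 2" using k_pos by simp
 thus ?case by (simp add: g_def r_def)
qed

lemma expectation_nn:
 assumes "p : borel_measurable M" "!!w. 0 <= p w" "!!w. w : space M ==> p w <= K"
 shows "NI M (%w. ennreal (p w)) = ennreal (EE p)"
 using assms by (intro nn_integral_eq_integral integrable_const_bound[of _ K]) auto

lemma psi_law:
 assumes [measurable]: "p : borel_measurable M" "f : BB"
 shows "NI (distr (density M p) borel (Y t)) (%x. f x) = NI M (%w. p w * f (Y t w))"
 by (subst nn_integral_distr) (auto simp: nn_integral_density)

lemma heat_fubini:
 assumes [measurable]: "p : borel_measurable M" "f : BB"
 shows "NI LB (%y. (NI M (%w. p w * ennreal (G ta (Y s w - y)))) * f y) = NI M (%w. p w * GN ta f (Y s w))"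
proof -
 interpret P: pair_sigma_finite M "LB :: (real^'n) measure" ..
 have "NI LB (%y. (NI M (%w. p w * ennreal (G ta (Y s w - y)))) * f y) = NI LB (%y. (NI M (%w. p w * ennreal (G ta (Y s w - y)) * f y)))"
  by (subst nn_integral_multc) auto
 also have "... = NI M (%w. (NI LB (%y. p w * ennreal (G ta (Y s w - y)) * f y)))" by (rule P.Fubini') measurable
 also have "... = NI M (%w. p w * GN ta f (Y s w))" unfolding GN_def by (subst nn_integral_cmult[symmetric]) (auto simp: mult_ac)
 finally show ?thesis .
qed

lemma heat_continuous:
 assumes "0 <= s" "s < t" "t <= s + t0" "bddF s psi" "!!w. 0 <= psi w" "bcont K fi" "!!x. 0 <= fi x"
 shows "EE (%w. psi w * fi (Y t w)) <= 2 * c1 * EE (%w. psi w * GC (t - s) fi (Y s w))"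
proof -
 have "(%n. 2 * c1 * EE (%w. psi w * GC (t - s) fi (Y s w)) + (1/2)^n * (K * EE psi)) ----> 2 * c1 * EE (%w. psi w * GC (t - s) fi (Y s w)) + 0 * (K * EE psi)"
  by (intro tendsto_intros LIMSEQ_power_zero) auto
 hence "EE (%w. psi w * fi (Y t w)) <= 2 * c1 * EE (%w. psi w * GC (t - s) fi (Y s w)) + 0 * (K * EE psi)"
  by (rule LIMSEQ_le_const) (use claim_upper[OF assms] in "auto simp: mult.assoc")
 thus ?thesis by simp
qed

text \<open>For continuous functions the bound compares two measures, the second of finite mass; so
  it extends to all nonnegative Borel functions, bounded or not.\<close>

lemma heat:
 assumes st: "0 <= s" "s < t" "t <= s + t0" and psi: "bddF s psi" "!!w. 0 <= psi w" and f[measurable]: "f : BB"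
 shows "NI M (%w. ennreal (psi w) * f (Y t w)) <= ennreal (2 * c1) * NI M (%w. ennreal (psi w) * GN (t - s) f (Y s w))"
proof -
 note [measurable] = bddF_D(2)[OF psi(1)]
 obtain P where P: "0 <= P" "!!w. w : space M ==> abs (psi w) <= P" using bddF_bound[OF psi(1)] by blast
 define \<nu> where "\<nu> = density LB (%y. ennreal (2 * c1) * NI M (%w. ennreal (psi w) * ennreal (G (t - s) (Y s w - y))))"
 have nu: "NI \<nu> (%x. h x) = ennreal (2 * c1) * NI M (%w. ennreal (psi w) * GN (t - s) h (Y s w))" if [measurable]: "h : BB" for h
  unfolding \<nu>_def by (subst nn_integral_density) (auto simp: mult.assoc nn_integral_cmult heat_fubini)
 have key: "NI (distr (density M (%w. ennreal (psi w))) borel (Y t)) (%x. ennreal (fi x)) <= NI \<nu> (%x. ennreal (fi x))"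
  if phi: "continuous_on UNIV fi" "!!x. 0 <= fi x & fi x <= 1" for fi
 proof -
  have b: "bcont 1 fi" "!!x. 0 <= fi x" using phi by (auto simp: bcont_def abs_le_iff intro: order.trans[of _ 0])
  have ts: "0 < t - s" using st by simp
  note g = GC_bcont[OF b ts] and [measurable] = bcontD(1)[OF b(1)] bcontD(1)[OF GC_bcont(1)[OF b ts]]
  have pb: "0 <= psi w * fi (Y t w)" "0 <= psi w * GC (t - s) fi (Y s w)" for w using psi b g by auto
  have pu: "psi w * fi (Y t w) <= P * 1" "psi w * GC (t - s) fi (Y s w) <= P * 1" if "w : space M" for w
   using P(2)[OF that] P(1) psi(2)[of w] bcontD(2)[OF b(1), of "Y t w"] bcontD(2)[OF g(1), of "Y s w"] b(2) g(2) by (intro mult_mono; simp)+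
  have 1: "NI M (%w. ennreal (psi w * fi (Y t w))) = ennreal (EE (%w. psi w * fi (Y t w)))"
   by (rule expectation_nn[OF _ pb(1) pu(1)]) measurable
  have 2: "NI M (%w. ennreal (psi w * GC (t - s) fi (Y s w))) = ennreal (EE (%w. psi w * GC (t - s) fi (Y s w)))"
   by (rule expectation_nn[OF _ pb(2) pu(2)]) measurable
  have "ennreal (EE (%w. psi w * fi (Y t w))) <= ennreal (2 * c1) * ennreal (EE (%w. psi w * GC (t - s) fi (Y s w)))"
   using c1(1) pb heat_continuous[OF st psi b] by (subst ennreal_mult[symmetric]) (auto intro!: ennreal_leI integral_nonneg')
  moreover have "GN (t - s) (%x. ennreal (fi x)) z = ennreal (GC (t - s) fi z)" for z by (rule GN_GC[OF _ b(2) bcontD(2)[OF b(1)] ts]) measurable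
  ultimately show ?thesis using psi(2) b(2) g(2) by (simp add: psi_law nu 1[symmetric] 2[symmetric] ennreal_mult)
 qed
 have "emeasure \<nu> UNIV = NI \<nu> (%x. 1)" by (simp add: \<nu>_def)
 also have "... = ennreal (2 * c1) * NI M (%w. ennreal (psi w))" using st G_nn(2) by (subst nu) (auto simp: GN_def)
 also have "... ~= \<infinity>"
  using expectation_nn[of psi P] P psi by (auto simp: abs_le_iff ennreal_mult_eq_top_iff)
 finally have fin: "emeasure \<nu> UNIV ~= \<infinity>" .
 have "NI (distr (density M (%w. ennreal (psi w))) borel (Y t)) (%x. f x) <= NI \<nu> (%x. f x)"
  by (rule nn_integral_le_of_continuous[OF _ _ fin open_UNIV _ key]) (auto simp: \<nu>_def)
 thus ?thesis by (simp add: psi_law nu)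
qed

text \<open>The conditional expectation of \<open>eta\<close> given \<open>Y s\<close> vanishes,
  expressed through test functions.\<close>

definition null :: "real => ('w => real) => bool" where
 "null s eta \<longleftrightarrow> bddF s eta & (ALL f K. f : borel_measurable borel --> (ALL x. abs (f x) <= K) --> EE (%w. eta w * f (Y s w)) = 0)"

text \<open>Testing with continuous functions shows that the positive and the negative part of
  \<open>eta\<close> give \<open>Y s\<close> the same image measure. A bounded Borel function is
  then shifted by its bound to become nonnegative.\<close>

lemma nullI:
 assumes eta: "bddF s eta" and z: "!!fi K. bcont K fi ==> EE (%w. eta w * fi (Y s w)) = 0"
 shows "null s eta"
 unfolding null_def
proof (intro conjI eta allI impI)
 fix f :: "real^'n => real" and K assume f: "f : BB" "ALL x. abs (f x) <= K"
 note [measurable] = bddF_D(2)[OF eta] f(1)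
 obtain P where P: "0 <= P" "!!w. w : space M ==> abs (eta w) <= P" using bddF_bound[OF eta] by blast
 define p q where "p w = max 0 (eta w)" and "q w = max 0 (- eta w)" for w
 have [measurable]: "p : borel_measurable M" "q : borel_measurable M" unfolding p_def q_def by measurable
 have pq: "eta w = p w - q w" "0 <= p w" "0 <= q w" for w by (auto simp: p_def q_def)
 have pqP: "p w <= P" "q w <= P" if "w : space M" for w using P(1) P(2)[OF that] by (auto simp: p_def q_def)
 have int: "integrable M (%w. p w * h (Y s w))" "integrable M (%w. q w * h (Y s w))"
  and nn: "(!!x. 0 <= h x) ==> (NI M (%w. ennreal (p w) * ennreal (h (Y s w)))) = ennreal (EE (%w. p w * h (Y s w)))"
   "(!!x. 0 <= h x) ==> (NI M (%w. ennreal (q w) * ennreal (h (Y s w)))) = ennreal (EE (%w. q w * h (Y s w)))"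
  if h[measurable]: "h : BB" and b: "!!x. abs (h x) <= k" for h k
 proof -
  have "norm (p w * h (Y s w)) <= P * k & norm (q w * h (Y s w)) <= P * k" if "w : space M" for w
   using pqP[OF that] pq b[of "Y s w"] P(1) by (auto simp: abs_mult intro!: mult_mono)
  thus i: "integrable M (%w. p w * h (Y s w))" "integrable M (%w. q w * h (Y s w))"
   by (auto intro!: integrable_const_bound[of _ "P * k"])
  show "NI M (%w. ennreal (p w) * ennreal (h (Y s w))) = ennreal (EE (%w. p w * h (Y s w)))"
   "NI M (%w. ennreal (q w) * ennreal (h (Y s w))) = ennreal (EE (%w. q w * h (Y s w)))" if "!!x. 0 <= h x"
   using nn_integral_eq_integral[OF i(1)] nn_integral_eq_integral[OF i(2)] pq that by (auto simp: ennreal_mult)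
 qed
 have eq: "EE (%w. p w * fi (Y s w)) = EE (%w. q w * fi (Y s w))" if b: "bcont k fi" for fi k
 proof -
  have "EE (%w. p w * fi (Y s w) - q w * fi (Y s w)) = 0" using z[OF b] by (simp add: pq left_diff_distrib)
  thus ?thesis using integral_diff'[OF int[OF bcontD(1,2)[OF b]]] by simp
 qed
 let ?D = "%u. distr (density M (%w. ennreal (u w))) borel (Y s)"
 have fin: "emeasure (?D p) UNIV ~= \<infinity>" "emeasure (?D q) UNIV ~= \<infinity>"
 proof -
  have "emeasure (?D u) UNIV = NI M (%w. ennreal (u w))" if [measurable]: "u : borel_measurable M" for u
   using psi_law[of "%w. ennreal (u w)" "%_. 1" s] by simp
  thus "emeasure (?D p) UNIV ~= \<infinity>" "emeasure (?D q) UNIV ~= \<infinity>"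
   using expectation_nn[of p P] expectation_nn[of q P] pqP pq by auto
 qed
 have key: "NI (?D p) (%x. ennreal (fi x)) = NI (?D q) (%x. ennreal (fi x))" if phi: "continuous_on UNIV fi" "!!x. 0 <= fi x & fi x <= 1" for fi
 proof -
  have b: "bcont 1 fi" using phi by (auto simp: bcont_def abs_le_iff intro: order.trans[of _ 0])
  note [measurable] = bcontD(1)[OF b]
  show ?thesis using eq[OF b] nn[OF bcontD(1,2)[OF b]] phi(2) by (simp add: psi_law)
 qed
 have le: "NI (?D p) (%x. h x) = NI (?D q) (%x. h x)" for h
  by (rule antisym; rule nn_integral_le_of_continuous[where V=UNIV]) (use fin key in auto)
 have pos: "EE (%w. p w * h (Y s w)) = EE (%w. q w * h (Y s w))"
  if h[measurable]: "h : BB" and b: "!!x. abs (h x) <= k" "!!x. 0 <= h x" for h k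
 proof -
  have "ennreal (EE (%w. p w * h (Y s w))) = ennreal (EE (%w. q w * h (Y s w)))"
   using le[of "%x. ennreal (h x)"] nn[OF h b(1) b(2)] by (simp add: psi_law)
  thus ?thesis using pq b(2) by (subst (asm) ennreal_inj) (auto intro!: integral_nonneg')
 qed
 have K: "0 <= K" using order.trans[OF abs_ge_zero f(2)[rule_format, of 0]] .
 have fK: "abs (f x + K) <= 2 * K" "0 <= f x + K" for x using f(2)[rule_format, of x] by auto
 have 1: "EE (%w. p w * (f (Y s w) + K)) = EE (%w. q w * (f (Y s w) + K))" by (rule pos[OF _ fK]) measurable
 have 2: "EE (%w. p w * K) = EE (%w. q w * K)" by (rule pos[of "%_. K" K]) (use K in auto)
 have i: "integrable M (%w. p w * (f (Y s w) + K))" "integrable M (%w. q w * (f (Y s w) + K))" "integrable M (%w. p w * K)" "integrable M (%w. q w * K)"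
  using int[of "%x. f x + K" "2*K"] int[of "%_. K" K] fK K f(1) by auto
 have "EE (%w. eta w * f (Y s w)) = EE (%w. (p w * (f (Y s w) + K) - p w * K) - (q w * (f (Y s w) + K) - q w * K))"
  by (simp add: pq algebra_simps)
 also have "... = 0" using i 1 2 by (simp add: integral_diff' del: integral_mult_left_zero)
 finally show "EE (%w. eta w * f (Y s w)) = 0" .
qed

text \<open>Division by \<open>kap\<close> makes the parametrix speak of \<open>fi\<close> itself,
  and its main term vanishes because \<open>eta\<close> is null at \<open>s\<close>. Only the error
  is left, a time integral of terms of the same kind with \<open>BK\<close> in place of
  \<open>fi\<close>; by the choice of \<open>t0\<close> each round gains a factor 1/2. Hence
  function and bound are general in the induction.\<close>

lemma null_contraction:
 assumes "0 <= s" "s <= t" "t <= s + t0" "null s eta" "!!w. w : space M ==> abs (eta w) <= Q" "0 <= Q" "bcont K fi"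
 shows "abs (EE (%w. eta w * fi (Y t w))) <= (1/2)^n * (K * Q)"
 using assms
proof (induction n arbitrary: t K fi)
 case 0
 note K = bcontD[OF 0(7)]
 have "abs (EE (%w. eta w * fi (Y t w))) <= Q * K"
  by (rule expectation_bounded) (use 0 K in "auto simp: abs_mult intro!: mult_mono")
 thus ?case by (simp add: mult.commute)
next
 case (Suc n)
 note st = Suc.prems(1-3) and eta = Suc.prems(4,5,6) and phi = Suc.prems(7)
 have b: "bddF s eta" using eta(1) by (simp add: null_def)
 have zero: "EE (%w. eta w * f (Y s w)) = 0" if "bcont k f" for f k
  using eta(1) bcontD(1,2)[OF that] unfolding null_def by blast
 show ?case
 proof (cases "s = t")
  case True
  thus ?thesis using zero[OF phi] bcontD(4)[OF phi] eta(3) by simp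
 next
  case False
  have kp: "0 < kap x" for x using k_pos(1) kap_bounds(1)[of x] by linarith
  define f where "f x = fi x / kap x" for x
  have fb: "bcont (K / k1) f" unfolding bcont_def f_def
  proof (intro conjI allI)
   show "continuous_on UNIV (%x. fi x / kap x)"
    by (intro continuous_on_divide bcontD(3)[OF phi] kap_continuous) (use kp in "auto simp: less_imp_neq[symmetric]")
   show "abs (fi x / kap x) <= K / k1" for x
    using bcontD(2)[OF phi, of x] kap_bounds(1)[of x] k_pos(1) kp[of x] by (auto simp: abs_divide intro!: frac_le)
  qed
  define D where "D = CH * ((1/2)^n * (K / k1 * Q))"
  have D0: "0 <= D" unfolding D_def using CH_nonneg bcontD(4)[OF phi] k_pos eta(3) by auto
  have "abs (EE (%w. eta w * (f (Y t w) * kap (Y t w))) - EE (%w. eta w * AK (t - s) f (Y s w))) <= 2 * D * sqrt (t - s)"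
  proof (rule parametrix[OF st(1) _ _ b fb _ D0])
   fix v assume v: "s <= v" "v < t"
   have tv: "0 < t - v" "t - v <= 1" using v st t0 by auto
   have "abs (EE (%w. eta w * BK (t - v) f (Y v w))) <= (1/2)^n * (CH / sqrt (t - v) * (K / k1) * Q)"
    by (rule Suc.IH[OF st(1) v(1) _ eta BK_bcont[OF fb tv]]) (use v st in auto)
   thus "abs (EE (%w. eta w * BK (t - v) f (Y v w))) <= D / sqrt (t - v)" by (simp add: D_def mult_ac)
  qed (use False st t0 in auto)
  moreover have "(%w. eta w * (f (Y t w) * kap (Y t w))) = (%w. eta w * fi (Y t w))"
   unfolding f_def using less_imp_neq[OF kp, symmetric] by simp
  moreover have "EE (%w. eta w * AK (t - s) f (Y s w)) = 0" by (rule zero[OF AK_bcont[OF fb]]) (use False st in auto)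
  ultimately have "abs (EE (%w. eta w * fi (Y t w))) <= 2 * D * sqrt (t - s)" by simp
  also have "... <= 2 * D * sqrt t0" using D0 st by (intro mult_left_mono) auto
  also have "... = (4 * (CH * sqrt t0)) * ((1/2)^n * (K / k1 * Q)) / 2" by (simp add: D_def)
  also have "... <= k1 * ((1/2)^n * (K / k1 * Q)) / 2"
   by (intro divide_right_mono mult_right_mono t0) (use bcontD(4)[OF phi] k_pos eta(3) in auto)
  also have "... = (1/2)^Suc n * (K * Q)" using k_pos by simp
  finally show ?thesis .
 qed
qed

lemma null_step: assumes "0 <= s" "s <= t" "t <= s + t0" "null s eta" shows "null t eta"
proof (rule nullI)
 have b: "bddF s eta" using assms(4) by (simp add: null_def)
 thus "bddF t eta" using assms(2) by (rule bddF_mono)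
 obtain Q where Q: "0 <= Q" "!!w. w : space M ==> abs (eta w) <= Q" using bddF_bound[OF b] by blast
 fix fi K assume phi: "bcont K fi"
 have "(%n. (1/2)^n * (K * Q)) ----> 0 * (K * Q)" by (intro tendsto_intros LIMSEQ_power_zero) auto
 hence "abs (EE (%w. eta w * fi (Y t w))) <= 0 * (K * Q)"
  by (rule LIMSEQ_le_const) (use null_contraction[OF assms Q(2,1) phi] in auto)
 thus "EE (%w. eta w * fi (Y t w)) = 0" by simp
qed

text \<open>The Markov property in the form used here: what vanishes given \<open>Y s\<close> also
  vanishes given any later \<open>Y t\<close>.\<close>

lemma null_later: assumes s: "0 <= s" "s <= t" and n: "null s eta" shows "null t eta"
proof -
 have st: "null (s + real k * (t0 * u)) eta" if "0 <= u" "u <= 1" for k u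
 proof (induction k)
  case (Suc k)
  have "0 <= real k * (t0 * u)" "t0 * u <= t0" "0 <= t0 * u" using that t0 by (auto intro: mult_left_le)
  thus ?case using s by (intro null_step[OF _ _ _ Suc]) (auto simp: distrib_right)
 qed (use n in simp)
 \<comment> \<open>The interval is cut into \<open>k\<close> equal steps, with \<open>k\<close> so
   large that each is shorter than \<open>t0\<close>; in \<open>st\<close>, \<open>u\<close> is the
   fraction of \<open>t0\<close> taken per step.\<close>
 obtain k :: nat where k: "(t - s) / t0 < real k" using reals_Archimedean2 by blast
 have kp: "0 < real k" using k s t0 by (meson diff_ge_0_iff_ge divide_nonneg_pos le_less_trans)
 have "null (s + real k * (t0 * ((t - s) / t0 / real k))) eta"
  by (rule st) (use k kp s t0 in "auto simp: divide_simps mult.commute")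
 moreover have "s + real k * (t0 * ((t - s) / t0 / real k)) = t" using kp t0 by simp
 ultimately show ?thesis by simp
qed

lemma bddF_comp:
 assumes "f : BB" "!!x. abs (f x) <= K" "0 <= s" shows "bddF s (%w. f (Y s w))"
 unfolding bddF_def using assms measurable_compose[OF Y_adapted assms(1)] by auto

lemma null_mult:
 assumes n: "null s eta" and f: "f : BB" "!!x. abs (f x) <= k" and s: "0 <= s"
 shows "null s (%w. eta w * f (Y s w))"
 unfolding null_def
proof (intro conjI allI impI)
 show "bddF s (%w. eta w * f (Y s w))" using n by (intro bddF_mult bddF_comp[OF f s]) (simp add: null_def)
 fix g :: "real^'n => real" and K assume g: "g : BB" "ALL x. abs (g x) <= K"
 have "abs (f x * g x) <= k * K" for x using f(2)[of x] g(2)[rule_format, of x] by (simp add: abs_mult mult_mono')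
 moreover have "(%x. f x * g x) : BB" using f g by auto
 ultimately have "EE (%w. eta w * (f (Y s w) * g (Y s w))) = 0"
  using n[unfolded null_def, THEN conjunct2, rule_format, of "%x. f x * g x" "k * K"] by simp
 thus "EE (%w. eta w * f (Y s w) * g (Y s w)) = 0" by (simp add: mult.assoc)
qed

text \<open>The factor at the earliest time is moved into the weight, which is still null there; the
  remaining factors lie at later times and are treated in the same way.\<close>

lemma null_prod:
 assumes "finite I" "null s eta" "0 <= s" "!!i. i : I ==> s <= r i"
  and "!!i. i : I ==> f i : BB" "!!i x. i : I ==> abs (f i x) <= k"
 shows "EE (%w. eta w * (PROD i:I. f i (Y (r i) w))) = 0"
 using assms
proof (induction "card I" arbitrary: I s eta)
 case 0
 hence "I = {}" by simp
 thus ?case using 0(3)[unfolded null_def, THEN conjunct2, rule_format, of "%_. 1" 1] by simp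
next
 case (Suc n)
 hence ne: "I ~= {}" by auto
 define j where "j = arg_min_on r I"
 have j: "j : I" "!!i. i : I ==> r j <= r i"
  using arg_min_if_finite[OF Suc.prems(1) ne, of r] by (auto simp: j_def not_less)
 have rj: "0 <= r j" using Suc.prems(3) Suc.prems(4)[OF j(1)] by simp
 have nj: "null (r j) (%w. eta w * f j (Y (r j) w))"
  by (rule null_mult[OF null_later[OF Suc.prems(3) Suc.prems(4)[OF j(1)] Suc.prems(2)] Suc.prems(5)[OF j(1)] Suc.prems(6)[OF j(1)] rj])
 have "EE (%w. (eta w * f j (Y (r j) w)) * (PROD i:I - {j}. f i (Y (r i) w))) = 0"
  by (rule Suc.hyps(1)[of "I - {j}" "r j" "%w. eta w * f j (Y (r j) w)"]) (use Suc.hyps(2) Suc.prems j rj nj in auto)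
 thus ?case using Suc.prems(1) j(1) by (simp add: prod.remove mult_ac)
qed

section \<open>Lower bound and minorization\<close>

definition "elam = exp (- (1 / (2 * lam)))"
definition "r0 = min t0 ((cq * elam / (8 * (CH * c1 + 1)))^2)"
definition "rho = sqrt r0 / 2"
definition "cm = exp (- (d1 / 2 * ln r0)) * elam / (2 * k2)"
definition "ib z D = (%w. indicator D (Y z w) :: real)"

lemma r0: "0 < r0" "r0 <= t0" "8 * (CH * c1 * sqrt r0) <= cq * elam" (is ?A) and rho: "0 < rho" and cm: "0 < cm"
proof -
 let ?q = "cq * elam / (8 * (CH * c1 + 1))"
 have C: "0 <= CH * c1" using CH_nonneg c1(1) by simp
 hence q: "0 < ?q" using cq_pos by (simp add: elam_def add_nonneg_pos)
 thus r: "0 < r0" "r0 <= t0" using t0 by (auto simp: r0_def)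
 have s: "sqrt r0 <= ?q" by (rule real_le_lsqrt) (use q in "auto simp: r0_def intro: less_imp_le")
 have "8 * (CH * c1 * sqrt r0) <= 8 * ((CH * c1 + 1) * ?q)" using C s r by (intro mult_left_mono mult_mono) auto
 also have "... = cq * elam" using C by (simp add: add_nonneg_eq_0_iff divide_simps)
 finally show ?A .
 show "0 < rho" "0 < cm" using r k_pos by (auto simp: rho_def cm_def elam_def)
qed

lemma ball_integrable:
 assumes f: "bcont 1 fi" "!!x. x \<notin> ball z r ==> fi x = 0" shows "integrable LB (fi :: real^'n => real)"
proof -
 note [measurable] = bcontD(1)[OF f(1)]
 have "integrable LB (indicator (ball z r) :: real^'n => real)" using emeasure_lborel_ball_finite[of z r] by (intro integrable_real_indicator) auto
 thus ?thesis
 proof (rule integrable_bound')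
  have "norm (fi x) <= norm (indicator (ball z r) x :: real)" for x using bcontD(2)[OF f(1), of x] f(2)[of x] by (cases "x : ball z r") auto
  thus "AE x in lborel. norm (fi x) <= norm (indicator (ball z r) x :: real)" by (rule AE_I2)
 qed simp
qed

lemma lower_continuous:
 assumes s: "0 <= s" and psi: "bddF s psi" "!!w. 0 <= psi w" "!!w. Y s w \<notin> ball z rho ==> psi w = 0"
  and phi: "bcont 1 fi" "!!x. 0 <= fi x" "!!x. x \<notin> ball z rho ==> fi x = 0"
 shows "cm * EE psi * BI LB (%y. fi y) <= EE (%w. psi w * fi (Y (s + r0) w))"
proof -
 define P where "P = exp (- (d1 / 2 * ln r0))"
 define E where "E = 4 * (CH * c1 * sqrt r0)"
 define I where "I = BI LB (%y. fi y)"
 have r1: "r0 <= 1" using r0 t0 by simp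
 note [measurable] = bcontD(1)[OF phi(1)]
 have i0: "integrable LB fi" by (rule ball_integrable[OF phi(1,3)])
 have E0: "0 <= E" using CH_nonneg c1 r0 by (simp add: E_def)
 have point: "cm * k2 * I <= AK r0 fi x - E * GC r0 fi x" if x: "x : ball z rho" for x
 proof -
  have G: "E * G r0 w <= P * elam / 2" for w
  proof -
   have "G r0 w <= P / cq" unfolding P_def by (rule G_le[OF r0(1)]) simp
   hence "E * G r0 w <= E * (P / cq)" using E0 by (rule mult_left_mono)
   also have "... <= cq * elam / 2 * (P / cq)" using r0(3) cq_pos by (intro mult_right_mono) (auto simp: E_def P_def)
   finally show ?thesis using cq_pos by (simp add: mult_ac)
  qed
  have q: "P * elam <= qk (N y) r0 (x - y)" if y: "y : ball z rho" for y
  proof -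
   have n: "norm (x - y) <= sqrt r0" using x y dist_triangle_less_add[of x z rho y rho] by (simp add: rho_def dist_norm dist_commute norm_minus_commute)
   have "(x - y) \<bullet> (N y *v (x - y)) <= 1 / lam * (norm (x - y) * norm (x - y))" using spd.qN[OF spd_N, of "x - y" y "x - y"] by (simp add: abs_le_iff)
   also have "... <= 1 / lam * (sqrt r0 * sqrt r0)" using n lam r0 by (intro mult_left_mono mult_mono) auto
   finally have "(x - y) \<bullet> (N y *v (x - y)) / (2 * r0) <= 1 / lam * r0 / (2 * r0)" using r0 by (intro divide_right_mono) auto
   hence "(x - y) \<bullet> (N y *v (x - y)) / (2 * r0) <= 1 / (2 * lam)" using r0 by simp
   thus ?thesis by (simp add: P_def elam_def qk_def d1_def exp_add[symmetric])
  qed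
  have iA: "integrable LB (%y. fi y * qk (N y) r0 (x - y))" by (rule AK_bound(1)[OF bcontD(1,2)[OF phi(1)] r0(1)])
  have iG: "integrable LB (%y. fi y * G r0 (x - y))"
   using kernel_integrable(1)[OF bcontD(1,2)[OF phi(1)], of "%y. G r0 (x - y)" 1 r0 x] r0 by simp
  have "cm * k2 * I = BI LB (%y. P * elam / 2 * fi y)" using k_pos by (simp add: cm_def P_def I_def)
  also have "... <= BI LB (%y. fi y * qk (N y) r0 (x - y) - E * (fi y * G r0 (x - y)))"
  proof (rule integral_mono)
   show "P * elam / 2 * fi y <= fi y * qk (N y) r0 (x - y) - E * (fi y * G r0 (x - y))" for y
   proof (cases "y : ball z rho")
    case True
    have "P * elam / 2 <= qk (N y) r0 (x - y) - E * G r0 (x - y)" using q[OF True] G[of "x - y"] by simp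
    from mult_left_mono[OF this phi(2)[of y]] show ?thesis by (simp add: algebra_simps)
   qed (use phi(3) in simp)
  qed (use i0 iA iG in auto)
  also have "... = AK r0 fi x - E * GC r0 fi x" using iA iG by (simp add: AK_def GC_def)
  finally show ?thesis .
 qed
 define g where "g = EE (%w. psi w * GC r0 fi (Y s w))"
 note gg = GC_bcont[OF phi(1,2) r0(1)]
 have g0: "0 <= g" unfolding g_def using psi gg by (intro integral_nonneg' mult_nonneg_nonneg) auto
 have "abs (EE (%w. psi w * (fi (Y (s + r0) w) * kap (Y (s + r0) w))) - EE (%w. psi w * AK (s + r0 - s) fi (Y s w))) <= 2 * (CH * (2 * c1 * g)) * sqrt (s + r0 - s)"
 proof (rule parametrix[OF s _ _ psi(1) phi(1)])
  show "0 <= CH * (2 * c1 * g)" using CH_nonneg c1 g0 by simp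
  fix v assume v: "s <= v" "v < s + r0"
  have "EE (%w. psi w * GC (s + r0 - v) fi (Y v w)) <= 2 * c1 * g"
  proof (cases "v = s")
   case True thus ?thesis using c1 mult_right_mono[of 1 "2 * c1" g] g0 by (simp add: g_def)
  next
   case False
   have tv: "0 < s + r0 - v" "0 < v - s" using v False by auto
   have "EE (%w. psi w * GC (s + r0 - v) fi (Y v w)) <= 2 * c1 * EE (%w. psi w * GC (v - s) (GC (s + r0 - v) fi) (Y s w))"
    by (rule heat_continuous[OF s _ _ psi(1,2) GC_bcont[OF phi(1,2) tv(1)]]) (use v False r0 in auto)
   also have "GC (v - s) (GC (s + r0 - v) fi) = GC r0 fi" using GC_semigroup[OF phi(1,2) tv(2,1)] by auto
   finally show ?thesis by (simp add: g_def)
  qed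
  from BK_domination[OF psi(1,2) phi(1,2) _ _ _ this]
  show "abs (EE (%w. psi w * BK (s + r0 - v) fi (Y v w))) <= CH * (2 * c1 * g) / sqrt (s + r0 - v)" using v s r1 by simp
 qed (use r0 r1 in auto)
 hence 1: "EE (%w. psi w * AK r0 fi (Y s w)) - E * g <= EE (%w. psi w * (fi (Y (s + r0) w) * kap (Y (s + r0) w)))"
  by (simp add: E_def mult_ac)
 have kb: "bcont k2 (%x. fi x * kap x)" unfolding bcont_def
 proof (intro conjI allI)
  show "abs (fi x * kap x) <= k2" for x
   using mult_mono[OF bcontD(2)[OF phi(1), of x] kap_bounds(2)[of x]] kap_bounds(1)[of x] k_pos by (simp add: abs_mult)
 qed (intro continuous_on_mult kap_continuous bcontD(3)[OF phi(1)])
 have 2: "EE (%w. psi w * (fi (Y (s + r0) w) * kap (Y (s + r0) w))) <= k2 * EE (%w. psi w * fi (Y (s + r0) w))"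
  by (rule expectation_mono_bdd[OF psi(1,2) kb phi(1)]) (use mult_left_mono[OF kap_bounds(2) phi(2)] k_pos s r0 in "auto simp: mult.commute")
 have iA: "integrable M (%w. psi w * AK r0 fi (Y s w))" "integrable M (%w. psi w * GC r0 fi (Y s w))"
  using psi_integrable[OF psi(1)] bcontD(1,2)[OF AK_bcont[OF phi(1) r0(1)]] bcontD(1,2)[OF gg(1)] by blast+
 have "cm * k2 * I * EE psi = EE (%w. cm * k2 * I * psi w)" by simp
 also have "... <= EE (%w. psi w * AK r0 fi (Y s w) - E * (psi w * GC r0 fi (Y s w)))"
 proof (rule integral_mono)
  show "cm * k2 * I * psi w <= psi w * AK r0 fi (Y s w) - E * (psi w * GC r0 fi (Y s w))" for w
  proof (cases "Y s w : ball z rho")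
   case True
   from mult_left_mono[OF point[OF True] psi(2)[of w]] show ?thesis by (simp add: algebra_simps)
  qed (use psi(3) in simp)
 qed (use bddF_D(3)[OF psi(1)] iA in auto)
 also have "... = EE (%w. psi w * AK r0 fi (Y s w)) - E * g" using iA by (simp add: g_def)
 finally have "k2 * (cm * EE psi * I) <= k2 * EE (%w. psi w * fi (Y (s + r0) w))" using 1 2 by (simp add: mult_ac)
 thus ?thesis using k_pos by (simp add: I_def)
qed

lemma bddF_indicator:
 assumes "bddF s psi" "D : sets borel" "0 <= s" shows "bddF s (%w. psi w * ib s D w)"
 unfolding ib_def by (rule bddF_mult[OF assms(1) bddF_comp[where K=1]]) (use assms in auto)

text \<open>From continuous functions to Borel sets: the comparison measure is a multiple of
  Lebesgue measure on the ball, so only functions vanishing outside the ball have to be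
  tested.\<close>

lemma lower_step:
 assumes s: "0 <= s" and psi: "bddF s psi" "!!w. 0 <= psi w" and D: "D : sets borel" "D <= ball z rho"
 shows "cm * measure LB D * EE (%w. psi w * ib s (ball z rho) w) <= EE (%w. psi w * ib (s + r0) D w)"
proof -
 let ?B = "ball z rho"
 define p where "p = (%w. psi w * ib s ?B w)"
 have p: "bddF s p" "!!w. 0 <= p w" "!!w. Y s w \<notin> ?B ==> p w = 0"
  using bddF_indicator[OF psi(1) _ s, of ?B] psi(2) by (auto simp: p_def ib_def)
 note [measurable] = bddF_D(2)[OF psi(1)] bddF_D(2)[OF p(1)] D(1)
 obtain P where P: "0 <= P" "!!w. w : space M ==> abs (p w) <= P" using bddF_bound[OF p(1)] by blast
 define E where "E = EE p"
 have E: "0 <= E" unfolding E_def using p by (intro integral_nonneg') auto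
 have nn: "NI M (%w. ennreal (p w) * ennreal (h (Y u w))) = ennreal (EE (%w. p w * h (Y u w)))"
  if [measurable]: "h : BB" and "!!x. 0 <= h x" "!!x. h x <= 1" for h u
 proof -
  have "p w * h (Y u w) <= P * 1" if "w : space M" for w using P(2)[OF that] P(1) p(2)[of w] \<open>!!x. h x <= 1\<close> \<open>!!x. 0 <= h x\<close> by (intro mult_mono) auto
  thus ?thesis using p(2) that(2) by (subst expectation_nn[of _ "P * 1", symmetric]) (auto simp: ennreal_mult)
 qed
 have "NI (density LB (%y. ennreal (cm * E) * indicator ?B y)) (%x. indicator D x) <= NI (distr (density M (%w. ennreal (p w))) borel (Y (s + r0))) (%x. indicator D x)"
 proof (rule nn_integral_le_of_continuous[where V="?B"])
  have "emeasure (distr (density M (%w. ennreal (p w))) borel (Y (s + r0))) UNIV = NI M (%w. ennreal (p w) * ennreal 1)"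
   using psi_law[of "%w. ennreal (p w)" "%_. 1" "s + r0"] by simp
  thus "emeasure (distr (density M (%w. ennreal (p w))) borel (Y (s + r0))) UNIV ~= \<infinity>" using nn[of "%_. 1"] by simp
  show "emeasure (density LB (%y. ennreal (cm * E) * indicator ?B y)) (- ?B) = 0"
   by (simp add: emeasure_density nn_integral_0_iff_AE indicator_def)
  fix fi :: "real^'n => real" assume f: "continuous_on UNIV fi" "!!x. 0 <= fi x & fi x <= 1" "!!x. x \<notin> ?B ==> fi x = 0"
  have b: "bcont 1 fi" "!!x. 0 <= fi x" using f by (auto simp: bcont_def abs_le_iff intro: order.trans[of _ 0])
  note [measurable] = bcontD(1)[OF b(1)]
  have i0: "integrable LB fi" by (rule ball_integrable[OF b(1) f(3)])
  have "NI (density LB (%y. ennreal (cm * E) * indicator ?B y)) (%x. ennreal (fi x)) = NI LB (%x. ennreal (cm * E) * ennreal (fi x))"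
   using f(3) by (subst nn_integral_density) (auto intro!: nn_integral_cong simp: indicator_def)
  also have "... = ennreal (cm * E) * ennreal (BI LB (%x. fi x))" using i0 b(2) by (simp add: nn_integral_cmult nn_integral_eq_integral)
  also have "... = ennreal (cm * E * BI LB (%x. fi x))" using E cm b(2) by (simp add: ennreal_mult)
  also have "... <= ennreal (EE (%w. p w * fi (Y (s + r0) w)))"
   unfolding E_def by (intro ennreal_leI lower_continuous[OF s p b f(3)])
  also have "... = NI (distr (density M (%w. ennreal (p w))) borel (Y (s + r0))) (%x. ennreal (fi x))"
   using f(2) by (simp add: psi_law nn)
  finally show "NI (density LB (%y. ennreal (cm * E) * indicator ?B y)) (%x. ennreal (fi x)) <= NI (distr (density M (%w. ennreal (p w))) borel (Y (s + r0))) (%x. ennreal (fi x))" .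
 qed auto
 moreover have "NI (density LB (%y. ennreal (cm * E) * indicator ?B y)) (%x. indicator D x) = ennreal (cm * E * measure LB D)"
 proof -
  have fin: "emeasure LB D < \<infinity>" using D emeasure_mono[OF D(2), of LB] emeasure_lborel_ball_finite[of z rho] by (auto simp: less_top[symmetric] top_unique)
  have "NI (density LB (%y. ennreal (cm * E) * indicator ?B y)) (%x. indicator D x) = NI LB (%x. ennreal (cm * E) * indicator D x)"
   using D(2) by (subst nn_integral_density) (auto intro!: nn_integral_cong simp: indicator_def)
  also have "... = ennreal (cm * E) * ennreal (measure LB D)" using fin by (simp add: nn_integral_cmult emeasure_eq_ennreal_measure)
  finally show ?thesis using E cm by (simp add: ennreal_mult)
 qed
 moreover have "NI (distr (density M (%w. ennreal (p w))) borel (Y (s + r0))) (%x. indicator D x) = ennreal (EE (%w. p w * ib (s + r0) D w))"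
 proof -
  have "NI (distr (density M (%w. ennreal (p w))) borel (Y (s + r0))) (%x. indicator D x) = NI M (%w. ennreal (p w) * indicator D (Y (s + r0) w))" by (rule psi_law) measurable
  thus ?thesis using nn[of "indicator D" "s + r0"] by (simp only: ib_def ennreal_indicator[symmetric]) (simp add: indicator_le_1)
 qed
 ultimately have "cm * E * measure LB D <= EE (%w. p w * ib (s + r0) D w)"
  by (simp add: ennreal_le_iff[OF integral_nonneg'] p(2) ib_def)
 also have "... <= EE (%w. psi w * ib (s + r0) D w)"
 proof (rule integral_mono)
  show "integrable M (%w. p w * ib (s + r0) D w)" "integrable M (%w. psi w * ib (s + r0) D w)"
   unfolding ib_def using psi_integrable[OF p(1), of "indicator D" 1] psi_integrable[OF psi(1), of "indicator D" 1] by auto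
  show "p w * ib (s + r0) D w <= psi w * ib (s + r0) D w" for w using psi(2)[of w] by (auto simp: p_def ib_def indicator_def)
 qed
 finally show ?thesis unfolding E_def p_def by (simp only: mult_ac)
qed

definition "vb = measure LB (ball (0::real^'n) (rho / 2))"

lemma vb: "0 < vb" unfolding vb_def using rho by (simp add: content_ball_pos)

lemma expectation_ib_mono:
 assumes "bddF s psi" "!!w. 0 <= psi w" "D <= C" "D : sets borel" "C : sets borel"
 shows "EE (%w. psi w * ib t D w) <= EE (%w. psi w * ib t C w)"
proof (rule integral_mono)
 show "integrable M (%w. psi w * ib t D w)" "integrable M (%w. psi w * ib t C w)"
  unfolding ib_def using psi_integrable[OF assms(1), of "indicator D" 1] psi_integrable[OF assms(1), of "indicator C" 1] assms by auto
 show "psi w * ib t D w <= psi w * ib t C w" for w using assms(2)[of w] assms(3) by (auto simp: ib_def indicator_def)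
qed

text \<open>A step of time \<open>r0\<close> carries mass from a ball to its Borel subsets in
  proportion to their volume. The subset is a ball of half the radius about a point \<open>y\<close>
  nearer to the origin; it lies in the ball of full radius about \<open>y\<close>, where the next
  step starts.\<close>

lemma chain:
 assumes "0 <= s" "bddF s psi" "!!w. 0 <= psi w" "D : sets borel" "D <= ball 0 rho" "norm z <= real k * (rho / 2)"
 shows "(cm * vb) ^ k * (cm * measure LB D) * EE (%w. psi w * ib s (ball z rho) w) <= EE (%w. psi w * ib (s + real (Suc k) * r0) D w)"
 using assms
proof (induction k arbitrary: s z psi)
 case 0
 thus ?case using lower_step[OF 0(1-4), of 0] by simp
next
 case (Suc k)
 \<comment> \<open>From \<open>z\<close> a distance rho / 2 towards the origin, or the origin itself
   when it is that near.\<close>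
 obtain y where y: "norm y <= real k * (rho / 2)" "norm (z - y) <= rho / 2"
 proof (cases "norm z <= rho / 2")
  case True thus ?thesis using rho by (intro that[of 0]) auto
 next
  case False
  hence z: "0 < norm z" using rho by (meson less_le_trans not_less half_gt_zero order_less_imp_le)
  let ?c = "1 - rho / 2 / norm z"
  have c: "0 <= ?c" "?c * norm z = norm z - rho / 2" using False z rho by (auto simp: field_simps)
  have "z - ?c *R z = (rho / 2 / norm z) *R z" by (simp add: algebra_simps)
  hence "norm (z - ?c *R z) = rho / 2" using z rho by simp
  moreover have "norm (?c *R z) = norm z - rho / 2" using c by simp
  ultimately show ?thesis using Suc.prems(6) by (intro that[of "?c *R z"]) (auto simp: distrib_right)
 qed
 have sub: "ball y (rho / 2) <= ball z rho" "ball y (rho / 2) <= ball y rho"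
 proof -
  show "ball y (rho / 2) <= ball z rho"
  proof
   fix x assume "x : ball y (rho / 2)"
   hence "dist z x < rho" using y(2) dist_triangle[of z x y] by (simp add: dist_norm)
   thus "x : ball z rho" by simp
  qed
 qed (use rho in "auto intro: subset_ball")
 have v: "measure LB (ball y (rho / 2)) = vb" unfolding vb_def using content_ball_conv_unit_ball[of "rho / 2" y] content_ball_conv_unit_ball[of "rho / 2" "0 :: real^'n"] rho by simp
 have 1: "cm * vb * EE (%w. psi w * ib s (ball z rho) w) <= EE (%w. psi w * ib (s + r0) (ball y (rho / 2)) w)"
  using lower_step[OF Suc.prems(1-3) _ sub(1)] v by simp
 also have "... <= EE (%w. psi w * ib (s + r0) (ball y rho) w)"
  by (rule expectation_ib_mono[OF Suc.prems(2,3) sub(2)]) auto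
 finally have "(cm * vb) ^ k * (cm * measure LB D) * (cm * vb * EE (%w. psi w * ib s (ball z rho) w)) <= (cm * vb) ^ k * (cm * measure LB D) * EE (%w. psi w * ib (s + r0) (ball y rho) w)"
  by (rule mult_left_mono) (use cm vb in auto)
 also have "... <= EE (%w. psi w * ib (s + r0 + real (Suc k) * r0) D w)"
  using Suc.prems r0 y by (intro Suc.IH bddF_mono[OF Suc.prems(2)]) auto
 finally show ?case by (simp add: algebra_simps)
qed

text \<open>The number of covering balls is a choice that sees only the dimension, \<open>R\<close>
  and \<open>rho\<close>, not the process; this keeps \<open>cR\<close> uniform in the coefficients.
  The 1 added in \<open>cR\<close> keeps the denominator positive.\<close>

definition "covers R n \<longleftrightarrow> (EX Z. finite Z & card Z = n & Z <= cball (0::real^'n) R & cball 0 R <= (\<Union>z\<in>Z. ball z rho))"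
definition "cover R = (SOME n. covers R n)"
definition "steps R = nat \<lceil>R / (rho / 2)\<rceil>"
definition "cR R = (cm * vb) ^ steps R * cm / (real (cover R) + 1)"
definition "tau R = real (Suc (steps R)) * r0"

lemma tau_pos: "0 < tau R" using r0 by (simp add: tau_def)
lemma cR_pos: "0 < cR R" unfolding cR_def using cm vb by (intro divide_pos_pos mult_pos_pos zero_less_power) auto

text \<open>Every ball of the cover is chained with the same number of steps, also when its centre
  is near the origin, so that all masses arrive at the common time \<open>s + tau R\<close>.\<close>

lemma minorization:
 assumes s: "0 <= s" and psi: "bddF s psi" "!!w. 0 <= psi w" and D: "D : sets borel" "D <= ball 0 rho"
 shows "cR R * measure LB D * EE (%w. psi w * ib s (cball 0 R) w) <= EE (%w. psi w * ib (s + tau R) D w)"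
proof -
 define K where "K = (cm * vb) ^ steps R * (cm * measure LB D)"
 define X where "X = EE (%w. psi w * ib (s + tau R) D w)"
 have K: "0 <= K" using cm vb by (simp add: K_def)
 have X: "0 <= X" unfolding X_def using psi(2) by (intro integral_nonneg') (auto simp: ib_def)
 have "EX n. covers R n"
 proof -
  have "EX Z<=cball (0::real^'n) R. finite Z & cball 0 R <= (\<Union>z\<in>Z. ball z rho)"
   by (rule compactE_image[of "cball (0::real^'n) R" "cball 0 R" "%z. ball z rho"]) (use rho in auto)
  thus ?thesis unfolding covers_def by blast
 qed
 hence "covers R (cover R)" unfolding cover_def by (rule someI_ex)
 then obtain Z where Z: "finite Z" "card Z = cover R" "Z <= cball (0::real^'n) R" "cball 0 R <= (\<Union>z\<in>Z. ball z rho)"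
  unfolding covers_def by blast
 have one: "K * EE (%w. psi w * ib s (ball z rho) w) <= X" if z: "z : Z" for z
  unfolding K_def X_def tau_def
 proof (rule chain[OF s psi D])
  have "norm z / (rho / 2) <= R / (rho / 2)" using z Z(3) rho by (intro divide_right_mono) auto
  also have "... <= real (steps R)" unfolding steps_def by linarith
  finally show "norm z <= real (steps R) * (rho / 2)" using rho by (simp add: field_simps)
 qed
 have i: "integrable M (%w. psi w * ib s C w)" if "C : sets borel" for C
  unfolding ib_def by (rule psi_integrable[OF psi(1), where k=1]) (use that in auto)
 have "EE (%w. psi w * ib s (cball 0 R) w) <= EE (%w. SUM z:Z. psi w * ib s (ball z rho) w)"
 proof (rule integral_mono)
  show "psi w * ib s (cball 0 R) w <= (SUM z:Z. psi w * ib s (ball z rho) w)" for w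
  proof (cases "Y s w : cball 0 R")
   case True
   then obtain z where z: "z : Z" "Y s w : ball z rho" using Z(4) by blast
   have "psi w * ib s (ball z rho) w <= (SUM z:Z. psi w * ib s (ball z rho) w)"
    by (rule member_le_sum[OF z(1)]) (use Z(1) psi(2) in "auto simp: ib_def")
   thus ?thesis using True z(2) by (simp add: ib_def)
  qed (use psi(2) in "auto simp: ib_def intro!: sum_nonneg")
 qed (use i in auto)
 also have "... = (SUM z:Z. EE (%w. psi w * ib s (ball z rho) w))" using i by (intro integral_sum') auto
 finally have "K * EE (%w. psi w * ib s (cball 0 R) w) <= (SUM z:Z. K * EE (%w. psi w * ib s (ball z rho) w))"
  unfolding sum_distrib_left[symmetric] by (rule mult_left_mono[OF _ K])
 also have "... <= real (cover R) * X" using sum_mono[OF one, of Z "%z. z"] Z(2) by simp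
 also have "... <= (real (cover R) + 1) * X" using X by (intro mult_right_mono) auto
 finally show ?thesis by (simp add: cR_def K_def X_def field_simps)
qed

end

section \<open>Radial functions of \<open>jb\<close>, the smooth substitute for the norm\<close>

definition jb :: "real^'n::finite => real" where "jb x = sqrt (1 + (norm x)^2)"

lemma jb: "1 <= jb x" "norm x <= jb x" "jb x <= 1 + norm x" "0 < jb x" "(jb x)^2 = 1 + (norm x)^2" "continuous_on T jb"
proof -
 show "1 <= jb x" "norm x <= jb x" "(jb x)^2 = 1 + (norm x)^2" by (auto simp: jb_def intro: real_le_rsqrt)
 thus "0 < jb x" by linarith
 show "jb x <= 1 + norm x" unfolding jb_def by (rule real_le_lsqrt) (auto simp: power2_sum)
 show "continuous_on T jb" unfolding jb_def by (intro continuous_intros)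
qed

text \<open>With \<open>rhess\<close> below: gradient and Hessian of \<open>g (jb x)\<close> when
  \<open>g1\<close> and \<open>g2\<close> are the first two derivatives of \<open>g\<close>.\<close>

definition rgrad :: "(real => real) => real^'n::finite => real^'n" where
 "rgrad g1 x = (g1 (jb x) / jb x) *R x"
definition rhess :: "(real => real) => (real => real) => real^'n::finite => real^'n^'n" where
 "rhess g1 g2 x = (g2 (jb x) / (jb x)^2 - g1 (jb x) / jb x ^ 3) *R outer x + (g1 (jb x) / jb x) *R mat 1"

lemma scale_frac_le: "abs y <= z ==> 0 < z ==> abs c <= K ==> abs (c / z * y) <= K" for c y z K :: real
 using mult_mono[of "abs y / z" 1 "abs c" K] by (simp add: abs_mult abs_divide mult.commute)

lemma radial_bounds:
 fixes x :: "real^'n::finite"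
 assumes "!!s. abs (g1 s) <= K" "!!s. abs (g2 s) <= K"
 shows "norm (rgrad g1 x) <= K" (is ?A) "norm (rhess g1 g2 x) <= K * (2 + norm (mat 1 :: real^'n^'n))" (is ?B)
proof -
 note j = jb(1,2,4,5)[of x]
 have K: "0 <= K" using order.trans[OF abs_ge_zero assms(1)] .
 have n2: "(norm x)^2 <= (jb x)^2" "(norm x)^2 <= jb x ^ 3"
 proof -
  show *: "(norm x)^2 <= (jb x)^2" using j by simp
  show "(norm x)^2 <= jb x ^ 3" by (rule order.trans[OF * power_increasing]) (use j in auto)
 qed
 show ?A using scale_frac_le[of "norm x" "jb x" "g1 (jb x)" K] j assms(1) by (simp add: rgrad_def abs_mult)
 have a: "abs (g2 (jb x) / (jb x)^2 * (norm x)^2) <= K" "abs (g1 (jb x) / jb x ^ 3 * (norm x)^2) <= K" "abs (g1 (jb x) / jb x * 1) <= K"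
  by (rule scale_frac_le; use jb(1)[of x] jb(4)[of x] n2 assms in simp)+
 have "norm (rhess g1 g2 x) <= abs (g2 (jb x) / (jb x)^2 - g1 (jb x) / jb x ^ 3) * (norm x)^2 + abs (g1 (jb x) / jb x) * norm (mat 1 :: real^'n^'n)"
  unfolding rhess_def by (rule order.trans[OF norm_triangle_ineq]) (simp add: norm_outer)
 also have "abs (g2 (jb x) / (jb x)^2 - g1 (jb x) / jb x ^ 3) * (norm x)^2 = abs (g2 (jb x) / (jb x)^2 * (norm x)^2 - g1 (jb x) / jb x ^ 3 * (norm x)^2)"
  by (simp only: left_diff_distrib[symmetric] abs_mult abs_power2)
 also have "... <= 2 * K" by (rule order.trans[OF abs_triangle_ineq4]) (use add_mono[OF a(1,2)] in simp)
 also have "abs (g1 (jb x) / jb x) * norm (mat 1 :: real^'n^'n) <= K * norm (mat 1 :: real^'n^'n)" using a(3) by (intro mult_right_mono) auto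
 finally show ?B by (simp add: algebra_simps)
qed

section \<open>Lyapunov function\<close>

text \<open>Taylor expansion of third order along the segment. The derivatives close up: u' = r, r'
  = s and s' = -3 r s / u, each bounded by a power of the length \<open>n\<close> because
  \<open>u\<close> is at least 1.\<close>

lemma radial_taylor:
 fixes g :: "real => real"
 assumes D: "!!s. (g has_real_derivative g1 s) (at s)" "!!s. (g1 has_real_derivative g2 s) (at s)" "!!s. (g2 has_real_derivative g3 s) (at s)"
  and K: "!!s. abs (g s) <= K" "!!s. abs (g1 s) <= K" "!!s. abs (g2 s) <= K" "!!s. abs (g3 s) <= K" and d: "0 < d"
 shows "taylor_le (K * (7 + norm (mat 1 :: real^'n::finite^'n))) d (%x. g (jb x)) (%x. g (jb x)) (%_. 0) (rgrad g1 :: real^'n => _) (rhess g1 g2)"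
 unfolding taylor_le_def
proof (intro allI)
 fix x y :: "real^'n"
 define h where "h = y - x"
 define n where "n = norm h"
 define nm where "nm = norm (mat 1 :: real^'n^'n)"
 define R where "R = g (jb y) - g (jb x) - rgrad g1 x \<bullet> h - h \<bullet> (rhess g1 g2 x *v h) / 2"
 have K0: "0 <= K" "0 <= nm" "0 <= n" using order.trans[OF abs_ge_zero K(1)] by (auto simp: nm_def n_def)
 define v where "v te = x + te *R h" for te
 define u where "u te = jb (v te)" for te
 define r where "r te = (v te \<bullet> h) / u te" for te
 define s where "s te = (n^2 - (r te)^2) / u te" for te
 have u: "1 <= u te" "0 < u te" for te using jb(1,4) by (auto simp: u_def)
 have r: "abs (r te) <= n" for te
  using scale_frac_le[of "norm (v te)" "u te" n n] jb(2,4)[of "v te"] K0 Cauchy_Schwarz_ineq2[of "v te" h]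
  by (simp add: r_def u_def n_def abs_divide divide_simps mult.commute)
 have r2: "(r te)^2 <= n^2" for te using r[of te] K0 by (simp add: abs_le_square_iff[symmetric])
 have s: "0 <= s te" "s te <= n^2" "s te / u te <= n^2" for te
 proof -
  show 1: "0 <= s te" unfolding s_def using r2[of te] u[of te] by simp
  have "s te <= (n^2 - (r te)^2) / 1" unfolding s_def using r2[of te] u[of te] by (intro divide_left_mono) auto
  thus 2: "s te <= n^2" by (rule order.trans) simp
  have "s te / u te <= s te / 1" using 1 u[of te] by (intro divide_left_mono) auto
  thus "s te / u te <= n^2" using 2 by simp
 qed
 have dv: "((%te. v te \<bullet> h) has_real_derivative n^2) (at te)" for te
  by (auto simp: v_def inner_add_left n_def power2_norm_eq_inner intro!: derivative_eq_intros)
 have du: "(u has_real_derivative r te) (at te)" for te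
 proof -
  define q where "q te = 1 + (x \<bullet> x + 2 * te * (x \<bullet> h) + te^2 * (h \<bullet> h))" for te
  have e: "u = (%te. sqrt (q te))"
   by (rule ext, simp only: u_def q_def jb_def v_def power2_norm_eq_inner inner_add_left inner_add_right) (simp add: inner_commute power2_eq_square algebra_simps)
  have pu: "0 < q te" using u(2)[of te] unfolding e by simp
  have "(q has_real_derivative 2 * (v te \<bullet> h)) (at te)"
   unfolding q_def[abs_def] by (rule derivative_eq_intros refl)+ (simp add: v_def inner_add_left)
  from DERIV_chain2[OF DERIV_real_sqrt[OF pu] this] show ?thesis by (simp add: e r_def inverse_eq_divide)
 qed
 have dr: "(r has_real_derivative s te) (at te)" for te
  unfolding r_def[abs_def] by (rule derivative_eq_intros dv du refl u(2)[THEN less_imp_neq, symmetric])+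
   (use u[of te] in "simp add: s_def r_def field_simps power2_eq_square")
 have ds: "(s has_real_derivative - 3 * r te * (s te / u te)) (at te)" for te
  unfolding s_def[abs_def] by (rule derivative_eq_intros dr du refl u(2)[THEN less_imp_neq, symmetric])+
   (use u[of te] in "simp add: s_def field_simps power2_eq_square")
 \<comment> \<open>Third derivative along the segment; the weights 1 + 3 + 3 of its terms make the
   7.\<close>
 define h3 where "h3 te = g3 (u te) * r te ^ 3 + 3 * (g2 (u te) * (r te * s te)) - 3 * (g1 (u te) * (r te * (s te / u te)))" for te
 have "abs (g (u 1) - g (u 0) - g1 (u 0) * r 0 - (g2 (u 0) * (r 0)^2 + g1 (u 0) * s 0) / 2) <= 7 * (K * n ^ 3)"
 proof (rule taylor3[where h="%te. g (u te)" and ?h1.0="%te. g1 (u te) * r te" and ?h2.0="%te. g2 (u te) * (r te)^2 + g1 (u te) * s te" and ?h3.0=h3])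
  fix te :: real
  note Dc = DERIV_chain2[OF D(1) du] DERIV_chain2[OF D(2) du] DERIV_chain2[OF D(3) du]
  show "((%te. g (u te)) has_real_derivative g1 (u te) * r te) (at te)" by (rule Dc)
  show "((%te. g1 (u te) * r te) has_real_derivative g2 (u te) * (r te)^2 + g1 (u te) * s te) (at te)"
   by (rule derivative_eq_intros Dc dr refl)+ (simp add: power2_eq_square)
  show "((%te. g2 (u te) * (r te)^2 + g1 (u te) * s te) has_real_derivative h3 te) (at te)"
   by (rule derivative_eq_intros Dc dr ds refl)+ (simp add: h3_def power2_eq_square power3_eq_cube algebra_simps)
  have a: "abs (r te ^ 3) <= n ^ 3" "abs (r te * s te) <= n ^ 3" "abs (r te * (s te / u te)) <= n ^ 3"
   using power_mono[OF r[of te], of 3] mult_mono[OF r[of te] s(2)[of te]] mult_mono[OF r[of te] s(3)[of te]] K0 s(1)[of te] u[of te]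
   by (auto simp: abs_mult power_abs power3_eq_cube power2_eq_square mult.assoc)
  have "abs (g3 (u te) * r te ^ 3) <= K * n ^ 3" "abs (g2 (u te) * (r te * s te)) <= K * n ^ 3" "abs (g1 (u te) * (r te * (s te / u te))) <= K * n ^ 3"
   unfolding abs_mult[of "g3 _"] abs_mult[of "g2 _"] abs_mult[of "g1 _"] using K a K0 by (intro mult_mono; simp)+
  thus "abs (h3 te) <= 7 * (K * n ^ 3)" unfolding h3_def by linarith
 qed
 moreover have "u 1 = jb y" "u 0 = jb x" by (auto simp: u_def v_def h_def)
 moreover have r0: "g1 (u 0) * r 0 = rgrad g1 x \<bullet> h" by (simp add: r_def u_def v_def rgrad_def)
 moreover have "g2 (u 0) * (r 0)^2 + g1 (u 0) * s 0 = h \<bullet> (rhess g1 g2 x *v h)"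
 proof -
  have "rhess g1 g2 x *v h = ((g2 (jb x) / (jb x)^2 - g1 (jb x) / jb x ^ 3) * (x \<bullet> h)) *R x + (g1 (jb x) / jb x) *R h"
   unfolding rhess_def by (simp add: matrix_vector_mult_add_rdistrib scaleR_matrix_vector_assoc[symmetric] outer_apply)
  moreover have "norm h * norm h = h \<bullet> h" by (simp add: power2_norm_eq_inner[symmetric] power2_eq_square)
  ultimately show ?thesis using jb(4)[of x]
   by (simp add: inner_add_right inner_commute u_def v_def r_def s_def n_def power2_norm_eq_inner field_simps power2_eq_square power3_eq_cube)
 qed
 ultimately have c: "abs R <= 7 * (K * n ^ 3)" by (simp add: R_def)
 have R1: "abs R <= K * (7 + nm) * n ^ 3"
 proof -
  have "7 * (K * n ^ 3) <= 7 * (K * n ^ 3) + nm * (K * n ^ 3)" using K0 by simp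
  thus ?thesis using c by (simp add: algebra_simps)
 qed
 have R2: "abs R <= K * (7 + nm) * n^2"
 proof (cases "n <= 1")
  case True
  have "n ^ 3 <= n^2" using True K0 by (intro power_decreasing) auto
  thus ?thesis using mult_left_mono[of "n^3" "n^2" "K * (7 + nm)"] R1 K0 by simp
 next
  case False
  note rb = radial_bounds[where x=x and K=K and ?g1.0=g1 and ?g2.0=g2, OF K(2,3)]
  have nn: "1 <= n^2" "n <= n^2" using False by (auto simp: power2_eq_square one_le_power mult_ge1_I)
  have "abs (rgrad g1 x \<bullet> h) <= K * n^2"
   using Cauchy_Schwarz_ineq2[of "rgrad g1 x" h] mult_mono[OF rb(1) nn(2)] K0 by (simp add: n_def)
  moreover have "abs (h \<bullet> (rhess g1 g2 x *v h)) <= K * (2 + nm) * n^2"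
  proof -
   have "abs (h \<bullet> (rhess g1 g2 x *v h)) <= n * (norm (rhess g1 g2 x) * n)"
    unfolding n_def by (rule order.trans[OF Cauchy_Schwarz_ineq2 mult_left_mono[OF norm_matrix_vector]]) simp
   also have "... <= n * (K * (2 + nm) * n)" unfolding nm_def using rb(2) K0 by (intro mult_left_mono mult_right_mono) auto
   finally show ?thesis by (simp add: power2_eq_square mult_ac)
  qed
  moreover have "abs (g (jb y) - g (jb x)) <= 2 * (K * n^2)"
   using K(1)[of "jb y"] K(1)[of "jb x"] mult_left_mono[OF nn(1) K0(1)] by linarith
  ultimately have "abs R <= 2 * (K * n^2) + K * n^2 + K * (2 + nm) * n^2 / 2" unfolding R_def by linarith
  also have "... <= K * (7 + nm) * n^2" using K0 mult_nonneg_nonneg[of K "n^2"] mult_nonneg_nonneg[of nm "K * n^2"] by (simp add: algebra_simps)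
  finally show ?thesis .
 qed
 have "abs R <= K * (7 + nm) * min (n^2) (n ^ 3)" using R1 R2 by (simp add: min_def)
 also have "... <= K * (7 + nm) * (min (n^2) (n ^ 3) + d * n + d^2)" using K0 d by (intro mult_left_mono) auto
 finally show "abs (g (jb y) - g (jb x) - d * 0 - rgrad g1 x \<bullet> (y - x) - (y - x) \<bullet> (rhess g1 g2 x *v (y - x)) / 2)
  <= K * (7 + norm (mat 1 :: real^'n^'n)) * (min ((norm (y - x))^2) (norm (y - x) ^ 3) + d * norm (y - x) + d^2)"
  by (simp add: R_def h_def n_def nm_def)
qed

text \<open>The Lyapunov function \<open>exp (eps * jb x)\<close> is reached as the increasing limit, for \<open>de\<close> decreasing to 0, of its bounded logistic truncations \<open>lg eps de (jb x)\<close>.\<close>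

definition lg :: "real => real => real => real" where "lg eps de s = 1 / (de + exp (- (eps * s)))"
definition lu :: "real => real => real => real" where "lu eps de s = exp (- (eps * s)) * lg eps de s"
definition lg1 :: "real => real => real => real" where "lg1 eps de s = eps * lu eps de s * lg eps de s"
definition lg2 :: "real => real => real => real" where "lg2 eps de s = eps^2 * (2 * (lu eps de s)^2 - lu eps de s) * lg eps de s"
definition lg3 :: "real => real => real => real" where
 "lg3 eps de s = eps ^ 3 * (lu eps de s - 6 * (lu eps de s)^2 + 6 * (lu eps de s) ^ 3) * lg eps de s"

text \<open>All derivatives are \<open>lg\<close> times a polynomial in \<open>lu\<close>, which
  lies in (0, 1]. The bound of \<open>lg2\<close> by eps times \<open>lg1\<close> does not involve
  \<open>de\<close>; it lets the drift absorb the second-order term for every truncation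
  alike.\<close>

lemma lg:
 assumes e: "0 < eps" "0 < de"
 shows "0 < lg eps de s" "lg eps de s <= 1 / de" "lg eps de s <= exp (eps * s)" (is ?A) "0 < lu eps de s" "lu eps de s <= 1"
  "0 <= lg1 eps de s" "lg1 eps de s <= eps * exp (eps * s)" (is ?B) "abs (lg2 eps de s) <= eps * lg1 eps de s"
  "(lg eps de has_real_derivative lg1 eps de s) (at s)" "(lg1 eps de has_real_derivative lg2 eps de s) (at s)" (is ?C) "(lg2 eps de has_real_derivative lg3 eps de s) (at s)" (is ?D)
  "EX K. ALL s. abs (lg eps de s) <= K & abs (lg1 eps de s) <= K & abs (lg2 eps de s) <= K & abs (lg3 eps de s) <= K" (is ?E)
proof -
 have p: "0 < de + exp (- (eps * s))" for s using e by (simp add: add_pos_pos)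
 show a: "0 < lg eps de s" "lg eps de s <= 1 / de" for s using p e by (auto simp: lg_def frac_le)
 show b: ?A
  using frac_le[of 1 1 "exp (- (eps * s))" "de + exp (- (eps * s))"] e by (simp add: lg_def exp_minus inverse_eq_divide)
 show u: "0 < lu eps de s" "lu eps de s <= 1" for s using p[of s] e a(1)[of s] by (auto simp: lu_def lg_def)
 show l1: "0 <= lg1 eps de s" for s using u(1) a(1) e by (simp add: lg1_def less_imp_le)
 have "lu eps de s * lg eps de s <= 1 * exp (eps * s)" using u a b by (intro mult_mono) (auto intro: less_imp_le)
 thus ?B using e by (simp add: lg1_def mult.assoc)
 have "lg2 eps de s = eps * lg1 eps de s * (2 * lu eps de s - 1)" for s by (simp add: lg1_def lg2_def power2_eq_square algebra_simps)
 moreover have "abs (2 * lu eps de s - 1) <= 1" for s using u[of s] by (simp add: abs_le_iff)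
 ultimately show l2: "abs (lg2 eps de s) <= eps * lg1 eps de s" for s
  using l1[of s] e mult_left_mono[of "abs (2 * lu eps de s - 1)" 1 "eps * lg1 eps de s"] by (simp add: abs_mult)
 show dg: "(lg eps de has_real_derivative lg1 eps de s) (at s)" for s
  unfolding lg_def[abs_def] by (rule derivative_eq_intros refl p[THEN less_imp_neq, symmetric])+ (use p[of s] in "simp add: lg1_def lu_def lg_def power2_eq_square")
 have du: "(lu eps de has_real_derivative eps * ((lu eps de s)^2 - lu eps de s)) (at s)" for s
  unfolding lu_def[abs_def] by (rule derivative_eq_intros dg refl)+ (simp add: lg1_def lu_def power2_eq_square algebra_simps)
 show ?C
  unfolding lg1_def[abs_def] by (rule derivative_eq_intros dg du refl)+ (simp add: lg1_def lg2_def power2_eq_square algebra_simps)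
 show ?D
  unfolding lg2_def[abs_def] by (rule derivative_eq_intros dg du refl)+ (simp add: lg1_def lg3_def power2_eq_square power3_eq_cube algebra_simps)
 define K where "K = (1 + eps + eps^2 + 13 * eps ^ 3) * (1 / de)"
 have K: "c * (1 / de) <= K" if "c <= 1 + eps + eps^2 + 13 * eps ^ 3" for c
  unfolding K_def by (rule mult_right_mono) (use that e in auto)
 have e3: "0 <= eps^2" "0 <= eps ^ 3" using e by auto
 have g1: "lg1 eps de s <= eps * (1 / de)" for s
  unfolding lg1_def using u[of s] a[of s] e by (intro mult_mono) (auto intro: mult_left_le less_imp_le)
 have "abs (lg eps de s) <= K & abs (lg1 eps de s) <= K & abs (lg2 eps de s) <= K & abs (lg3 eps de s) <= K" for s
 proof (intro conjI)
  show "abs (lg eps de s) <= K" using a[of s] K[of 1] e e3 by simp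
  show "abs (lg1 eps de s) <= K" using g1[of s] l1[of s] K[of eps] e e3 by simp
  show "abs (lg2 eps de s) <= K" using order.trans[OF l2[of s] mult_left_mono[OF g1[of s] less_imp_le[OF e(1)]]] K[of "eps^2"] e e3 by (simp add: power2_eq_square)
  have "(lu eps de s)^2 <= 1" "(lu eps de s)^3 <= 1" "0 <= (lu eps de s)^3" using u[of s] by (auto simp: power_le_one)
  hence "abs (lu eps de s - 6 * (lu eps de s)^2 + 6 * (lu eps de s) ^ 3) <= 13" using u[of s] zero_le_power2[of "lu eps de s"] unfolding abs_le_iff by linarith
  hence "abs (lg3 eps de s) <= eps ^ 3 * 13 * (1 / de)" unfolding lg3_def abs_mult using a[of s] e by (intro mult_mono) auto
  thus "abs (lg3 eps de s) <= K" using K[of "eps ^ 3 * 13"] e e3 by simp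
 qed
 thus ?E by blast
qed

locale ergodic_sde = elliptic_sde a b M W X A B L lam
 for a :: "real^'n::finite => real^'n^'n" and b :: "real^'n => real^'n"
  and M :: "'w measure" and W X :: "real => 'w => real^'n" and A B L lam :: real +
 fixes dr rd :: real
 assumes drift: "0 < dr" "0 < rd" "rd <= norm x ==> x \<bullet> b x <= - dr * norm x"
begin

text \<open>\<open>ep\<close> is so small that the second-order term \<open>ep * SB / 2\<close>
  costs at most dr / 4; where \<open>jb\<close> is at least \<open>J\<close>, the terms divided by
  \<open>jb\<close> cost at most another dr / 4, so half of the drift survives. \<open>Kl\<close>
  bounds what can happen elsewhere.\<close>

definition "nm = norm (mat 1 :: real^'n^'n)"
definition "ep = dr / (2 * (SB + 1))"
definition "J = max (rd + 1) (4 * (dr + nm * SB) / dr)"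
definition "Kl = ep * exp (ep * J) * (B + ep * SB / 2 + nm * SB + dr)"
definition V :: "real^'n => real" where "V x = exp (ep * jb x)"

lemma SB0: "0 <= SB" "0 <= nm" "0 < ep" "0 < Kl" "ep * SB / 2 <= dr / 4" (is ?A)
proof -
 show s: "0 <= SB" "0 <= nm" using d1 pos by (auto simp: SB_def nm_def)
 show e: "0 < ep" using s drift by (simp add: ep_def)
 thus "0 < Kl" unfolding Kl_def using s pos drift by (intro mult_pos_pos add_nonneg_pos) (auto simp: add_nonneg_nonneg)
 have "dr / (2 * k) * k = dr / 2" if "k ~= 0" for k using that by simp
 from this[of "SB + 1"] have "ep * (SB + 1) = dr / 2" using s by (simp only: ep_def)
 hence "ep * SB + ep = dr / 2" by (simp add: distrib_left)
 thus ?A using e by linarith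
qed

lemma V: "1 <= V x" "0 < V x" "V : BB" "continuous_on T V"
proof -
 show "1 <= V x" "0 < V x" using SB0(3) jb(4)[of x] by (auto simp: V_def less_imp_le)
 show c: "continuous_on T V" for T unfolding V_def by (intro continuous_intros jb)
 show "V : BB" by (rule borel_measurable_continuous_onI[OF c])
qed

text \<open>Stated for any \<open>g1\<close> between 0 and the derivative of exp(ep s) that
  dominates \<open>g2\<close> up to the factor \<open>ep\<close>, so that all truncations obey it
  with the same \<open>Kl\<close>.\<close>

lemma generator_bound:
 assumes g: "0 <= g1 (jb x)" "abs (g2 (jb x)) <= ep * g1 (jb x)" "g1 (jb x) <= ep * exp (ep * jb x)"
 shows "gen (%_. 0) (rgrad g1) (rhess g1 g2) x <= Kl - dr / 2 * g1 (jb x)"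
proof -
 define j where "j = jb x"
 define e where "e = g1 j"
 define p where "p = (x \<bullet> b x) / j"
 define q where "q = x \<bullet> (S x *v x)"
 define m where "m = mat 1 \<bullet> S x"
 note jj = jb(1,2,3,4)[of x, folded j_def] and sb = SB0
 have e0: "0 <= e" using g by (simp add: e_def j_def)
 have q: "0 <= q" "q / j^2 <= SB"
 proof -
  show "0 <= q" unfolding q_def S_form by simp
  have "q <= norm x * (norm (S x) * norm x)" unfolding q_def using Cauchy_Schwarz_ineq2[of x "S x *v x"] mult_left_mono[OF norm_matrix_vector norm_ge_zero, of x "S x" x] by simp
  also have "... <= j * (SB * j)" using jj sb S_bound[of x] by (intro mult_mono) auto
  finally show "q / j^2 <= SB" using jj by (simp add: divide_simps power2_eq_square mult_ac)
 qed
 have m: "m / j <= nm * SB / j"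
  unfolding m_def nm_def using Cauchy_Schwarz_ineq2[of "mat 1" "S x"] mult_left_mono[OF S_bound norm_ge_zero, of "mat 1 :: real^'n^'n" x] jj by (intro divide_right_mono) auto
 have "gen (%_. 0) (rgrad g1) (rhess g1 g2) x = e * p + ((g2 j / j^2 - e / j ^ 3) * q + e / j * m) / 2"
  by (simp add: gen_def rgrad_def rhess_def S_def[symmetric] inner_add_left outer_inner e_def j_def p_def q_def m_def)
 also have "... = e * p + g2 j * (q / j^2) / 2 - e * (q / j ^ 3) / 2 + e * (m / j) / 2" by (simp add: field_simps)
 also have "... <= e * p + (ep * e) * SB / 2 - 0 + e * (nm * SB / j) / 2"
 proof -
  have "g2 j * (q / j^2) <= abs (g2 j) * (q / j^2)" using q(1) by (intro mult_right_mono) auto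
  also have "... <= (ep * e) * SB" using g(2) q jj e0 sb by (intro mult_mono) (auto simp: e_def j_def)
  finally have "g2 j * (q / j^2) <= (ep * e) * SB" .
  moreover have "0 <= e * (q / j ^ 3)" using e0 q jj by simp
  moreover have "e * (m / j) <= e * (nm * SB / j)" using m e0 by (rule mult_left_mono)
  moreover have aux2: "x <= x' ==> 0 <= y ==> z <= z' ==> u + x / 2 - y / 2 + z / 2 <= u + x' / 2 - 0 + z' / 2" for u x x' y z z' :: real by linarith
  ultimately show ?thesis by (intro aux2)
 qed
 finally have 1: "gen (%_. 0) (rgrad g1) (rhess g1 g2) x <= e * (p + ep * SB / 2 + nm * SB / j / 2)" by (simp add: algebra_simps)
 have aux: "p <= - d + u ==> u + v <= d / 4 ==> y <= d / 4 ==> 0 <= v ==> p + y + v / 2 <= - (d / 2)" for p d u v y :: real by linarith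
 define k where "k = nm * SB / j"
 have nj: "0 <= k" using sb jj by (auto simp: k_def)
 show ?thesis
 proof (cases "J <= j")
  case True
  have x: "rd <= norm x" using True jj by (simp add: J_def)
  have "p <= - dr * norm x / j" unfolding p_def using drift(3)[OF x] jj by (intro divide_right_mono) auto
  also have "... <= (- dr * (j - 1)) / j" using jj drift by (intro divide_right_mono) auto
  also have "... = - dr + dr / j" using jj by (simp add: field_simps)
  finally have p: "p <= - dr + dr / j" .
  have "(dr + nm * SB) / j <= dr / 4" using True jj drift by (simp add: J_def field_simps)
  hence "dr / j + k <= dr / 4" by (simp add: k_def add_divide_distrib)
  hence "p + ep * SB / 2 + nm * SB / j / 2 <= - (dr / 2)" using aux[OF p _ sb(5) nj] by (simp add: k_def)
  from mult_left_mono[OF this e0] show ?thesis using 1 sb(4) by (simp add: e_def j_def mult.commute)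
 next
  case False
  have "p <= B"
  proof -
   have "x \<bullet> b x <= j * B" using Cauchy_Schwarz_ineq2[of x "b x"] mult_mono[OF jj(2) b_bound[of x]] jj by auto
   thus ?thesis using jj by (simp add: p_def divide_simps mult.commute)
  qed
  moreover have "nm * SB / j <= nm * SB / 1" using jj sb by (intro divide_left_mono) auto
  hence "k <= nm * SB" by (simp add: k_def)
  ultimately have "p + ep * SB / 2 + k / 2 + dr / 2 <= B + ep * SB / 2 + nm * SB + dr" using nj drift(1) by linarith
  hence *: "p + ep * SB / 2 + nm * SB / j / 2 + dr / 2 <= B + ep * SB / 2 + nm * SB + dr" by (simp add: k_def)
  have "e <= ep * exp (ep * j)" using g(3) by (simp add: e_def j_def)
  also have "... <= ep * exp (ep * J)" using False sb by simp
  finally have e1: "e <= ep * exp (ep * J)" .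
  have "e * (p + ep * SB / 2 + nm * SB / j / 2 + dr / 2) <= e * (B + ep * SB / 2 + nm * SB + dr)" using * e0 by (rule mult_left_mono)
  also have "... <= Kl" unfolding Kl_def using e1 pos sb drift by (intro mult_right_mono) (auto simp: add_nonneg_nonneg)
  finally show ?thesis using 1 by (simp add: e_def[symmetric] j_def[symmetric] distrib_left mult.commute)
 qed
qed

lemma lg_bcont: "0 < de ==> bcont (1 / de) (%x. lg ep de (jb x))" "0 < de ==> EX K. bcont K (%x. lg1 ep de (jb x))"
proof -
 assume d: "0 < de"
 have c: "continuous_on UNIV (%x. f (jb x))" if "!!s. (f has_real_derivative f' s) (at s)" for f f' :: "real => real"
  by (rule continuous_on_compose2[OF DERIV_continuous_on jb(6), where t=UNIV]) (auto intro: that)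
 note l = lg[OF SB0(3) d]
 show "bcont (1 / de) (%x. lg ep de (jb x))" unfolding bcont_def using c[OF l(9)] l(1,2) by (auto simp: abs_of_pos)
 obtain K where "abs (lg1 ep de s) <= K" for s using l(12) by blast
 thus "EX K. bcont K (%x. lg1 ep de (jb x))" unfolding bcont_def using c[OF l(10)] by blast
qed

abbreviation (input) "E1 psi de v == EE (%w. psi w * lg1 ep de (jb (Y v w)))"
abbreviation (input) "E0 psi de v == EE (%w. psi w * lg ep de (jb (Y v w)))"

text \<open>Truncation makes all functions bounded, so Dynkin's formula applies; the constants of
  the resulting inequality do not depend on \<open>de\<close>.\<close>

lemma lyapunov_truncated:
 assumes st: "0 <= s" "s <= t" and psi: "bddF s psi" "!!w. 0 <= psi w" and d: "0 < de"
 shows "continuous_on {s..t} (%v. E1 psi de v)" (is ?A)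
  and "E0 psi de t + dr / 2 * integral {s..t} (%v. E1 psi de v)
   <= E0 psi de s + Kl * (t - s) * EE psi" (is ?B)
proof -
 let ?g = "%x. gen (%_. 0) (rgrad (lg1 ep de)) (rhess (lg1 ep de) (lg2 ep de)) x"
 note l = lg[OF SB0(3) d]
 obtain K where K: "!!s. abs (lg ep de s) <= K" "!!s. abs (lg1 ep de s) <= K" "!!s. abs (lg2 ep de s) <= K" "!!s. abs (lg3 ep de s) <= K" using l(12) by blast
 have K0: "0 <= K" using order.trans[OF abs_ge_zero K(1)] .
 obtain K1 where b1: "bcont K1 (%x. lg1 ep de (jb x))" using lg_bcont(2)[OF d] by blast
 define C where "C = K * (7 + nm)"
 have CK: "K <= C" "K * (2 + nm) <= C" "0 <= C" using K0 SB0 by (auto simp: C_def distrib_left intro!: mult_left_mono)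
 have cc: "continuous_on UNIV (%x :: real^'n. f (jb x))" if "!!s. (f has_real_derivative f' s) (at s)" for f f' :: "real => real"
  by (rule continuous_on_compose2[OF DERIV_continuous_on jb(6), where t=UNIV]) (auto intro: that)
 have c2: "continuous_on UNIV (%x :: real^'n. lg2 ep de (jb x))" by (rule cc[OF l(11)])
 have jn: "jb x ~= 0" for x :: "real^'n" using jb(4)[of x] by simp
 have gc: "continuous_on UNIV (rgrad (lg1 ep de) :: real^'n => _)" unfolding rgrad_def[abs_def]
  by (intro continuous_intros jb bcontD(3)[OF b1]) (use jn in auto)
 have hc: "continuous_on UNIV (rhess (lg1 ep de) (lg2 ep de) :: real^'n => _)" unfolding rhess_def[abs_def]
  by (intro continuous_intros jb bcontD(3)[OF b1] c2 outer_continuous) (use jn in auto)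
 have Gc: "continuous_on UNIV ?g" unfolding gen_def S_def[symmetric]
  by (intro continuous_intros gc hc coeff_continuous S_cont) auto
 note rb = radial_bounds[where ?g1.0="lg1 ep de" and ?g2.0="lg2 ep de" and K=K, OF K(2,3)]
 have Hb: "norm (rhess (lg1 ep de) (lg2 ep de) x) <= C" "norm (rgrad (lg1 ep de) x) <= C" for x :: "real^'n"
  using order.trans[OF rb(2)[of x] CK(2)[unfolded nm_def]] order.trans[OF rb(1)[of x] CK(1)] by auto
 have Gb: "abs (?g x) <= C * (1 + B + SB / 2)" for x
 proof -
  have "abs (?g x) <= C * (1 + B + norm (S x) / 2)" unfolding S_def by (rule gen_bound) (use Hb CK in auto)
  also have "... <= C * (1 + B + SB / 2)" using S_bound[of x] CK by (intro mult_left_mono) auto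
  finally show ?thesis .
 qed
 have G2: "continuous_on ({s..t} \<times> UNIV) (%(v, x). ?g x)" "continuous_on ({s..t} \<times> UNIV) (%(v, x :: real^'n). lg1 ep de (jb x))"
  unfolding case_prod_beta by (rule continuous_on_compose2[OF Gc continuous_on_snd[OF continuous_on_id]], simp)
   (rule continuous_on_compose2[OF bcontD(3)[OF b1] continuous_on_snd[OF continuous_on_id]], simp)
 have "((%v. EE (%w. psi w * ?g (Y v w))) has_integral
   E0 psi de t - E0 psi de s) {s..t}"
 proof (rule dynkin[OF st psi(1) CK(3), where f="%_ x. lg ep de (jb x)" and p="%_ _. 0" and g="%_. rgrad (lg1 ep de)" and H="%_. rhess (lg1 ep de) (lg2 ep de)"])
  show "taylor_le C (v - u) (%x. lg ep de (jb x)) (%x. lg ep de (jb x)) (%_ :: real^'n. 0) (rgrad (lg1 ep de)) (rhess (lg1 ep de) (lg2 ep de))" if "u < v" for u v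
   unfolding C_def nm_def by (rule radial_taylor[OF l(9-11) K]) (use that in simp)
  show "abs (lg ep de (jb x)) <= C" for x :: "real^'n" using order.trans[OF K(1) CK(1)] .
 qed (use G2(1) Gb Hb CK gc hc bcontD(1)[OF lg_bcont(1)[OF d]] in "auto intro: borel_measurable_continuous_onI")
 moreover show f1: ?A
  by (rule expectation_continuous(1)[OF psi(1) G2(2)]) (use bcontD(2)[OF b1] in auto)
 hence "((%v. Kl * EE psi - dr / 2 * E1 psi de v) has_integral
   (t - s) *R (Kl * EE psi) - dr / 2 * integral {s..t} (%v. E1 psi de v)) {s..t}"
  using has_integral_const_real[of "Kl * EE psi" s t] st
  by (intro has_integral_diff has_integral_mult_right integrable_integral integrable_continuous_real) auto
 ultimately have "E0 psi de t - E0 psi de s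
   <= (t - s) *R (Kl * EE psi) - dr / 2 * integral {s..t} (%v. E1 psi de v)"
 proof (rule has_integral_le)
  fix v assume v: "v : {s..t}"
  have i: "integrable M (%w. psi w * ?g (Y v w))" "integrable M (%w. psi w * lg1 ep de (jb (Y v w)))"
   using psi_integrable[OF psi(1) borel_measurable_continuous_onI[OF Gc] Gb] psi_integrable[OF psi(1) bcontD(1,2)[OF b1]] by auto
  have "EE (%w. psi w * ?g (Y v w)) <= EE (%w. Kl * psi w - dr / 2 * (psi w * lg1 ep de (jb (Y v w))))"
  proof (rule integral_mono[OF i(1)])
   show "integrable M (%w. Kl * psi w - dr / 2 * (psi w * lg1 ep de (jb (Y v w))))" using i bddF_D(3)[OF psi(1)] by auto
   show "psi w * ?g (Y v w) <= Kl * psi w - dr / 2 * (psi w * lg1 ep de (jb (Y v w)))" for w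
    using mult_left_mono[OF generator_bound[of "lg1 ep de" "Y v w" "lg2 ep de", OF l(6,8,7)] psi(2)[of w]] by (simp add: algebra_simps)
  qed
  also have "... = Kl * EE psi - dr / 2 * E1 psi de v" using i bddF_D(3)[OF psi(1)] by simp
  finally show "EE (%w. psi w * ?g (Y v w)) <= Kl * EE psi - dr / 2 * E1 psi de v" .
 qed
 thus ?B by (simp add: algebra_simps)
qed

definition EV :: "('w => real) => real => ennreal" where "EV psi t = NI M (%w. ennreal (psi w) * ennreal (V (Y t w)))"

lemma lg_limit:
 shows "incseq (%n. lg ep (1 / real (Suc n)) s)" (is ?A) "(%n. lg ep (1 / real (Suc n)) s) ----> exp (ep * s)" (is ?B)
  "incseq (%n. lg1 ep (1 / real (Suc n)) s)" (is ?C) "(%n. lg1 ep (1 / real (Suc n)) s) ----> ep * exp (ep * s)" (is ?D)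
proof -
 show i: ?A unfolding lg_def
  by (intro incseq_SucI divide_left_mono add_mono mult_pos_pos add_nonneg_pos) (auto simp: frac_le)
 have "(%n. 1 / (1 / real (Suc n) + exp (- (ep * s)))) ----> 1 / (0 + exp (- (ep * s)))"
  by (intro tendsto_divide tendsto_add tendsto_const LIMSEQ_Suc[OF lim_1_over_n]) auto
 thus l: ?B by (simp add: lg_def exp_minus inverse_eq_divide)
 have e: "lg1 ep de s = ep * exp (- (ep * s)) * (lg ep de s * lg ep de s)" for de by (simp add: lg1_def lu_def)
 have p: "0 <= lg ep (1 / real (Suc n)) s" for n using lg(1)[OF SB0(3), of "1 / real (Suc n)" s] by simp
 show ?C unfolding e
  by (intro incseq_SucI mult_left_mono mult_mono incseq_SucD[OF i] p) (use SB0(3) in auto)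
 have "(%n. lg1 ep (1 / real (Suc n)) s) ----> ep * exp (- (ep * s)) * (exp (ep * s) * exp (ep * s))"
  unfolding e by (intro tendsto_mult tendsto_const l)
 thus ?D by (simp add: exp_minus field_simps)
qed

abbreviation (input) "ls n x == lg ep (1 / real (Suc n)) (jb (x :: real^'n))"
abbreviation (input) "l1 n x == lg1 ep (1 / real (Suc n)) (jb (x :: real^'n))"

lemma lyapunov_limit:
 assumes psi: "bddF s psi" "!!w. 0 <= psi w"
 shows "(%n. ennreal (EE (%w. psi w * ls n (Y v w)))) ----> EV psi v" (is ?A)
  and "(%n. ennreal (EE (%w. psi w * l1 n (Y v w)))) ----> ennreal ep * EV psi v" (is ?B)
  and "incseq (%n. ennreal (EE (%w. psi w * l1 n (Y v w))))" (is ?C)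
  and "ennreal (EE (%w. psi w * ls n (Y v w))) <= EV psi v" (is ?D)
proof -
 note [measurable] = bddF_D(2)[OF psi(1)] V(3)
 have d: "0 < 1 / real (Suc n)" for n by simp
 note l = lg[OF SB0(3) d]
 have "ALL n. EX K. bcont K (%x. l1 n x)" by (intro allI lg_bcont(2) d)
 from choice[OF this] obtain K1 where b1: "!!n. bcont (K1 n) (%x. l1 n x)" by blast
 note b0 = lg_bcont(1)[OF d]
 have m[measurable]: "(%x. ls n x) : borel_measurable (borel :: (real^'n) measure)" "(%x. l1 n x) : borel_measurable (borel :: (real^'n) measure)" for n
  using bcontD(1)[OF b0] bcontD(1)[OF b1] by auto
 have mm: "(%w. ls n (Y v w)) : borel_measurable M" "(%w. l1 n (Y v w)) : borel_measurable M" for n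
  using measurable_compose[OF Y_measurable m(1)] measurable_compose[OF Y_measurable m(2)] by auto
 note [measurable] = mm
 have e0: "ennreal (EE (%w. psi w * ls n (Y v w))) = NI M (%w. ennreal (psi w * ls n (Y v w)))" for n
  by (rule nn_integral_eq_integral[symmetric, OF psi_integrable[OF psi(1) bcontD(1,2)[OF b0]]]) (use psi(2) l(1) in "auto simp: less_imp_le")
 have e1: "ennreal (EE (%w. psi w * l1 n (Y v w))) = NI M (%w. ennreal (psi w * l1 n (Y v w)))" for n
  by (rule nn_integral_eq_integral[symmetric, OF psi_integrable[OF psi(1) bcontD(1,2)[OF b1]]]) (use psi(2) l(6) in auto)
 have ev: "EV psi v = NI M (%w. ennreal (psi w * exp (ep * jb (Y v w))))" using psi(2) by (simp add: EV_def V_def ennreal_mult)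
 show ?A
  unfolding e0 ev
 proof (rule nn_integral_LIMSEQ)
  show "incseq (%n w. ennreal (psi w * ls n (Y v w)))"
   by (intro incseq_SucI le_funI ennreal_leI mult_left_mono incseq_SucD[OF lg_limit(1)] psi)
  show "(%n. ennreal (psi w * ls n (Y v w))) ----> ennreal (psi w * exp (ep * jb (Y v w)))" for w
   by (intro tendsto_ennrealI tendsto_mult tendsto_const lg_limit)
 qed measurable
 have i1: "incseq (%n w. ennreal (psi w * l1 n (Y v w)))"
  by (intro incseq_SucI le_funI ennreal_leI mult_left_mono incseq_SucD[OF lg_limit(3)] psi)
 have "(%n. (NI M (%w. ennreal (psi w * l1 n (Y v w))))) ----> (NI M (%w. ennreal (psi w * (ep * exp (ep * jb (Y v w))))))"
 proof (rule nn_integral_LIMSEQ[OF i1])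
  show "(%n. ennreal (psi w * l1 n (Y v w))) ----> ennreal (psi w * (ep * exp (ep * jb (Y v w))))" for w
   by (intro tendsto_ennrealI tendsto_mult[OF tendsto_const] lg_limit)
 qed measurable
 also have "NI M (%w. ennreal (psi w * (ep * exp (ep * jb (Y v w))))) = ennreal ep * EV psi v"
 proof -
  have "ennreal (psi w * (ep * exp (ep * jb (Y v w)))) = ennreal ep * (ennreal (psi w) * ennreal (V (Y v w)))" for w
   using psi(2) SB0(3) V(2) by (simp add: V_def ennreal_mult[symmetric] mult_ac)
  thus ?thesis unfolding EV_def by (simp add: nn_integral_cmult)
 qed
 finally show ?B unfolding e1 .
 show ?C
  unfolding e1 using i1 by (intro incseq_SucI nn_integral_mono) (auto simp: incseq_Suc_iff le_fun_def)
 show ?D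
  unfolding e0 ev by (intro nn_integral_mono ennreal_leI mult_left_mono l psi)
qed

text \<open>Monotone limit of the truncated inequalities. Values in \<open>ennreal\<close> allow a
  start without finite \<open>V\<close>-moment.\<close>

lemma lyapunov_integral:
 assumes st: "0 <= s" "s <= t" and psi: "bddF s psi" "!!w. 0 <= psi w"
 shows "EV psi t + ennreal (dr / 2 * ep) * NI LB (%v. EV psi v * indicator {s..t} v) <= EV psi s + ennreal (Kl * (t - s) * EE psi)"
proof -
 let ?f = "%n v. EE (%w. psi w * lg ep (1 / real (Suc n)) (jb (Y v w)))"
 let ?h = "%n v. EE (%w. psi w * lg1 ep (1 / real (Suc n)) (jb (Y v w)))"
 have d: "0 < 1 / real (Suc n)" for n by simp
 note l = lg[OF SB0(3) d] and L = lyapunov_limit[OF psi] and T = lyapunov_truncated[OF st psi d]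
 have pos: "0 <= ?f n v" "0 <= ?h n v" for n v
  using psi(2) l(1,6) by (auto intro!: integral_nonneg' mult_nonneg_nonneg simp: less_imp_le)
 have E0: "0 <= EE psi" using psi(2) by (intro integral_nonneg') auto
 have hint: "NI LB (%v. ennreal (?h n v) * indicator {s..t} v) = ennreal (integral {s..t} (?h n))" for n
  by (rule nn_integral_has_integral_lebesgue'[OF pos(2) integrable_integral[OF integrable_continuous_real[OF T(1)]]])
 have "(%n. NI LB (%v. ennreal (?h n v) * indicator {s..t} v)) ----> (NI LB (%v. ennreal ep * EV psi v * indicator {s..t} v))"
 proof (rule nn_integral_LIMSEQ)
  show "incseq (%n v. ennreal (?h n v) * indicator {s..t} v)"
   using L(3) by (intro incseq_SucI le_funI mult_right_mono) (auto simp: incseq_Suc_iff)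
  show "(%v. ennreal (?h n v) * indicator {s..t} v) : borel_measurable LB" for n
  proof -
   have "(%v. indicator {s..t} v *R ?h n v) : BB" by (rule borel_measurable_continuous_on_indicator[OF _ T(1)]) simp
   hence "(%v. ennreal (indicator {s..t} v *R ?h n v)) : BB" by measurable
   moreover have "(%v. ennreal (?h n v) * indicator {s..t} v) = (%v. ennreal (indicator {s..t} v *R ?h n v))" by (rule ext) (simp add: indicator_def)
   ultimately show ?thesis by simp
  qed
  show "(%n. ennreal (?h n v) * indicator {s..t} v) ----> ennreal ep * EV psi v * indicator {s..t} v" for v
   using L(2)[of v] by (cases "v : {s..t}") auto
 qed
 hence lim: "(%n. ennreal (?f n t) + ennreal (dr / 2) * NI LB (%v. ennreal (?h n v) * indicator {s..t} v)) ---->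
   EV psi t + ennreal (dr / 2) * NI LB (%v. ennreal ep * EV psi v * indicator {s..t} v)"
  by (intro tendsto_add L(1) ennreal_tendsto_cmult) auto
 have le: "ennreal (?f n t) + ennreal (dr / 2) * NI LB (%v. ennreal (?h n v) * indicator {s..t} v) <= EV psi s + ennreal (Kl * (t - s) * EE psi)" for n
 proof -
  have i0: "0 <= integral {s..t} (?h n)" using pos(2) by (intro integral_nonneg integrable_continuous_real[OF T(1)]) auto
  have "ennreal (?f n t) + ennreal (dr / 2) * ennreal (integral {s..t} (?h n)) = ennreal (?f n t + dr / 2 * integral {s..t} (?h n))"
   using pos i0 drift by (subst ennreal_mult[symmetric], simp, simp, subst ennreal_plus[symmetric]) auto
  also have "... <= ennreal (?f n s + Kl * (t - s) * EE psi)" by (rule ennreal_leI[OF T(2)])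
  also have "... = ennreal (?f n s) + ennreal (Kl * (t - s) * EE psi)" using pos SB0(4) E0 st by (intro ennreal_plus) auto
  also have "... <= EV psi s + ennreal (Kl * (t - s) * EE psi)" by (intro add_right_mono L(4))
  finally show ?thesis unfolding hint .
 qed
 have "EV psi t + ennreal (dr / 2) * NI LB (%v. ennreal ep * EV psi v * indicator {s..t} v) <= EV psi s + ennreal (Kl * (t - s) * EE psi)"
  using lim le by (intro LIMSEQ_le_const2) auto
 moreover have [measurable]: "EV psi : borel_measurable LB"
 proof -
  note [measurable] = bddF_D(2)[OF psi(1)] V(3)
  show ?thesis unfolding EV_def[abs_def] by measurable
 qed
 have "NI LB (%v. ennreal ep * EV psi v * indicator {s..t} v) = ennreal ep * NI LB (%v. EV psi v * indicator {s..t} v)"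
  by (simp add: mult.assoc nn_integral_cmult)
 moreover have "ennreal (dr / 2 * ep) = ennreal (dr / 2) * ennreal ep" by (rule ennreal_mult) (use drift SB0(3) in auto)
 ultimately show ?thesis by (simp only: mult.assoc)
qed

definition "gam ta = 1 / (1 + dr / 2 * ep * ta)"

text \<open>The second bound feeds the first back into the integrated inequality: the terminal value
  exceeds any earlier one by at most \<open>k\<close>, so the time integral is at least
  \<open>ta\<close> times the terminal value minus \<open>k\<close>. Solving for the terminal value
  gives the factor \<open>gam\<close>.\<close>

lemma lyapunov:
 assumes st: "0 <= s" "0 <= ta" and psi: "bddF s psi" "!!w. 0 <= psi w"
 shows "EV psi (s + ta) <= EV psi s + ennreal (Kl * ta * EE psi)" (is ?A)
  "EV psi (s + ta) <= ennreal (gam ta) * EV psi s + ennreal (Kl * ta * EE psi)" (is ?B)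
proof -
 define c where "c = dr / 2 * ep"
 define k where "k = Kl * ta * EE psi"
 have E0: "0 <= EE psi" using psi(2) by (intro integral_nonneg') auto
 have g: "gam ta = 1 / (1 + c * ta)" unfolding gam_def c_def by (rule refl)
 have ck: "0 <= c" "0 <= k" using drift SB0 E0 st by (auto simp: c_def k_def)
 show 1: ?A
  using lyapunov_integral[OF st(1) _ psi, of "s + ta"] st by (auto intro: order.trans[OF add_increasing2])
 show ?B
 proof (cases "EV psi s = \<infinity>")
  case True
  have "0 < gam ta" using ck st by (simp add: g add_pos_nonneg)
  thus ?thesis using True by (simp add: ennreal_mult_top)
 next
  case False
  then obtain Vs where Vs: "0 <= Vs" "EV psi s = ennreal Vs" by (cases "EV psi s") auto
  have "EV psi (s + ta) ~= \<infinity>" using 1 Vs by (auto simp: top_unique)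
  then obtain Vt where Vt: "0 <= Vt" "EV psi (s + ta) = ennreal Vt" by (cases "EV psi (s + ta)") auto
  \<comment> \<open>The integrated inequality from \<open>v\<close> to the end, with the nonnegative
    integral dropped.\<close>
  have low: "ennreal (Vt - k) <= EV psi v" if v: "v : {s..s + ta}" for v
  proof -
   have "EV psi (v + (s + ta - v)) + ennreal (dr / 2 * ep) * NI LB (%u. EV psi u * indicator {v..v + (s + ta - v)} u) <= EV psi v + ennreal (Kl * (v + (s + ta - v) - v) * EE psi)"
    by (rule lyapunov_integral) (use v st bddF_mono[OF psi(1)] psi(2) in auto)
   hence "EV psi (s + ta) <= EV psi v + ennreal (Kl * (s + ta - v) * EE psi)" by (auto intro: order.trans[OF add_increasing2])
   also have "... <= EV psi v + ennreal k" unfolding k_def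
    using v E0 SB0(4) by (intro add_left_mono ennreal_leI mult_right_mono mult_left_mono) auto
   finally show ?thesis unfolding Vt using ck by (simp add: ennreal_minus[symmetric] ennreal_minus_le_iff add.commute)
  qed
  have "ennreal (Vt - k) * ennreal ta = NI LB (%v. ennreal (Vt - k) * indicator {s..s + ta} v)" using st by (simp add: nn_integral_cmult_indicator)
  also have "... <= NI LB (%v. EV psi v * indicator {s..s + ta} v)" using low by (intro nn_integral_mono) (auto simp: indicator_def)
  finally have "ennreal Vt + ennreal c * (ennreal (Vt - k) * ennreal ta) <= ennreal Vs + ennreal k"
   using order.trans[OF add_left_mono[OF mult_left_mono] lyapunov_integral[OF st(1) _ psi, of "s + ta"]] st
   unfolding Vt Vs c_def k_def by (simp add: mult.assoc)
  hence "ennreal (Vt + c * (max 0 (Vt - k) * ta)) <= ennreal (Vs + k)"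
  proof -
   have m: "ennreal (Vt - k) = ennreal (max 0 (Vt - k))" by (cases "0 <= Vt - k") (auto simp: ennreal_neg max_def)
   have m0: "0 <= c * (max 0 (Vt - k) * ta)" using ck st by simp
   have "ennreal (c * (max 0 (Vt - k) * ta)) = ennreal c * (ennreal (Vt - k) * ennreal ta)"
    unfolding m using ck st by (simp only: ennreal_mult max.cobounded1 mult_nonneg_nonneg)
   thus ?thesis using \<open>ennreal Vt + _ <= _\<close> unfolding ennreal_plus[OF Vt(1) m0] ennreal_plus[OF Vs(1) ck(2)] by simp
  qed
  hence "Vt + c * (max 0 (Vt - k) * ta) <= Vs + k" using Vs ck by (subst (asm) ennreal_le_iff) auto
  moreover have "c * ((Vt - k) * ta) <= c * (max 0 (Vt - k) * ta)" using ck st by (intro mult_left_mono mult_right_mono) auto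
  ultimately have "(Vt - k) * (1 + c * ta) <= Vs" by (simp add: algebra_simps)
  hence "Vt - k <= gam ta * Vs" using ck st by (simp add: g add_pos_nonneg pos_le_divide_eq)
  hence "ennreal Vt <= ennreal (gam ta * Vs + k)" by (intro ennreal_leI) simp
  also have "... = ennreal (gam ta) * ennreal Vs + ennreal k" using Vs ck st by (subst ennreal_plus) (auto simp: ennreal_mult[symmetric] g)
  finally show ?thesis unfolding Vt Vs k_def .
 qed
qed

section \<open>Harris contraction\<close>

text \<open>\<open>Ki\<close> is the fixed point of the map sending k to Kl r0 + g0 k. Weights with
  \<open>mV\<close> at most \<open>kp\<close> times \<open>mass\<close> count as concentrated, and
  outside the radius \<open>RR\<close> the function \<open>V\<close> exceeds 4 kp. \<open>be\<close>
  is so small that the growth be * Ki of the second part of the norm costs only half of the gain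
  \<open>mm\<close> in the first.\<close>

definition "g0 = gam r0"
definition "Ki = Kl * r0 / (1 - g0)"
definition "kp = 4 * Ki / (1 - g0)"
definition "RR = ln (4 * kp) / ep"
definition "tt = tau RR"
definition "mm = cR RR * measure LB (ball (0::real^'n) rho) / 2"
definition "be = mm / (2 * Ki)"
definition "th = max (1 - mm / 2) ((1 + g0) / 2)"
abbreviation "mass eta \<equiv> EE (%w. abs (eta w))"
abbreviation "mV s eta \<equiv> EE (%w. abs (eta w) * V (Y s w))"
definition "fin s eta \<longleftrightarrow> bddF s eta & integrable M (%w. abs (eta w) * V (Y s w))"

lemma harris_constants: "0 < g0" "g0 < 1" "0 < Ki" "Kl * r0 + g0 * Ki = Ki" (is ?A) "kp * (1 - g0) = 4 * Ki" (is ?B) "0 < kp" "0 < mm" "0 < be" "be * Ki = mm / 2" "0 < th" "th < 1" "0 < tt"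
proof -
 have "0 < dr / 2 * ep * r0" using drift SB0 r0 by simp
 thus g: "0 < g0" "g0 < 1" unfolding g0_def gam_def by (simp_all del: times_divide_eq_left)
 thus K: "0 < Ki" using SB0 r0 by (simp add: Ki_def)
 have "Ki * (1 - g0) = Kl * r0" using g by (simp add: Ki_def)
 thus ?A by (simp add: algebra_simps)
 show ?B "0 < kp" using g K by (auto simp: kp_def)
 show m: "0 < mm" unfolding mm_def using cR_pos rho by (simp add: content_ball_pos)
 thus "0 < be" "be * Ki = mm / 2" using K by (auto simp: be_def)
 show "0 < th" "th < 1" using g m by (auto simp: th_def less_max_iff_disj)
 show "0 < tt" using tau_pos by (simp add: tt_def)
qed

lemma bddF_abs: "bddF s eta ==> bddF s (%w. abs (eta w))"
 unfolding bddF_def by auto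

lemma EV_abs: "fin s eta ==> EV (%w. abs (eta w)) s = ennreal (mV s eta)"
 unfolding fin_def EV_def using less_imp_le[OF V(2)] by (subst nn_integral_eq_integral[symmetric]) (auto simp: ennreal_mult)

lemma ib_integrable: "bddF s r ==> C : sets borel ==> integrable M (%w. r w * ib t C w)"
 unfolding ib_def by (rule psi_integrable[where k=1]) auto

lemma mV_nonneg: "0 <= mV s eta"
 by (intro integral_nonneg' mult_nonneg_nonneg abs_ge_zero less_imp_le[OF V(2)])

text \<open>\<open>tt\<close> is a multiple of \<open>r0\<close>, and iterating the bound over
  \<open>r0\<close> does not enlarge its constant because \<open>Ki\<close> is the fixed
  point.\<close>

lemma lyapunov_tt:
 assumes s: "0 <= s" and psi: "bddF s psi" "!!w. 0 <= psi w"
 shows "EV psi (s + tt) <= ennreal g0 * EV psi s + ennreal (Ki * EE psi)"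
proof -
 have E0: "0 <= EE psi" using psi(2) by (intro integral_nonneg') auto
 note h = harris_constants
 have "EV psi (s + real (Suc m) * r0) <= ennreal g0 * EV psi s + ennreal (Ki * EE psi)" for m
 proof (induction m)
  case 0
  have "Kl * r0 * EE psi <= Ki * EE psi" using h E0 by (intro mult_right_mono) (smt (verit) mult_pos_pos)+
  thus ?case using lyapunov(2)[OF s _ psi, of r0] r0 by (auto simp: g0_def intro: order.trans[OF _ add_left_mono] ennreal_leI)
 next
  case (Suc m)
  have "EV psi (s + real (Suc m) * r0 + r0) <= ennreal g0 * EV psi (s + real (Suc m) * r0) + ennreal (Kl * r0 * EE psi)"
   unfolding g0_def by (rule lyapunov(2)) (use s r0 psi bddF_mono[OF psi(1)] in auto)
  also have "... <= ennreal g0 * (1 * EV psi s + ennreal (Ki * EE psi)) + ennreal (Kl * r0 * EE psi)"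
   by (rule add_right_mono[OF mult_left_mono[OF order.trans[OF Suc add_right_mono[OF mult_right_mono]]]]) (use h in auto)
  also have "... = ennreal g0 * EV psi s + (ennreal (g0 * (Ki * EE psi)) + ennreal (Kl * r0 * EE psi))"
   using h E0 by (simp add: distrib_left ennreal_mult add.assoc)
  also have "ennreal (g0 * (Ki * EE psi)) + ennreal (Kl * r0 * EE psi) = ennreal ((Kl * r0 + g0 * Ki) * EE psi)"
  proof -
   have p: "0 <= g0 * (Ki * EE psi)" "0 <= Kl * r0 * EE psi" using h(1,3) E0 SB0(4) r0(1) by auto
   have "(Kl * r0 + g0 * Ki) * EE psi = g0 * (Ki * EE psi) + Kl * r0 * EE psi" by (simp only: distrib_right mult.assoc add.commute)
   thus ?thesis by (simp only: ennreal_plus[OF p])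
  qed
  finally show ?case unfolding h(4) by (simp add: algebra_simps)
 qed
 thus ?thesis by (simp add: tt_def tau_def)
qed

text \<open>\<open>eta\<close> is replaced by its conditional expectation given \<open>Y_t\<close>, so that its positive part lives on a set of the form \<open>Y_t : D\<close>.\<close>
lemma conditional_weight:
 assumes t: "0 <= t" and eta: "bddF t eta"
 obtains eta' D where "bddF t eta'" "null t (%w. eta w - eta' w)" "D : sets borel" "!!w. w : space M ==> abs (eta' w) = eta' w * (2 * ib t D w - 1)"
  "EV (%w. abs (eta' w)) t <= EV (%w. abs (eta w)) t"
proof -
 define Fs where "Fs = vimage_algebra (space M) (Y t) (borel :: (real^'n) measure)"
 have Ys: "Y t : space M \<rightarrow> space borel" by simp
 have sM: "sets Fs <= sets M" unfolding Fs_def sets_vimage_algebra2[OF Ys] by (auto intro!: measurable_sets[OF Y_measurable])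
 have sF: "sets Fs <= sets (F t)" unfolding Fs_def sets_vimage_algebra2[OF Ys] using measurable_sets[OF Y_adapted[OF t]] space_F by auto
 have sp: "space Fs = space M" by (simp add: Fs_def)
 interpret Q: finite_measure_subalgebra M Fs by unfold_locales (use sM sp in "simp add: subalgebra_def")
 have YF[measurable]: "Y t : borel_measurable Fs" unfolding Fs_def by (rule measurable_vimage_algebra1[OF Ys])
 obtain k where k: "0 <= k" "!!w. w : space M ==> abs (eta w) <= k" using bddF_bound[OF eta] by blast
 note [measurable] = bddF_D(2)[OF eta] V(3) and ie = bddF_D(3)[OF eta]
 \<comment> \<open>Clamped to [-k, k]: the conditional expectation is bounded only almost
   everywhere, whereas weights are bounded everywhere.\<close>
 define eta' where "eta' = (%w. max (- k) (min k (real_cond_exp M Fs eta w)))"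
 have em: "eta' : borel_measurable Fs" unfolding eta'_def by measurable
 have ae: "AE w in M. eta' w = real_cond_exp M Fs eta w"
 proof -
  have kk: "- k <= eta w" "eta w <= k" if "w : space M" for w using k(2)[OF that] by auto
  have "AE w in M. - k <= real_cond_exp M Fs eta w" by (rule Q.real_cond_exp_ge_c[OF ie AE_I2]) (rule kk)
  moreover have "AE w in M. real_cond_exp M Fs eta w <= k" by (rule Q.real_cond_exp_le_c[OF ie AE_I2]) (rule kk)
  ultimately show ?thesis by eventually_elim (simp add: eta'_def)
 qed
 have b': "bddF t eta'" unfolding bddF_def
 proof (intro conjI exI ballI)
  show "eta' : borel_measurable (F t)" using em sF sp space_F by (auto simp: measurable_def)
  show "abs (eta' w) <= k" for w using k(1) by (auto simp: eta'_def abs_le_iff)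
 qed
 note [measurable] = bddF_D(2)[OF b']
 have n: "null t (%w. eta w - eta' w)"
 proof (rule nullI)
  show "bddF t (%w. eta w - eta' w)" using eta b' unfolding bddF_def
   by (auto intro!: borel_measurable_diff) (meson abs_triangle_ineq4 add_mono order.trans)
  fix fi K assume p: "bcont K fi"
  note [measurable] = bcontD(1)[OF p]
  have i: "integrable M (%w. fi (Y t w) * eta w)" using psi_integrable[OF eta bcontD(1,2)[OF p], of t] by (simp add: mult.commute)
  have "EE (%w. eta' w * fi (Y t w)) = EE (%w. fi (Y t w) * real_cond_exp M Fs eta w)"
   by (rule integral_cong_AE) (use ae in "auto elim!: eventually_mono")
  also have "... = EE (%w. eta w * fi (Y t w))" using Q.real_cond_exp_intg(2)[OF i] by (simp add: mult.commute)
  finally show "EE (%w. (eta w - eta' w) * fi (Y t w)) = 0"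
   using psi_integrable[OF eta bcontD(1,2)[OF p], of t] psi_integrable[OF b' bcontD(1,2)[OF p], of t] by (simp add: left_diff_distrib)
 qed
 have "{w : space Fs. 0 <= eta' w} : sets Fs" using em by measurable
 then obtain D where D: "D : sets borel" "{w : space Fs. 0 <= eta' w} = Y t -` D Int space M" unfolding Fs_def sets_vimage_algebra2[OF Ys] by auto
 have s: "abs (eta' w) = eta' w * (2 * ib t D w - 1)" if w: "w : space M" for w
  using w eq_refl[OF D(2)] eq_refl[OF D(2)[symmetric]] by (cases "0 <= eta' w") (auto simp: ib_def indicator_def sp)
 have "EV (%w. abs (eta' w)) t <= NI M (%w. ennreal (V (Y t w)) * nn_cond_exp M Fs (%w. ennreal (abs (eta w))) w)" unfolding EV_def
 proof (rule nn_integral_mono_AE)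
  have "AE w in M. abs (real_cond_exp M Fs eta w) <= nn_cond_exp M Fs (%w. ennreal (abs (eta w))) w" by (rule Q.real_cond_exp_abs) simp
  with ae show "AE w in M. ennreal (abs (eta' w)) * ennreal (V (Y t w)) <= ennreal (V (Y t w)) * nn_cond_exp M Fs (%w. ennreal (abs (eta w))) w"
   by eventually_elim (simp add: mult.commute mult_right_mono)
 qed
 also have "... = EV (%w. abs (eta w)) t" unfolding EV_def by (subst Q.nn_cond_exp_intg) (auto simp: mult.commute)
 finally have ev: "EV (%w. abs (eta' w)) t <= EV (%w. abs (eta w)) t" .
 show thesis by (rule that[of eta' D]) (fact b' n D(1) s ev)+
qed

text \<open>Markov's inequality: outside the radius \<open>RR\<close> the weight is at most |eta| V
  / (4 kp), which totals at most a quarter of the mass, while \<open>p\<close> carries half of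
  it.\<close>

lemma near_mass:
 assumes s: "0 <= s" and eta: "fin s eta" "mV s eta <= kp * mass eta"
  and p: "bddF s p" "!!w. 0 <= p w" "!!w. p w <= abs (eta w)" "EE p = mass eta / 2"
 shows "mass eta / 4 <= EE (%w. p w * ib s (cball 0 RR) w)"
proof -
 have i: "integrable M p" "integrable M (%w. p w * ib s (cball 0 RR) w)" "integrable M (%w. abs (eta w) * V (Y s w))"
  using bddF_D(3)[OF p(1)] eta(1) by (auto simp: fin_def intro: ib_integrable[OF p(1)])
 have kp: "0 < 4 * kp" using harris_constants by simp
 have "EE p <= EE (%w. p w * ib s (cball 0 RR) w + abs (eta w) * V (Y s w) / (4 * kp))"
 proof (rule integral_mono)
  show "p w <= p w * ib s (cball 0 RR) w + abs (eta w) * V (Y s w) / (4 * kp)" for w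
  proof (cases "Y s w : cball 0 RR")
   case True thus ?thesis using kp V(2)[of "Y s w"] by (simp add: ib_def)
  next
   case False
   hence "ln (4 * kp) / ep < jb (Y s w)" using jb(2)[of "Y s w"] by (simp add: RR_def)
   hence "exp (ln (4 * kp)) < V (Y s w)" unfolding V_def using SB0(3) by (simp add: divide_simps mult.commute)
   hence "1 <= V (Y s w) / (4 * kp)" using kp by simp
   from mult_left_mono[OF this abs_ge_zero[of "eta w"]] show ?thesis using False p(3)[of w] by (simp add: ib_def)
  qed
 qed (use i in auto)
 also have "... = EE (%w. p w * ib s (cball 0 RR) w) + mV s eta / (4 * kp)" using i by simp
 also have "mV s eta / (4 * kp) <= kp * mass eta / (4 * kp)" using eta(2) kp by (intro divide_right_mono) auto
 finally show ?thesis using p(4) kp by simp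
qed

text \<open>If \<open>mV\<close> is at most \<open>kp\<close> times the mass, the positive and the
  negative part both put mass on one ball at the end of the step; there they cancel and the mass
  shrinks. Otherwise the Lyapunov part dominates the norm and its own contraction suffices.\<close>

lemma harris_step:
 assumes s: "0 <= s" and eta: "fin s eta" "EE eta = 0"
 obtains eta' where "fin (s + tt) eta'" "EE eta' = 0" "null (s + tt) (%w. eta w - eta' w)"
  "mass eta' + be * mV (s + tt) eta' <= th * (mass eta + be * mV s eta)"
proof -
 note h = harris_constants
 define t where "t = s + tt"
 have t: "0 <= t" "s <= t" using s h by (auto simp: t_def)
 have b: "bddF s eta" "bddF t eta" using eta(1) t bddF_mono by (auto simp: fin_def)
 obtain eta' D where e: "bddF t eta'" "null t (%w. eta w - eta' w)" "D : sets borel" "!!w. w : space M ==> abs (eta' w) = eta' w * (2 * ib t D w - 1)"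
  "EV (%w. abs (eta' w)) t <= EV (%w. abs (eta w)) t" using conditional_weight[OF t(1) b(2)] by blast
 note [measurable] = bddF_D(2)[OF e(1)] V(3) e(3)
 have z: "EE (%w. eta w * f (Y t w)) = EE (%w. eta' w * f (Y t w))" if f: "f : BB" "!!x. abs (f x) <= k" for f k
 proof -
  have "EE (%w. (eta w - eta' w) * f (Y t w)) = 0" using e(2) f unfolding null_def by blast
  thus ?thesis using psi_integrable[OF b(2) f, of t] psi_integrable[OF e(1) f, of t] by (simp add: left_diff_distrib)
 qed
 have N0: "0 <= mass eta" "0 <= mass eta'" "0 <= mV s eta" using mV_nonneg by (auto intro!: integral_nonneg')
 have e1: "EV (%w. abs (eta' w)) t <= ennreal (g0 * mV s eta + Ki * mass eta)"
  using order.trans[OF e(5)[unfolded t_def] lyapunov_tt[OF s bddF_abs[OF b(1)]]] EV_abs[OF eta(1)] N0 h by (simp add: t_def ennreal_mult)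
 hence i': "integrable M (%w. abs (eta' w) * V (Y t w))"
  by (intro integrableI_bounded) (auto simp: EV_def ennreal_mult abs_mult less_imp_le[OF V(2)] abs_of_pos[OF V(2)] elim!: order.strict_trans1)
 hence fin': "fin t eta'" using e(1) by (simp add: fin_def)
 have U: "mV t eta' <= g0 * mV s eta + Ki * mass eta"
  using e1[unfolded EV_abs[OF fin']] by (subst (asm) ennreal_le_iff) (use N0 h in auto)
 define p q where "p = (%w. max 0 (eta w))" and "q = (%w. max 0 (- eta w))"
 have pq: "bddF s p" "bddF s q" "!!w. 0 <= p w" "!!w. 0 <= q w" "!!w. p w <= abs (eta w)" "!!w. q w <= abs (eta w)" "!!w. eta w = p w - q w" "!!w. abs (eta w) = p w + q w"
 proof -
  obtain k where k: "0 <= k" "!!w. w : space M ==> abs (eta w) <= k" using bddF_bound[OF b(1)] by blast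
  thus "bddF s p" "bddF s q" unfolding bddF_def p_def q_def using bddF_D(1)[OF b(1)]
   by (auto intro!: exI[of _ k] borel_measurable_max borel_measurable_uminus simp: abs_le_iff)
 qed (auto simp: p_def q_def)
 note ii = bddF_D(3)[OF pq(1)] bddF_D(3)[OF pq(2)]
 have half: "EE p = mass eta / 2" "EE q = mass eta / 2"
 proof -
  have "EE (%w. p w - q w) = 0" using eta(2) pq(7) by (simp add: p_def q_def)
  moreover have "mass eta = EE (%w. p w + q w)" by (rule integral_cong'[OF refl pq(8)])
  ultimately show "EE p = mass eta / 2" "EE q = mass eta / 2" using ii by auto
 qed
 note id = ib_integrable[where t=t]
 \<comment> \<open>The parts of the positive and of the negative mass that land where the
   conditional weight has the opposite sign; each is lost twice.\<close>
 define x y where "x = EE (%w. p w * ib t (- D) w)" and "y = EE (%w. q w * ib t D w)"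
 have xy0: "0 <= x" "0 <= y" using pq by (auto simp: x_def y_def ib_def intro!: integral_nonneg')
 have "mass eta' = EE (%w. eta' w * (2 * ib t D w - 1))" by (rule integral_cong') (use e(4) in auto)
 also have "... = EE (%w. eta w * (2 * ib t D w - 1))"
  unfolding ib_def by (rule z[symmetric, where k=1]) (auto simp: indicator_def)
 also have "... = EE (%w. (p w + q w) - 2 * (p w * ib t (- D) w) - 2 * (q w * ib t D w))"
  by (rule integral_cong') (auto simp: pq(7) ib_def indicator_def)
 also have "... = mass eta - 2 * x - 2 * y" using ii id[OF pq(1), of "- D"] id[OF pq(2), of D] by (simp add: x_def y_def integral_cong'[OF refl pq(8)])
 finally have N: "mass eta' = mass eta - 2 * x - 2 * y" .
 have minor: "cR RR * measure LB (ball 0 rho Int C) * EE (%w. r w * ib s (cball 0 RR) w) <= EE (%w. r w * ib t C w)"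
  if "bddF s r" "!!w. 0 <= r w" "C : sets borel" for r C
  unfolding t_def tt_def by (rule order.trans[OF minorization[OF s that(1,2)] expectation_ib_mono[OF that(1,2)]]) (use that(3) in auto)
 have key: "mass eta' + be * mV t eta' <= th * (mass eta + be * mV s eta)"
 proof -
  define n u where "n = mass eta" and "u = mV s eta"
  have nu: "0 <= n" "0 <= u" "mV t eta' <= g0 * u + Ki * n" using N0 U by (auto simp: n_def u_def)
  have beU: "be * mV t eta' <= be * (g0 * u) + mm / 2 * n"
   using mult_left_mono[OF nu(3) less_imp_le[OF h(8)]] h(9) by (simp add: distrib_left mult.assoc[symmetric])
  have thn: "(1 - mm / 2) * n <= th * n" "(1 + g0) / 2 * (be * u) <= th * (be * u)" using nu h by (auto intro!: mult_right_mono simp del: times_divide_eq_left simp: th_def)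
  show ?thesis
  proof (cases "u <= kp * n")
   case True
   have nm: "n / 4 <= EE (%w. p w * ib s (cball 0 RR) w)" "n / 4 <= EE (%w. q w * ib s (cball 0 RR) w)"
    unfolding n_def using near_mass[OF s eta(1) _ pq(1,3,5) half(1)] near_mass[OF s eta(1) _ pq(2,4,6) half(2)] True by (auto simp: n_def u_def)
   have c: "0 <= cR RR * measure LB (ball 0 rho Int C)" for C :: "(real^'n) set" using cR_pos by (simp add: less_imp_le)
   \<comment> \<open>\<open>D\<close> divides the ball: \<open>p\<close> is tested outside
     \<open>D\<close> and \<open>q\<close> inside, and the two shares add up to the whole ball
     whatever \<open>D\<close> is.\<close>
   have xy: "cR RR * measure LB (ball 0 rho Int - D) * (n / 4) <= x" "cR RR * measure LB (ball 0 rho Int D) * (n / 4) <= y"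
    using order.trans[OF mult_left_mono[OF nm(1) c] minor[OF pq(1,3), of "- D"]] order.trans[OF mult_left_mono[OF nm(2) c] minor[OF pq(2,4), of D]] by (auto simp: x_def y_def)
   have "measure LB (ball 0 rho Int - D) + measure LB (ball 0 rho Int D) = measure LB (ball (0::real^'n) rho)"
   proof -
    have f: "emeasure LB (ball (0::real^'n) rho Int C) ~= \<infinity>" for C
     using order.strict_trans1[OF emeasure_mono[of "ball 0 rho Int C" "ball 0 rho" LB] emeasure_lborel_ball_finite[of 0 rho]] by auto
    have "ball (0::real^'n) rho = (ball 0 rho Int - D) \<union> (ball 0 rho Int D)" by auto
    thus ?thesis using measure_Union[OF f f, of "- D" D] e(3) by (simp add: Int_commute inf_left_commute)
   qed
   hence se: "cR RR * measure LB (ball 0 rho Int - D) * (n / 4) + cR RR * measure LB (ball 0 rho Int D) * (n / 4) = mm / 2 * n"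
    unfolding mm_def by (simp add: distrib_left[symmetric] distrib_right[symmetric])
   have "mm / 2 * n <= x + y" unfolding se[symmetric] by (rule add_mono[OF xy])
   hence "mass eta' <= n - mm * n" using N[folded n_def] by linarith
   hence "mass eta' + be * mV t eta' <= (1 - mm / 2) * n + g0 * (be * u)" using beU by (simp add: algebra_simps)
   also have "g0 * (be * u) <= (1 + g0) / 2 * (be * u)" using h nu by (intro mult_right_mono) auto
   finally show ?thesis using thn by (simp add: n_def u_def distrib_left)
  next
   case False
   \<comment> \<open>By the choice of \<open>kp\<close> the slack (1 - g0) / 2 of the Lyapunov part
     covers both the growth mm / 2 and the wanted decrease mm / 2 in the mass term.\<close>
   have "be * (kp * n) * ((1 - g0) / 2) = be * n * (kp * (1 - g0)) / 2" by (simp add: mult_ac)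
   also have "... = be * Ki * n * 2" unfolding h(5) by simp
   finally have "mm / 2 * n * 2 = be * (kp * n) * ((1 - g0) / 2)" unfolding h(9) by (rule sym)
   also have "... <= be * u * ((1 - g0) / 2)" using False h by (intro mult_right_mono mult_left_mono) auto
   finally have f: "mm / 2 * n * 2 <= be * u * ((1 - g0) / 2)" .
   have "mass eta' <= n" using N xy0 by (simp add: n_def[symmetric])
   hence "mass eta' + be * mV t eta' <= n + (be * (g0 * u) + mm / 2 * n)" using beU by simp
   also have "... <= (1 - mm / 2) * n + (1 + g0) / 2 * (be * u)" using f by (simp add: algebra_simps add_divide_distrib diff_divide_distrib)
   finally show ?thesis using thn by (simp add: n_def u_def distrib_left)
  qed
 qed
 have "EE eta' = 0" using z[of "%_. 1" 1] eta(2) by simp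
 thus thesis using that[of eta'] fin' e(2) key unfolding t_def by blast
qed

lemma null_add: assumes "null s p" "null s q" shows "null s (%w. p w + q w)"
proof (rule nullI)
 have b: "bddF s p" "bddF s q" using assms by (auto simp: null_def)
 thus "bddF s (%w. p w + q w)" unfolding bddF_def by (auto intro!: borel_measurable_add) (meson abs_triangle_ineq add_mono order.trans)
 fix fi K assume "bcont K fi"
 note c = bcontD(1,2)[OF this]
 have "EE (%w. p w * fi (Y s w)) = 0" "EE (%w. q w * fi (Y s w)) = 0" using assms c unfolding null_def by blast+
 thus "EE (%w. (p w + q w) * fi (Y s w)) = 0"
  using psi_integrable[OF b(1) c, of s] psi_integrable[OF b(2) c, of s] by (simp add: distrib_right)
qed

text \<open>The weight is replaced at each step; the differences are null, remain null at later
  times and add up.\<close>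

lemma harris:
 assumes s: "0 <= s" and eta: "fin s eta" "EE eta = 0"
 shows "EX eta'. fin (s + real k * tt) eta' & EE eta' = 0 & null (s + real k * tt) (%w. eta w - eta' w) &
  mass eta' + be * mV (s + real k * tt) eta' <= th ^ k * (mass eta + be * mV s eta)"
proof (induction k)
 case 0
 have "null s (%w. 0)" by (rule nullI) (auto simp: bddF_def)
 thus ?case using eta by (intro exI[of _ eta]) simp
next
 case (Suc k)
 note h = harris_constants
 let ?s = "s + real k * tt"
 from Suc obtain e where e: "fin ?s e" "EE e = 0" "null ?s (%w. eta w - e w)" "mass e + be * mV ?s e <= th ^ k * (mass eta + be * mV s eta)" by blast
 have s0: "0 <= ?s" using s h by simp
 obtain e' where e': "fin (?s + tt) e'" "EE e' = 0" "null (?s + tt) (%w. e w - e' w)" "mass e' + be * mV (?s + tt) e' <= th * (mass e + be * mV ?s e)"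
  using harris_step[OF s0 e(1,2)] by blast
 have st: "s + real (Suc k) * tt = ?s + tt" by (simp add: algebra_simps)
 have "null (?s + tt) (%w. eta w - e w)" using null_later[OF s0 _ e(3)] h by simp
 from null_add[OF this e'(3)] have n: "null (?s + tt) (%w. eta w - e' w)" by simp
 have "mass e' + be * mV (?s + tt) e' <= th ^ Suc k * (mass eta + be * mV s eta)"
  using order.trans[OF e'(4) mult_left_mono[OF e(4) less_imp_le[OF h(10)]]] by (simp add: mult.assoc)
 thus ?case unfolding st using e'(1,2) n by blast
qed

text \<open>After \<open>k\<close> steps the weight may be exchanged for a small one: the difference
  is null and is not seen by products of functions at later times. The factors may sit at different
  times, as the asynchronous kernel product requires.\<close>

lemma mixing:
 assumes s: "0 <= s" and eta: "fin s eta" "EE eta = 0"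
  and I: "finite I" "!!i. i : I ==> s + real k * tt <= r i" "!!i. i : I ==> f i : BB" "!!i x. i : I ==> abs (f i x) <= c i"
 shows "abs (EE (%w. eta w * (PROD i:I. f i (Y (r i) w)))) <= (PROD i:I. c i) * (th ^ k * (mass eta + be * mV s eta))"
proof -
 note h = harris_constants
 obtain e where e: "fin (s + real k * tt) e" "null (s + real k * tt) (%w. eta w - e w)"
  "mass e + be * mV (s + real k * tt) e <= th ^ k * (mass eta + be * mV s eta)" using harris[OF s eta, of k] by blast
 have b: "bddF s eta" "bddF (s + real k * tt) e" using eta(1) e(1) by (auto simp: fin_def)
 have c0: "0 <= c i" if "i : I" for i using order.trans[OF abs_ge_zero I(4)[OF that]] .
 let ?P = "%w. PROD i:I. f i (Y (r i) w)"
 have [measurable]: "?P : borel_measurable M" using I(3) by (intro borel_measurable_prod measurable_compose[OF Y_measurable]) auto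
 have Pb: "abs (?P w) <= (PROD i:I. c i)" for w unfolding abs_prod by (rule prod_mono) (use I(4) in auto)
 have int: "integrable M (%w. u w * ?P w)" if "bddF v u" for u v
 proof (rule integrable_bound'[OF integrable_mult_right[OF integrable_abs[OF bddF_D(3)[OF that]], of "PROD i:I. c i"]])
  have "norm (u w * ?P w) <= norm ((PROD i:I. c i) * abs (u w))" for w
   using mult_right_mono[OF Pb[of w] abs_ge_zero[of "u w"]] order.trans[OF abs_ge_zero Pb[of w]] by (simp add: abs_mult mult.commute)
  thus "AE w in M. norm (u w * ?P w) <= norm ((PROD i:I. c i) * abs (u w))" by (rule AE_I2)
 qed (use bddF_D(2)[OF that] in measurable)
 define B' where "B' = 1 + (SUM i:I. c i)"
 have B': "c i <= B'" if "i : I" for i using member_le_sum[OF that, of c] c0 I(1) by (auto simp: B'_def)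
 have "EE (%w. (eta w - e w) * ?P w) = 0"
  by (rule null_prod[OF I(1) e(2) _ I(2,3), where k=B']) (use s h I(4) B' in "auto intro: order.trans")
 hence "EE (%w. eta w * ?P w) = EE (%w. e w * ?P w)" using int[OF b(1)] int[OF b(2)] by (simp add: left_diff_distrib)
 also have "\<bar>...\<bar> <= EE (%w. (PROD i:I. c i) * \<bar>e w\<bar>)"
 proof (rule order.trans[OF integral_abs_bound integral_mono[OF integrable_abs[OF int[OF b(2)]]]])
  show "abs (e w * ?P w) <= (PROD i:I. c i) * abs (e w)" for w using mult_right_mono[OF Pb[of w] abs_ge_zero[of "e w"]] by (simp add: abs_mult mult.commute)
 qed (use bddF_D(3)[OF b(2)] in auto)
 also have "... = (PROD i:I. c i) * mass e" by simp
 also have "... <= (PROD i:I. c i) * (th ^ k * (mass eta + be * mV s eta))"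
 proof (rule mult_left_mono)
  have "0 <= be * mV (s + real k * tt) e" by (rule mult_nonneg_nonneg[OF less_imp_le[OF h(8)] mV_nonneg])
  thus "mass e <= th ^ k * (mass eta + be * mV s eta)" using e(3) by simp
 qed (use c0 in "auto intro: prod_nonneg")
 finally show ?thesis .
qed

end

context elliptic_sde begin

section \<open>Asynchronous observation times\<close>

text \<open>One-dimensional factors of the Gaussian smoothing by \<open>G\<close>;
  \<open>cn / sqrt ta\<close> is the maximum of the density \<open>nd ta\<close>.\<close>

definition "nd ta = normal_density 0 (sqrt (2 * A^2 * ta))"
definition sm :: "real => (real => ennreal) => real => ennreal" where "sm ta f v = NI LB (%u. f u * ennreal (nd ta (v - u)))"
definition "cn = 1 / sqrt (4 * pi * A^2)"

lemma nd_measurable[measurable]: "nd ta : BB" unfolding nd_def by measurable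
lemma sm_measurable[measurable]: assumes [measurable]: "f : BB" shows "sm ta f : BB"
 unfolding sm_def by measurable
lemma cn: "0 < cn" using pos by (simp add: cn_def)

lemma nd: assumes "0 < ta" shows "nd ta v <= cn / sqrt ta" (is ?A) "NI LB (%v. ennreal (nd ta (v - u))) = 1" (is ?B) "NI LB (%u. ennreal (nd ta (v - u))) = 1" (is ?C)
proof -
 have s: "0 < sqrt (2 * A^2 * ta)" using assms pos by simp
 have "nd ta v <= 1 / sqrt (2 * pi * (2 * A^2 * ta)) * 1"
  unfolding nd_def normal_density_def using assms pos by (intro mult_mono) auto
 also have "sqrt (2 * pi * (2 * A^2 * ta)) = sqrt (4 * pi * A^2) * sqrt ta" by (subst real_sqrt_mult[symmetric]) (simp add: mult_ac)
 finally show ?A by (simp add: cn_def)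
 have i: "NI LB (%v. ennreal (nd ta v)) = 1" unfolding nd_def using s
  by (subst nn_integral_eq_integral) (auto simp: integral_normal_density)
 show ?B
  by (subst i[symmetric], subst (2) lborel_distr_plus[of "- u", symmetric], subst nn_integral_distr) auto
 thus ?C
  using i by (subst i[symmetric], subst (2) lborel_distr_plus[of "- v", symmetric], subst nn_integral_distr)
   (auto simp: nd_def normal_density_def power2_commute)
qed

text \<open>The two facts on which the asynchronous bounds rest: smoothing keeps the integral, and
  it bounds the supremum by the integral.\<close>

lemma sm: assumes [measurable]: "f : BB" and t: "0 < ta"
 shows "sm ta f v <= ennreal (cn / sqrt ta) * NI LB (%u. f u)" (is ?A) "NI LB (%v. sm ta f v) = NI LB (%u. f u)" (is ?B)
proof -
 have "sm ta f v <= NI LB (%u. f u * ennreal (cn / sqrt ta))"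
  unfolding sm_def using nd(1)[OF t] by (intro nn_integral_mono mult_left_mono ennreal_leI) auto
 thus ?A by (simp add: nn_integral_multc mult.commute)
 have "NI LB (%v. sm ta f v) = NI LB (%u. (NI LB (%v. f u * ennreal (nd ta (v - u)))))"
  unfolding sm_def by (rule lborel_pair.Fubini') measurable
 also have "... = NI LB (%u. f u)" by (rule nn_integral_cong) (simp add: nn_integral_cmult nd(2)[OF t])
 finally show ?B .
qed

lemma GN_prod:
 assumes [measurable]: "!!l. f l : BB" and t: "0 < ta"
 shows "GN ta (%y. PROD l:I. f l (y $ l)) z = (PROD l:I. sm ta (f l) (z $ l))"
proof -
 define g where "g l = (if l : I then f l else (%_. 1))" for l
 have [measurable]: "g l : BB" for l by (simp add: g_def)
 have g: "(PROD l:I. f l (y $ l)) = (PROD l:UNIV. g l (y $ l))" for y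
  by (rule prod.mono_neutral_cong_left) (auto simp: g_def)
 have "GN ta (%y. PROD l:I. f l (y $ l)) z = NI LB (%y. (PROD l:UNIV. g l (y $ l) * ennreal (nd ta (z $ l - y $ l))))"
  unfolding GN_def g G_def gauss_def nd_def by (simp add: prod.distrib prod_ennreal[symmetric])
 also have "... = (PROD l:UNIV. sm ta (g l) (z $ l))" unfolding sm_def by (rule nn_integral_vec_prod) measurable
 also have "... = (PROD l:I. sm ta (f l) (z $ l))"
  by (rule prod.mono_neutral_cong_right) (auto simp: g_def sm_def nd(3)[OF t])
 finally show ?thesis .
qed

text \<open>The factor of the earliest time becomes part of the weight, and the later factors are
  moved back to that time by induction. Then all sit at one time and \<open>heat\<close> moves them
  to \<open>p\<close>, smoothing each coordinate separately because \<open>G\<close> factorises. Of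
  the new functions only the integrals are remembered.\<close>

lemma async_upper:
 fixes f :: "'n => real => real"
 assumes "0 <= p" "bddF p psi" "!!w. 0 <= psi w" "!!l. l : I ==> p <= r l & r l <= p + t0"
  and f: "!!l. f l : BB" "!!l v. 0 <= f l v" "!!l v. f l v <= k"
 shows "EX f'. (ALL l. f' l : borel_measurable borel) & (ALL l:I. (NI LB (%v. f' l v)) = NI LB (%v. ennreal (f l v))) &
  (NI M (%w. ennreal (psi w) * (PROD l:I. ennreal (f l (Y (r l) w $ l))))) <= ennreal ((2 * c1) ^ card I) * NI M (%w. ennreal (psi w) * (PROD l:I. f' l (Y p w $ l)))"
 using assms(1-4)
proof (induction "card I" arbitrary: I p psi)
 case 0
 hence "I = {}" by simp
 thus ?case by (intro exI[of _ "%_ _. 0"]) simp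
next
 case (Suc n)
 hence ne: "I ~= {}" by auto
 define j where "j = arg_min_on r I"
 have j: "j : I" "!!i. i : I ==> r j <= r i" using arg_min_if_finite[OF _ ne, of r] by (auto simp: j_def not_less)
 have rj: "0 <= r j" "p <= r j" "r j <= p + t0" using Suc.prems(1) Suc.prems(4)[OF j(1)] by auto
 define ph where "ph = (%w. psi w * f j (Y (r j) w $ j))"
 have fb: "bddF (r j) (%w. f j (Y (r j) w $ j))"
  by (rule bddF_comp[where f="%y. f j (y $ j)" and K=k]) (use f rj in "auto simp: abs_le_iff intro!: measurable_compose[OF borel_measurable_nth] intro: order.trans[of _ 0]")
 have ph: "bddF (r j) ph" "!!w. 0 <= ph w" unfolding ph_def using bddF_mult[OF bddF_mono[OF Suc.prems(2) rj(2)] fb] Suc.prems(3) f(2) by auto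
 have "EX f'. (ALL l. f' l : borel_measurable borel) & (ALL l:I - {j}. (NI LB (%v. f' l v)) = NI LB (%v. ennreal (f l v))) &
  (NI M (%w. ennreal (ph w) * (PROD l:I - {j}. ennreal (f l (Y (r l) w $ l))))) <= ennreal ((2 * c1) ^ card (I - {j})) * NI M (%w. ennreal (ph w) * (PROD l:I - {j}. f' l (Y (r j) w $ l)))"
 proof (rule Suc.hyps(1)[OF _ rj(1) ph])
  show "r j <= r l & r l <= r j + t0" if "l : I - {j}" for l using j(2)[of l] Suc.prems(4)[of l] rj that by auto
 qed (use Suc.hyps(2) j in auto)
 then obtain g where g: "!!l. g l : BB" "!!l. l : I - {j} ==> (NI LB (%v. g l v)) = NI LB (%v. ennreal (f l v))"
  "NI M (%w. ennreal (ph w) * (PROD l:I - {j}. ennreal (f l (Y (r l) w $ l)))) <= ennreal ((2 * c1) ^ card (I - {j})) * NI M (%w. ennreal (ph w) * (PROD l:I - {j}. g l (Y (r j) w $ l)))" by blast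
 define q where "q = g(j := %v. ennreal (f j v))"
 have q[measurable]: "q l : BB" for l using g(1) f(1) by (simp add: q_def)
 have qi: "NI LB (%v. q l v) = NI LB (%v. ennreal (f l v))" if "l : I" for l using g(2) that by (simp add: q_def)
 have fI: "finite I" by simp
 have 1: "ennreal (ph w) * (PROD l:I - {j}. ennreal (f l (Y (r l) w $ l))) = ennreal (psi w) * (PROD l:I. ennreal (f l (Y (r l) w $ l)))" for w
  unfolding ph_def prod.remove[OF fI j(1)] using Suc.prems(3) f(2) by (simp add: ennreal_mult mult.assoc)
 have 2: "ennreal (ph w) * (PROD l:I - {j}. g l (Y (r j) w $ l)) = ennreal (psi w) * (PROD l:I. q l (Y (r j) w $ l))" for w
  unfolding ph_def prod.remove[OF fI j(1)] using Suc.prems(3) f(2) by (simp add: ennreal_mult mult.assoc q_def)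
 have cd: "card I = Suc (card (I - {j}))" using card_Suc_Diff1[OF fI j(1)] by simp
 have main: "NI M (%w. ennreal (psi w) * (PROD l:I. ennreal (f l (Y (r l) w $ l)))) <= ennreal ((2 * c1) ^ card (I - {j})) * NI M (%w. ennreal (psi w) * (PROD l:I. q l (Y (r j) w $ l)))"
  using g(3) unfolding 1 2 .
 have C: "ennreal ((2 * c1) ^ card (I - {j})) * ennreal (2 * c1) = ennreal ((2 * c1) ^ card I)" using c1(1) unfolding cd by (simp add: ennreal_mult[symmetric] mult.commute)
 show ?case
 proof (cases "r j = p")
  case True
  have "ennreal ((2 * c1) ^ card (I - {j})) <= ennreal ((2 * c1) ^ card I)" using c1(1) unfolding cd by (intro ennreal_leI power_increasing) auto
  thus ?thesis using q qi order.trans[OF main mult_right_mono] True by (intro exI[of _ q]) auto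
 next
  case False
  have t: "p < r j" "0 < r j - p" using False rj by auto
  have "NI M (%w. ennreal (psi w) * (PROD l:I. q l (Y (r j) w $ l))) <= ennreal (2 * c1) * NI M (%w. ennreal (psi w) * GN (r j - p) (%y. PROD l:I. q l (y $ l)) (Y p w))"
   by (rule heat[OF Suc.prems(1) t(1) rj(3) Suc.prems(2,3)]) measurable
  from order.trans[OF main mult_left_mono[OF this]]
  have "NI M (%w. ennreal (psi w) * (PROD l:I. ennreal (f l (Y (r l) w $ l)))) <= ennreal ((2 * c1) ^ card I) * NI M (%w. ennreal (psi w) * (PROD l:I. sm (r j - p) (q l) (Y p w $ l)))"
   unfolding GN_prod[OF q t(2)] mult.assoc[symmetric] C by simp
  thus ?thesis using sm(2)[OF q t(2)] qi q by (intro exI[of _ "%l. sm (r j - p) (q l)"]) auto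
 qed
qed

text \<open>One more Gaussian step, back to \<open>u < p\<close>, turns the integrals of the factors
  into suprema, at the price 1 / sqrt(p - u) per component.\<close>

lemma async_density:
 fixes f :: "'n => real => real"
 assumes up: "0 <= u" "u < p" "p <= u + t0" and psi: "bddF u psi" "!!w. 0 <= psi w" and r: "!!l. l : I ==> p <= r l & r l <= p + t0"
  and f: "!!l. f l : BB" "!!l v. 0 <= f l v" "!!l v. f l v <= k" "!!l. (NI LB (%v. ennreal (f l v))) <= ennreal c"
 shows "NI M (%w. ennreal (psi w) * (PROD l:I. ennreal (f l (Y (r l) w $ l))))
  <= ennreal ((2 * c1) ^ Suc (card I)) * (ennreal (cn / sqrt (p - u)) * ennreal c) ^ card I * NI M (%w. ennreal (psi w))"
proof -
 have p: "0 <= p" "bddF p psi" "0 < p - u" using up bddF_mono[OF psi(1), of p] by auto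
 note [measurable] = bddF_D(2)[OF psi(1)]
 obtain q where Q: "(ALL l. q l : borel_measurable borel) & (ALL l:I. (NI LB (%v. q l v)) = NI LB (%v. ennreal (f l v))) &
  (NI M (%w. ennreal (psi w) * (PROD l:I. ennreal (f l (Y (r l) w $ l))))) <= ennreal ((2 * c1) ^ card I) * NI M (%w. ennreal (psi w) * (PROD l:I. q l (Y p w $ l)))"
  using async_upper[OF p(1,2) psi(2) r f(1-3)] ..
 note q = Q[THEN conjunct1, rule_format] Q[THEN conjunct2, THEN conjunct1, rule_format] Q[THEN conjunct2, THEN conjunct2]
 note [measurable] = q(1)
 have "NI M (%w. ennreal (psi w) * (PROD l:I. q l (Y p w $ l))) <= ennreal (2 * c1) * NI M (%w. ennreal (psi w) * GN (p - u) (%y. PROD l:I. q l (y $ l)) (Y u w))"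
  by (rule heat[OF up psi]) measurable
 also have "NI M (%w. ennreal (psi w) * GN (p - u) (%y. PROD l:I. q l (y $ l)) (Y u w)) <= NI M (%w. ennreal (psi w) * (ennreal (cn / sqrt (p - u)) * ennreal c) ^ card I)"
 proof (intro nn_integral_mono mult_left_mono)
  fix w
  have "(PROD l:I. sm (p - u) (q l) (Y u w $ l)) <= (PROD l:I. ennreal (cn / sqrt (p - u)) * ennreal c)"
   by (rule prod_mono_ennreal) (use order.trans[OF sm(1)[OF q(1) p(3)] mult_left_mono] q(2) f(4) in auto)
  thus "GN (p - u) (%y. PROD l:I. q l (y $ l)) (Y u w) <= (ennreal (cn / sqrt (p - u)) * ennreal c) ^ card I"
   by (simp add: GN_prod[OF q(1) p(3)])
 qed simp
 also have "... = (ennreal (cn / sqrt (p - u)) * ennreal c) ^ card I * NI M (%w. ennreal (psi w))" by (subst nn_integral_multc) (auto simp: mult.commute)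
 finally have "NI M (%w. ennreal (psi w) * (PROD l:I. ennreal (f l (Y (r l) w $ l)))) <= ennreal ((2 * c1) ^ card I) * (ennreal (2 * c1) * ((ennreal (cn / sqrt (p - u)) * ennreal c) ^ card I * NI M (%w. ennreal (psi w))))"
  by (rule order.trans[OF q(3) mult_left_mono]) (auto simp: mult_left_mono)
 moreover have "ennreal ((2 * c1) ^ card I) * ennreal (2 * c1) = ennreal ((2 * c1) ^ Suc (card I))" using c1(1) by (simp add: ennreal_mult[symmetric] mult.commute)
 ultimately show ?thesis by (simp add: mult.assoc[symmetric])
qed

text \<open>Near time 0 there is no earlier time to go back to; the bound on the initial density
  takes the place of the last smoothing.\<close>

lemma async_initial:
 fixes f :: "'n => real => real"
 assumes p: "0 <= p" "p <= t0" and init: "!!g. g : borel_measurable borel ==> (NI M (%w. g (Y 0 w))) <= ennreal cp * NI LB (%x. g x)"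
  and r: "!!l. p <= r l & r l <= p + t0"
  and f: "!!l. f l : BB" "!!l v. 0 <= f l v" "!!l v. f l v <= k" "!!l. (NI LB (%v. ennreal (f l v))) <= ennreal c"
 shows "NI M (%w. (PROD l:UNIV. ennreal (f l (Y (r l) w $ l)))) <= ennreal ((2 * c1) ^ Suc CARD('n)) * (ennreal cp * ennreal c ^ CARD('n))"
proof -
 have b: "bddF v (%w. 1)" "0 <= (1::real)" for v by (auto simp: bddF_def)
 obtain q where Q: "(ALL l. q l : borel_measurable borel) & (ALL l:UNIV. (NI LB (%v. q l v)) = NI LB (%v. ennreal (f l v))) &
  (NI M (%w. ennreal 1 * (PROD l:UNIV. ennreal (f l (Y (r l) w $ l))))) <= ennreal ((2 * c1) ^ CARD('n)) * NI M (%w. ennreal 1 * (PROD l:UNIV. q l (Y p w $ l)))"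
  using async_upper[OF p(1) b(1) b(2) r f(1-3)] ..
 note q = Q[THEN conjunct1, rule_format] Q[THEN conjunct2, THEN conjunct1, rule_format, OF UNIV_I] Q[THEN conjunct2, THEN conjunct2, unfolded ennreal_1 mult_1_left]
 note [measurable] = q(1)
 have lim: "NI M (%w. (PROD l:UNIV. g l (Y 0 w $ l))) <= ennreal cp * ennreal c ^ CARD('n)"
  if [measurable]: "!!l. g l : BB" and "!!l. (NI LB (%v. g l v)) = NI LB (%v. ennreal (f l v))" for g :: "'n => real => ennreal"
 proof -
  have "NI M (%w. (PROD l:UNIV. g l (Y 0 w $ l))) <= ennreal cp * NI LB (%x. (PROD l:UNIV. g l (x $ l)))" by (rule init) measurable
  also have "NI (LB :: (real^'n) measure) (%x. (PROD l:UNIV. g l (x $ l))) = (PROD l:UNIV. NI LB (%v. g l v))" by (rule nn_integral_vec_prod) measurable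
  also have "... <= (PROD l:(UNIV::'n set). ennreal c)" by (rule prod_mono_ennreal) (use that(2) f(4) in auto)
  finally show ?thesis by (simp add: mult_left_mono)
 qed
 have "NI M (%w. (PROD l:UNIV. q l (Y p w $ l))) <= ennreal (2 * c1) * (ennreal cp * ennreal c ^ CARD('n))"
 proof (cases "p = 0")
  case True
  have "NI M (%w. (PROD l:UNIV. q l (Y p w $ l))) <= 1 * (ennreal cp * ennreal c ^ CARD('n))" using lim[OF q(1,2)] True by simp
  also have "... <= ennreal (2 * c1) * (ennreal cp * ennreal c ^ CARD('n))" using c1(1) by (intro mult_right_mono) (auto simp: ennreal_1[symmetric] simp del: ennreal_1)
  finally show ?thesis .
 next
  case False
  have p0: "0 < p" using False p by simp
  have "NI M (%w. ennreal 1 * (PROD l:UNIV. q l (Y p w $ l))) <= ennreal (2 * c1) * NI M (%w. ennreal 1 * GN (p - 0) (%y. PROD l:UNIV. q l (y $ l)) (Y 0 w))"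
   by (rule heat[OF _ _ _ b(1,2)]) (use p p0 in auto)
  also have "... <= ennreal (2 * c1) * (ennreal cp * ennreal c ^ CARD('n))"
   using lim[of "%l. sm p (q l)"] sm(2)[OF q(1) p0] q(1,2) by (intro mult_left_mono) (auto simp: GN_prod[OF q(1) p0])
  finally show ?thesis by simp
 qed
 from order.trans[OF q(3) mult_left_mono[OF this]]
 have "NI M (%w. (PROD l:UNIV. ennreal (f l (Y (r l) w $ l)))) <= ennreal ((2 * c1) ^ CARD('n)) * ennreal (2 * c1) * (ennreal cp * ennreal c ^ CARD('n))" by (simp add: mult.assoc)
 moreover have "ennreal ((2 * c1) ^ CARD('n)) * ennreal (2 * c1) = ennreal ((2 * c1) ^ Suc CARD('n))" using c1(1) by (simp add: ennreal_mult[symmetric] mult.commute)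
 ultimately show ?thesis by simp
qed

end

section \<open>Covariances of the kernel products\<close>

text \<open>\<open>r u l\<close> abstracts the last observation time of component \<open>l\<close>
  up to \<open>u\<close>, and \<open>dl\<close> the mesh. The law of the process enters only at time
  0, through a density bound \<open>cp\<close> and a \<open>V\<close>-moment
  \<open>vp\<close>.\<close>

locale async_sde = ergodic_sde a b M W X A B L lam dr rd
 for a :: "real^'n::finite => real^'n^'n" and b :: "real^'n => real^'n"
  and M :: "'w measure" and W X :: "real => 'w => real^'n" and A B L lam dr rd :: real +
 fixes Kf :: "real => real" and Kb :: real and h :: "'n => real" and x0 :: "real^'n" and r :: "real => 'n => real" and dl T cp vp :: real and i1 i2 :: 'n
 assumes Kf[measurable]: "Kf : BB" and Kb: "abs (Kf v) <= Kb" "1 <= Kb" "1 < abs v ==> Kf v = 0"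
  and h: "0 < h l" "h l <= 1" and i12: "i1 ~= i2"
  and rm[measurable]: "(%u. r u l) : BB" and r: "0 <= u ==> u <= T ==> 0 <= r u l & u - dl <= r u l & r u l <= u"
  and dl: "0 <= dl" "4 * dl <= h i1 * h i2" and P2: "h i1 * h i2 <= t0" and T: "0 < T" and cp: "0 <= cp" "0 <= vp"
  and init: "g : borel_measurable borel ==> (NI M (%w. g (Y 0 w))) <= ennreal cp * NI LB (%x. g x)"
  and initV: "NI M (%w. ennreal (V (Y 0 w))) <= ennreal vp"
begin

text \<open>\<open>Z\<close> is the integrand of the estimator. \<open>zb\<close> bounds it,
  \<open>m1\<close> bounds its mean absolute value whatever the bandwidths, and the mean of |Z_u
  Z_v| will be at most m2 / (Q s) at lags s between \<open>P2\<close> and \<open>t0\<close>, and at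
  most \<open>m3\<close> beyond \<open>t0\<close>.\<close>

definition "fl l v = scaled_kernel Kf (h l) (x0 $ l - v)"
definition "Z u w = (PROD l:UNIV. fl l (Y (r u l) w $ l))"
definition "P2 = h i1 * h i2"
definition "Q = (PROD l:UNIV - {i1, i2}. h l)"
definition "dd = CARD('n)"
definition "zb = Kb ^ dd / (P2 * Q)"
definition "m1 = (2 * c1) ^ Suc dd * (2 * Kb) ^ dd * (cp + (cn / sqrt t0) ^ dd)"
definition "m2 = Kb ^ dd * ((2 * c1) ^ 3 * (8 * cn^2 * Kb^2) * m1)"
definition "m3 = (2 * c1) ^ Suc dd * (cn / sqrt (t0 / 2) * (2 * Kb)) ^ dd * m1"
abbreviation "EZ u \<equiv> EE (Z u)"

lemma fl: "abs (fl l v) <= Kb / h l" "fl l : BB" "NI LB (%v. ennreal (abs (fl l v))) <= ennreal (2 * Kb)" (is ?A) "abs (fl l v) <= zb" (is ?B)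
proof -
 note hl = h[of l]
 show 1: "abs (fl l v) <= Kb / h l" for v using Kb(1) hl by (simp add: fl_def scaled_kernel_def abs_mult divide_right_mono)
 show [measurable]: "fl l : BB" unfolding fl_def scaled_kernel_def by measurable
 have "ennreal (abs (fl l v)) <= ennreal (Kb / h l) * indicator {x0 $ l - h l..x0 $ l + h l} v" for v
 proof (cases "v : {x0 $ l - h l..x0 $ l + h l}")
  case False
  hence "1 < abs ((x0 $ l - v) / h l)" using hl by (auto simp: abs_divide divide_simps)
  thus ?thesis using Kb(3) by (simp add: fl_def scaled_kernel_def)
 qed (use 1 in "auto intro: ennreal_leI")
 hence "NI LB (%v. ennreal (abs (fl l v))) <= NI LB (%v. ennreal (Kb / h l) * indicator {x0 $ l - h l..x0 $ l + h l} v)" by (intro nn_integral_mono) auto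
 also have "... = ennreal (Kb / h l * (2 * h l))" using hl Kb(2) by (simp add: nn_integral_cmult_indicator ennreal_mult[symmetric])
 finally show ?A using hl by (simp add: mult.commute)
 have q: "P2 * Q = (PROD l:UNIV. h l)"
  unfolding P2_def Q_def using i12 prod.remove[of UNIV i1 h] prod.remove[of "UNIV - {i1}" i2 h] by (simp add: Diff_insert2[symmetric] mult.assoc)
 have "(PROD l:UNIV. h l) <= h l" using prod.remove[of UNIV l h] prod_le_1[of "UNIV - {l}" h] h hl by (simp add: less_imp_le mult_left_le)
 moreover have "0 < (PROD l:UNIV. h l)" using h by (simp add: prod_pos)
 moreover have "Kb ^ 1 <= Kb ^ dd" using Kb(2) by (intro power_increasing) (auto simp: dd_def Suc_le_eq)
 ultimately have "Kb / h l <= zb" unfolding zb_def q using hl Kb(2) by (intro frac_le) auto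
 thus ?B using 1[of v] by simp
qed

lemma pos_consts: "0 < P2" "0 < Q" "Q <= 1" "P2 <= t0" "P2 * Q = (PROD l:UNIV. h l)" (is ?A) "0 <= zb" "0 <= m1" "0 <= m2" "0 <= m3" "dl <= P2 / 4" "zb * P2 = Kb ^ dd / Q" (is ?B) "card (UNIV - {i1, i2}) <= dd" (is ?C)
proof -
 show "Q <= 1" unfolding Q_def by (rule prod_le_1) (use h in "auto intro: less_imp_le")
 show p: "0 < P2" "0 < Q" "P2 <= t0" "dl <= P2 / 4" using h dl P2 by (auto simp: P2_def Q_def prod_pos)
 show ?A
  unfolding P2_def Q_def using i12 prod.remove[of UNIV i1 h] prod.remove[of "UNIV - {i1}" i2 h] by (simp add: Diff_insert2[symmetric] mult.assoc)
 show "0 <= zb" "0 <= m1" using p Kb(2) c1(1) cn cp t0 by (auto simp: zb_def m1_def)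
 thus "0 <= m2" "0 <= m3" using p Kb(2) c1(1) cn cp t0 by (auto simp: m2_def m3_def)
 show ?B using p by (simp add: zb_def)
 show ?C unfolding dd_def by (rule card_mono) auto
qed

lemma Z_bound: "abs (Z u w) <= zb"
proof -
 have "abs (Z u w) <= (PROD l:UNIV. Kb / h l)" unfolding Z_def abs_prod by (rule prod_mono) (use fl(1) in auto)
 also have "... = zb" unfolding zb_def pos_consts(5) dd_def by (simp add: prod_dividef)
 finally show ?thesis .
qed

lemma Z_bddF: assumes "0 <= u" "u <= T" shows "bddF u (Z u)" "bddF u (%w. abs (Z u w))" (is ?A)
proof -
 have "(%w. fl l (Y (r u l) w $ l)) : borel_measurable (F u)" for l
 proof -
  have "Y (r u l) : borel_measurable (F u)" using measurable_F_mono[OF Y_adapted] r[OF assms, of l] by blast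
  from measurable_compose[OF borel_measurable_nth[OF this] fl(2)] show ?thesis .
 qed
 hence "Z u : borel_measurable (F u)" unfolding Z_def[abs_def] by (rule borel_measurable_prod)
 thus "bddF u (Z u)" unfolding bddF_def using Z_bound by blast
 thus ?A by (rule bddF_abs)
qed

lemma absZ: "ennreal (abs (Z u w)) = (PROD l:UNIV. ennreal (abs (fl l (Y (r u l) w $ l))))"
 unfolding Z_def abs_prod by (simp add: prod_ennreal)

text \<open>Each kernel factor has integral at most 2 Kb whatever its bandwidth, so a density bound
  suffices: that of the initial law for small \<open>u\<close>, otherwise the one gained over a time
  \<open>t0\<close> just before the observations.\<close>

lemma nnEZ: assumes "0 <= u" "u <= T" shows "NI M (%w. ennreal (abs (Z u w))) <= ennreal m1"
proof -
 define p where "p = max 0 (u - dl)"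
 have dt: "dl <= t0" using pos_consts t0 by simp
 have rp: "p <= r u l & r u l <= p + t0" for l using r[OF assms, of l] dt by (auto simp: p_def)
 have fm: "(%v. abs (fl l v)) : BB" for l using fl(2)[of l] by measurable
 have Cd: "0 <= (2 * c1) ^ Suc dd * (2 * Kb) ^ dd" using c1(1) Kb(2) by simp
 have m: "ennreal ((2 * c1) ^ Suc dd * (2 * Kb) ^ dd * x) <= ennreal m1" if "x <= cp + (cn / sqrt t0) ^ dd" for x
  unfolding m1_def using that Cd by (intro ennreal_leI mult_left_mono) auto
 show ?thesis
 proof (cases "p <= t0")
  case True
  have "NI M (%w. ennreal (abs (Z u w))) <= ennreal ((2 * c1) ^ Suc dd) * (ennreal cp * ennreal (2 * Kb) ^ dd)"
   unfolding absZ dd_def by (rule async_initial[where p=p and k=zb, OF _ True init rp fm abs_ge_zero fl(4,3)]) (auto simp: p_def)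
  also have "... = ennreal ((2 * c1) ^ Suc dd * (2 * Kb) ^ dd * cp)" using c1(1) Kb(2) cp by (simp add: ennreal_mult[symmetric] ennreal_power mult_ac)
  finally show ?thesis using m[of cp] cn t0 by simp
 next
  case False
  have "NI M (%w. ennreal 1 * (PROD l:UNIV. ennreal (abs (fl l (Y (r u l) w $ l))))) <=
    ennreal ((2 * c1) ^ Suc CARD('n)) * (ennreal (cn / sqrt (p - (p - t0))) * ennreal (2 * Kb)) ^ CARD('n) * NI M (%w. ennreal 1)"
   by (rule async_density[where k=zb, OF _ _ _ _ _ rp fm abs_ge_zero fl(4,3)]) (use False t0 in "auto simp: bddF_def")
  also have "... = ennreal ((2 * c1) ^ Suc dd * (2 * Kb) ^ dd * (cn / sqrt t0) ^ dd)"
   using c1(1) Kb(2) cn t0 emeasure_space_1 by (simp add: ennreal_mult[symmetric] ennreal_power dd_def power_mult_distrib power_divide mult_ac)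
  finally show ?thesis using order.trans[OF _ m[of "(cn / sqrt t0) ^ dd"]] cp by (simp add: absZ)
 qed
qed

lemma EZ: assumes "0 <= u" "u <= T" shows "EE (%w. abs (Z u w)) <= m1"
proof -
 note b = Z_bddF[OF assms]
 have "ennreal (EE (%w. abs (Z u w))) <= ennreal m1"
  using nnEZ[OF assms] bddF_D(3)[OF b(2)] by (simp add: nn_integral_eq_integral)
 thus ?thesis using pos_consts(7) by simp
qed

lemma ZZ_le:
 assumes u: "0 <= u" "u <= T" and v: "0 <= v" "v <= T" and c: "0 <= c" "NI M (%w. ennreal (abs (Z u w)) * ennreal (abs (Z v w))) <= ennreal c"
 shows "abs (EE (%w. (Z u w - EZ u) * (Z v w - EZ v))) <= c + m1^2"
proof -
 note [measurable] = bddF_D(2)[OF Z_bddF(1)[OF u]] bddF_D(2)[OF Z_bddF(1)[OF v]]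
 note i = bddF_D(3)[OF Z_bddF(1)[OF u]] bddF_D(3)[OF Z_bddF(1)[OF v]]
 have iz: "integrable M (%w. Z u w * Z v w)"
  by (rule integrable_const_bound[of _ "zb * zb"]) (auto simp: abs_mult intro!: AE_I2 mult_mono Z_bound order.trans[OF abs_ge_zero Z_bound])
 have "EE (%w. (Z u w - EZ u) * (Z v w - EZ v)) = EE (%w. Z u w * Z v w - EZ v * Z u w - EZ u * Z v w + EZ u * EZ v)"
  by (simp add: algebra_simps)
 also have "... = EE (%w. Z u w * Z v w) - EZ u * EZ v" using i iz by (simp add: prob_space)
 finally have e: "EE (%w. (Z u w - EZ u) * (Z v w - EZ v)) = EE (%w. Z u w * Z v w) - EZ u * EZ v" .
 have "abs (EE (%w. Z u w * Z v w)) <= EE (%w. abs (Z u w * Z v w))" by (rule integral_abs_bound)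
 also have "ennreal ... <= ennreal c" using c(2) integrable_abs[OF iz] by (subst nn_integral_eq_integral[symmetric]) (auto simp: abs_mult ennreal_mult)
 hence "EE (%w. abs (Z u w * Z v w)) <= c" using c(1) by simp
 finally have "abs (EE (%w. Z u w * Z v w)) <= c" .
 moreover have "abs (EZ u) <= m1" "abs (EZ v) <= m1" using order.trans[OF integral_abs_bound EZ[OF u]] order.trans[OF integral_abs_bound EZ[OF v]] by auto
 hence "abs (EZ u * EZ v) <= m1 * m1" unfolding abs_mult by (intro mult_mono) auto
 ultimately show ?thesis unfolding e power2_eq_square by linarith
qed

abbreviation (input) "ZZ u v == NI M (%w. ennreal (abs (Z u w)) * ennreal (abs (Z v w)))"
abbreviation (input) "f12 v w == (PROD l:{i1, i2}. abs (fl l (Y (r v l) w $ l)))"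
abbreviation (input) "e12 v w == (PROD l:{i1, i2}. ennreal (abs (fl l (Y (r v l) w $ l))))"

text \<open>Any lag: the supremum of one factor. Intermediate lags: only the coordinates
  \<open>i1\<close> and \<open>i2\<close> are smoothed, each at the price of 1 over the square root
  of the lag, and the others are bounded by Kb / h_l, which gives 1 / Q. Long lags: all coordinates
  are smoothed. An observation may precede \<open>v\<close> by \<open>dl\<close>, but
  \<open>dl\<close> is at most P2 / 4, so beyond \<open>P2\<close> at least half of the lag is
  left.\<close>

lemma nnZZ:
 assumes u: "0 <= u" "u <= T" and v: "u <= v" "v <= T"
 shows "ZZ u v <= ennreal (zb * m1)" (is ?A)
  and "P2 <= v - u ==> v - u <= t0 ==> ZZ u v <= ennreal (m2 / (Q * (v - u)))"
  and "t0 <= v - u ==> ZZ u v <= ennreal m3"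
proof -
 note pc = pos_consts and b = Z_bddF(2)[OF u]
 have v0: "0 <= v" using u v by simp
 note [measurable] = bddF_D(2)[OF Z_bddF(1)[OF u]] bddF_D(2)[OF Z_bddF(1)[OF v0 v(2)]]
 have fm: "(%v. abs (fl l v)) : BB" for l using fl(2)[of l] by measurable
 have dt: "dl <= t0 / 4" using pc by simp
 have rp: "v - dl <= r v l & r v l <= v - dl + t0" for l using r[OF v0 v(2), of l] dt t0 by auto
 have "ZZ u v <= NI M (%w. ennreal zb * ennreal (abs (Z u w)))"
  by (intro nn_integral_mono) (subst mult.commute, intro mult_right_mono ennreal_leI Z_bound, simp)
 also have "... <= ennreal zb * ennreal m1" by (subst nn_integral_cmult) (auto intro!: mult_left_mono nnEZ u)
 finally show ?A using pc by (simp add: ennreal_mult)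
 show "ZZ u v <= ennreal m3" if s: "t0 <= v - u"
 proof -
  have "NI M (%w. ennreal (abs (Z u w)) * (PROD l:UNIV. ennreal (abs (fl l (Y (r v l) w $ l))))) <=
   ennreal ((2 * c1) ^ Suc CARD('n)) * (ennreal (cn / sqrt (v - dl - (v - dl - t0 / 2))) * ennreal (2 * Kb)) ^ CARD('n) * NI M (%w. ennreal (abs (Z u w)))"
   by (rule async_density[where k=zb, OF _ _ _ bddF_mono[OF b] abs_ge_zero rp fm abs_ge_zero fl(4,3)]) (use s u dt t0 in auto)
  also have "... <= ennreal ((2 * c1) ^ Suc CARD('n)) * (ennreal (cn / sqrt (v - dl - (v - dl - t0 / 2))) * ennreal (2 * Kb)) ^ CARD('n) * ennreal m1" by (intro mult_left_mono nnEZ u) auto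
  also have "... = ennreal m3" using c1(1) Kb(2) cn t0 pc unfolding m3_def dd_def
   by (simp add: ennreal_mult[symmetric] ennreal_power)
  finally show ?thesis by (simp add: absZ)
 qed
 show "ZZ u v <= ennreal (m2 / (Q * (v - u)))" if s: "P2 <= v - u" "v - u <= t0"
 proof -
  have s0: "0 < v - u" "(v - u) / 2 <= v - dl - u" using s pc by auto
  have le: "abs (Z v w) <= Kb ^ dd / Q * f12 v w" for w
  proof -
   have e: "abs (Z v w) = (PROD l:UNIV - {i1, i2}. abs (fl l (Y (r v l) w $ l))) * f12 v w"
    unfolding Z_def abs_prod by (rule prod.subset_diff) auto
   have "(PROD l:UNIV - {i1, i2}. abs (fl l (Y (r v l) w $ l))) <= (PROD l:UNIV - {i1, i2}. Kb / h l)" by (rule prod_mono) (use fl(1) in auto)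
   also have "... = Kb ^ card (UNIV - {i1, i2}) / Q" unfolding Q_def by (simp add: prod_dividef)
   also have "... <= Kb ^ dd / Q" using pc Kb(2) by (intro divide_right_mono power_increasing) auto
   finally show ?thesis unfolding e by (rule mult_right_mono) (simp add: prod_nonneg)
  qed
  have "ZZ u v <= NI M (%w. ennreal (Kb ^ dd / Q) * (ennreal (abs (Z u w)) * e12 v w))"
  proof (rule nn_integral_mono)
   fix w
   have "ennreal (abs (Z u w)) * ennreal (abs (Z v w)) <= ennreal (abs (Z u w)) * ennreal (Kb ^ dd / Q * f12 v w)"
    by (intro mult_left_mono ennreal_leI le) simp
   also have "... = ennreal (Kb ^ dd / Q) * (ennreal (abs (Z u w)) * e12 v w)"
   proof -
    have "ennreal (Kb ^ dd / Q * f12 v w) = ennreal (Kb ^ dd / Q) * ennreal (f12 v w)"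
     by (rule ennreal_mult) (use pc Kb(2) in "simp_all add: prod_nonneg")
    thus ?thesis by (simp only: prod_ennreal[symmetric] abs_ge_zero mult_ac)
   qed
   finally show "ennreal (abs (Z u w)) * ennreal (abs (Z v w)) <= ennreal (Kb ^ dd / Q) * (ennreal (abs (Z u w)) * e12 v w)" .
  qed
  also have "... = ennreal (Kb ^ dd / Q) * NI M (%w. ennreal (abs (Z u w)) * e12 v w)"
  proof (rule nn_integral_cmult)
   have "(%w. fl l (Y (r v l) w $ l)) : borel_measurable M" for l by (rule measurable_compose[OF borel_measurable_nth[OF Y_measurable] fl(2)])
   note [measurable] = this
   show "(%w. ennreal (abs (Z u w)) * e12 v w) : borel_measurable M" by measurable
  qed
  finally have I: "ZZ u v <= ennreal (Kb ^ dd / Q) * NI M (%w. ennreal (abs (Z u w)) * e12 v w)" .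
  have "NI M (%w. ennreal (abs (Z u w)) * e12 v w) <=
   ennreal ((2 * c1) ^ Suc (card {i1, i2})) * (ennreal (cn / sqrt (v - dl - u)) * ennreal (2 * Kb)) ^ card {i1, i2} * NI M (%w. ennreal (abs (Z u w)))"
   by (rule async_density[where k=zb, OF u(1) _ _ b abs_ge_zero rp fm abs_ge_zero fl(4,3)]) (use s s0 dl in auto)
  also have "... <= ennreal ((2 * c1) ^ Suc (card {i1, i2})) * (ennreal (cn / sqrt (v - dl - u)) * ennreal (2 * Kb)) ^ card {i1, i2} * ennreal m1" by (intro mult_left_mono nnEZ u) auto
  also have "... = ennreal ((2 * c1) ^ 3 * (cn / sqrt (v - dl - u) * (2 * Kb))^2 * m1)"
   using i12 c1(1) Kb(2) cn s0 pc by (simp add: ennreal_mult[symmetric] ennreal_power numeral_3_eq_3 power2_eq_square)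
  finally have "NI M (%w. ennreal (abs (Z u w)) * e12 v w) <= ennreal ((2 * c1) ^ 3 * (cn / sqrt (v - dl - u) * (2 * Kb))^2 * m1)" .
  note order.trans[OF I mult_left_mono[OF this]]
  also have "ennreal (Kb ^ dd / Q) * ennreal ((2 * c1) ^ 3 * (cn / sqrt (v - dl - u) * (2 * Kb))^2 * m1) = ennreal (Kb ^ dd / Q * ((2 * c1) ^ 3 * (cn / sqrt (v - dl - u) * (2 * Kb))^2 * m1))"
   using c1(1) Kb(2) pc by (intro ennreal_mult[symmetric]) auto
  also have "... <= ennreal (m2 / (Q * (v - u)))"
  proof (rule ennreal_leI)
   have "(cn / sqrt (v - dl - u) * (2 * Kb))^2 = 4 * cn^2 * Kb^2 / (v - dl - u)" using s0 by (simp add: power_mult_distrib power_divide)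
   also have "... <= 4 * cn^2 * Kb^2 / ((v - u) / 2)" using s0 by (intro divide_left_mono) auto
   finally have "(cn / sqrt (v - dl - u) * (2 * Kb))^2 <= 8 * cn^2 * Kb^2 / (v - u)" by simp
   hence "Kb ^ dd / Q * ((2 * c1) ^ 3 * (cn / sqrt (v - dl - u) * (2 * Kb))^2 * m1) <= Kb ^ dd / Q * ((2 * c1) ^ 3 * (8 * cn^2 * Kb^2 / (v - u)) * m1)"
    using c1(1) Kb(2) pc by (intro mult_left_mono mult_right_mono) auto
   thus "Kb ^ dd / Q * ((2 * c1) ^ 3 * (cn / sqrt (v - dl - u) * (2 * Kb))^2 * m1) <= m2 / (Q * (v - u))" by (simp add: m2_def mult_ac)
  qed
  finally show ?thesis by simp
 qed
qed

text \<open>Covariance bound after \<open>k\<close> periods: \<open>zb\<close> for the later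
  product, and \<open>th ^ k\<close> times a bound of the weighted norm of the earlier one,
  centred.\<close>

definition "mx k = zb * (th ^ k * (2 * zb * (1 + be * (vp + Kl * T))))"

lemma cov_mixing:
 assumes u: "0 <= u" "u <= T" and v: "v <= T" "u + real k * tt <= v - dl"
 shows "abs (EE (%w. (Z u w - EZ u) * (Z v w - EZ v))) <= mx k"
proof -
 note hc = harris_constants and z = Z_bound and b = Z_bddF(1)[OF u]
 have "0 <= real k * tt" using hc(12) by simp
 hence v0: "0 <= v" using u v dl(1) by linarith
 define eta where "eta = (%w. Z u w - EZ u)"
 have EZb: "abs (EZ u) <= zb" by (rule expectation_bounded) (use z pos_consts in auto)
 have eb: "abs (eta w) <= 2 * zb" for w using z[of u w] EZb by (simp add: eta_def)
 have bE: "bddF u eta" unfolding bddF_def using bddF_D(1)[OF b] eb by (auto simp: eta_def)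
 note [measurable] = bddF_D(2)[OF b] bddF_D(2)[OF bE] V(3) and ib = bddF_D(3)[OF b]
 \<comment> \<open>The \<open>V\<close>-moment at time \<open>u\<close> is reached from the initial
   one by the Lyapunov bound. Its linear growth in \<open>T\<close> will be beaten by
   \<open>th ^ k\<close>.\<close>
 have one: "EV (%w. 1) (0 + u) <= ennreal (vp + Kl * T)"
 proof -
  have "EV (%w. 1) (0 + u) <= EV (%w. 1) 0 + ennreal (Kl * u * EE (%w. 1))" by (rule lyapunov(1)) (use u in "auto simp: bddF_def")
  also have "... <= ennreal vp + ennreal (Kl * T)" using initV u SB0(4) by (intro add_mono ennreal_leI) (auto simp: EV_def prob_space)
  finally show ?thesis using cp SB0(4) T by (simp add: ennreal_plus)
 qed
 have ev: "NI M (%w. ennreal (abs (eta w) * V (Y u w))) <= ennreal (2 * zb * (vp + Kl * T))"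
 proof -
  have "NI M (%w. ennreal (abs (eta w) * V (Y u w))) <= NI M (%w. ennreal (2 * zb) * (ennreal 1 * ennreal (V (Y u w))))"
   using eb pos_consts(6) V(2) by (intro nn_integral_mono) (auto simp: ennreal_mult[symmetric] less_imp_le intro!: ennreal_leI mult_right_mono)
  also have "... = ennreal (2 * zb) * EV (%w. 1) u" by (simp add: nn_integral_cmult EV_def)
  also have "... <= ennreal (2 * zb) * ennreal (vp + Kl * T)" using one by (intro mult_left_mono) auto
  finally show ?thesis using pos_consts(6) cp SB0(4) T by (simp add: ennreal_mult)
 qed
 have V0: "0 <= V x" for x using V(2)[of x] by simp
 hence fin': "fin u eta" unfolding fin_def using bE ev by (intro conjI integrableI_bounded) (auto simp: abs_mult elim!: order.strict_trans1)
 have U: "mV u eta <= 2 * zb * (vp + Kl * T)"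
  using ev fin' V0 pos_consts(6) cp SB0(4) T unfolding fin_def by (subst (asm) nn_integral_eq_integral) auto
 have N: "mass eta <= 2 * zb" using expectation_bounded[of "%w. abs (eta w)" "2 * zb"] eb pos_consts(6) by (simp add: abs_le_iff)
 have E0: "EE eta = 0" unfolding eta_def using ib by (simp add: prob_space)
 have "abs (EE (%w. eta w * (PROD l:UNIV. fl l (Y (r v l) w $ l)))) <= (PROD l:UNIV. Kb / h l) * (th ^ k * (mass eta + be * mV u eta))"
  by (rule mixing[OF u(1) fin' E0, where f="%l y. fl l (y $ l)"]) (use r[OF v0 v(1)] v(2) fl(1) in "auto intro: order.trans measurable_compose[OF borel_measurable_nth[OF measurable_ident_sets[OF refl]] fl(2)]")
 also have "(PROD l:UNIV. Kb / h l) = zb" unfolding zb_def pos_consts(5) dd_def by (simp add: prod_dividef)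
 also have "zb * (th ^ k * (mass eta + be * mV u eta)) <= zb * (th ^ k * (2 * zb + be * (2 * zb * (vp + Kl * T))))"
  using N U hc pos_consts by (intro mult_left_mono add_mono) auto
 also have "... = mx k" by (simp add: mx_def algebra_simps)
 also have "EE (%w. eta w * (PROD l:UNIV. fl l (Y (r v l) w $ l))) = EE (%w. eta w * Z v w - EZ v * eta w) + EZ v * EE eta"
 proof -
  note bv = Z_bddF(1)[OF v0 v(1)]
  note [measurable] = bddF_D(2)[OF bv]
  have "integrable M (%w. eta w * Z v w)"
   by (rule integrable_const_bound[of _ "2 * zb * zb"]) (auto simp: abs_mult intro!: AE_I2 mult_mono eb z order.trans[OF abs_ge_zero z] order.trans[OF abs_ge_zero eb])
  thus ?thesis using bddF_D(3)[OF bE] by (simp add: Z_def)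
 qed
 finally show ?thesis using E0 by (simp add: eta_def right_diff_distrib mult.commute)
qed

definition "NT = density LB (%u. ennreal (indicator {0..T} u))"

lemma NT: "finite_measure NT" "emeasure NT UNIV = ennreal T" (is ?A) "sets NT = sets borel" "space NT = UNIV"
 "f : borel_measurable borel ==> (BI NT (%u. f u)) = (LINT u:{0..T}|lborel. f u)" for f :: "real => real"
proof -
 show ?A unfolding NT_def using T by (simp add: emeasure_density ennreal_indicator)
 thus "finite_measure NT" by (intro finite_measureI) (simp add: NT_def)
 show "f : borel_measurable borel ==> (BI NT (%u. f u)) = (LINT u:{0..T}|lborel. f u)"
  unfolding NT_def set_lebesgue_integral_def by (rule integral_density) auto
qed (auto simp: NT_def)

lemma NT_fubini:
 assumes G: "(%(u, w). H u w) : borel_measurable (LB XM M)" "!!u w. abs (H u w) <= c"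
  and psi[measurable]: "psi : borel_measurable M" and k: "!!w. abs (psi w) <= k"
 shows "EE (%w. psi w * BI NT (%u. H u w)) = BI NT (%u. EE (%w. psi w * H u w))" (is ?A)
  "integrable NT (%u. EE (%w. psi w * H u w))" (is ?B) "(%w. BI NT (%u. H u w)) : borel_measurable M" (is ?C) "abs (BI NT (%u. H u w)) <= c * T" (is ?D)
proof -
 interpret N: finite_measure NT by (rule NT)
 interpret P: pair_sigma_finite NT M ..
 interpret PF: finite_measure "NT XM M" by (rule finite_measure_pair_measure) unfold_locales
 have c: "0 <= c" using order.trans[OF abs_ge_zero G(2)] .
 have [measurable_cong]: "sets NT = sets borel" by (rule NT)
 have [measurable]: "(%(u, w). H u w) : borel_measurable (NT XM M)" using G(1) by (simp cong: measurable_cong_sets sets_pair_measure_cong)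
 have i: "integrable (NT XM M) (%(u, w). psi w * H u w)"
  by (rule PF.integrable_const_bound[of _ "k * c"]) (auto simp: abs_mult intro!: AE_I2 mult_mono G k order.trans[OF abs_ge_zero k])
 have "EE (%w. psi w * BI NT (%u. H u w)) = EE (%w. BI NT (%u. psi w * H u w))" by simp
 also have "... = BI NT (%u. EE (%w. psi w * H u w))" by (rule P.Fubini_integral[OF i])
 finally show ?A .
 show ?B using P.integrable_fst'[OF i] by simp
 show ?C by measurable
 have "abs (BI NT (%u. H u w)) <= BI NT (%u. c)"
 proof (cases "integrable NT (%u. H u w)")
  case True thus ?thesis by (intro order.trans[OF integral_abs_bound integral_mono] integrable_abs G) auto
 qed (use c in "auto simp: not_integrable_integral_eq intro!: integral_nonneg'")
 also have "BI NT (%u. c) = c * T" using NT(2,4) T by (simp add: measure_def)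
 finally show ?D .
qed

lemma Z_joint: "(%(u, w). Z u w) : borel_measurable (LB XM M)"
proof -
 have "(%(u, w). Y (r u l) w) : borel_measurable (LB XM M)" for l
 proof -
  have "(%p. (r (fst p) l, snd p)) : measurable (LB XM M) (LB XM M)" by measurable
  from measurable_compose[OF this Y_joint] show ?thesis by (simp add: case_prod_beta)
 qed
 from measurable_compose[OF borel_measurable_nth[OF this] fl(2)]
 have "(%p. PROD l:UNIV. fl l ((case p of (u, w) => Y (r u l) w) $ l)) : borel_measurable (LB XM M)" by (intro borel_measurable_prod) auto
 thus ?thesis by (simp add: Z_def case_prod_beta)
qed

text \<open>The regimes overlap and are simply added. The product of the means, at most m1^2, also
  occurs at short and intermediate lags; it is paid by the third term, which covers all lags up to
  \<open>D\<close>. The 1 subtracted from \<open>D\<close> leaves room for the mesh.\<close>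

lemma covariance_envelope:
 assumes D: "1 <= D" "real k * tt <= D - 1" and uv: "0 <= u" "u <= v" "v <= T"
 shows "ennreal (abs (EE (%w. (Z u w - EZ u) * (Z v w - EZ v)))) <= ennreal (zb * m1) * indicator {0..P2} (v - u) + ennreal (m2 / Q / (v - u)) * indicator {P2..t0} (v - u)
  + ennreal (m3 + m1^2) * indicator {0..D} (v - u) + ennreal (mx k) * indicator {0..T} (v - u)"
  (is "ennreal ?c <= ?A + ?B + ?C + ?D")
proof -
 define s where "s = v - u"
 note pc = pos_consts
 have u: "0 <= u" "u <= T" "0 <= v" using uv by auto
 note z = ZZ_le[OF u(1,2) u(3) uv(3)] and n = nnZZ[OF u(1,2) uv(2,3)]
 have s0: "0 <= s" "s <= T" using uv by (auto simp: s_def)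
 have m: "m1^2 <= m3 + m1^2" "0 <= m3 + m1^2" using pc by auto
 have add: "ennreal (x + m1^2) <= ennreal x + ennreal (m3 + m1^2)" if "0 <= x" for x using that m by (subst ennreal_plus[symmetric]) (auto intro: ennreal_leI)
 have D0: "P2 <= D" "t0 <= D" using pc t0 D by auto
 consider "s < P2" | "P2 <= s" "s <= t0" | "t0 < s" "s <= D" | "D < s" by linarith
 thus ?thesis
 proof cases
  case 1
  have "ennreal ?c <= ennreal (zb * m1) + ennreal (m3 + m1^2)"
   using order.trans[OF ennreal_leI[OF z[OF _ n(1)]] add] pc by simp
  also have "... <= ?A + ?B + ?C + ?D" using 1 s0 D0 by (simp add: s_def[symmetric] add_increasing2 add.assoc add_mono)
  finally show ?thesis .
 next
  case 2
  have "0 <= m2 / (Q * (v - u))" using pc 2 s0 by (simp add: s_def)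
  hence "ennreal ?c <= ennreal (m2 / (Q * (v - u))) + ennreal (m3 + m1^2)"
   using order.trans[OF ennreal_leI[OF z[OF _ n(2)]] add] 2 by (simp add: s_def)
  also have "... <= ?A + ?B + ?C + ?D" using 2 s0 D0 by (simp add: s_def[symmetric] add_increasing add_increasing2 add.assoc add_mono)
  finally show ?thesis .
 next
  case 3
  have "ennreal ?c <= ennreal (m3 + m1^2)" using ennreal_leI[OF z[OF _ n(3)]] pc 3 by (simp add: s_def)
  also have "... <= ?A + ?B + ?C + ?D" using 3 s0 by (simp add: s_def[symmetric] add_increasing add_increasing2)
  finally show ?thesis .
 next
  case 4
  have "dl <= 1" using pc t0 by simp
  hence "ennreal ?c <= ennreal (mx k)" using 4 D by (intro ennreal_leI cov_mixing[OF u(1,2) uv(3)]) (simp add: s_def)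
  also have "... <= ?A + ?B + ?C + ?D" using s0 by (simp add: s_def[symmetric] add_increasing add_increasing2)
  finally show ?thesis .
 qed
qed

text \<open>A double time integral of covariances, each bounded by a function of the lag. For fixed
  \<open>u\<close> both signs of the lag occur, whence the 2; the outer integral gives
  \<open>T\<close> against the 1 / T^2 of the average. The term in 1 / s integrates to ln t0 - ln
  P2.\<close>

lemma variance_bound:
 assumes D: "1 <= D" "real k * tt <= D - 1"
 shows "variance (%w. 1 / T * (LINT u:{0..T}|lborel. Z u w)) <= 2 / T * (Kb ^ dd / Q * m1 + m2 / Q * (ln t0 - ln P2) + (m3 + m1^2) * D + mx k * T)"
proof -
 define II where "II = Kb ^ dd / Q * m1 + m2 / Q * (ln t0 - ln P2) + (m3 + m1^2) * D + mx k * T"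
 define kb where "kb s = ennreal (zb * m1) * indicator {0..P2} s + ennreal (m2 / Q / s) * indicator {P2..t0} s
  + ennreal (m3 + m1^2) * indicator {0..D} s + ennreal (mx k) * indicator {0..T} s" for s :: real
 define g where "g u w = Z u w - EZ u" for u w
 define S where "S w = BI NT (%u. g u w)" for w
 note pc = pos_consts and hc = harris_constants
 interpret N: finite_measure NT by (rule NT)
 have lnP: "ln P2 <= ln t0" using pc t0 by simp
 have mx0: "0 <= mx k" using pc hc cp SB0(4) T by (simp add: mx_def)
 have II0: "0 <= II" unfolding II_def using pc lnP mx0 D T Kb(2) by (intro add_nonneg_nonneg mult_nonneg_nonneg) auto
 have [measurable]: "kb : BB" unfolding kb_def[abs_def] by measurable
 have kbI: "NI LB (%s. kb s) = ennreal II"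
 proof -
  have hi: "((%s. m2 / Q / s) has_integral m2 / Q * ln t0 - m2 / Q * ln P2) {P2..t0}"
  proof (rule fundamental_theorem_of_calculus[OF pc(4)])
   fix s assume "s : {P2..t0}"
   hence "0 < s" using pc by auto
   thus "((%s. m2 / Q * ln s) has_vector_derivative m2 / Q / s) (at s within {P2..t0})"
    unfolding has_real_derivative_iff_has_vector_derivative[symmetric] by (auto intro!: derivative_eq_intros simp: divide_inverse)
  qed
  define Bf where "Bf s = ennreal (m2 / Q / s) * indicator {P2..t0} s" for s :: real
  have [measurable]: "Bf : BB" unfolding Bf_def[abs_def] by measurable
  define J where "J = m2 / Q * ln t0 - m2 / Q * ln P2"
  have 1: "NI LB (%s. Bf s) = ennreal J"
   unfolding Bf_def J_def by (rule nn_integral_has_integral_lebesgue'[OF _ hi]) (use pc in auto)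
  have "NI LB (%s. kb s) = ennreal (zb * m1) * ennreal P2 + ennreal J + ennreal (m3 + m1^2) * ennreal D + ennreal (mx k) * ennreal T"
   unfolding kb_def Bf_def[symmetric] using pc(1) D T by (simp add: nn_integral_add nn_integral_cmult_indicator 1 del: ennreal_plus)
  also have "... = ennreal (zb * m1 * P2 + J + (m3 + m1^2) * D + mx k * T)"
  proof -
   have "0 <= J" using mult_left_mono[OF lnP, of "m2 / Q"] pc by (simp add: J_def)
   thus ?thesis using pc mx0 D T by (simp add: ennreal_mult[symmetric] ennreal_plus[symmetric] del: ennreal_plus)
  qed
  also have "zb * m1 * P2 + J + (m3 + m1^2) * D + mx k * T = II"
  proof -
   have "zb * m1 * P2 = zb * P2 * m1" by simp
   thus ?thesis unfolding pc(11) II_def J_def by (simp only: right_diff_distrib)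
  qed
  finally show ?thesis .
 qed
 have cov: "ennreal (abs (EE (%w. g u w * g v w))) <= kb (v - u) + kb (u - v)" if "u : {0..T}" "v : {0..T}" for u v
 proof (cases "u <= v")
  case True
  thus ?thesis using covariance_envelope[OF D, of u v] that by (auto simp: kb_def g_def intro: order.trans add_increasing2)
 next
  case False
  thus ?thesis using covariance_envelope[OF D, of v u] that by (auto simp: kb_def g_def mult.commute[of "Z u _ - _"] intro: order.trans add_increasing)
 qed
 note zj = NT_fubini[OF Z_joint Z_bound]
 have one: "(%w. 1) : borel_measurable M" "abs (1::real) <= 1" by auto
 have EZm: "EZ : borel_measurable LB"
 proof -
  note [measurable] = Z_joint
  have "(%u. EE (%w. (case (u, w) of (u, w) => Z u w))) : borel_measurable LB" by measurable
  thus ?thesis by simp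
 qed
 have gj: "(%(u, w). g u w) : borel_measurable (LB XM M)"
 proof -
  have "(%p. (case p of (u, w) => Z u w) - EZ (fst p)) : borel_measurable (LB XM M)"
   using Z_joint measurable_compose[OF measurable_fst EZm] by (rule borel_measurable_diff)
  thus ?thesis by (simp add: g_def case_prod_beta)
 qed
 have EZb: "abs (EZ u) <= zb" for u by (rule expectation_bounded) (use Z_bound pc in auto)
 have gb: "abs (g u w) <= 2 * zb" for u w using Z_bound[of u w] EZb[of u] by (simp add: g_def)
 have gm: "g u : borel_measurable M" for u
  using measurable_compose[OF measurable_Pair1'[of u LB M] gj] by simp
 note F = NT_fubini[OF gj gb]
 have Sm: "S : borel_measurable M" unfolding S_def[abs_def] by (rule F(3)[OF one])
 have Sb: "abs (S w) <= 2 * zb * T" for w unfolding S_def by (rule F(4)[OF one])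
 have inner: "abs (EE (%w. S w * g u w)) <= 2 * II" if u: "u : {0..T}" for u
 proof -
  have "EE (%w. S w * g u w) = BI NT (%v. EE (%w. g u w * g v w))"
   using F(1)[OF gm[of u] gb] by (simp add: S_def mult.commute)
  also have "ennreal \<bar>...\<bar> <= NI NT (%v. ennreal \<bar>EE (%w. g u w * g v w)\<bar>)"
   using integral_norm_bound_ennreal[OF F(2)[OF gm[of u] gb]] by simp
  also have "... = NI LB (%v. ennreal (indicator {0..T} v) * ennreal (abs (EE (%w. g u w * g v w))))"
   unfolding NT_def
  proof (rule nn_integral_density)
   have "integrable NT (%v. EE (%w. g u w * g v w))" by (rule F(2)[OF gm[of u] gb])
   hence "(%v. EE (%w. g u w * g v w)) : borel_measurable NT" by (rule borel_measurable_integrable)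
   thus "(%v. ennreal (abs (EE (%w. g u w * g v w)))) : borel_measurable LB" by (simp add: NT_def measurable_cong_sets[OF NT(3) refl])
  qed simp
  also have "... <= NI LB (%v. kb (v - u) + kb (u - v))" using cov[OF u] by (intro nn_integral_mono) (simp add: indicator_def)
  also have "... = NI LB (%v. kb (v - u)) + NI LB (%v. kb (u - v))" by (rule nn_integral_add) auto
  also have "... = ennreal II + ennreal II"
   using nn_integral_real_affine[of kb 1 "- u"] nn_integral_real_affine[of kb "-1" u] by (simp add: kbI)
  also have "... = ennreal (2 * II)" using II0 by (simp add: ennreal_plus[symmetric] del: ennreal_plus)
  finally show ?thesis using II0 by simp
 qed
 have "EE (%w. (S w)^2) = EE (%w. S w * BI NT (%u. g u w))" by (simp add: S_def power2_eq_square)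
 also have "... = BI NT (%u. EE (%w. S w * g u w))" by (rule F(1)[OF Sm Sb])
 also have "... <= BI NT (%u. 2 * II)"
 proof (rule integral_mono_AE)
  have "AE u in NT. u : {0..T}" unfolding NT_def by (subst AE_density, simp, rule AE_I2) (simp add: indicator_def)
  thus "AE u in NT. EE (%w. S w * g u w) <= 2 * II"
   by (rule AE_mp) (intro AE_I2 impI order.trans[OF abs_ge_self inner])
 qed (use F(2)[OF Sm Sb] in auto)
 also have "... = 2 * II * T" using NT(2,4) T by (simp add: measure_def)
 finally have S2: "EE (%w. (S w)^2) <= 2 * II * T" .
 define est where "est w = 1 / T * (LINT u:{0..T}|lborel. Z u w)" for w
 have Zm: "(%u. Z u w) : BB" if "w : space M" for w
  using measurable_compose[OF measurable_Pair2'[OF that, of LB] Z_joint] by simp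
 have est: "est w = 1 / T * BI NT (%u. Z u w)" if "w : space M" for w unfolding est_def using NT(5)[OF Zm[OF that]] by simp
 have EZi: "integrable NT EZ" using zj(2)[OF one] by simp
 have "EE est = EE (%w. 1 / T * BI NT (%u. Z u w))" by (rule integral_cong') (use est in auto)
 also have "... = 1 / T * BI NT (%u. EZ u)" using zj(1)[OF one] by simp
 finally have Eest: "EE est = 1 / T * BI NT (%u. EZ u)" .
 have dif: "est w - EE est = 1 / T * S w" if w: "w : space M" for w
 proof -
  have "integrable NT (%u. Z u w)"
   by (rule N.integrable_const_bound[of _ zb]) (use Z_bound Zm[OF w] in "auto simp: measurable_cong_sets[OF NT(3) refl]")
  thus ?thesis unfolding est[OF w] Eest S_def g_def using EZi by (simp add: diff_divide_distrib)
 qed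
 have "variance est = EE (%w. (1 / T)^2 * (S w)^2)" by (rule integral_cong') (auto simp: dif power_mult_distrib[symmetric] simp del: power_mult_distrib)
 also have "... <= (1 / T)^2 * (2 * II * T)" using S2 by (simp del: times_divide_eq_left add: mult_left_mono divide_right_mono)
 also have "... = 2 / T * II" using T by (simp add: power2_eq_square)
 finally show ?thesis by (simp add: est_def[abs_def] II_def)
qed

end

section \<open>From the assumptions on the coefficients to the locale constants\<close>

lemma entry_le_op_norm: "abs (N $ i $ j) <= op_norm N" for N :: "real^'n::finite^'n"
proof -
 have "N $ i $ j = (N *v axis j 1) $ i" by (simp add: matrix_vector_mult_basis column_def)
 also have "\<bar>...\<bar> <= norm (N *v axis j 1)" by (rule component_le_norm_cart)
 also have "... <= op_norm N * norm (axis j 1 :: real^'n)" unfolding op_norm_def by (rule onorm) (rule matrix_vector_mul_bounded_linear)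
 finally show ?thesis by simp
qed

text \<open>Uniformity demands a Lipschitz constant depending only on the bounds of the partial
  derivatives: coordinates are changed one at a time, with the mean value inequality on each
  segment.\<close>

lemma partial_lipschitz:
 fixes f :: "real^'n::finite => 'b::real_normed_vector"
 assumes d: "!!i. partially_differentiable i f" and c: "!!i x. norm (partial i f x) <= c"
 shows "norm (f x - f y) <= c * CARD('n) * norm (x - y)"
proof -
 have line: "norm (f (x + s *R axis i 1) - f x) <= c * abs s" for x s i
 proof -
  have D: "((%s. f (x + s *R axis i 1)) has_derivative (%h. h *R partial i f (x + s *R axis i 1))) (at s)" for s
  proof -
   have "((%r. f ((x + s *R axis i 1) + r *R axis i 1)) has_vector_derivative partial i f (x + s *R axis i 1)) (at (s - s))"
    using d[of i] unfolding partially_differentiable_def partial_def by (simp add: vector_derivative_works[symmetric])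
   moreover have "((%u. u - s) has_vector_derivative 1) (at s)" by (auto intro!: derivative_eq_intros)
   ultimately show ?thesis using vector_diff_chain_at[of "%u. u - s" 1 s]
    by (fastforce simp: has_vector_derivative_def comp_def scaleR_diff_left)
  qed
  have "norm ((%s. f (x + s *R axis i 1)) s - (%s. f (x + s *R axis i 1)) 0) <= c * norm (s - 0)"
  proof (rule differentiable_bound[of UNIV])
   show "onorm (%h. h *R partial i f (x + s *R axis i 1)) <= c" for s
   proof (rule onorm_le)
    show "norm (h *R partial i f (x + s *R axis i 1)) <= c * norm h" for h :: real using mult_right_mono[OF c abs_ge_zero, of i "x + s *R axis i 1" h] by (simp add: mult.commute)
   qed
  qed (use D in auto)
  thus ?thesis by simp
 qed
 have "norm (f (\<chi> i. if i : S then x $ i else y $ i) - f y) <= c * (SUM i:S. abs (x $ i - y $ i))" if "finite S" for S using that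
 proof induction
  case empty
  have "(\<chi> i. y $ i) = y" by (simp add: vec_eq_iff)
  thus ?case by simp
 next
  case (insert j S)
  let ?v = "\<chi> i. if i : S then x $ i else y $ i"
  have "(\<chi> i. if i : insert j S then x $ i else y $ i) = ?v + (x $ j - y $ j) *R axis j 1"
   using insert.hyps by (auto simp: vec_eq_iff axis_def)
  thus ?case using line[of ?v "x $ j - y $ j" j] insert norm_triangle_le[of "f (\<chi> i. if i : insert j S then x $ i else y $ i) - f ?v" "f ?v - f y"] by (simp add: distrib_left)
 qed
 from this[of UNIV] have "norm (f x - f y) <= c * (SUM i:UNIV. abs (x $ i - y $ i))" by simp
 also have "... <= c * (SUM i:(UNIV::'n set). norm (x - y))"
  using component_le_norm_cart[of "x - y"] order.trans[OF norm_ge_zero c] by (intro mult_left_mono sum_mono) auto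
 finally show ?thesis by simp
qed

text \<open>\<open>norm\<close> of a matrix is Euclidean in its entries, while the assumptions use
  operator norms; each entry is at most the operator norm, which costs two factors
  \<open>CARD('n)\<close>. The third one in the Lipschitz constant comes from changing coordinates
  one by one.\<close>

lemma ergodic_sdeI:
 fixes a :: "real^'n::finite => real^'n^'n" and l a0 a1 b0 b1 C rh :: real
 assumes A1: "A1 l a0 a1 b0 b1 a b" and A2: "A2 C rh b" and pos: "0 < l" "l <= a0" "0 < a1" "0 < b0" "0 < b1" "0 < C" "0 < rh" and sol: "strong_solution a b M W X"
 shows "ergodic_sde a b M W X (CARD('n) * (CARD('n) * a0)) b0 (CARD('n) * (CARD('n) * a1) * CARD('n) + b1 * CARD('n)) (l^2) C rh"
proof
 let ?d = "real CARD('n)"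
 have d: "0 < ?d" by simp
 have c: "!!i. partially_differentiable i a" "!!i. partially_differentiable i b" "!!x. op_norm (a x) <= a0" "!!i x. op_norm (partial i a x) <= a1"
  "!!x. norm (b x) <= b0" "!!i x. norm (partial i b x) <= b1" "!!x u. l^2 * (u \<bullet> u) <= u \<bullet> ((a x ** transpose (a x)) *v u)"
  using A1 unfolding A1_def by (auto simp: One_nat_def)
 have fro: "norm N <= ?d * (?d * k)" if "op_norm N <= k" for N :: "real^'n^'n" and k
  by (rule entry_norm) (use order.trans[OF entry_le_op_norm that] in auto)
 show "norm (a x) <= ?d * (?d * a0)" for x by (rule fro[OF c(3)])
 show "norm (b x) <= b0" for x by (rule c)
 have n: "0 <= ?d * (?d * a1) * ?d * norm (x - y)" "0 <= b1 * ?d * norm (x - y)" for x y :: "real^'n" using pos by auto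
 show "norm (a x - a y) <= (?d * (?d * a1) * ?d + b1 * ?d) * norm (x - y)" for x y
  using partial_lipschitz[OF c(1) fro[OF c(4)], of x y] n(2)[of x y] by (simp add: distrib_right)
 show "norm (b x - b y) <= (?d * (?d * a1) * ?d + b1 * ?d) * norm (x - y)" for x y
  using partial_lipschitz[OF c(2) c(6), of x y] n(1)[of x y] by (simp add: distrib_right)
 show "l^2 * (norm u)^2 <= u \<bullet> ((a x ** transpose (a x)) *v u)" for u x using c(7)[of u x] by (simp add: power2_norm_eq_inner)
 show "x \<bullet> b x <= - C * norm x" if "rh <= norm x" for x using A2 that by (simp add: A2_def)
qed (use pos sol in "auto intro!: add_pos_pos mult_pos_pos")

context ergodic_sde begin

definition "cpi = 2 * c1 * (exp (- (d1 / 2 * ln t0)) / cq)"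
definition "vpi = 2 * Kl / (dr * ep)"

lemma nn_integral_Y: assumes [measurable]: "g : BB" and t: "0 <= t" shows "NI M (%w. g (Y t w)) = NI (distr M borel (X t)) (%x. g x)"
proof -
 have [measurable]: "X t : borel_measurable M" using measurable_F_M[OF X_adapted[OF t]] .
 have "NI M (%w. g (Y t w)) = NI M (%w. g (X t w))"
  by (rule nn_integral_cong_AE) (use Y_eq_X t in "auto elim!: eventually_mono")
 thus ?thesis by (simp add: nn_integral_distr)
qed

text \<open>The density bound is \<open>heat\<close> over a time \<open>t0\<close>, with equal laws
  at both ends. For \<open>V\<close> the truncated Lyapunov inequality on [0, 1] is used: its
  boundary terms are finite and cancel by stationarity, and the time integral is that of a
  constant.\<close>

lemma stationary_bounds:
 assumes law: "!!t. 0 <= t ==> distr M borel (X t) = \<mu>"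
 shows "g : borel_measurable borel ==> (NI \<mu> (%x. g x)) <= ennreal cpi * NI LB (%x. g x)" and "NI \<mu> (%x. ennreal (V x)) <= ennreal vpi" (is ?A)
proof -
 have b1: "bddF v (%w. 1)" "0 <= (1::real)" for v by (auto simp: bddF_def)
 show "NI \<mu> (%x. g x) <= ennreal cpi * NI LB (%x. g x)" if [measurable]: "g : BB"
 proof -
  let ?s = "exp (- (d1 / 2 * ln t0)) / cq"
  have GN: "GN t0 g z <= ennreal ?s * NI LB (%x. g x)" for z
  proof -
   have "GN t0 g z <= NI LB (%y. g y * ennreal ?s)" unfolding GN_def
    by (intro nn_integral_mono mult_left_mono ennreal_leI G_le t0) auto
   thus ?thesis by (simp add: nn_integral_multc mult.commute)
  qed
  have "NI \<mu> (%x. g x) = NI M (%w. ennreal 1 * g (Y t0 w))" using nn_integral_Y[OF that, of t0] law[of t0] t0 by simp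
  also have "... <= ennreal (2 * c1) * NI M (%w. ennreal 1 * GN (t0 - 0) g (Y 0 w))" by (rule heat[OF _ _ _ b1]) (use t0 in auto)
  also have "... <= ennreal (2 * c1) * NI M (%w. ennreal ?s * NI LB (%x. g x))" using GN by (intro mult_left_mono nn_integral_mono) auto
  also have "... = ennreal cpi * NI LB (%x. g x)"
   using c1(1) cq_pos by (simp add: cpi_def emeasure_space_1 mult.assoc[symmetric] ennreal_mult[symmetric])
  finally show ?thesis .
 qed
 have ex: "EE (%w. 1 * f (Y t w)) = BI \<mu> (%x. f x)" if [measurable]: "f : BB" and t: "0 <= t" for f :: "real^'n => real" and t
 proof -
  have [measurable]: "X t : borel_measurable M" using measurable_F_M[OF X_adapted[OF t]] .
  have "EE (%w. 1 * f (Y t w)) = EE (%w. f (X t w))"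
   by (rule integral_cong_AE) (use Y_eq_X t in "auto elim!: eventually_mono")
  moreover have "BI \<mu> (%x. f x) = EE (%w. f (X t w))" unfolding law[OF t, symmetric] by (rule integral_distr) measurable
  ultimately show ?thesis by simp
 qed
 have "EE (%w. 1 * lg1 ep (1 / real (Suc n)) (jb (Y 0 w))) <= 2 * Kl / dr" for n
 proof -
  have d: "0 < 1 / real (Suc n)" by simp
  obtain K where K: "bcont K (%x. lg1 ep (1 / real (Suc n)) (jb x))" using lg_bcont(2)[OF d] by blast
  note e = ex[OF bcontD(1)[OF lg_bcont(1)[OF d]]] and e1 = ex[OF bcontD(1)[OF K]]
  have "integral {0..1} (%v. EE (%w. 1 * lg1 ep (1 / real (Suc n)) (jb (Y v w)))) = integral {0..1} (%v :: real. BI \<mu> (%x. lg1 ep (1 / real (Suc n)) (jb x)))"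
   by (rule Henstock_Kurzweil_Integration.integral_cong) (use e1 in auto)
  hence "integral {0..1} (%v. EE (%w. 1 * lg1 ep (1 / real (Suc n)) (jb (Y v w)))) = EE (%w. 1 * lg1 ep (1 / real (Suc n)) (jb (Y 0 w)))"
   using e1[of 0] by simp
  hence "dr / 2 * EE (%w. 1 * lg1 ep (1 / real (Suc n)) (jb (Y 0 w))) <= Kl"
   using lyapunov_truncated(2)[OF _ _ b1 d, of 0 1] e[of 0] e[of 1] by (simp add: prob_space)
  thus ?thesis using drift(1) by (simp add: field_simps)
 qed
 hence "ennreal ep * EV (%w. 1) 0 <= ennreal (2 * Kl / dr)"
  by (intro LIMSEQ_le_const2[OF lyapunov_limit(2)[OF b1(1)[of 0], of 0]] exI[of _ 0] allI impI ennreal_leI) auto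
 hence "ennreal (1 / ep) * (ennreal ep * EV (%w. 1) 0) <= ennreal (1 / ep) * ennreal (2 * Kl / dr)" by (rule mult_left_mono) simp
 moreover have "ennreal (1 / ep) * ennreal ep = 1" using SB0(3) by (simp add: ennreal_mult[symmetric])
 moreover have "ennreal (1 / ep) * ennreal (2 * Kl / dr) = ennreal vpi" using SB0 drift(1) by (simp add: ennreal_mult[symmetric] vpi_def mult.commute)
 moreover have "EV (%w. 1) 0 = NI \<mu> (%x. ennreal (V x))"
  using nn_integral_Y[of "%x. ennreal (V x)" 0] V(3) law[of 0] by (simp add: EV_def)
 ultimately show ?A by (simp add: mult.assoc[symmetric])
qed

end

text \<open>Since 1 / Q is at least a positive power T^q, the number of mixing periods is at least
  of order T^q. The exponential gain beats the powers of T that come from the suprema of the kernels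
  and from the growth of the \<open>V\<close>-moment.\<close>

lemma bandwidth_eventually:
 fixes al :: "'n::finite => real" and rho :: "real => real"
 assumes al: "!!j. 0 < al j" and rho: "\<forall>\<^sub>F T in at_top. 1 / T <= rho T & rho T <= ln T / T" and i: "i1 ~= i2" "3 <= CARD('n)"
  and c: "0 < t0" "0 < th" "th < 1" "0 < tt" "0 <= be" "0 <= vp" "0 <= Kl" "0 <= K"
 defines "hh \<equiv> %T j. rho T powr al j" and "Q \<equiv> %T. PROD l:UNIV - {i1, i2}. rho T powr al l"
 shows "\<forall>\<^sub>F T in at_top. (ALL j. 0 < hh T j & hh T j <= 1) & hh T i1 * hh T i2 <= t0 & 1 <= (SUM j:UNIV. abs (ln (hh T j))) &
  (EX k. real k * tt <= (SUM j:UNIV. abs (ln (hh T j))) / Q T - 1 &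
   T * (K / (hh T i1 * hh T i2 * Q T) * (th ^ k * (2 * (K / (hh T i1 * hh T i2 * Q T)) * (1 + be * (vp + Kl * T))))) <= 1)"
proof -
 have "card (UNIV - {i1, i2}) ~= 0" using i by (simp add: card_Diff_subset)
 \<comment> \<open>A third coordinate exists because the dimension is at least 3; its bandwidth
   alone makes \<open>Q\<close> at most a negative power of \<open>T\<close>.\<close>
 then obtain i3 where i3: "i3 : UNIV - {i1, i2}" by (metis card.empty ex_in_conv)
 define p q g where "p = (SUM l:UNIV. al l)" and "q = al i3 / 2" and "g = - ln th / tt"
 have pq: "0 < p" "0 < q" "0 < g" using al c divide_neg_pos[of "ln th" tt] by (auto simp: p_def q_def g_def sum_pos)
 define E0 where "E0 = 2 * K^2 * (1 + be * vp + be * Kl) * exp (g + g * tt)"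
 have "((%T. E0 * (T powr (2 * p + 2) * exp (- g * (T powr q)))) \<longlongrightarrow> E0 * 0) at_top"
  by (intro tendsto_mult tendsto_const) (use pq in real_asymp)
 hence ev1: "\<forall>\<^sub>F T in at_top. E0 * (T powr (2 * p + 2) * exp (- g * (T powr q))) < 1" by (rule order_tendstoD) simp
 have "((%T::real. T powr - (al i1 / 2)) \<longlongrightarrow> 0) at_top" using al[of i1] by real_asymp
 hence ev2: "\<forall>\<^sub>F T in at_top. T powr - (al i1 / 2) < t0" using c(1) by (rule order_tendstoD)
 have "filterlim (%T::real. al i1 / 2 * ln T) at_top at_top" using al[of i1] by real_asymp
 hence ev3: "\<forall>\<^sub>F T in at_top. 1 <= al i1 / 2 * ln T" unfolding filterlim_at_top by (rule spec)
 have ev4: "\<forall>\<^sub>F T::real in at_top. ln T <= sqrt T" by real_asymp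
 show ?thesis using ev1 ev2 ev3 ev4 rho eventually_ge_at_top[of 1]
 proof eventually_elim
  case (elim T)
  define r where "r = rho T"
  define S where "S = (SUM j:UNIV. abs (ln (hh T j)))"
  have T: "1 <= T" "0 < T" using elim(6) by auto
  have rr: "1 / T <= r" "0 < r" "r <= T powr - (1/2)"
  proof -
   show "1 / T <= r" using elim(5) by (simp add: r_def)
   moreover have "0 < 1 / T" using T by simp
   ultimately show "0 < r" by linarith
   have "r <= sqrt T / T" unfolding r_def by (rule order.trans[OF elim(5)[THEN conjunct2] divide_right_mono[OF elim(4)]]) (use T in simp)
   also have "sqrt T / T = T powr (1/2) / T powr 1" using T by (simp add: powr_half_sqrt)
   also have "... = T powr - (1/2)" by (subst powr_diff[symmetric]) simp
   finally show "r <= T powr - (1/2)" .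
  qed
  have hT: "r powr x <= T powr - (x / 2)" if "0 < x" for x
   using powr_mono2[OF less_imp_le[OF that] less_imp_le[OF rr(2)] rr(3)] by (simp add: powr_powr)
  have r1: "r <= 1" using hT[of 1] rr(2) powr_mono[of "- (1/2)" 0 T] T by simp
  have h: "0 < hh T j" "hh T j <= 1" for j using rr(2) r1 al[of j] by (auto simp: hh_def r_def[symmetric] powr_le1)
  have lnr: "ln T / 2 <= - ln r"
  proof -
   have "ln r <= ln (T powr - (1/2))" using rr T by (subst ln_le_cancel_iff) auto
   thus ?thesis using T by (simp add: ln_powr)
  qed
  have lnh: "abs (ln (hh T j)) = al j * - ln r" for j
   using rr(2) r1 al[of j] by (simp add: hh_def r_def[symmetric] ln_powr abs_mult abs_of_nonpos)
  have "al i1 / 2 * ln T <= abs (ln (hh T i1))" unfolding lnh using mult_left_mono[OF lnr less_imp_le[OF al[of i1]]] by simp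
  also have "... <= S" unfolding S_def by (rule member_le_sum) auto
  finally have S1: "1 <= S" using elim(3) by simp
  have two: "hh T i1 * hh T i2 <= t0"
  proof -
   have "hh T i1 * hh T i2 <= hh T i1" by (rule mult_left_le) (use h[of i1] h[of i2] in auto)
   also have "... <= t0" using hT[OF al[of i1]] elim(2) by (simp add: hh_def r_def[symmetric])
   finally show ?thesis .
  qed
  have Qh: "Q T = (PROD l:UNIV - {i1, i2}. hh T l)" by (simp add: Q_def hh_def)
  have Q0: "0 < Q T" unfolding Qh using h by (simp add: prod_pos)
  have Qq: "Q T <= T powr - q"
  proof -
   have "Q T = hh T i3 * (PROD l:UNIV - {i1, i2} - {i3}. hh T l)" unfolding Qh by (rule prod.remove[OF _ i3]) simp
   also have "... <= hh T i3" using h by (intro mult_left_le prod_le_1) (auto intro: less_imp_le)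
   also have "... <= T powr - q" using hT[OF al[of i3]] by (simp add: hh_def r_def[symmetric] q_def)
   finally show ?thesis .
  qed
  have D: "T powr q <= S / Q T"
  proof -
   have "T powr q = 1 / T powr - q" by (simp add: powr_minus_divide)
   also have "... <= S / Q T" using S1 Qq Q0 by (intro frac_le) auto
   finally show ?thesis .
  qed
  have PQ: "hh T i1 * hh T i2 * Q T = r powr p"
  proof -
   have "(PROD l:UNIV. hh T l) = r powr p" unfolding p_def hh_def r_def[symmetric] using rr(2) by (simp add: powr_sum)
   thus ?thesis unfolding Qh using i(1) prod.remove[of UNIV i1 "hh T"] prod.remove[of "UNIV - {i1}" i2 "hh T"] by (simp add: Diff_insert2[symmetric] mult.assoc)
  qed
  define z where "z = K / (hh T i1 * hh T i2 * Q T)"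
  have z: "0 <= z" "z <= K * T powr p"
  proof -
   have "(1 / T) powr p <= r powr p" using rr(1) T pq by (intro powr_mono2) auto
   hence "K / r powr p <= K / (1 / T) powr p" using c(8) T rr(2) by (intro divide_left_mono) auto
   also have "... = K * T powr p" using T by (simp add: powr_divide)
   finally show "z <= K * T powr p" unfolding z_def PQ .
  qed (use c(8) PQ in "simp add: z_def")
  have T1: "1 <= T powr q" using T pq by (simp add: ge_one_powr_ge_zero)
  \<comment> \<open>The number of full periods in the lag budget; the subtracted 1 and the rounding
    cost the constant factor exp(g + g tt).\<close>
  define k where "k = nat \<lfloor>(S / Q T - 1) / tt\<rfloor>"
  have k: "real k * tt <= S / Q T - 1" "(T powr q - 1) / tt - 1 <= real k"
  proof -
   have "0 <= (S / Q T - 1) / tt" using D T1 c(4) by simp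
   hence "real k <= (S / Q T - 1) / tt" unfolding k_def by simp
   thus "real k * tt <= S / Q T - 1" using c(4) by (simp add: pos_le_divide_eq)
   have "(T powr q - 1) / tt <= (S / Q T - 1) / tt" using D c(4) by (intro divide_right_mono) auto
   moreover have "(S / Q T - 1) / tt < real k + 1" unfolding k_def by linarith
   ultimately show "(T powr q - 1) / tt - 1 <= real k" by linarith
  qed
  have thk: "th ^ k <= exp (g + g * tt) * exp (- g * T powr q)"
  proof -
   have "th ^ k = exp (ln th * real k)" using c(2) by (simp add: exp_of_nat_mult mult.commute)
   also have "ln th * real k <= ln th * ((T powr q - 1) / tt - 1)" using k(2) c(2,3) by (intro mult_left_mono_neg) auto
   also have "... = (g + g * tt) + - g * T powr q" using c(4) by (simp add: g_def field_simps)
   finally show ?thesis by (simp only: exp_add[symmetric] exp_le_cancel_iff)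
  qed
  have "1 + be * (vp + Kl * T) <= (1 + be * vp + be * Kl) * T"
  proof -
   have "be * vp * 1 <= be * vp * T" using c T by (intro mult_left_mono) auto
   thus ?thesis using T by (simp add: algebra_simps)
  qed
  hence "T * (z * (th ^ k * (2 * z * (1 + be * (vp + Kl * T))))) <=
   T * ((K * T powr p) * ((exp (g + g * tt) * exp (- g * T powr q)) * (2 * (K * T powr p) * ((1 + be * vp + be * Kl) * T))))"
   using z thk c T by (intro mult_left_mono mult_mono mult_nonneg_nonneg add_nonneg_nonneg) auto
  also have "... = E0 * (T powr (2 * p + 2) * exp (- g * (T powr q)))"
  proof -
   have "T powr (2 * p + 2) = T powr p * T powr p * T powr 2" by (simp only: powr_add mult_2)
   moreover have "T powr 2 = T * T" using T by (simp add: power2_eq_square)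
   ultimately have "T powr (2 * p + 2) = T powr p * T powr p * (T * T)" by (simp only:)
   thus ?thesis by (simp add: E0_def power2_eq_square)
  qed
  finally have "T * (z * (th ^ k * (2 * z * (1 + be * (vp + Kl * T))))) <= 1" using elim(1) by simp
  thus ?case using h two S1 k(1) unfolding z_def S_def by blast
 qed
qed

text \<open>The clamp \<open>max 0 u\<close> avoids the supremum of an empty set, so that the map is
  monotone, hence measurable, on the whole line.\<close>

lemma sampling:
 assumes sch: "sampling_scheme T t"
 shows "mono (%u. last_obs t n l (max 0 u))" (is ?A) "0 <= mesh t n"
  and "0 <= u ==> u <= T n ==> 0 <= last_obs t n l u & u - mesh t n <= last_obs t n l u & last_obs t n l u <= u"
proof -
 have s: "t n l 0 = 0" "!!i. i < n ==> t n l i < t n l (Suc i)" "t n l n <= T n" "t n l (Suc n) = T n" for l using sch by (auto simp: sampling_scheme_def)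
 have inc: "t n l i <= t n l (Suc i)" if "i <= n" for i l using s(2)[of i l] s(3,4)[of l] that by (cases "i = n") auto
 let ?S = "%u. {t n l i |i. i <= n & t n l i <= u}"
 have fin: "finite (?S u)" for u by simp
 have zero: "0 : ?S u" if "0 <= u" for u using s(1)[of l] that by force
 show ?A
 proof (rule monoI)
  fix u v :: real assume "u <= v"
  thus "last_obs t n l (max 0 u) <= last_obs t n l (max 0 v)" unfolding last_obs_def
   using zero[of "max 0 u"] fin[of "max 0 v"] by (intro cSup_subset_mono) (auto intro: bdd_above_finite)
 qed
 have step: "t n l (Suc i) - t n l i <= mesh t n" if "i <= n" for i l
 proof -
  have "t n l (Suc i) - t n l i <= (SUP i\<in>{0..n}. t n l (Suc i) - t n l i)" by (rule cSUP_upper) (use that in auto)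
  also have "... <= mesh t n" unfolding mesh_def by (rule cSUP_upper) auto
  finally show ?thesis .
 qed
 show "0 <= mesh t n" using inc[of 0 l] step[of 0 l] by simp
 show "0 <= last_obs t n l u & u - mesh t n <= last_obs t n l u & last_obs t n l u <= u" if u: "0 <= u" "u <= T n"
 proof (intro conjI)
  show "0 <= last_obs t n l u" unfolding last_obs_def by (rule cSup_upper[OF zero[OF u(1)] bdd_above_finite[OF fin]])
  show "last_obs t n l u <= u" unfolding last_obs_def by (rule cSup_least) (use zero[OF u(1)] in auto)
  define i where "i = Max {i. i <= n & t n l i <= u}"
  have ne: "0 : {i. i <= n & t n l i <= u}" using s(1) u by simp
  have "i : {i. i <= n & t n l i <= u}" unfolding i_def by (rule Max_in) (use ne in auto)
  hence i: "i <= n" "t n l i <= u" by auto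
  have "u <= t n l (Suc i)"
  proof (cases "i = n")
   case False
   show ?thesis
   proof (rule ccontr)
    assume "\<not> u <= t n l (Suc i)"
    hence "Suc i <= i" unfolding i_def[symmetric] using i False by (subst (2) i_def, intro Max_ge) auto
    thus False by simp
   qed
  qed (use s(4)[of l] u in simp)
  moreover have "t n l i <= last_obs t n l u" unfolding last_obs_def by (rule cSup_upper) (use i fin in "auto intro: bdd_above_finite")
  ultimately show "u - mesh t n <= last_obs t n l u" using step[OF i(1), of l] by simp
 qed
qed

context async_sde begin

text \<open>The estimator reads \<open>X\<close>, the estimates concern \<open>Y\<close>; they agree
  almost surely at all nonnegative times. Joint measurability of the integrand built from
  \<open>X\<close> comes from the finite range of the observation times. Each term of the variance
  bound is a multiple of \<open>D\<close>: 1 / Q and 1 are below \<open>D\<close>, and the logarithm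
  of \<open>P2\<close> is part of its sum.\<close>

lemma estimator_variance:
 assumes fin: "!!l. finite (range (%u. r u l))" and r0: "!!u l. 0 <= r u l"
  and S: "1 <= (SUM j:UNIV. abs (ln (h j)))" and k: "real k * tt <= (SUM j:UNIV. abs (ln (h j))) / Q - 1" and m: "T * mx k <= 1"
 shows "variance (%w. 1 / T * (LINT u:{0..T}|lborel. (PROD l:UNIV. scaled_kernel Kf (h l) (x0 $ l - X (r u l) w $ l)))) <=
  2 * (Kb ^ dd * m1 + m2 + m3 + m1^2 + 1) / T * ((SUM j:UNIV. abs (ln (h j))) / Q)"
proof -
 define D where "D = (SUM j:UNIV. abs (ln (h j))) / Q"
 define ZX where "ZX u w = (PROD l:UNIV. fl l (X (r u l) w $ l))" for u w
 define eX eY where "eX w = 1 / T * (LINT u:{0..T}|lborel. ZX u w)" and "eY w = 1 / T * (LINT u:{0..T}|lborel. Z u w)" for w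
 note pc = pos_consts
 have XJ: "(%(u, w). X (r u l) w) : borel_measurable (LB XM M)" for l
 proof -
  have "(%p. X (r (fst p) l) (snd p)) : borel_measurable (LB XM M)"
  proof (rule measurable_compose_countable'[where I="range (%u. r u l)" and f="%s p. X s (snd p)"])
   show "(%p. X s (snd p)) : borel_measurable (LB XM M)" if "s : range (%u. r u l)" for s
    using that r0 by (intro measurable_compose[OF measurable_snd measurable_F_M[OF X_adapted]]) auto
   have "(%p. r (fst p) l) : borel_measurable (LB XM M)" by measurable
   from measurable_sets[OF this borel_singleton[OF sets.empty_sets]] show "(%p. r (fst p) l) : measurable (LB XM M) (count_space (range (%u. r u l)))"
    unfolding measurable_count_space_eq2[OF fin] by (auto simp: space_pair_measure)
  qed (use fin in "auto intro: countable_finite")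
  thus ?thesis by (simp add: case_prod_beta)
 qed
 have ZXj: "(%(u, w). ZX u w) : borel_measurable (LB XM M)"
 proof -
  from measurable_compose[OF borel_measurable_nth[OF XJ] fl(2)]
  have "(%p. PROD l:UNIV. fl l ((case p of (u, w) => X (r u l) w) $ l)) : borel_measurable (LB XM M)" by (intro borel_measurable_prod) auto
  thus ?thesis by (simp add: ZX_def case_prod_beta)
 qed
 have ms: "(%w. 1 / T * (LINT u:{0..T}|lborel. f u w)) : borel_measurable M" if "(%(u, w). f u w) : borel_measurable (LB XM M)" for f :: "real => 'w => real"
 proof -
  have "(%(w, u). f u w) : borel_measurable (M XM LB)" using measurable_compose[OF measurable_pair_swap' that] by (simp add: case_prod_beta)
  note [measurable] = this
  show ?thesis unfolding set_lebesgue_integral_def by measurable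
 qed
 have [measurable]: "eX : borel_measurable M" "eY : borel_measurable M" unfolding eX_def[abs_def] eY_def[abs_def] by (intro ms ZXj Z_joint)+
 have ae: "AE w in M. eX w = eY w"
  using Y_eq_X by eventually_elim (simp add: eX_def eY_def ZX_def Z_def r0)
 have E: "EE eX = EE eY" by (rule integral_cong_AE) (use ae in auto)
 have "variance eX = variance eY" unfolding E by (rule integral_cong_AE) (use ae in "auto elim!: eventually_mono")
 also have "... <= 2 / T * (Kb ^ dd / Q * m1 + m2 / Q * (ln t0 - ln P2) + (m3 + m1^2) * D + mx k * T)"
  unfolding eY_def[abs_def]
 proof (rule variance_bound)
  show "1 <= D" unfolding D_def using S pc by (simp add: divide_simps)
  show "real k * tt <= D - 1" using k by (simp add: D_def)
 qed
 also have "... <= 2 / T * (Kb ^ dd * m1 * D + m2 * D + (m3 + m1^2) * D + D)"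
 proof (rule mult_left_mono)
  have iQ: "1 / Q <= D" "1 <= D" unfolding D_def using S pc by (auto simp: divide_simps)
  have "ln t0 - ln P2 <= abs (ln (h i1)) + abs (ln (h i2))"
  proof -
   have "ln P2 = ln (h i1) + ln (h i2)" unfolding P2_def using h by (simp add: ln_mult_pos)
   moreover have "ln t0 <= 0" using t0 by simp
   ultimately show ?thesis by linarith
  qed
  also have "... = (SUM j:{i1, i2}. abs (ln (h j)))" using i12 by simp
  also have "... <= (SUM j:UNIV. abs (ln (h j)))" by (rule sum_mono2) auto
  finally have "m2 / Q * (ln t0 - ln P2) <= m2 / Q * (SUM j:UNIV. abs (ln (h j)))" using pc by (intro mult_left_mono) auto
  hence "m2 / Q * (ln t0 - ln P2) <= m2 * D" by (simp add: D_def)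
  moreover have "Kb ^ dd * m1 * (1 / Q) <= Kb ^ dd * m1 * D" using iQ pc Kb(2) by (intro mult_left_mono) auto
  hence "Kb ^ dd / Q * m1 <= Kb ^ dd * m1 * D" by simp
  moreover have "mx k * T <= D" using m iQ by (simp add: mult.commute)
  ultimately show "Kb ^ dd / Q * m1 + m2 / Q * (ln t0 - ln P2) + (m3 + m1^2) * D + mx k * T <= Kb ^ dd * m1 * D + m2 * D + (m3 + m1^2) * D + D" by linarith
 qed (use T in simp)
 also have "... = 2 * (Kb ^ dd * m1 + m2 + m3 + m1^2 + 1) / T * D" using T by (simp add: field_simps)
 finally show ?thesis by (simp add: eX_def[abs_def] ZX_def fl_def D_def)
qed

end

lemma last_obs_finite:
 assumes "sampling_scheme T t" shows "finite (range (%u. last_obs t n l (max 0 u)))" (is ?A) "0 <= last_obs t n l (max 0 u)" (is ?B)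
proof -
 have z: "0 : {t n l i |i. i <= n & t n l i <= max 0 u}" for u using assms by (auto simp: sampling_scheme_def intro!: exI[of _ 0])
 have f: "finite {t n l i |i. i <= n & t n l i <= max 0 u}" for u by simp
 show ?B unfolding last_obs_def by (rule cSup_upper[OF z bdd_above_finite[OF f]])
 have "last_obs t n l (max 0 u) : t n l ` {..n}" for u
  unfolding last_obs_def using Max_in[OF f[of u]] z[of u] by (subst cSup_eq_Max[OF f]) auto
 hence "range (%u. last_obs t n l (max 0 u)) <= t n l ` {..n}" by auto
 thus ?A by (rule finite_subset) simp
qed

theorem proposition3:
  fixes e :: "nat \<Rightarrow> 'n::finite"
    and \<beta> L :: "'n \<Rightarrow> real"
    and a\<^sub>m\<^sub>i\<^sub>n a\<^sub>0 a\<^sub>1 b\<^sub>0 b\<^sub>1 C \<rho> :: real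
    and m :: nat and K :: "real \<Rightarrow> real"
    and T :: "nat \<Rightarrow> real" and t :: "nat \<Rightarrow> 'n \<Rightarrow> nat \<Rightarrow> real"
    and x :: "real ^ 'n"
  assumes "CARD('n) \<ge> 3"
    and "bij_betw e {1..CARD('n)} UNIV"
    and "0 < \<beta> (e 1)"
    and "\<forall>j\<in>{1..<CARD('n)}. \<beta> (e j) \<le> \<beta> (e (Suc j))"
    and "\<forall>i. 0 < L i"
    and "0 < a\<^sub>m\<^sub>i\<^sub>n" and "a\<^sub>m\<^sub>i\<^sub>n \<le> a\<^sub>0" and "0 < a\<^sub>1" and "0 < b\<^sub>0" and "0 < b\<^sub>1"
    and "0 < C" and "0 < \<rho>"
    and "kernel_of_order m K" and "\<forall>i. \<beta> i \<le> real m"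
    and "sampling_scheme T t"
    and "filterlim T at_top sequentially"
    and "mesh t \<longlonglongrightarrow> 0"
    and "\<forall>n. T n > 1 \<longrightarrow>
           mesh t n \<le> 1 / 4 * opt_bandwidth e \<beta> (T n) (e 1) * opt_bandwidth e \<beta> (T n) (e 2)"
  shows "(\<forall>a b. A1 a\<^sub>m\<^sub>i\<^sub>n a\<^sub>0 a\<^sub>1 b\<^sub>0 b\<^sub>1 a b \<and> A2 C \<rho> b \<longrightarrow>
            (\<exists>c>0. \<exists>T\<^sub>0>0. \<forall>\<pi> (M :: 'w measure) W X. stationary_solution a b \<pi> M W X \<longrightarrow>
               (\<forall>n. T n \<ge> T\<^sub>0 \<longrightarrow>
                  prob_space.variance M (async_estimator K (opt_bandwidth e \<beta> (T n)) T t X n x)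
                    \<le> c / T n * ((\<Sum>j\<in>UNIV. \<bar>ln (opt_bandwidth e \<beta> (T n) j)\<bar>)
                        / (\<Prod>l = 3..CARD('n). opt_bandwidth e \<beta> (T n) (e l)))))) \<and>
         (\<exists>c>0. \<forall>(a, b) \<in> Sigma_tilde \<beta> L a\<^sub>m\<^sub>i\<^sub>n a\<^sub>0 a\<^sub>1 b\<^sub>0 b\<^sub>1 C \<rho>.
            \<exists>T\<^sub>0>0. \<forall>\<pi> (M :: 'w measure) W X. stationary_solution a b \<pi> M W X \<longrightarrow>
               (\<forall>n. T n \<ge> T\<^sub>0 \<longrightarrow>
                  prob_space.variance M (async_estimator K (opt_bandwidth e \<beta> (T n)) T t X n x)
                    \<le> c / T n * ((\<Sum>j\<in>UNIV. \<bar>ln (opt_bandwidth e \<beta> (T n) j)\<bar>)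
                        / (\<Prod>l = 3..CARD('n). opt_bandwidth e \<beta> (T n) (e l)))))"
proof -
 note asm = assms
 define A where "A = real CARD('n) * (real CARD('n) * a\<^sub>0)"
 define Lc where "Lc = real CARD('n) * (real CARD('n) * a\<^sub>1) * real CARD('n) + b\<^sub>1 * real CARD('n)"
 define lam where "lam = a\<^sub>m\<^sub>i\<^sub>n^2"
 \<comment> \<open>The locale constants are functions of the dimension and of numeric bounds, so
   they can be named here, before any coefficients or process are fixed. This is the source of the
   uniform \<open>c\<close>.\<close>
 define cp where "cp = ergodic_sde.cpi TYPE('n) A b\<^sub>0 Lc lam"
 define vp where "vp = ergodic_sde.vpi TYPE('n) A b\<^sub>0 C \<rho>"
 define t0 where "t0 = elliptic_sde.t0 TYPE('n) A b\<^sub>0 Lc lam"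
 define th where "th = ergodic_sde.th TYPE('n) A b\<^sub>0 Lc lam C \<rho>"
 define tt where "tt = ergodic_sde.tt TYPE('n) A b\<^sub>0 Lc lam C \<rho>"
 define be where "be = ergodic_sde.be TYPE('n) A b\<^sub>0 Lc lam C \<rho>"
 define Kl where "Kl = ergodic_sde.Kl TYPE('n) A b\<^sub>0 C \<rho>"
 define hh where "hh T = opt_bandwidth e \<beta> T" for T
 have d3: "3 <= CARD('n)" and e: "bij_betw e {1..CARD('n)} UNIV" using asm(1,2) .
 have K: "K : BB" "bounded (range K)" "closure {x. K x ~= 0} <= {-1..1}" using asm(13) by (auto simp: kernel_of_order_def)
 obtain Kb where Kb: "!!v. \<bar>K v\<bar> <= Kb" "1 <= Kb"
 proof -
  obtain k where "!!v. \<bar>K v\<bar> <= k" using K(2) by (auto simp: bounded_iff)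
  thus thesis by (intro that[of "max 1 k"]) (auto simp: le_max_iff_disj)
 qed
 have K1: "K v = 0" if "1 < \<bar>v\<bar>" for v
 proof (rule ccontr)
  assume "K v ~= 0"
  hence "v : {-1..1}" using K(3) closure_subset[of "{x. K x ~= 0}"] by blast
  thus False using that by auto
 qed
 have bet: "0 < \<beta> (e k)" if "1 <= k" "k <= CARD('n)" for k using that
 proof (induction k rule: dec_induct)
  case base thus ?case using asm(3) by simp
 next
  case (step k)
  thus ?case using asm(4)[rule_format, of k] by fastforce
 qed
 have bpos: "0 < \<beta> j" for j
 proof -
  obtain k where "k : {1..CARD('n)}" "j = e k" using bij_betw_imp_surj_on[OF e] by blast
  thus ?thesis using bet by auto
 qed
 have rate: "0 < rate_exponent e \<beta> j" for j
 proof -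
  have "0 < (\<Sum>l = 3..CARD('n). 1 / \<beta> (e l))" using d3 bpos by (intro sum_pos) auto
  hence "0 < beta_bar3 e \<beta>" unfolding beta_bar3_def using d3 by simp
  thus ?thesis unfolding rate_exponent_def using bpos[of j] d3 by (intro divide_pos_pos mult_pos_pos) auto
 qed
 have inj: "inj_on e {1..CARD('n)}" using e by (rule bij_betw_imp_inj_on)
 have ee: "e 1 ~= e 2" using inj_onD[OF inj, of 1 2] d3 by auto
 have Qe: "(PROD l:UNIV - {e 1, e 2}. g l) = (\<Prod>l = 3..CARD('n). g (e l))" for g :: "'n => real"
 proof -
  have "UNIV - {e 1, e 2} = e ` ({1..CARD('n)} - {1, 2})"
   using inj_on_image_set_diff[OF inj, of "{1..CARD('n)}" "{1, 2}"] bij_betw_imp_surj_on[OF e] d3 by simp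
  also have "{1..CARD('n)} - {1, 2} = {3..CARD('n)}" by auto
  finally have "UNIV - {e 1, e 2} = e ` {3..CARD('n)}" .
  moreover have "inj_on e {3..CARD('n)}" by (rule inj_on_subset[OF inj]) auto
  ultimately show ?thesis by (simp add: prod.reindex)
 qed
 define rho where "rho T = (if \<beta> (e 2) < \<beta> (e 3) then ln T / T else 1 / T)" for T :: real
 have hr: "hh T j = rho T powr rate_exponent e \<beta> j" for T j by (simp add: hh_def opt_bandwidth_def rho_def)
 have "\<forall>\<^sub>F T::real in at_top. 1 / T <= ln T / T" by real_asymp
 hence rho: "\<forall>\<^sub>F T in at_top. 1 / T <= rho T & rho T <= ln T / T" by eventually_elim (simp add: rho_def)
 \<comment> \<open>The signs of these constants are known only inside the locales, that is, once
   some solution exists. Without a solution the claim is vacuous; so the threshold \<open>N\<close>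
   is chosen under the condition \<open>good\<close>, before any solution is given.\<close>
 define good where "good \<longleftrightarrow> 0 < t0 & 0 < th & th < 1 & 0 < tt & 0 <= be & 0 <= vp & 0 <= Kl"
 define P where "P T \<longleftrightarrow> (ALL j. 0 < hh T j & hh T j <= 1) & hh T (e 1) * hh T (e 2) <= t0 & 1 <= (SUM j:UNIV. \<bar>ln (hh T j)\<bar>) &
  (EX k. real k * tt <= (SUM j:UNIV. \<bar>ln (hh T j)\<bar>) / (PROD l:UNIV - {e 1, e 2}. hh T l) - 1 &
   T * (Kb ^ CARD('n) / (hh T (e 1) * hh T (e 2) * (PROD l:UNIV - {e 1, e 2}. hh T l)) * (th ^ k * (2 * (Kb ^ CARD('n) / (hh T (e 1) * hh T (e 2) * (PROD l:UNIV - {e 1, e 2}. hh T l))) * (1 + be * (vp + Kl * T))))) <= 1)" for T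
 have "EX N. good --> (ALL T>=N. P T)"
 proof (cases good)
  case True
  hence "\<forall>\<^sub>F T in at_top. P T" unfolding P_def hr good_def
   by (intro bandwidth_eventually rate rho ee d3) (use Kb(2) in auto)
  thus ?thesis by (auto simp: eventually_at_top_linorder)
 qed simp
 then obtain N where N: "!!T. good ==> N <= T ==> P T" by blast
 \<comment> \<open>\<open>max 1\<close> makes \<open>c\<close> positive without knowing that a
   solution exists.\<close>
 define c where "c = max 1 (2 * (Kb ^ CARD('n) * async_sde.m1 TYPE('n) A b\<^sub>0 Lc lam Kb cp + async_sde.m2 TYPE('n) A b\<^sub>0 Lc lam Kb cp + async_sde.m3 TYPE('n) A b\<^sub>0 Lc lam Kb cp + (async_sde.m1 TYPE('n) A b\<^sub>0 Lc lam Kb cp)^2 + 1))"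
 define T0 where "T0 = max N 2"
 have main: "prob_space.variance M (async_estimator K (opt_bandwidth e \<beta> (T n)) T t X n x)
   <= c / T n * ((SUM j:UNIV. \<bar>ln (opt_bandwidth e \<beta> (T n) j)\<bar>) / (\<Prod>l = 3..CARD('n). opt_bandwidth e \<beta> (T n) (e l)))"
  if A12: "A1 a\<^sub>m\<^sub>i\<^sub>n a\<^sub>0 a\<^sub>1 b\<^sub>0 b\<^sub>1 a b" "A2 C \<rho> b" and st: "stationary_solution a b \<pi> M W X" and Tn: "T0 <= T n"
  for a :: "real^'n => real^'n^'n" and b \<pi> n and M :: "'w measure" and W X
 proof -
  have sol: "strong_solution a b M W X" "invariant_density a b \<pi>" "distributed M LB (X 0) (%x. ennreal (\<pi> x))" using st by (auto simp: stationary_solution_def)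
  interpret E: ergodic_sde a b M W X A "b\<^sub>0" Lc lam C \<rho>
   unfolding A_def Lc_def lam_def by (rule ergodic_sdeI[OF A12 _ _ _ _ _ _ _ sol(1)]) (use asm in auto)
  \<comment> \<open>The canonical stationary process supplies the bounds on the measure with density
    \<open>\<pi>\<close>; the given process inherits them through its initial law. Both
    interpretations share the same constants.\<close>
  obtain Mc :: "(real ^ 'n \<times> (real => real ^ 'n)) measure" and Wc Xc where can: "strong_solution a b Mc Wc Xc" "!!t. 0 <= t ==> distr Mc borel (Xc t) = density LB (%x. ennreal (\<pi> x))"
   using sol(2) unfolding invariant_density_def invariant_measure_def by blast
  interpret Cc: ergodic_sde a b Mc Wc Xc A "b\<^sub>0" Lc lam C \<rho>
   unfolding A_def Lc_def lam_def by (rule ergodic_sdeI[OF A12 _ _ _ _ _ _ _ can(1)]) (use asm in auto)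
  have law: "distr M borel (X 0) = density LB (%x. ennreal (\<pi> x))"
  proof -
   have "distr M borel (X 0) = distr M LB (X 0)" by (rule distr_cong) auto
   thus ?thesis using distributed_distr_eq_density[OF sol(3)] by simp
  qed
  have vp0: "0 <= vp" unfolding vp_def E.vpi_def using E.SB0 E.drift by simp
  have cp0: "0 <= cp" unfolding cp_def E.cpi_def using E.c1 E.cq_pos by simp
  have g: good unfolding good_def t0_def th_def tt_def be_def Kl_def using E.t0 E.harris_constants E.SB0 vp0 by auto
  \<comment> \<open>\<open>T0\<close> is at least 2, which activates the mesh assumption, stated for
    horizons above 1.\<close>
  have T2: "1 < T n" "N <= T n" using Tn by (auto simp: T0_def)
  have PT: "P (T n)" by (rule N[OF g T2(2)])
  define h where "h = hh (T n)"
  have mesh: "mesh t n <= 1 / 4 * h (e 1) * h (e 2)" unfolding h_def hh_def using asm(18) T2 by blast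
  define r where "r u l = last_obs t n l (max 0 u)" for u l
  note samp = sampling[OF asm(15)]
  interpret Z: async_sde a b M W X A "b\<^sub>0" Lc lam C \<rho> K Kb h x r "mesh t n" "T n" cp vp "e 1" "e 2"
  proof unfold_locales
   show "(%u. r u l) : BB" for l unfolding r_def by (rule borel_measurable_mono[OF samp(1)])
   show "0 <= r u l & u - mesh t n <= r u l & r u l <= u" if "0 <= u" "u <= T n" for u l using samp(3)[OF that, of l] that by (simp add: r_def max_absorb2)
   show "NI M (%w. f (E.Y 0 w)) <= ennreal cp * NI LB (%x. f x)" if "f : BB" for f
    using E.nn_integral_Y[OF that, of 0] law Cc.stationary_bounds(1)[OF can(2) that] by (simp add: cp_def)
   show "NI M (%w. ennreal (E.V (E.Y 0 w))) <= ennreal vp"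
    using E.nn_integral_Y[of "%x. ennreal (E.V x)" 0] law Cc.stationary_bounds(2)[OF can(2)] E.V(3) by (simp add: vp_def)
   show "h (e 1) * h (e 2) <= elliptic_sde.t0 TYPE('n) A b\<^sub>0 Lc lam" using PT by (simp add: P_def h_def t0_def)
  qed (use K(1) Kb K1 PT ee mesh samp(2) T2 vp0 cp0 in "auto simp: P_def h_def")
  have zb: "Z.zb = Kb ^ CARD('n) / (h (e 1) * h (e 2) * (PROD l:UNIV - {e 1, e 2}. h l))" unfolding Z.zb_def Z.P2_def Z.Q_def Z.dd_def ..
  obtain k where k: "real k * tt <= (SUM j:UNIV. \<bar>ln (h j)\<bar>) / Z.Q - 1" "T n * Z.mx k <= 1"
   using PT unfolding P_def h_def[symmetric] Z.mx_def zb Z.Q_def th_def be_def Kl_def by blast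
  have S: "1 <= (SUM j:UNIV. \<bar>ln (h j)\<bar>)" unfolding h_def by (rule PT[unfolded P_def, THEN conjunct2, THEN conjunct2, THEN conjunct1])
  define est where "est w = 1 / T n * (LINT u:{0..T n}|lborel. (PROD l:UNIV. scaled_kernel K (h l) (x $ l - X (r u l) w $ l)))" for w
  have est: "async_estimator K (opt_bandwidth e \<beta> (T n)) T t X n x = est"
  proof
   fix w
   have "(LINT u:{0..T n}|lborel. (PROD l:UNIV. scaled_kernel K (h l) (x $ l - X (last_obs t n l u) w $ l))) = (LINT u:{0..T n}|lborel. (PROD l:UNIV. scaled_kernel K (h l) (x $ l - X (r u l) w $ l)))"
    by (rule set_lebesgue_integral_cong) (auto simp: r_def max_absorb2)
   thus "async_estimator K (opt_bandwidth e \<beta> (T n)) T t X n x w = est w" by (simp add: async_estimator_def est_def h_def hh_def)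
  qed
  have D0: "0 <= (SUM j:UNIV. \<bar>ln (h j)\<bar>) / Z.Q" using S Z.pos_consts by simp
  have "E.variance est <= 2 * (Kb ^ Z.dd * Z.m1 + Z.m2 + Z.m3 + Z.m1^2 + 1) / T n * ((SUM j:UNIV. \<bar>ln (h j)\<bar>) / Z.Q)"
   unfolding est_def[abs_def] by (rule Z.estimator_variance[OF _ _ S k(1)[unfolded tt_def] k(2)]) (use last_obs_finite[OF asm(15)] in "auto simp: r_def")
  also have "... <= c / T n * ((SUM j:UNIV. \<bar>ln (h j)\<bar>) / Z.Q)"
   by (rule mult_right_mono[OF divide_right_mono D0]) (use T2 in "auto simp: c_def Z.dd_def")
  finally show ?thesis unfolding est Z.Q_def Qe by (simp add: h_def hh_def)
 qed
 have c0: "0 < c" "0 < T0" by (auto simp: c_def T0_def)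
 have fin: "EX T\<^sub>0>0. ALL \<pi> (M :: 'w measure) W X. stationary_solution a b \<pi> M W X --> (ALL n. T n >= T\<^sub>0 -->
   prob_space.variance M (async_estimator K (opt_bandwidth e \<beta> (T n)) T t X n x)
    <= c / T n * ((SUM j:UNIV. \<bar>ln (opt_bandwidth e \<beta> (T n) j)\<bar>) / (\<Prod>l = 3..CARD('n). opt_bandwidth e \<beta> (T n) (e l))))"
  if "A1 a\<^sub>m\<^sub>i\<^sub>n a\<^sub>0 a\<^sub>1 b\<^sub>0 b\<^sub>1 a b" "A2 C \<rho> b" for a b
  using c0(2) main[OF that] by (intro exI[of _ T0] conjI allI impI) auto
 have "A1 a\<^sub>m\<^sub>i\<^sub>n a\<^sub>0 a\<^sub>1 b\<^sub>0 b\<^sub>1 a b & A2 C \<rho> b" if "(a, b) : Sigma_tilde \<beta> L a\<^sub>m\<^sub>i\<^sub>n a\<^sub>0 a\<^sub>1 b\<^sub>0 b\<^sub>1 C \<rho>" for a b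
  using that by (simp add: Sigma_tilde_def Sigma_class_def)
 note S = this
 show ?thesis
  by (rule conjI; (intro allI impI)?; rule exI[of _ c]; rule conjI[OF c0(1)]; (intro ballI, clarify)?) (rule fin; blast dest: S)+
qed

end
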